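(* Let $n\ge 2$, let $W(r)=(1-r^2)^2$, and let $u\in C^2(\mathbb R^n,[-1,1])$ solve $\Delta u=W'(u)$ in $\mathbb R^n$, with $\partial u/\partial x_n>0$ in $\mathbb R^n$, and satisfying the energy bound: there is $C>0$ such that $\int_{B_R}\big(\tfrac12|\nabla u|^2+W(u)\big)\,dx\le CR^{n-1}$ for every $R>1$. Let $L_-,L_+\subseteq {\rm C}(d_o,h_o)$ be the limit sets described in the context. Suppose there exist $d\in(0,d_o]$ and $\overline K,K\in(0,h_o]$ with $\overline K>K$ such that $L_-\cap {\rm C}(d,\overline K)\neq\varnothing$, $L_+\cap {\rm C}(d,\overline K)\neq\varnothing$, and $\big((\partial L_-)\cup(\partial L_+)\big)\cap {\rm C}(d,\overline K)\subseteq\{|x_n|<K\}$. Then: (i) $\lim_{x_n\to-\infty}u(x',x_n)=-1$ and $\lim_{x_n\to+\infty}u(x',x_n)=1$ for every $x'\in\mathbb R^{n-1}$; (ii) $u$ is a local minimizer; (iii) if $2\le n\le 8$, then $u$ is 1D.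
   Context: Points of $\mathbb R^n$ are written $x=(x',x_n)\in\mathbb R^{n-1}\times\mathbb R$. For $\varepsilon>0$ set $u_\varepsilon(x):=u(x/\varepsilon)$. For $d,h>0$ the open cylinder is ${\rm C}(d,h):=\{x\in\mathbb R^n: |x'|<d,\ |x_n|<h\}$. The numbers $d_o,h_o>0$ are fixed. Under the energy bound (by results of Hutchinson–Tonegawa) there is a sequence $\varepsilon_j\to0^+$ such that $u_{\varepsilon_j}$ converges a.e. in ${\rm C}(d_o,h_o)$ to a function with values in $\{-1,1\}$; such a sequence is fixed, and all limits "$\varepsilon\to0^+$" are taken along it. Then $L_-:=\{p\in{\rm C}(d_o,h_o): u_{\varepsilon}(p)\to-1\}$ and $L_+:=\{p\in{\rm C}(d_o,h_o): u_{\varepsilon}(p)\to 1\}$ (defined by pointwise convergence, not up to null sets). Boundaries are topological boundaries. $u$ is a local minimizer if for every bounded open $\Omega\subset\mathbb R^n$ and every $\varphi\in C_0^\infty(\Omega)$, $\mathcal E(u,\Omega)\le\mathcal E(u+\varphi,\Omega)$, where $\mathcal E(v,\Omega)=\int_\Omega \frac12|\nabla v|^2+W(v)\,dx$. $u$ is 1D if there are $\omega\in S^{n-1}$ and $u_o:\mathbb R\to\mathbb R$ with $u(x)=u_o(\omega\cdot x)$ for all $x$ (equivalently all level sets of $u$ are hyperplanes). *)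

theory Defs
  imports "HOL-Analysis.Analysis"
begin

text \<open>Points of R^n are pairs (x', x_n) with x' :: real^'m, so n = CARD('m) + 1 \<ge> 2.\<close>

definition W :: "real \<Rightarrow> real" where
  "W r = (1 - r\<^sup>2)\<^sup>2"

definition W' :: "real \<Rightarrow> real" where
  "W' r = -4 * r * (1 - r\<^sup>2)"

definition partial :: "('a::real_normed_vector \<Rightarrow> real) \<Rightarrow> 'a \<Rightarrow> 'a \<Rightarrow> real" where
  "partial f b x = frechet_derivative f (at x) b"

definition C2 :: "('a::euclidean_space \<Rightarrow> real) \<Rightarrow> bool" where
  "C2 f \<longleftrightarrow> (\<forall>x. f differentiable (at x)) \<and>
     (\<forall>b\<in>Basis. \<forall>x. (partial f b) differentiable (at x)) \<and>
     (\<forall>b\<in>Basis. \<forall>c\<in>Basis. continuous_on UNIV (partial (partial f b) c))"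

definition laplacian :: "('a::euclidean_space \<Rightarrow> real) \<Rightarrow> 'a \<Rightarrow> real" where
  "laplacian f x = (\<Sum>b\<in>Basis. partial (partial f b) b x)"

definition grad_sq :: "('a::euclidean_space \<Rightarrow> real) \<Rightarrow> 'a \<Rightarrow> real" where
  "grad_sq f x = (\<Sum>b\<in>Basis. (partial f b x)\<^sup>2)"

definition energy :: "('a::euclidean_space \<Rightarrow> real) \<Rightarrow> 'a set \<Rightarrow> real" where
  "energy v \<Omega> = integral \<Omega> (\<lambda>x. grad_sq v x / 2 + W (v x))"

fun iter_partial :: "('a::euclidean_space \<Rightarrow> real) \<Rightarrow> 'a list \<Rightarrow> 'a \<Rightarrow> real" where
  "iter_partial f [] = f"
| "iter_partial f (b # bs) = partial (iter_partial f bs) b"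

definition smooth :: "('a::euclidean_space \<Rightarrow> real) \<Rightarrow> bool" where
  "smooth f \<longleftrightarrow> (\<forall>bs. set bs \<subseteq> Basis \<longrightarrow> (\<forall>x. iter_partial f bs differentiable (at x)))"

definition test_fun :: "'a::euclidean_space set \<Rightarrow> ('a \<Rightarrow> real) \<Rightarrow> bool" where
  "test_fun \<Omega> \<phi> \<longleftrightarrow> smooth \<phi> \<and> compact (closure {x. \<phi> x \<noteq> 0}) \<and>
     closure {x. \<phi> x \<noteq> 0} \<subseteq> \<Omega>"

definition local_minimizer :: "('a::euclidean_space \<Rightarrow> real) \<Rightarrow> bool" where
  "local_minimizer u \<longleftrightarrow> (\<forall>\<Omega> \<phi>. open \<Omega> \<and> bounded \<Omega> \<and> test_fun \<Omega> \<phi> \<longrightarrow>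
      energy u \<Omega> \<le> energy (\<lambda>x. u x + \<phi> x) \<Omega>)"

definition one_dim :: "('a::euclidean_space \<Rightarrow> real) \<Rightarrow> bool" where
  "one_dim u \<longleftrightarrow> (\<exists>\<omega> (u0::real \<Rightarrow> real). norm \<omega> = 1 \<and> (\<forall>x. u x = u0 (\<omega> \<bullet> x)))"

definition cyl :: "real \<Rightarrow> real \<Rightarrow> ((real^'m) \<times> real) set" where
  "cyl d h = {x. norm (fst x) < d \<and> \<bar>snd x\<bar> < h}"

definition Lset :: "(((real^'m) \<times> real) \<Rightarrow> real) \<Rightarrow> (nat \<Rightarrow> real) \<Rightarrow> real \<Rightarrow> real \<Rightarrow> real
    \<Rightarrow> ((real^'m) \<times> real) set" where
  "Lset u eps d0 h0 s = {p \<in> cyl d0 h0. (\<lambda>j. u ((1 / eps j) *\<^sub>R p)) \<longlonglongrightarrow> s}"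

end

theory Submission
 imports Defs
begin

text \<open>
 Write \<open>u = tanh (sqrt 2 * z)\<close>. Modica's inequality says \<open>|grad z| \<le> 1\<close>, so (i) propagates from one
 vertical line, on which it follows from the limit sets, to all of them. With (i) the translates of the graph
 of \<open>u\<close> in the direction \<open>e\<close> foliate and calibrate, which gives (ii).

 For (iii) in dimension at least 4, minimality and the limit sets confine the interface of \<open>u\<close>, along the
 scales \<open>1 / eps j\<close>, to a slab. The stress tensor is divergence free; tested with
 \<open>\<eta>\<^sup>2 x\<^sub>n w\<close>, where \<open>w\<close> is a regularised \<open>- ln z\<^sub>n\<close>, it bounds the mean of \<open>w\<close> on large balls, and a
 mean value inequality, which is again obtained from the stress tensor, turns this into a lower bound for
 \<open>z\<^sub>n = grad z \<bullet> e\<close>. The same inequality then bounds the weighted curvature mass, so that the level sets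
 are flat at large scales, and a Bernstein type maximum principle for \<open>|grad z / z\<^sub>n - \<nu>|\<^sup>2\<close> shows that
 \<open>grad z / z\<^sub>n\<close> is constant. In dimensions 2 and 3 a logarithmic cutoff suffices. No step uses the
 classification of minimal cones.
\<close>

section \<open>Calculus with gradients and Hessians\<close>

text \<open>Blow-downs of the interface may be singular, so every estimate is made on
  \<open>u\<close> itself. The variable \<open>z\<close> fits this: for the profile
  \<open>tanh (sqrt 2 * t)\<close> in a fixed direction \<open>z\<close> is affine with unit
  gradient, so \<open>Q = 1 - |grad z|^2\<close> and the Hessian of \<open>z\<close> both measure
  the distance from being one-dimensional, and Modica's inequality reads \<open>Q >= 0\<close>. The
  mean value inequality comes from subtracting the stress identity from twice the weighted
  integration by parts: the tangential coupling of the two gradients cancels, and what remains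
  carries a factor \<open>Q\<close> or the normal derivatives of both functions. Its kernel decays
  like \<open>|x|^(3-n)\<close>, the Green function of an interface of dimension n - 1; this is why
  dimensions 2 and 3 are treated apart. Confinement along the radii \<open>1 / eps j\<close> is
  enough because the slope estimate picks its radius after the regularisation parameter. In the
  Bernstein argument positions \<open>x\<close> are replaced by approximate foot points
  \<open>x - z grad z\<close> on the interface, because the drift of the weighted Laplacian would
  otherwise dominate at large distances.\<close>

notation (input) scaleR (infixr "$*" 75)
notation (input) inner (infixl "$." 70)

lemmas cnt = continuous_intros and pow2 = power2_eq_square and alg = algebra_simps and mlm = mult_left_mono and mrm = mult_right_mono and cnt2 = continuous_on_compose2 and dvi = derivative_eq_intros and nrm2 = power2_norm_eq_inner and pmd = power_mult_distrib and CS2 = Cauchy_Schwarz_ineq2 and mnn = mult_nonneg_nonneg and icn = integrable_continuous and hdc = has_derivative_compose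

definition C1g :: "('a::euclidean_space => real) => ('a => 'a) => bool" where
 "C1g f g \<longleftrightarrow> (\<forall>x. (f has_derivative (%h. g x $. h)) (at x)) & continuous_on UNIV g"

text \<open>Gradient and Hessian are explicit arguments, so that derivatives of composite functions
  are computed by rules. Continuity of the Hessian is asked for each fixed direction only, and its
  symmetry is not part of the predicate but derived in \<open>C2g_symmetric\<close>.\<close>

definition C2g :: "('a::euclidean_space => real) => ('a => 'a) => ('a => 'a => 'a) => bool" where
 "C2g f g H \<longleftrightarrow> C1g f g & (\<forall>x. (g has_derivative H x) (at x)) &
   (\<forall>h. continuous_on UNIV (%x. H x h))"

definition tr :: "('a::euclidean_space => 'a) => real" where
 "tr H = (\<Sum>b\<in>Basis. H b $. b)"

definition csupp :: "('a::euclidean_space => 'b::real_vector) => bool" where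
 "csupp f \<longleftrightarrow> (\<exists>R. \<forall>x. norm x > R --> f x = 0)"

lemma C1gD: "C1g f g ==> (f has_derivative (%h. g x $. h)) (at x)"
 and C1g_cont_grad: "C1g f g ==> continuous_on S g"
 by (auto simp: C1g_def intro: continuous_on_subset)

lemma C1g_cont: "C1g f g ==> continuous_on S f"
 by (meson C1gD has_derivative_continuous continuous_at_imp_continuous_on)

lemma C1g_DERIV:
 assumes "C1g f g"
 shows "((%s. f (x + s $* h)) has_real_derivative (g (x + s $* h) $. h)) (at s)"
proof -
 have "((%s. f (x + s $* h)) has_derivative (%d. g (x + s $* h) $. (d $* h))) (at s)"
  by (rule hdc[of "%s. x + s $* h" "%d. d $* h" s UNIV f, OF _ C1gD[OF assms]])
    (auto intro!: dvi)
 then show ?thesis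
  by (rule has_derivative_imp_has_field_derivative) (auto simp: mult.commute)
qed

lemma C1g_const: "C1g (%x. c) (%x. 0)"
 by (auto simp: C1g_def)

lemma C1g_inner: "C1g (%x. x $. v) (%x. v)"
 by (auto simp: C1g_def inner_commute intro!: dvi)

lemma C1g_add: "C1g f g ==> C1g f' g' ==> C1g (%x. f x + f' x) (%x. g x + g' x)"
 by (auto simp: C1g_def inner_add_left intro!: derivative_intros cnt)

lemma C1g_mult: "C1g f g ==> C1g f' g' ==> C1g (%x. f x*f' x) (%x. f x $* g' x + f' x $* g x)"
 unfolding C1g_def[of "%x. f x*f' x"]
 using C1gD[of f g] C1gD[of f' g'] C1g_cont[of f g UNIV] C1g_cont[of f' g' UNIV]
  C1g_cont_grad[of f g UNIV] C1g_cont_grad[of f' g' UNIV]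
 by (auto simp: inner_add_left alg intro!: dvi cnt)

lemma C1g_cmult: "C1g f g ==> C1g (%x. c*f x) (%x. c $* g x)"
 using C1g_mult[OF C1g_const[of c]] by simp

lemma C1g_sum: "(!!i. i : I ==> C1g (f i) (g i)) ==> C1g (%x. \<Sum>i\<in>I. f i x) (%x. \<Sum>i\<in>I. g i x)"
 by (induction I rule: infinite_finite_induct) (auto intro: C1g_const C1g_add)

lemma C1g_compose:
 assumes "C1g f g" "!!x. (k has_real_derivative k' (f x)) (at (f x))" "continuous_on (range f) k'"
 shows "C1g (%x. k (f x)) (%x. k' (f x) $* g x)"
 unfolding C1g_def
proof (intro conjI allI)
 fix x
 show "((%x. k (f x)) has_derivative ($.) (k' (f x) $* g x)) (at x)"
  using hdc[OF C1gD[OF assms(1)] assms(2)[of x, unfolded has_field_derivative_def]]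
  by (simp add: inner_scaleR_left[abs_def])
 show "continuous_on UNIV (%x. k' (f x) $* g x)"
  using C1g_cont[OF assms(1)] C1g_cont_grad[OF assms(1)]
  by (auto intro!: cnt cnt2[OF assms(3)])
qed

lemma C2gD:
 assumes "C2g f g H"
 shows "C1g f g" "(f has_derivative (%h. g x $. h)) (at x)" "(g has_derivative H x) (at x)"
  "continuous_on S (%x. H x h)" "linear (H x)" "continuous_on S g" "continuous_on S f"
 using assms unfolding C2g_def
 by (auto intro: continuous_on_subset C1gD C1g_cont C1g_cont_grad has_derivative_linear)

lemma C2g_cont_tr: "C2g f g H ==> continuous_on S (%x. tr (H x))"
 unfolding tr_def by (intro cnt) (auto dest: C2gD)

lemma linear_expand: "linear H ==> H (v::'a::euclidean_space) = (\<Sum>b\<in>Basis. (v $. b) $* H b)"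
 by (metis (no_types, lifting) euclidean_representation linear_scale linear_sum sum.cong)

lemma C2g_cont_apply:
 assumes "C2g f g H" "continuous_on S v"
 shows "continuous_on S (%x. H x (v x))"
proof -
 have "H x (v x) = (\<Sum>b\<in>Basis. (v x $. b) $* H x b)" for x
  by (rule linear_expand[OF C2gD(5)[OF assms(1)]])
 then show ?thesis
  by (simp only:) (intro cnt assms(2) C2gD(4)[OF assms(1)])
qed

lemma C2g_grad_inner_C1g:
 assumes f: "C2g f g H" and sym: "!!x h k. H x h $. k = H x k $. h"
 shows "C1g (%x. g x $. v) (%x. H x v)"
 unfolding C1g_def
proof (intro conjI allI)
 fix x
 have "((%x. g x $. v) has_derivative (%h. H x h $. v)) (at x)"
  using C2gD(3)[OF f] by (auto intro!: dvi)
 moreover have "(%h. H x h $. v) = ($.) (H x v)"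
  using sym by auto
 ultimately show "((%x. g x $. v) has_derivative ($.) (H x v)) (at x)"
  by simp
qed (use C2gD(4)[OF f] in auto)

text \<open>Schwarz's theorem through the second difference \<open>Dl\<close>, which is visibly
  symmetric in \<open>h\<close> and \<open>k\<close>: two mean value theorems write it as
  \<open>s^2\<close> times a Hessian value at a nearby point, and continuity in the base point does
  the rest.\<close>

lemma C2g_symmetric:
 fixes f :: "'a::euclidean_space => real"
 assumes f: "C2g f g H"
 shows "H x h $. k = H x k $. h"
proof -
 define Dl where "Dl s h k = f (x + s $* h + s $* k) - f (x + s $* h) - f (x + s $* k) + f x" for s h k
 have key: "\<exists>xj et. 0 < xj & xj < s & 0 < et & et < s & Dl s h k = s^2*(H (x + xj $* h + et $* k) k $. h)"
  if "s > 0" for s h k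
 proof -
  define ph where "ph a = f ((x + s $* k) + a $* h) - f (x + a $* h)" for a
  have d: "(ph has_real_derivative (g ((x + s $* k) + a $* h) $. h - g (x + a $* h) $. h)) (at a)" for a
   unfolding ph_def by (intro DERIV_diff C1g_DERIV[OF C2gD(1)[OF f]])
  obtain xj where xi: "0 < xj" "xj < s" "ph s - ph 0 = (s - 0)*(g ((x + s $* k) + xj $* h) $. h - g (x + xj $* h) $. h)"
   using MVT2[OF \<open>s > 0\<close>, of ph, OF d] by blast
  define q where "q b = g ((x + xj $* h) + b $* k) $. h" for b
  have d2: "(q has_real_derivative (H ((x + xj $* h) + b $* k) k $. h)) (at b)" for b
  proof -
   have "((%b. g ((x + xj $* h) + b $* k)) has_derivative (%d. H ((x + xj $* h) + b $* k) (d $* k))) (at b)"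
    by (rule hdc[of "%b. (x + xj $* h) + b $* k" "%d. d $* k" b UNIV g, OF _ C2gD(3)[OF f]])
      (auto intro!: dvi)
   then have "(q has_derivative (%d. H ((x + xj $* h) + b $* k) (d $* k) $. h)) (at b)"
    unfolding q_def by (auto intro!: dvi)
   then show ?thesis
    by (rule has_derivative_imp_has_field_derivative)
      (simp add: linear_cmul[OF C2gD(5)[OF f]] mult.commute)
  qed
  obtain et where eta: "0 < et" "et < s" "q s - q 0 = (s - 0)*(H ((x + xj $* h) + et $* k) k $. h)"
   using MVT2[OF \<open>s > 0\<close>, of q, OF d2] by blast
  have "Dl s h k = ph s - ph 0"
   by (simp add: Dl_def ph_def alg)
  also have "... = s*(q s - q 0)"
   using xi(3) by (simp add: q_def alg)
  finally have "Dl s h k = s^2*(H (x + xj $* h + et $* k) k $. h)"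
   using eta(3) by (simp add: pow2)
  then show ?thesis using xi eta by blast
 qed
 have lim: "(%n. Dl (1/real (Suc n)) h k/(1/real (Suc n))^2) \<longlonglongrightarrow> H x k $. h" for h k
 proof -
  obtain xj et where xe: "!!n. 0 < xj n & xj n < 1/real (Suc n) & 0 < et n & et n < 1/real (Suc n) &
    Dl (1/real (Suc n)) h k = (1/real (Suc n))^2*(H (x + xj n $* h + et n $* k) k $. h)"
  proof -
   have "\<forall>n. \<exists>xj et. 0 < xj & xj < 1/real (Suc n) & 0 < et & et < 1/real (Suc n) &
    Dl (1/real (Suc n)) h k = (1/real (Suc n))^2*(H (x + xj $* h + et $* k) k $. h)"
    by (intro allI key) simp
   from choice[OF this] obtain xj where "\<forall>n. \<exists>et. 0 < xj n & xj n < 1/real (Suc n) & 0 < et & et < 1/real (Suc n) &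
    Dl (1/real (Suc n)) h k = (1/real (Suc n))^2*(H (x + xj n $* h + et $* k) k $. h)" ..
   from choice[OF this] show ?thesis using that by blast
  qed
  have z: "(%n. 1/real (Suc n)) \<longlonglongrightarrow> 0"
   using LIMSEQ_inverse_real_of_nat by (simp add: field_simps)
  have "xj \<longlonglongrightarrow> 0" "et \<longlonglongrightarrow> 0"
   by (rule tendsto_sandwich[OF _ _ tendsto_const z]; use xe in \<open>auto intro!: always_eventually less_imp_le\<close>)+
  then have "(%n. x + xj n $* h + et n $* k) \<longlonglongrightarrow> x + 0 $* h + 0 $* k"
   by (intro tendsto_intros)
  moreover have "isCont (%y. H y k $. h) x"
   using C2gD(4)[OF f, of UNIV k] by (auto simp: continuous_on_eq_continuous_at intro!: cnt)
  ultimately have "(%n. H (x + xj n $* h + et n $* k) k $. h) \<longlonglongrightarrow> H x k $. h"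
   using isCont_tendsto_compose[of x "%y. H y k $. h"] by simp
  moreover have "Dl (1/real (Suc n)) h k/(1/real (Suc n))^2 = H (x + xj n $* h + et n $* k) k $. h" for n
   using xe[of n] by simp
  ultimately show ?thesis by simp
 qed
 have "Dl s h k = Dl s k h" for s
  by (simp add: Dl_def alg)
 then show ?thesis
  using LIMSEQ_unique[OF lim[of h k]] lim[of k h] by simp
qed

lemma C2g_partial: "C2g f g H ==> C1g (%x. g x $. v) (%x. H x v)"
 using C2g_grad_inner_C1g C2g_symmetric by metis

lemma C2g_const: "C2g (%x. c) (%x. 0) (%x h. 0)"
 by (auto simp: C2g_def C1g_const)

lemma C2g_inner: "C2g (%x. x $. v) (%x. v) (%x h. 0)"
 by (auto simp: C2g_def C1g_inner)

lemma C2g_add: "C2g f g H ==> C2g f' g' H' ==> C2g (%x. f x + f' x) (%x. g x + g' x) (%x h. H x h + H' x h)"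
 unfolding C2g_def by (auto intro!: C1g_add derivative_intros cnt)

lemma C2g_mult:
 assumes "C2g f g H" "C2g f' g' H'"
 shows "C2g (%x. f x*f' x) (%x. f x $* g' x + f' x $* g x)
   (%x h. f x $* H' x h + (g x $. h) $* g' x + f' x $* H x h + (g' x $. h) $* g x)"
 unfolding C2g_def
proof (intro conjI allI)
 show "C1g (%x. f x*f' x) (%x. f x $* g' x + f' x $* g x)"
  using assms by (auto intro: C1g_mult C2gD)
 fix x
 show "((%x. f x $* g' x + f' x $* g x) has_derivative
   (%h. f x $* H' x h + (g x $. h) $* g' x + f' x $* H x h + (g' x $. h) $* g x)) (at x)"
  using C2gD(2,3)[OF assms(1)] C2gD(2,3)[OF assms(2)]
  by (auto intro!: dvi simp: alg)
 fix h
 show "continuous_on UNIV (%x. f x $* H' x h + (g x $. h) $* g' x + f' x $* H x h + (g' x $. h) $* g x)"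
  using assms by (intro cnt) (auto dest: C2gD)
qed

lemma C2g_cmult: "C2g f g H ==> C2g (%x. c*f x) (%x. c $* g x) (%x h. c $* H x h)"
 using C2g_mult[OF C2g_const[of c]] by simp

lemma C2g_sum: "(!!i. i : I ==> C2g (f i) (g i) (H i)) ==>
  C2g (%x. \<Sum>i\<in>I. f i x) (%x. \<Sum>i\<in>I. g i x) (%x h. \<Sum>i\<in>I. H i x h)"
 by (induction I rule: infinite_finite_induct) (auto intro: C2g_const C2g_add)

lemma C2g_compose:
 assumes f: "C2g f g H" and k: "!!x. (k has_real_derivative k' (f x)) (at (f x))"
  "!!x. (k' has_real_derivative k'' (f x)) (at (f x))" "continuous_on (range f) k''"
 shows "C2g (%x. k (f x)) (%x. k' (f x) $* g x)
   (%x h. k' (f x) $* H x h + (k'' (f x)*(g x $. h)) $* g x)"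
 unfolding C2g_def
proof (intro conjI allI)
 have ck: "continuous_on (range f) k'"
  by (rule continuous_at_imp_continuous_on) (use k(2) DERIV_isCont in blast)
 show "C1g (%x. k (f x)) (%x. k' (f x) $* g x)"
  by (rule C1g_compose[OF C2gD(1)[OF f] k(1) ck])
 fix x
 have "((%x. k' (f x)) has_derivative (%h. k'' (f x)*(g x $. h))) (at x)"
  using hdc[OF C2gD(2)[OF f] k(2)[unfolded has_field_derivative_def]] by simp
 then show "((%x. k' (f x) $* g x) has_derivative
   (%h. k' (f x) $* H x h + (k'' (f x)*(g x $. h)) $* g x)) (at x)"
  using C2gD(3)[OF f] by (auto intro!: dvi)
 fix h
 show "continuous_on UNIV (%x. k' (f x) $* H x h + (k'' (f x)*(g x $. h)) $* g x)"
  using f by (auto intro!: cnt cnt2[OF ck] cnt2[OF k(3)] dest: C2gD)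
qed

lemma tr_add: "tr (%h. A h + B h) = tr A + tr B"
 and tr_scale: "tr (%h. c $* A h) = c*tr A"
 and tr_zero: "tr (%h. 0) = 0"
 and tr_sum: "tr (%h. \<Sum>i\<in>I. C i h) = (\<Sum>i\<in>I. tr (C i))"
 and tr_id: "tr (%h::'a::euclidean_space. h) = real DIM('a)"
 by (simp_all add: tr_def inner_add_left sum.distrib sum_distrib_left inner_sum_left inner_same_Basis)
   (rule sum.swap)

lemma tr_rank1: "tr (%h. (v $. h) $* w) = v $. w"
 by (simp add: tr_def euclidean_inner[of v w])

lemma tr_rank1': "tr (%h. (c*(v $. h)) $* w) = c*(v $. w)"
 using tr_scale[of c "%h. (v $. h) $* w"] by (simp add: tr_rank1)

lemmas tr_simps = tr_add tr_scale tr_zero tr_sum tr_id tr_rank1 tr_rank1'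

lemma C2g_norm2: "C2g (%x::'a::euclidean_space. x $. x) (%x. 2 $* x) (%x h. 2 $* h)"
 unfolding C2g_def C1g_def
 by (auto intro!: dvi cnt simp: inner_commute alg)

text \<open>The directional derivative vanishes at \<open>x\<close>; if \<open>H x h $. h\<close>
  were positive it would be positive just beyond \<open>x\<close> and push \<open>f\<close> above
  its maximum.\<close>

lemma C2g_max:
 fixes f :: "'a::euclidean_space => real"
 assumes f: "C2g f g H" and S: "open S" "x : S" and mx: "!!y. y : S ==> f y <= f x"
 shows "g x = 0" "H x h $. h <= 0" "tr (H x) <= 0"
proof -
 obtain r where r: "r > 0" "ball x r \<subseteq> S" using S open_contains_ball by blast
 have "(%h. g x $. h) = (%h. 0)"
  by (rule differential_zero_maxmin[OF S(2) S(1) C2gD(2)[OF f]]) (use mx in auto)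
 then show g0: "g x = 0" by (metis inner_eq_zero_iff)
 show *: "H x h $. h <= 0" for h
 proof (rule ccontr)
  assume "\<not> H x h $. h <= 0"
  then have pos: "H x h $. h > 0" and h0: "h ~= 0" by auto
  have dd: "((%s. g (x + s $* h) $. h) has_real_derivative (H x h $. h)) (at 0)"
  proof -
   have "((%b. g (x + b $* h)) has_derivative (%d. H (x + 0 $* h) (d $* h))) (at 0)"
    by (rule hdc[of "%b. x + b $* h" "%d. d $* h" 0 UNIV g, OF _ C2gD(3)[OF f]])
      (auto intro!: dvi)
   then have "((%b. g (x + b $* h) $. h) has_derivative (%d. H x (d $* h) $. h)) (at 0)"
    by (auto intro!: dvi)
   then show ?thesis
    by (rule has_derivative_imp_has_field_derivative)
      (simp add: linear_cmul[OF C2gD(5)[OF f]] mult.commute)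
  qed
  obtain d where d: "d > 0" "!!s. 0 < s ==> s < d ==> g (x + (0 + s) $* h) $. h > g (x + 0 $* h) $. h"
   using DERIV_pos_inc_right[OF dd pos] by auto
  define s where "s = min d (r/norm h)/2"
  have s: "0 < s" "s < d" "s*norm h < r"
   using d(1) r(1) h0 by (auto simp: s_def min_def field_simps)
  obtain xj where xi: "0 < xj" "xj < s" "f (x + s $* h) - f (x + 0 $* h) = (s - 0)*(g (x + xj $* h) $. h)"
   using MVT2[OF s(1), of "%s. f (x + s $* h)" "%s. g (x + s $* h) $. h"] C1g_DERIV[OF C2gD(1)[OF f]] by blast
  have "g (x + xj $* h) $. h > 0"
   using d(2)[of xj] xi s g0 by simp
  then have "s*(g (x + xj $* h) $. h) > 0" using s by simp
  then have "f (x + s $* h) > f x"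
   using xi(3) by simp
  moreover have "x + s $* h : S"
   using r(2) s by (auto simp: dist_norm)
  ultimately show False using mx by fastforce
 qed
 show "tr (H x) <= 0" unfolding tr_def by (intro sum_nonpos *)
qed

text \<open>Passage from the partial derivatives in \<open>C2\<close> to the coordinate-free
  calculus in which everything below is done.\<close>

lemma C2_imp_C2g:
 fixes f :: "'a::euclidean_space => real"
 assumes "C2 f"
 shows "C2g f (%x. \<Sum>b\<in>Basis. partial f b x $* b)
  (%x h. \<Sum>b\<in>Basis. frechet_derivative (partial f b) (at x) h $* b)"
 unfolding C2g_def C1g_def
proof (intro conjI allI)
 have df: "(f has_derivative frechet_derivative f (at x)) (at x)" for x
  using assms unfolding C2_def by (simp add: frechet_derivative_works[symmetric])
 have dp: "(partial f b has_derivative frechet_derivative (partial f b) (at x)) (at x)" if "b : Basis" for b x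
  using assms that unfolding C2_def by (simp add: frechet_derivative_works[symmetric])
 fix x
 have "frechet_derivative f (at x) = ($.) (\<Sum>b\<in>Basis. partial f b x $* b)"
 proof
  fix h
  show "frechet_derivative f (at x) h = (\<Sum>b\<in>Basis. partial f b x $* b) $. h"
   by (subst linear_expand[OF has_derivative_linear[OF df]])
     (simp add: inner_sum_left partial_def inner_commute[of h] mult.commute)
 qed
 then show "(f has_derivative ($.) (\<Sum>b\<in>Basis. partial f b x $* b)) (at x)"
  using df[of x] by simp
 show "((%x. \<Sum>b\<in>Basis. partial f b x $* b) has_derivative
   (%h. \<Sum>b\<in>Basis. frechet_derivative (partial f b) (at x) h $* b)) (at x)"
  by (intro derivative_intros dp)
 show "continuous_on UNIV (%x. \<Sum>b\<in>Basis. partial f b x $* b)"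
  by (intro cnt continuous_at_imp_continuous_on ballI has_derivative_continuous[OF dp])
 fix h
 have "frechet_derivative (partial f b) (at x) h = (\<Sum>c\<in>Basis. (h $. c) $* partial (partial f b) c x)" if "b : Basis" for b x
  unfolding partial_def[of "partial f b"] by (rule linear_expand[OF has_derivative_linear[OF dp[OF that]]])
 then show "continuous_on UNIV (%x. \<Sum>b\<in>Basis. frechet_derivative (partial f b) (at x) h $* b)"
  using assms unfolding C2_def by (simp add: cnt)
qed

lemma C2g_partial_eq:
 assumes "C2g f g H"
 shows "partial f b x = g x $. b" "partial (partial f b) c x = H x c $. b"
proof -
 show 1: "partial f b x = g x $. b" for x
  using frechet_derivative_at[OF C2gD(2)[OF assms]] by (simp add: partial_def fun_eq_iff)
 then have "partial f b = (%x. g x $. b)" by auto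
 moreover have "((%x. g x $. b) has_derivative (%h. H x h $. b)) (at x)"
  using C2gD(3)[OF assms] by (auto intro!: dvi)
 ultimately show "partial (partial f b) c x = H x c $. b"
  using frechet_derivative_at by (metis partial_def)
qed

lemma C1g_partial_eq: "C1g f g ==> partial f b x = g x $. b"
 using frechet_derivative_at[OF C1gD, of f g x] by (simp add: partial_def fun_eq_iff)

lemma C1g_grad_sq: "C1g f g ==> grad_sq f x = g x $. g x"
 by (simp add: grad_sq_def C1g_partial_eq euclidean_inner[of "g x" "g x"] pow2)

lemma C2g_laplacian: "C2g f g H ==> laplacian f x = tr (H x)"
 by (simp add: laplacian_def C2g_partial_eq tr_def)

section \<open>Integration by parts\<close>

lemma csupp_mult:
 fixes f g :: "'a::euclidean_space => real"
 shows "csupp f ==> csupp (%x. f x*g x)" "csupp g ==> csupp (%x. f x*g x)"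
 by (force simp: csupp_def)+

lemma csupp_grad:
 assumes "C1g f g" "csupp f" shows "csupp g"
proof -
 obtain R where R: "!!x. norm x > R ==> f x = 0" using assms(2) unfolding csupp_def by blast
 have "g x = 0" if "norm x > R" for x
 proof -
  have "open {x::'a. norm x > R}" by (intro open_Collect_less cnt)
  then have "(%h. g x $. h) = (%h. 0)"
   by (intro has_derivative_unique[OF C1gD[OF assms(1)]])
     (rule has_derivative_transform_within_open[OF has_derivative_const[of 0]], use that R in auto)
  then show ?thesis by (metis inner_eq_zero_iff)
 qed
 then show ?thesis unfolding csupp_def by blast
qed

lemma integrable_csupp:
 fixes f :: "'a::euclidean_space => 'b::euclidean_space"
 assumes "continuous_on UNIV f" "csupp f"
 shows "integrable lborel f"
proof -
 obtain R where R: "!!x. norm x > R ==> f x = 0" using assms(2) unfolding csupp_def by blast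
 have "integrable lborel (%x. indicator (cball 0 R) x $* f x)"
  by (rule borel_integrable_compact) (auto intro: continuous_on_subset[OF assms(1)])
 also have "(%x. indicator (cball 0 R) x $* f x) = f"
  using R by (auto simp: fun_eq_iff indicator_def)
 finally show ?thesis .
qed

lemma lborel_integral_shift:
 fixes f :: "'a::euclidean_space => real"
 assumes "continuous_on UNIV f"
 shows "(LINT x|lborel. f (x + a)) = (LINT x|lborel. f x)"
proof -
 have fm: "f : borel_measurable borel" using assms borel_measurable_continuous_onI by blast
 have "(LINT x|lborel. f x) = (LINT x|distr lborel borel ((+) a). f x)"
  by (simp add: lborel_distr_plus)
 also have "... = (LINT x|lborel. f (a + x))"
  by (rule integral_distr) (use fm in auto)
 finally show ?thesis by (simp add: add.commute)
qed

text \<open>By translation invariance every difference quotient \<open>q k\<close> has integral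
  zero. The quotients are bounded by a constant on one fixed ball, so dominated convergence carries
  this over to the derivative.\<close>

lemma integral_grad_zero:
 fixes f :: "'a::euclidean_space => real"
 assumes f: "C1g f g" "csupp f"
 shows "(LINT x|lborel. g x $. b) = 0"
proof -
 obtain R where R: "!!x. norm x > R ==> f x = 0" using f(2) unfolding csupp_def by blast
 \<comment> \<open>The radius is enlarged by \<open>norm b\<close> so that the ball contains the
   supports of all quotients, whose steps are at most \<open>norm b\<close> long.\<close>
 define S where "S = cball (0::'a) (\<bar>R\<bar> + norm b)"
 have "compact S" by (simp add: S_def)
 obtain M where M: "!!x. norm (g x) <= M"
 proof -
  obtain R2 where R2: "!!x. norm x > R2 ==> g x = 0" using csupp_grad[OF f] unfolding csupp_def by blast
  have "bounded (g ` cball 0 R2)"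
   by (intro compact_imp_bounded compact_continuous_image C1g_cont_grad[OF f(1)]) simp
  then obtain M where "!!x. x : cball 0 R2 ==> norm (g x) <= M" unfolding bounded_iff by blast
  then have "norm (g x) <= max M 0" for x
   using R2[of x] by (cases "norm x > R2") (auto simp: not_less le_max_iff_disj)
  then show ?thesis using that by blast
 qed
 define q where "q k x = real (Suc k)*(f (x + (1/real (Suc k)) $* b) - f x)" for k x
 have shf: "continuous_on UNIV (%x. f (x + v))" for v
  by (intro cnt2[OF C1g_cont[OF f(1), of UNIV]] cnt) auto
 have intf: "integrable lborel f" by (intro integrable_csupp C1g_cont[OF f(1)] f(2))
 have ints: "integrable lborel (%x. f (x + v))" for v
 proof (rule integrable_csupp[OF shf])
  have "norm (x + v) > R" if "norm x > R + norm v" for x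
   using norm_triangle_ineq4[of "x + v" v] that by simp
  then show "csupp (%x. f (x + v))" unfolding csupp_def using R by blast
 qed
 have q0: "(LINT x|lborel. q k x) = 0" for k
  unfolding q_def using ints intf lborel_integral_shift[OF C1g_cont[OF f(1), of UNIV]]
  by (simp add: Bochner_Integration.integral_diff)
 have qb: "norm (q k x) <= indicator S x $* (M*norm b)" for k x
 proof (cases "x : S")
  case True
  have "0 < 1/real (Suc k)" by simp
  from MVT2[OF this, of "%s. f (x + s $* b)", OF C1g_DERIV[OF f(1)]] obtain xj where "f (x + (1/real (Suc k)) $* b) - f x = (1/real (Suc k))*(g (x + xj $* b) $. b)" by auto
  then have "q k x = g (x + xj $* b) $. b" by (simp add: q_def)
  then have "\<bar>q k x\<bar> <= norm (g (x + xj $* b))*norm b" using CS2 by simp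
  also have "... <= M*norm b" by (intro mrm M) auto
  finally show ?thesis using True by simp
 next
  case False
  then have n: "norm x > \<bar>R\<bar> + norm b" by (simp add: S_def)
  have "norm ((1/real (Suc k)) $* b) <= norm b" by (simp add: divide_le_eq mlm[of 1 "1 + real k" "norm b", simplified])
  then have "norm (x + (1/real (Suc k)) $* b) > R"
   using norm_triangle_ineq4[of "x + (1/real (Suc k)) $* b" "(1/real (Suc k)) $* b"] n by simp
  moreover have "norm x > R" using n norm_ge_zero[of b] by linarith
  ultimately show ?thesis using False R by (simp add: q_def)
 qed
 have "(%k. LINT x|lborel. q k x) \<longlonglongrightarrow> (LINT x|lborel. g x $. b)"
 proof (rule integral_dominated_convergence[where w="%x. indicator S x $* (M*norm b)"])
  show "(%x. g x $. b) : borel_measurable lborel"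
   using C1g_cont_grad[OF f(1), of UNIV] by (auto intro!: borel_measurable_continuous_onI cnt)
  show "q k : borel_measurable lborel" for k
   unfolding q_def using shf C1g_cont[OF f(1), of UNIV] by (auto intro!: borel_measurable_continuous_onI cnt)
  show "integrable lborel (%x. indicator S x $* (M*norm b))"
   by (rule borel_integrable_compact[OF \<open>compact S\<close>]) auto
  show "AE x in lborel. norm (q k x) <= indicator S x $* (M*norm b)" for k using qb by simp
  have "(%k. q k x) \<longlonglongrightarrow> g x $. b" for x
  proof -
   have "((%s. f (x + s $* b)) has_real_derivative (g (x + 0 $* b) $. b)) (at 0)"
    by (rule C1g_DERIV[OF f(1)])
   then have "((%s. (f (x + s $* b) - f x) / s) \<longlongrightarrow> g x $. b) (at 0)"
    by (simp add: DERIV_def)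
   moreover have "filterlim (%k. 1/real (Suc k)) (at 0) sequentially"
    using LIMSEQ_inverse_real_of_nat by (auto simp: filterlim_at field_simps)
   ultimately have "(%k. (f (x + (1/real (Suc k)) $* b) - f x)/(1/real (Suc k))) \<longlonglongrightarrow> g x $. b"
    by (rule filterlim_compose)
   then show ?thesis by (simp add: q_def mult.commute)
  qed
  then show "AE x in lborel. (%k. q k x) \<longlonglongrightarrow> g x $. b" by simp
 qed
 then show ?thesis using q0 by (simp add: LIMSEQ_const_iff)
qed

lemma integral_div_zero:
 fixes X :: "'a::euclidean_space => 'a"
 assumes X: "!!x. (X has_derivative X' x) (at x)" "!!h. continuous_on UNIV (%x. X' x h)" "csupp X"
 shows "(LINT x|lborel. tr (X' x)) = 0"
proof -
 have C: "C1g (%x. X x $. b) (%x. \<Sum>c\<in>Basis. (X' x c $. b) $* c)" for b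
  unfolding C1g_def
 proof (intro conjI allI)
  fix x
  have "((%x. X x $. b) has_derivative (%h. X' x h $. b)) (at x)"
   using X(1) by (auto intro!: dvi)
  moreover have "X' x h $. b = (\<Sum>c\<in>Basis. (X' x c $. b) $* c) $. h" for h
   by (subst linear_expand[OF has_derivative_linear[OF X(1)[of x]], of h])
     (simp add: inner_sum_left inner_commute[of h] mult.commute)
  then have "(%h. X' x h $. b) = ($.) (\<Sum>c\<in>Basis. (X' x c $. b) $* c)" by (rule ext)
  ultimately show "((%x. X x $. b) has_derivative ($.) (\<Sum>c\<in>Basis. (X' x c $. b) $* c)) (at x)"
   by (simp only:)
 qed (intro cnt X(2))
 have cs: "csupp (%x. X x $. b)" for b
  using X(3) by (force simp: csupp_def)
 have *: "(LINT x|lborel. X' x b $. b) = 0" "integrable lborel (%x. X' x b $. b)" if "b : Basis" for b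
 proof -
  have e: "(\<Sum>c\<in>Basis. (X' x c $. b) $* c) $. b = X' x b $. b" for x
   using that by (simp add: inner_sum_left inner_Basis if_distrib sum.delta cong: if_cong)
  show "(LINT x|lborel. X' x b $. b) = 0"
   using integral_grad_zero[OF C cs, of b b] unfolding e .
  have "csupp (%x. (\<Sum>c\<in>Basis. (X' x c $. b) $* c) $. b)"
   using csupp_grad[OF C cs, of b] by (force simp: csupp_def)
  then show "integrable lborel (%x. X' x b $. b)"
   unfolding e by (intro integrable_csupp cnt X(2))
 qed
 show ?thesis
  unfolding tr_def using * by (subst Bochner_Integration.integral_sum) auto
qed

lemma integral_by_parts:
 assumes "C1g f g" "C1g p q" "csupp f | csupp p"
 shows "(LINT x|lborel. f x*(q x $. b)) = - (LINT x|lborel. p x*(g x $. b))"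
proof -
 note C = C1g_mult[OF assms(1,2)]
 have cs: "csupp (%x. f x*p x)" using assms(3) by (auto intro: csupp_mult)
 have 1: "integrable lborel (%x. f x*(q x $. b))"
 proof (rule integrable_csupp)
  show "continuous_on UNIV (%x. f x*(q x $. b))"
   by (intro cnt C1g_cont[OF assms(1)] C1g_cont_grad[OF assms(2)])
  show "csupp (%x. f x*(q x $. b))"
   using assms(3) csupp_grad[OF assms(2)] by (force simp: csupp_def)
 qed
 have 2: "integrable lborel (%x. p x*(g x $. b))"
 proof (rule integrable_csupp)
  show "continuous_on UNIV (%x. p x*(g x $. b))"
   by (intro cnt C1g_cont[OF assms(2)] C1g_cont_grad[OF assms(1)])
  show "csupp (%x. p x*(g x $. b))"
   using assms(3) csupp_grad[OF assms(1)] by (force simp: csupp_def)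
 qed
 show ?thesis
  using integral_grad_zero[OF C cs, of b] 1 2 by (simp add: inner_add_left)
qed

section \<open>Third derivatives of solutions, and a weak Harnack inequality\<close>

lemma DERIV_pos_part_power:
 "((%s::real. (max 0 s)^Suc (Suc k)) has_real_derivative real (Suc (Suc k))*(max 0 s)^Suc k) (at s)"
proof -
 consider "s > 0" | "s < 0" | "s = 0" by linarith
 then show ?thesis
 proof cases
  case 1
  have "((%s::real. s^Suc (Suc k)) has_real_derivative real (Suc (Suc k)) * s^Suc k) (at s)"
   by (rule DERIV_pow[THEN DERIV_cong]) simp
  then show ?thesis
   using 1 has_field_derivative_transform_within_open[of "%s. s^Suc (Suc k)" _ s "{0<..}" "%s. (max 0 s)^Suc (Suc k)"]
   by (auto simp: max_def)
 next
  case 2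
  show ?thesis
   using 2 has_field_derivative_transform_within_open[of "%s. 0" 0 s "{..<0}" "%s. (max 0 s)^Suc (Suc k)"]
   by (auto simp: max_def)
 next
  case 3
  have "((%h::real. (max 0 h)^Suc (Suc k)/h) \<longlongrightarrow> 0) (at 0)"
  proof (rule Lim_null_comparison)
   show "\<forall>\<^sub>F h in at 0. norm ((max 0 h)^Suc (Suc k)/h) <= \<bar>h\<bar>^Suc k"
   proof (intro always_eventually allI)
    fix h :: real
    show "norm ((max 0 h)^Suc (Suc k)/h) <= \<bar>h\<bar>^Suc k"
    proof (cases "h > 0")
     case False
     then have "(max 0 h)^Suc (Suc k)/h = 0" by simp
     then show ?thesis by (simp only: norm_zero zero_le_power abs_ge_zero)
    qed simp
   qed
   have "((%h::real. \<bar>h\<bar>^Suc k) \<longlongrightarrow> \<bar>0\<bar>^Suc k) (at 0)" by (intro tendsto_intros)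
   then show "((%h::real. \<bar>h\<bar>^Suc k) \<longlongrightarrow> 0) (at 0)" by simp
  qed
  then show ?thesis using 3 by (simp add: DERIV_def)
 qed
qed

section \<open>Polynomial kernels on the unit ball and integrals with a parameter\<close>

definition kr :: "'a::euclidean_space => real" where "kr y = (max 0 (1 - y $. y))^2"
text \<open>A potential for the first kernel: the gradient of \<open>kP\<close> at \<open>y\<close>
  is \<open>- kr y $* y\<close>. This is what turns the radial derivative of a \<open>kr\<close>
  mean into a \<open>kP\<close> mean of the Laplacian.\<close>

definition kP :: "'a::euclidean_space => real" where "kP y = (max 0 (1 - y $. y))^3/6"

lemma C1g_kr: "C1g kr (%y. (- 4*max 0 (1 - y $. y)) $* y)"
proof -
 have "C1g (%y. 1 + (-1)*(y $. y)) (%y::'a. 0 + (-1) $* (2 $* y))"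
  by (intro C1g_add C1g_const C1g_cmult C2gD(1)[OF C2g_norm2])
 from C1g_compose[OF this, of "%s. (max 0 s)^Suc (Suc 0)", OF DERIV_pos_part_power]
 show ?thesis unfolding kr_def[abs_def]
  by (simp add: numeral_2_eq_2 cnt)
qed

lemma C1g_kP: "C1g kP (%y. - kr y $* y)"
proof -
 have "C1g (%y. 1 + (-1)*(y $. y)) (%y::'a. 0 + (-1) $* (2 $* y))"
  by (intro C1g_add C1g_const C1g_cmult C2gD(1)[OF C2g_norm2])
 from C1g_cmult[OF C1g_compose[OF this, of "%s. (max 0 s)^Suc (Suc 1)", OF DERIV_pos_part_power], of "1/6"]
 show ?thesis unfolding kP_def[abs_def] kr_def
  by (simp add: numeral_3_eq_3 numeral_2_eq_2 cnt)
qed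

lemma kr_nonneg: "kr y >= 0" and kP_nonneg: "kP y >= 0" and kP_le: "6*kP y <= kr y"
 using power_decreasing[of 2 3 "max 0 (1 - y $. y)"] by (auto simp: kr_def kP_def)

lemma inner_One: "i : Basis ==> One $. (i::'a::euclidean_space) = 1"
 by (simp add: inner_sum_left inner_Basis if_distrib sum.delta cong: if_cong)

lemma inner_self_ge_1: "norm y >= 1 ==> y $. (y::'a::real_inner) >= 1"
 by (simp add: dot_square_norm one_le_power)

lemma kr_zero: "norm y >= 1 ==> kr y = 0" and kP_zero: "norm y >= 1 ==> kP y = 0"
 using inner_self_ge_1[of y] by (simp_all add: kr_def kP_def max_def)

lemma csupp_kr: "csupp kr" and csupp_kP: "csupp kP"
 unfolding csupp_def by (auto intro!: exI[of _ 1] kr_zero kP_zero)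

abbreviation cb :: "'a::euclidean_space set" where "cb \<equiv> cbox (- One) One"

lemma integral_cb_eq_LINT:
 fixes f :: "'a::euclidean_space => real"
 assumes "continuous_on UNIV f" "!!y. norm y >= 1 ==> f y = 0"
 shows "integral cb f = (LINT y|lborel. f y)"
proof -
 have "csupp f" unfolding csupp_def using assms(2) by (auto intro!: exI[of _ 1])
 then have i: "integrable lborel f" using assms(1) by (intro integrable_csupp)
 have "integral cb f = integral UNIV (%y. if y : cb then f y else 0)"
  by (simp add: integral_restrict_UNIV)
 also have "(%y. if y : cb then f y else 0) = f"
 proof
  fix y :: 'a
  have "y : cb" if "norm y < 1"
  proof -
   have "\<bar>y $. i\<bar> <= 1" if "i : Basis" for i
    using Basis_le_norm[OF that, of y] \<open>norm y < 1\<close> by linarith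
   then show ?thesis by (auto simp: mem_box inner_One abs_le_iff minus_le_iff)
  qed
  then show "(if y : cb then f y else 0) = f y" using assms(2)[of y] by force
 qed
 also have "integral UNIV f = (LINT y|lborel. f y)" by (rule integral_lborel[OF i])
 finally show ?thesis .
qed

lemma inner_fun_eqD: "($.) a = ($.) (b::'a::real_inner) ==> a = b"
 by (metis inner_commute vector_eq_rdot)

text \<open>Weight and shift live on a box in a second space \<open>'b\<close>. One lemma thus
  serves convolutions on the ball, the kernels in radius and position of \<open>solution_C3\<close>,
  and integrals along vertical lines.\<close>

lemma conv_has_derivative:
 fixes V :: "'a::euclidean_space => 'c::euclidean_space" and pj :: "'b::euclidean_space => 'a"
 assumes V: "!!x. (V has_derivative V' x) (at x)" "!!h. continuous_on UNIV (%x. V' x h)"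
  and a: "continuous_on (cbox al be) a" and p: "continuous_on (cbox al be) pj"
 shows "((%x. integral (cbox al be) (%t. a t $* V (x + pj t))) has_derivative
   (%h. integral (cbox al be) (%t. a t $* V' (x + pj t) h))) (at x)"
  and "continuous_on UNIV (%x. integral (cbox al be) (%t. a t $* V' (x + pj t) h))"
proof -
 have bl: "bounded_linear (V' x)" for x using V(1) has_derivative_bounded_linear by blast
 have cV: "continuous_on UNIV V"
  using V(1) by (meson continuous_at_imp_continuous_on has_derivative_continuous)
 have c1: "continuous_on (UNIV \<times> cbox al be) (%(x, t). a t $* V' (x + pj t) h)" for h
  unfolding split_beta
  by (intro cnt cnt2[OF a] cnt2[OF V(2)]
    cnt2[OF p]) auto
 then show "continuous_on UNIV (%x. integral (cbox al be) (%t. a t $* V' (x + pj t) h))"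
  by (intro integral_continuous_on_param) (auto simp: split_beta)
 define fx where "fx x t = Blinfun (%h. a t $* V' (x + pj t) h)" for x t
 have fx: "blinfun_apply (fx x t) = (%h. a t $* V' (x + pj t) h)" for x t
  unfolding fx_def by (rule bounded_linear_Blinfun_apply) (intro bounded_linear_intros bl)
 have cfx: "continuous_on (UNIV \<times> cbox al be) (%(x, t). fx x t)"
  by (rule continuous_on_blinfun_componentwise) (use c1 in \<open>auto simp: fx split_beta\<close>)
 have "((%x. integral (cbox al be) (%t. a t $* V (x + pj t))) has_derivative
   blinfun_apply (integral (cbox al be) (fx x))) (at x within UNIV)"
 proof (rule leibniz_rule[OF _ _ cfx])
  show "((%x. a t $* V (x + pj t)) has_derivative blinfun_apply (fx x t)) (at x within UNIV)" for x t
  proof -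
   have "((%x. V (x + pj t)) has_derivative (%h. V' (x + pj t) h)) (at x)"
    by (rule hdc[of "%x. x + pj t" "%h. h" x UNIV V, OF _ V(1)]) (auto intro!: dvi)
   then show ?thesis unfolding fx by (auto intro!: dvi)
  qed
  show "(%t. a t $* V (x + pj t)) integrable_on cbox al be" for x
   by (intro icn cnt a cnt2[OF cV] p) auto
 qed auto
 moreover have "blinfun_apply (integral (cbox al be) (fx x)) = (%h. integral (cbox al be) (%t. a t $* V' (x + pj t) h))"
 proof
  fix h
  have "fx x integrable_on cbox al be"
   by (rule icn) (rule cnt2[OF cfx, of _ "%t. (x, t)", simplified], auto intro!: cnt)
  then have "integral (cbox al be) (%t. blinfun_apply (fx x t) h) = blinfun_apply (integral (cbox al be) (fx x)) h"
   using integral_linear[of "fx x" "cbox al be" "%f. blinfun_apply f h"] by (auto simp: o_def bounded_linear_intros)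
  then show "blinfun_apply (integral (cbox al be) (fx x)) h = integral (cbox al be) (%t. a t $* V' (x + pj t) h)"
   by (simp add: fx)
 qed
 ultimately show "((%x. integral (cbox al be) (%t. a t $* V (x + pj t))) has_derivative
   (%h. integral (cbox al be) (%t. a t $* V' (x + pj t) h))) (at x)"
  by simp
qed

lemma conv_C1g:
 fixes f :: "'a::euclidean_space => real" and pj :: "'b::euclidean_space => 'a"
 assumes f: "C1g f g" and a: "continuous_on (cbox al be) a" and p: "continuous_on (cbox al be) pj"
 shows "C1g (%x. integral (cbox al be) (%t. a t*f (x + pj t)))
   (%x. integral (cbox al be) (%t. a t $* g (x + pj t)))"
 unfolding C1g_def
proof (intro conjI allI)
 note cg = C1g_cont_grad[OF f, of UNIV]
 fix x
 have i: "(%t. a t $* g (x + pj t)) integrable_on cbox al be" for x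
  by (intro icn cnt a cnt2[OF cg] p) auto
 have "integral (cbox al be) (%t. a t $* (g (x + pj t) $. h)) = integral (cbox al be) (%t. a t $* g (x + pj t)) $. h" for h
  using integral_linear[OF i bounded_linear_inner_left[of h], of x] by (simp add: o_def)
 with conv_has_derivative(1)[OF C1gD[OF f] _ a p, of x]
 show "((%x. integral (cbox al be) (%t. a t*f (x + pj t))) has_derivative
    ($.) (integral (cbox al be) (%t. a t $* g (x + pj t)))) (at x)"
  by (simp add: cnt cg)
 show "continuous_on UNIV (%x. integral (cbox al be) (%t. a t $* g (x + pj t)))"
  by (rule integral_continuous_on_param, unfold split_beta)
    (intro cnt cnt2[OF a] cnt2[OF cg] cnt2[OF p], auto)
qed

lemma conv_C2g:
 fixes f :: "'a::euclidean_space => real" and pj :: "'b::euclidean_space => 'a"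
 assumes f: "C2g f g H" and a: "continuous_on (cbox al be) a" and p: "continuous_on (cbox al be) pj"
 shows "C2g (%x. integral (cbox al be) (%t. a t*f (x + pj t)))
   (%x. integral (cbox al be) (%t. a t $* g (x + pj t)))
   (%x h. integral (cbox al be) (%t. a t $* H (x + pj t) h))"
 unfolding C2g_def
 using conv_C1g[OF C2gD(1)[OF f] a p] conv_has_derivative[OF C2gD(3)[OF f] C2gD(4)[OF f] a p] by auto

lemma C2g_dilate:
 fixes r :: real
 assumes "C2g w g H"
 shows "C2g (%y. w (x + r $* y)) (%y. r $* g (x + r $* y)) (%y h. (r*r) $* H (x + r $* y) h)"
 unfolding C2g_def C1g_def
proof (intro conjI allI)
 have d: "((%y. x + r $* y) has_derivative (%h. r $* h)) (at y)" for y
  by (auto intro!: dvi)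
 fix y
 show "((%y. w (x + r $* y)) has_derivative ($.) (r $* g (x + r $* y))) (at y)"
  using hdc[OF d C2gD(2)[OF assms]] by (simp add: inner_scaleR_left[abs_def])
 have "((%y. g (x + r $* y)) has_derivative (%h. H (x + r $* y) (r $* h))) (at y)"
  by (rule hdc[OF d C2gD(3)[OF assms]])
 then show "((%y. r $* g (x + r $* y)) has_derivative (%h. (r*r) $* H (x + r $* y) h)) (at y)"
  by (auto intro!: dvi simp: linear_cmul[OF C2gD(5)[OF assms]])
 show "continuous_on UNIV (%y. r $* g (x + r $* y))"
  by (intro cnt cnt2[OF C2gD(6)[OF assms, of UNIV]]) auto
 fix h
 show "continuous_on UNIV (%y. (r*r) $* H (x + r $* y) h)"
  by (intro cnt cnt2[OF C2gD(4)[OF assms, of UNIV]]) auto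
qed

text \<open>Differentiation under the integral produces \<open>kr y $* y\<close>, minus the gradient
  of \<open>kP\<close>. One integration by parts then yields the Laplacian, with a factor
  \<open>r\<close> from the dilation.\<close>

lemma kernel_mean_deriv:
 fixes w :: "'a::euclidean_space => real"
 assumes w: "C2g w g H"
 shows "((%r. integral cb (%y. kr y*w (x + r $* y))) has_real_derivative
   r*integral cb (%y. kP y*tr (H (x + r $* y)))) (at r)"
proof -
 have ckr: "continuous_on S kr" and ckP: "continuous_on S kP" for S :: "'a set"
  using C1g_kr C1g_kP C1g_cont by auto
 have cw: "continuous_on UNIV w" and cg: "continuous_on UNIV g" using C2gD[OF w] by auto
 have "((%r. integral cb (%y. kr y*w (x + r $* y))) has_real_derivative
   integral cb (%y. kr y*(g (x + r $* y) $. y))) (at r within UNIV)"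
 proof (rule leibniz_rule_field_derivative)
  show "((%r. kr y*w (x + r $* y)) has_real_derivative kr y*(g (x + r $* y) $. y)) (at r within UNIV)" for r y
   using C1g_DERIV[OF C2gD(1)[OF w], of x y r] by (auto intro!: dvi)
  show "(%y. kr y*w (x + r $* y)) integrable_on cb" for r
   by (intro icn cnt ckr cnt2[OF cw]) auto
  show "continuous_on (UNIV \<times> cb) (%(r, y). kr y*(g (x + r $* y) $. y))"
   unfolding split_beta
   by (intro cnt cnt2[OF ckr[of UNIV]] cnt2[OF cg]) auto
 qed auto
 moreover have "integral cb (%y. kr y*(g (x + r $* y) $. y)) = r*integral cb (%y. kP y*tr (H (x + r $* y)))"
 proof -
  have cH: "continuous_on UNIV (%y. tr (H (x + r $* y)))"
   by (rule cnt2[OF C2g_cont_tr[OF w, of UNIV]]) (auto intro!: cnt)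
  have c1: "continuous_on UNIV (%y. kr y*(g (x + r $* y) $. y))"
   by (intro cnt ckr cnt2[OF cg]) auto
  have c2: "continuous_on UNIV (%y. kP y*tr (H (x + r $* y)))"
   by (intro cnt ckP cH)
  have "(LINT y|lborel. tr (%h. kP y $* (r $* H (x + r $* y) h) + ((- kr y $* y) $. h) $* g (x + r $* y))) = 0"
  proof (rule integral_div_zero)
   show "((%y. kP y $* g (x + r $* y)) has_derivative
     (%h. kP y $* (r $* H (x + r $* y) h) + ((- kr y $* y) $. h) $* g (x + r $* y))) (at y)" for y
   proof -
    have "((%y. g (x + r $* y)) has_derivative (%h. H (x + r $* y) (r $* h))) (at y)"
     by (rule hdc[OF _ C2gD(3)[OF w]]) (auto intro!: dvi)
    then show ?thesis
     using C1gD[OF C1g_kP, of y]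
     by (auto intro!: dvi simp: linear_cmul[OF C2gD(5)[OF w]])
   qed
   show "continuous_on UNIV (%y. kP y $* (r $* H (x + r $* y) h) + ((- kr y $* y) $. h) $* g (x + r $* y))" for h
    by (intro cnt ckP ckr cnt2[OF cg] cnt2[OF C2gD(4)[OF w, of UNIV]]) auto
   show "csupp (%y. kP y $* g (x + r $* y))"
    using csupp_kP by (force simp: csupp_def)
  qed
  then have e: "(LINT y|lborel. r*(kP y*tr (H (x + r $* y))) - kr y*(g (x + r $* y) $. y)) = 0"
   by (simp only: tr_simps inner_scaleR_left) (simp add: inner_commute alg)
  have i1: "integrable lborel (%y. kr y*(g (x + r $* y) $. y))"
   by (rule integrable_csupp[OF c1]) (rule csupp_mult(1)[OF csupp_kr])
  have i2: "integrable lborel (%y. kP y*tr (H (x + r $* y)))"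
   by (rule integrable_csupp[OF c2]) (rule csupp_mult(1)[OF csupp_kP])
  have "(LINT y|lborel. kr y*(g (x + r $* y) $. y)) = r*(LINT y|lborel. kP y*tr (H (x + r $* y)))"
   using e i1 i2 by simp
  moreover have "integral cb (%y. kr y*(g (x + r $* y) $. y)) = (LINT y|lborel. kr y*(g (x + r $* y) $. y))"
   by (rule integral_cb_eq_LINT[OF c1]) (simp add: kr_zero)
  moreover have "integral cb (%y. kP y*tr (H (x + r $* y))) = (LINT y|lborel. kP y*tr (H (x + r $* y)))"
   by (rule integral_cb_eq_LINT[OF c2]) (simp add: kP_zero)
  ultimately show ?thesis by simp
 qed
 ultimately show ?thesis by simp
qed

lemma kr_mass_pos: "integral cb (kr :: 'a::euclidean_space => real) > 0"
proof -
 have "integral cb (kr :: 'a => real) >= 0" by (intro integral_nonneg icn C1g_cont[OF C1g_kr]) (auto simp: kr_nonneg)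
 moreover have "integral cb (kr :: 'a => real) ~= 0"
 proof
  assume *: "integral cb (kr :: 'a => real) = 0"
  have "(kr has_integral 0) (cb :: 'a set)"
   using * icn[OF C1g_cont[OF C1g_kr]] by (metis integrable_integral)
  moreover have "(0::'a) : cbox (- One) One" by (auto simp: mem_box inner_One)
  moreover have "box (- One) (One::'a) ~= {}" by (auto simp: box_ne_empty inner_One)
  ultimately have "kr (0::'a) = 0"
   using has_integral_0_cbox_imp_0[of "- One::'a" One kr 0] C1g_cont[OF C1g_kr] kr_nonneg by blast
  then show False by (simp add: kr_def)
 qed
 ultimately show ?thesis by simp
qed

text \<open>Elliptic regularity without singular kernels. Integrating
  \<open>kernel_mean_deriv\<close> over radii from 0 to 1 represents \<open>u\<close> by means of
  \<open>u\<close> and \<open>k u\<close> against bounded kernels. When the derivative in direction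
  \<open>v\<close> is moved onto the kernels, \<open>U x $. v\<close> becomes an integral of
  translates of the twice differentiable functions \<open>u\<close> and \<open>k u\<close>, and
  inherits their regularity.\<close>

lemma solution_C3:
 fixes u :: "'a::euclidean_space => real"
 assumes u: "C2g u U Hu" and pde: "!!x. tr (Hu x) = k (u x)"
  and k: "!!s. (k has_real_derivative k' s) (at s)" "!!s. (k' has_real_derivative k'' s) (at s)"
   "continuous_on UNIV k''"
 shows "\<exists>K. C2g (%x. U x $. v) (%x. Hu x v) K"
proof -
 define c where "c = integral (cb::'a set) kr"
 have c: "c > 0" unfolding c_def by (rule kr_mass_pos)
 have ckr: "continuous_on S kr" and ckP: "continuous_on S kP" for S :: "'a set"
  using C1g_kr C1g_kP C1g_cont by auto
 have f: "C2g (%x. k (u x)) (%x. k' (u x) $* U x) (%x h. k' (u x) $* Hu x h + (k'' (u x)*(U x $. h)) $* U x)"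
  by (rule C2g_compose[OF u k(1,2)]) (auto intro: continuous_on_subset[OF k(3)])
 note cf = C2gD(7)[OF f, of UNIV] and cF = C2gD(6)[OF f, of UNIV]
 \<comment> \<open>Radius and position are joined in one box, so that the double integral is a
   single integral with shift \<open>fst t $* snd t\<close>.\<close>
 define S :: "(real \<times> 'a) set" where "S = cbox (0, - One) (1, One)"
 have cS: "continuous_on S (%t. fst t*kP (snd t))" "continuous_on S (%t. fst t $* snd t)"
  by (intro cnt cnt2[OF ckP[of UNIV]]; simp)+
 have rep: "c*u x = integral cb (%y. kr y*u (x + y)) - integral S (%t. (fst t*kP (snd t))*k (u (x + fst t $* snd t)))" for x
 proof -
  have "((%r. r*integral cb (%y. kP y*tr (Hu (x + r $* y)))) has_integral
    (integral cb (%y. kr y*u (x + 1 $* y)) - integral cb (%y. kr y*u (x + 0 $* y)))) {0..1}"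
   by (rule fundamental_theorem_of_calculus)
     (auto simp: has_real_derivative_iff_has_vector_derivative[symmetric] intro!: has_field_derivative_at_within kernel_mean_deriv[OF u])
  then have "integral {0..1} (%r. r*integral cb (%y. kP y*k (u (x + r $* y)))) =
    integral cb (%y. kr y*u (x + y)) - c*u x"
   by (simp add: pde integral_unique c_def mult.commute[of _ "u x"])
  moreover have "integral S (%t. (fst t*kP (snd t))*k (u (x + fst t $* snd t)))
    = integral {0..1} (%r. r*integral cb (%y. kP y*k (u (x + r $* y))))"
  proof -
   have "continuous_on S (%t. (fst t*kP (snd t))*k (u (x + fst t $* snd t)))"
    by (intro cnt cS cnt2[OF cf]) auto
   then show ?thesis
    unfolding S_def by (subst integral_prod_continuous) (auto simp: mult.assoc)
  qed
  ultimately show ?thesis by simp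
 qed
 have C: "C1g (%x. integral cb (%y. kr y*u (x + y)) + (-1)*integral S (%t. (fst t*kP (snd t))*k (u (x + fst t $* snd t))))
   (%x. integral cb (%y. kr y $* U (x + y)) + (-1) $* integral S (%t. (fst t*kP (snd t)) $* (k' (u (x + fst t $* snd t)) $* U (x + fst t $* snd t))))"
  unfolding S_def
  by (intro C1g_add C1g_cmult conv_C1g[OF C2gD(1)[OF u]] conv_C1g[OF C2gD(1)[OF f]] ckr cS[unfolded S_def] cnt)
 have C': "C1g (%x. c*u x) (%x. c $* U x)" by (rule C1g_cmult[OF C2gD(1)[OF u]])
 have gradeq: "c $* U x = integral cb (%y. kr y $* U (x + y)) - integral S (%t. (fst t*kP (snd t)) $* (k' (u (x + fst t $* snd t)) $* U (x + fst t $* snd t)))" for x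
 proof -
  have eq: "(%x. c*u x) = (%x. integral cb (%y. kr y*u (x + y)) + (-1)*integral S (%t. (fst t*kP (snd t))*k (u (x + fst t $* snd t))))"
   using rep by auto
  have "($.) (c $* U x) = ($.) (integral cb (%y. kr y $* U (x + y)) + (-1) $* integral S (%t. (fst t*kP (snd t)) $* (k' (u (x + fst t $* snd t)) $* U (x + fst t $* snd t))))"
   by (intro has_derivative_unique[OF C1gD[OF C'[unfolded eq]] C1gD[OF C]])
  from inner_fun_eqD[OF this] show ?thesis by simp
 qed
 \<comment> \<open>The factor \<open>r\<close> is the one which the dilation puts in front of the
   gradient; it is used up here, and the new kernel stays bounded down to
   \<open>r = 0\<close>.\<close>
 have parts: "integral cb (%y. q y*(r*(G (x + r $* y) $. v))) = - integral cb (%y. (q' y $. v)*F (x + r $* y))"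
  if q: "C1g q q'" "!!y. norm y >= 1 ==> q y = 0" "!!y. norm y >= 1 ==> q' y = 0" and F: "C2g F G HF"
  for q q' r x and F :: "'a => real" and G HF
 proof -
  have cs: "csupp q" unfolding csupp_def using q(2) by (auto intro!: exI[of _ 1])
  note d = C2g_dilate[OF F, of x r]
  have c1: "continuous_on UNIV (%y. q y*(r*(G (x + r $* y) $. v)))"
   by (intro cnt C1g_cont[OF q(1)] cnt2[OF C2gD(6)[OF F, of UNIV]]) auto
  have c2: "continuous_on UNIV (%y. (q' y $. v)*F (x + r $* y))"
   by (intro cnt C1g_cont_grad[OF q(1)] cnt2[OF C2gD(7)[OF F, of UNIV]]) auto
  have "(LINT y|lborel. q y*(r*(G (x + r $* y) $. v))) = - (LINT y|lborel. (q' y $. v)*F (x + r $* y))"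
   using integral_by_parts[OF q(1) C2gD(1)[OF d], of v] cs by (simp add: mult.commute)
  then show ?thesis
   by (subst integral_cb_eq_LINT[OF c1], simp add: q)
     (subst integral_cb_eq_LINT[OF c2], auto simp: q)
 qed
 let ?kr' = "%y::'a. (- 4*max 0 (1 - y $. y)) $* y"
 let ?kP' = "%y::'a. - kr y $* y"
 have ckr': "continuous_on S ?kr'" and ckP': "continuous_on S ?kP'" for S
  using C1g_cont_grad[OF C1g_kr] C1g_cont_grad[OF C1g_kP] by auto
 have cS': "continuous_on S (%t. ?kP' (snd t) $. v)"
  by (intro cnt cnt2[OF ckr[of UNIV]]) auto
 have main: "c*(U x $. v) = (-1)*integral cb (%y. (?kr' y $. v)*u (x + y))
   + integral S (%t. (?kP' (snd t) $. v)*k (u (x + fst t $* snd t)))" for x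
 proof -
  have i1: "(%y. kr y $* U (x + y)) integrable_on cb"
   by (intro icn cnt ckr cnt2[OF C2gD(6)[OF u, of UNIV]]) auto
  have i2: "(%t. (fst t*kP (snd t)) $* (k' (u (x + fst t $* snd t)) $* U (x + fst t $* snd t))) integrable_on S"
   unfolding S_def
   by (intro icn continuous_on_scaleR[OF cS(1)[unfolded S_def]] cnt2[OF cF] cnt) auto
  have "c*(U x $. v) = (c $* U x) $. v" by simp
  also have "... = integral cb (%y. kr y*(1*(U (x + 1 $* y) $. v))) -
    integral S (%t. (fst t*kP (snd t))*((k' (u (x + fst t $* snd t)) $* U (x + fst t $* snd t)) $. v))"
   using integral_linear[OF i1 bounded_linear_inner_left[of v]] integral_linear[OF i2 bounded_linear_inner_left[of v]]
   by (simp add: gradeq inner_diff_left o_def mult.assoc)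
  also have "integral cb (%y. kr y*(1*(U (x + 1 $* y) $. v))) = - integral cb (%y. (?kr' y $. v)*u (x + 1 $* y))"
   by (rule parts[OF C1g_kr _ _ u]) (auto simp: kr_zero max_def dest: inner_self_ge_1)
  also have "integral S (%t. (fst t*kP (snd t))*((k' (u (x + fst t $* snd t)) $* U (x + fst t $* snd t)) $. v))
    = integral {0..1} (%r. integral cb (%y. kP y*(r*((k' (u (x + r $* y)) $* U (x + r $* y)) $. v))))"
  proof -
   have "continuous_on S (%t. (fst t*kP (snd t))*((k' (u (x + fst t $* snd t)) $* U (x + fst t $* snd t)) $. v))"
    by (intro continuous_on_mult[OF cS(1)] continuous_on_inner cnt2[OF cF] cnt) auto
   then show ?thesis
    unfolding S_def by (subst integral_prod_continuous) (auto simp: alg)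
  qed
  also have "... = integral {0..1} (%r. - integral cb (%y. (?kP' y $. v)*k (u (x + r $* y))))"
   by (intro integral_cong parts[OF C1g_kP _ _ f]) (auto simp: kP_zero kr_zero)
  also have "... = - integral S (%t. (?kP' (snd t) $. v)*k (u (x + fst t $* snd t)))"
  proof -
   have "continuous_on S (%t. (?kP' (snd t) $. v)*k (u (x + fst t $* snd t)))"
    by (intro continuous_on_mult[OF cS'] cnt2[OF cf] cnt) auto
   then show ?thesis
    unfolding S_def by (subst integral_prod_continuous) auto
  qed
  finally show ?thesis by simp
 qed
 let ?G = "%x. (1/c) $* ((-1) $* integral cb (%y. (?kr' y $. v) $* U (x + y))
   + integral S (%t. (?kP' (snd t) $. v) $* (k' (u (x + fst t $* snd t)) $* U (x + fst t $* snd t))))"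
 have "\<exists>K. C2g (%x. (1/c)*((-1)*integral cb (%y. (?kr' y $. v)*u (x + y))
   + integral S (%t. (?kP' (snd t) $. v)*k (u (x + fst t $* snd t))))) ?G K"
 proof -
  have "continuous_on cb (%y. ?kr' y $. v)" by (intro continuous_on_inner ckr' continuous_on_const)
  note K1 = conv_C2g[OF u this continuous_on_id]
  note K2 = conv_C2g[OF f cS'[unfolded S_def] cS(2)[unfolded S_def], folded S_def]
  from C2g_cmult[OF C2g_add[OF C2g_cmult[OF K1, of "-1"] K2], of "1/c"] show ?thesis by blast
 qed
 moreover have "(%x. (1/c)*((-1)*integral cb (%y. (?kr' y $. v)*u (x + y))
   + integral S (%t. (?kP' (snd t) $. v)*k (u (x + fst t $* snd t))))) = (%x. U x $. v)"
  using c by (simp only: main[symmetric]) auto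
 ultimately obtain K where K: "C2g (%x. U x $. v) ?G K" by (simp only:) blast
 have "?G x = Hu x v" for x
 proof -
  have "($.) (?G x) = ($.) (Hu x v)"
   by (rule has_derivative_unique[OF C2gD(2)[OF K] C1gD[OF C2g_partial[OF u]]])
  then show ?thesis by (rule inner_fun_eqD)
 qed
 then have "?G = (%x. Hu x v)" by (rule ext)
 with K show ?thesis by (auto simp only:)
qed

text \<open>With \<open>6 * kP <= kr\<close> the bound on the Laplacian gives
  \<open>m' r <= C/6 * r * m r\<close> for the \<open>kr\<close> means \<open>m\<close> of
  \<open>w\<close>. Gronwall's factor over the unit interval is \<open>exp (C/12)\<close>.\<close>

lemma weak_Harnack:
 fixes w :: "'a::euclidean_space => real"
 assumes w: "C2g w g H" and pos: "!!x. w x > 0" and le: "!!x. tr (H x) <= C*w x" and C: "C >= 0"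
 shows "integral cb (%y. kr y*w (x + y)) <= exp (C/12)*(integral (cb::'a set) kr*w x)"
proof -
 have ckr: "continuous_on S kr" and ckP: "continuous_on S kP" for S :: "'a set"
  using C1g_kr C1g_kP C1g_cont by auto
 have cw: "continuous_on S (%y. w (x + r $* y))" for r S
  by (intro cnt2[OF C2gD(7)[OF w, of UNIV]] cnt) auto
 have cH: "continuous_on S (%y. tr (H (x + r $* y)))" for r S
  by (intro cnt2[OF C2g_cont_tr[OF w, of UNIV]] cnt) auto
 define m where "m r = integral cb (%y. kr y*w (x + r $* y))" for r
 define m' where "m' r = r*integral cb (%y. kP y*tr (H (x + r $* y)))" for r
 have dm: "(m has_real_derivative m' r) (at r)" for r
  unfolding m_def[abs_def] m'_def by (rule kernel_mean_deriv[OF w])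
 have ub: "m' r <= C/6*r*m r" if "r >= 0" for r
 proof -
  have "integral cb (%y. kP y*tr (H (x + r $* y))) <= integral cb (%y. C/6*(kr y*w (x + r $* y)))"
  proof (rule integral_le)
   show "(%y. kP y*tr (H (x + r $* y))) integrable_on cb" "(%y. C/6*(kr y*w (x + r $* y))) integrable_on cb"
    by (intro icn cnt ckr ckP cw cH)+
   fix y
   have "kP y*tr (H (x + r $* y)) <= kP y*(C*w (x + r $* y))"
    by (intro mlm le kP_nonneg)
   also have "... = (6*kP y)*(C/6*w (x + r $* y))" by simp
   also have "... <= kr y*(C/6*w (x + r $* y))"
    using pos[of "x + r $* y"] C by (intro mrm kP_le) auto
   finally show "kP y*tr (H (x + r $* y)) <= C/6*(kr y*w (x + r $* y))" by (simp add: alg)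
  qed
  then have "integral cb (%y. kP y*tr (H (x + r $* y))) <= C/6*m r" by (simp add: m_def)
  from mlm[OF this that] show ?thesis unfolding m'_def
   by (simp add: alg)
 qed
 have "m 1*exp (- (C/12)*1^2) <= m 0*exp (- (C/12)*0^2)"
 proof (rule DERIV_nonpos_imp_nonincreasing[of 0 1 "%r. m r*exp (- (C/12)*r^2)"])
  fix r :: real assume r: "0 <= r" "r <= 1"
  have "((%r. m r*exp (- (C/12)*r^2)) has_real_derivative (m' r - C/6*r*m r)*exp (- (C/12)*r^2)) (at r)"
   using dm[of r] by (auto intro!: dvi simp: alg)
  moreover have "(m' r - C/6*r*m r)*exp (- (C/12)*r^2) <= 0"
   using ub[OF r(1)] by (simp add: mult_nonpos_nonneg)
  ultimately show "\<exists>y. ((%r. m r*exp (- (C/12)*r^2)) has_real_derivative y) (at r) & y <= 0" by blast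
 qed simp
 then have "m 1 <= m 0*exp (C/12)" by (simp add: exp_minus field_simps)
 then show ?thesis by (simp add: m_def mult.commute)
qed

section \<open>The Allen--Cahn equation in the variable \<open>z\<close>, \<open>u = tanh (sqrt 2 * z)\<close>\<close>

lemma tanh_artanh_real:
 fixes x :: real
 assumes "\<bar>x\<bar> < 1"
 shows "tanh (artanh x) = x"
proof -
 have "exp (- 2 * artanh x) = (1 - x)/(1 + x)"
 proof -
  have "(1 + x)/(1 - x) > 0" using assms by (intro divide_pos_pos) linarith+
  then have "exp (- ln ((1 + x)/(1 - x))) = inverse ((1 + x)/(1 - x))"
   by (simp only: exp_minus exp_ln)
  then show ?thesis by (simp add: artanh_def)
 qed
 moreover have "1 + x > 0" using assms by linarith
 then have "1 - (1 - x)/(1 + x) = 2*x/(1 + x)" "1 + (1 - x)/(1 + x) = 2/(1 + x)"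
  by (simp_all add: field_simps)
 ultimately show ?thesis
  using \<open>1 + x > 0\<close> by (simp add: tanh_real_altdef)
qed

lemma DERIV_half_sqrt2_inverse:
 fixes s :: real
 assumes "1 - s\<^sup>2 ~= 0"
 shows "((%s. sqrt 2/2/(1 - s\<^sup>2)) has_real_derivative sqrt 2 * s/(1 - s\<^sup>2)^2) (at s)"
proof -
 have "((%s. 1 - s\<^sup>2) has_real_derivative - (2 * s)) (at s)"
  by (auto intro!: dvi)
 from DERIV_divide[OF DERIV_const this assms] show ?thesis
  by (rule DERIV_cong) (simp only: pow2, simp)
qed

lemma C1g_unique: "C1g f g ==> C1g f g' ==> g = g'"
proof
 fix x assume "C1g f g" "C1g f g'"
 then show "g x = g' x"
  by (intro inner_fun_eqD) (rule has_derivative_unique[OF C1gD C1gD])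
qed

lemma C2g_unique: "C2g f g H ==> C2g f g' H' ==> g = g' & H = H'"
 by (metis C1g_unique C2gD(1,3) ext has_derivative_unique)

text \<open>\<open>K a x b\<close> and \<open>K b x a\<close> are both the gradient of
  \<open>H x a $. b\<close>, so third derivatives commute and the trace may be taken before
  differentiating in direction \<open>v\<close>.\<close>

lemma third_derivative_swap:
 fixes f :: "'a::euclidean_space => real"
 assumes f: "C2g f g H" and K: "!!v. C2g (%x. g x $. v) (%x. H x v) (K v)"
  and t: "C1g (%x. tr (H x)) tu"
 shows "tr (K v x) = tu x $. v"
proof -
 have c: "C1g (%x. H x a $. b) (%x. K a x b)" for a b
  by (rule C2g_partial[OF K])
 have s: "K a x b = K b x a" for a b
 proof -
  have "C1g (%x. H x a $. b) (%x. K b x a)"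
   using c[of b a] by (simp add: C2g_symmetric[OF f, of _ b a])
  from C1g_unique[OF c this] show ?thesis by meson
 qed
 have "C1g (%x. tr (H x)) (%x. \<Sum>b\<in>Basis. K b x b)"
  unfolding tr_def by (intro C1g_sum c)
 from C1g_unique[OF t this] have "tu x $. v = (\<Sum>b\<in>Basis. K b x b $. v)"
  by (simp add: inner_sum_left)
 also have "... = (\<Sum>b\<in>Basis. K v x b $. b)"
  by (intro sum.cong refl) (metis C2g_symmetric[OF K] s)
 finally show ?thesis by (simp add: tr_def)
qed

definition frob :: "('a::euclidean_space => 'a) => real" where
 "frob H = L2_set (%b. norm (H b)) Basis"

lemma frob_nonneg: "frob H >= 0"
 by (simp add: frob_def L2_set_nonneg)

lemma frob_sq: "(frob H)^2 = (\<Sum>b\<in>Basis. H b $. H b)"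
 by (simp add: frob_def L2_set_def sum_nonneg nrm2)

lemma norm_le_frob:
 assumes "linear H"
 shows "norm (H h) <= frob H*norm h"
proof -
 have "norm (H h) <= (\<Sum>b\<in>Basis. norm ((h $. b) $* H b))"
  by (subst linear_expand[OF assms]) (rule norm_sum)
 also have "... <= (\<Sum>b\<in>Basis. \<bar>norm (H b)\<bar>*\<bar>h $. b\<bar>)"
  by (intro sum_mono) (simp add: mult.commute)
 also have "... <= L2_set (%b. norm (H b)) Basis*L2_set (%b. h $. b) Basis"
  by (rule L2_set_mult_ineq)
 also have "L2_set (%b. h $. b) Basis = norm h"
  by (simp add: norm_eq_sqrt_inner L2_set_def euclidean_inner[of h h] pow2)
 finally show ?thesis by (simp add: frob_def)
qed

lemma tr_le_frob: "(tr (H :: 'a::euclidean_space => 'a))^2 <= real DIM('a)*(frob H)^2"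
proof -
 have "\<bar>tr H\<bar> <= (\<Sum>b\<in>Basis. \<bar>norm (H b)\<bar>*\<bar>1\<bar>)"
  unfolding tr_def by (rule order_trans[OF sum_abs]) (intro sum_mono, simp add: CS2[of _ b for b, THEN order_trans])
 also have "... <= frob H*L2_set (%b::'a. 1) Basis"
  unfolding frob_def by (rule L2_set_mult_ineq)
 also have "L2_set (%b::'a. 1) Basis = sqrt (real DIM('a))" by (simp add: L2_set_def)
 finally have "\<bar>tr H\<bar>\<^sup>2 <= (frob H * sqrt (real DIM('a)))^2"
  by (intro power_mono) auto
 then show ?thesis by (simp add: pmd mult.commute)
qed

section \<open>The solution in terms of \<open>z\<close>: identities of first, second and third
  order\<close>

locale ac =
 fixes u :: "'a::euclidean_space => real" and U :: "'a => 'a" and Hu :: "'a => 'a => 'a" and e :: 'a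
 assumes u: "C2g u U Hu" and u_bound: "!!x. \<bar>u x\<bar> < 1"
  and pde: "!!x. tr (Hu x) = W' (u x)" and mono_e: "!!x. U x $. e > 0" and norm_e: "norm e = 1"
begin

definition z :: "'a => real" where "z x = sqrt 2/2 * artanh (u x)"
definition sg :: "'a => real" where "sg x = 1 - (u x)\<^sup>2"
definition Z :: "'a => 'a" where "Z x = (sqrt 2/2 / sg x) $* U x"
definition B :: "'a => 'a => 'a" where
 "B x h = (sqrt 2/2 / sg x) $* Hu x h + (sqrt 2*u x/(sg x)^2*(U x $. h)) $* U x"
text \<open>The discrepancy between potential and gradient energy, normalised to vanish for the
  profile \<open>tanh (sqrt 2 * t)\<close>.\<close>

definition Q :: "'a => real" where "Q x = 1 - Z x $. Z x"
definition ze :: "'a => real" where "ze x = Z x $. e"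
definition be :: "'a => real" where "be x = frob (B x)"

text \<open>The weighted Laplacian \<open>M f = sg\<^sup>-\<^sup>2 div (sg\<^sup>2 grad f)\<close>, as a function of gradient and Hessian.\<close>
definition Mo :: "('a => 'a) => ('a => 'a => 'a) => 'a => real" where
 "Mo g H x = tr (H x) - 4 * sqrt 2*u x*(Z x $. g x)"

lemma sg_pos: "sg x > 0" and sg_le: "sg x <= 1" and u_sq: "(u x)^2 = 1 - sg x"
proof -
 have "(u x)^2 < 1" using u_bound[of x] by (simp add: abs_square_less_1)
 then show "sg x > 0" "sg x <= 1" "(u x)^2 = 1 - sg x" by (auto simp: sg_def)
qed

lemma U_eq: "U x = (sqrt 2 * sg x) $* Z x"
 using sg_pos[of x] by (simp add: Z_def)

lemma u_eq_tanh: "u x = tanh (sqrt 2*z x)"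
proof -
 have "sqrt 2*z x = artanh (u x)" by (simp add: z_def)
 then show ?thesis using u_bound[of x] by (simp add: tanh_artanh_real)
qed

lemma ze_pos: "ze x > 0"
 using mono_e[of x] sg_pos[of x] by (simp add: ze_def Z_def)

lemma C2g_z: "C2g z Z B"
proof -
 have "C2g (%x. sqrt 2/2 * artanh (u x)) (%x. (sqrt 2/2/(1 - (u x)\<^sup>2)) $* U x)
  (%x h. (sqrt 2/2/(1 - (u x)\<^sup>2)) $* Hu x h + (sqrt 2*u x/(1 - (u x)\<^sup>2)^2*(U x $. h)) $* U x)"
 proof (rule C2g_compose[OF u, of "%s. sqrt 2/2 * artanh s" "%s. sqrt 2/2/(1 - s\<^sup>2)" "%s. sqrt 2 * s/(1 - s\<^sup>2)^2"])
  fix x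
  have nz: "1 - (u x)\<^sup>2 ~= 0" using sg_pos[of x] by (simp add: sg_def)
  show "((%s. sqrt 2/2 * artanh s) has_real_derivative sqrt 2/2/(1 - (u x)\<^sup>2)) (at (u x))"
   using DERIV_cmult[OF artanh_real_has_field_derivative[OF u_bound[of x]], of "sqrt 2/2"] by simp
  show "((%s. sqrt 2/2/(1 - s\<^sup>2)) has_real_derivative sqrt 2*u x/(1 - (u x)\<^sup>2)^2) (at (u x))"
   by (rule DERIV_half_sqrt2_inverse[OF nz])
 next
  have "(1 - s\<^sup>2) ~= 0" if "s : range u" for s
  proof -
   obtain x where "s = u x" using \<open>s : range u\<close> by blast
   then show ?thesis using sg_pos[of x] by (simp add: sg_def)
  qed
  then show "continuous_on (range u) (%s. sqrt 2 * s/(1 - s\<^sup>2)^2)" by (intro cnt) auto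
 qed
 then show ?thesis by (simp add: z_def[abs_def] Z_def[abs_def] B_def[abs_def] sg_def)
qed

lemma linB: "linear (B x)" by (rule C2gD(5)[OF C2g_z])
lemma B_sym: "B x h $. k = B x k $. h" by (rule C2g_symmetric[OF C2g_z])
lemma norm_B: "norm (B x h) <= be x*norm h" unfolding be_def by (rule norm_le_frob[OF linB])
lemma be_nonneg: "be x >= 0" by (simp add: be_def frob_nonneg)

text \<open>Inserting \<open>U_eq\<close> into the equation for \<open>u\<close>, the two
  contributions differ only by the factor \<open>Z x $. Z x\<close>, so the Laplacian of
  \<open>z\<close> is a multiple of the discrepancy.\<close>

lemma trB: "tr (B x) = - 2 * sqrt 2*u x*Q x"
proof -
 have "tr (B x) = sqrt 2/2 / sg x*W' (u x) + sqrt 2*u x/(sg x)^2*(U x $. U x)"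
  unfolding B_def by (simp only: tr_simps pde)
 also have "... = - 2 * sqrt 2*u x*Q x"
  using sg_pos[of x] unfolding Q_def U_eq[of x] W'_def sg_def[symmetric]
  by (simp add: field_simps pow2)
 finally show ?thesis .
qed

lemma C1g_Q: "C1g Q (%x. (-2) $* B x (Z x))"
proof -
 have "C1g (%x. 1 + (-1)*(\<Sum>b\<in>Basis. (Z x $. b)*(Z x $. b)))
   (%x. 0 + (-1) $* (\<Sum>b\<in>Basis. (Z x $. b) $* B x b + (Z x $. b) $* B x b))"
  by (intro C1g_add C1g_const C1g_cmult C1g_sum C1g_mult C2g_partial[OF C2g_z])
 moreover have "(%x. 1 + (-1)*(\<Sum>b\<in>Basis. (Z x $. b)*(Z x $. b))) = Q"
  by (simp add: Q_def fun_eq_iff euclidean_inner[of "Z _" "Z _"])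
 moreover have "0 + (-1) $* (\<Sum>b\<in>Basis. (Z x $. b) $* B x b + (Z x $. b) $* B x b) = (-2) $* B x (Z x)" for x
  using linear_expand[OF linB, of x "Z x"] by (simp add: sum.distrib scaleR_2)
 ultimately show ?thesis by simp
qed

text \<open>The Hessian of a component of \<open>Z\<close>, a third derivative of \<open>z\<close>.
  Its existence is \<open>C2g_Zv\<close>; no formula for it is available, hence the choice
  operator.\<close>

definition K :: "'a => 'a => 'a => 'a" where "K v = (SOME K. C2g (%x. Z x $. v) (%x. B x v) K)"

lemma C2g_Zv: "C2g (%x. Z x $. v) (%x. B x v) (K v)"
proof -
 have "\<exists>K. C2g (%x. U x $. v) (%x. Hu x v) K"
 proof (rule solution_C3[OF u, of W' "%s. -4 + 12 * s^2" "%s. 24 * s"])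
  show "tr (Hu x) = W' (u x)" for x by (rule pde)
  show "(W' has_real_derivative -4 + 12 * s^2) (at s)" for s
   unfolding W'_def[abs_def] by (auto intro!: dvi simp: pow2 alg)
  show "((%s. -4 + 12 * s^2) has_real_derivative 24 * s) (at s)" for s :: real
   by (auto intro!: dvi)
 qed (intro cnt)
 then obtain K1 where K1: "C2g (%x. U x $. v) (%x. Hu x v) K1" by blast
 have "C2g (%x. sqrt 2/2/(1 - (u x)\<^sup>2)) (%x. (sqrt 2*u x/(1 - (u x)\<^sup>2)^2) $* U x)
  (%x h. (sqrt 2*u x/(1 - (u x)\<^sup>2)^2) $* Hu x h + ((sqrt 2*(1 + 3*(u x)^2)/(1 - (u x)\<^sup>2)^3)*(U x $. h)) $* U x)"
 proof (rule C2g_compose[OF u, of "%s. sqrt 2/2/(1 - s\<^sup>2)" "%s. sqrt 2 * s/(1 - s\<^sup>2)^2" "%s. sqrt 2*(1 + 3 * s^2)/(1 - s\<^sup>2)^3"])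
  fix x
  have nz: "1 - (u x)\<^sup>2 ~= 0" using sg_pos[of x] by (simp add: sg_def)
  show "((%s. sqrt 2/2/(1 - s\<^sup>2)) has_real_derivative sqrt 2*u x/(1 - (u x)\<^sup>2)^2) (at (u x))"
   by (rule DERIV_half_sqrt2_inverse[OF nz])
  define w where "w = 1 - (u x)\<^sup>2"
  have w: "w ~= 0" "(u x)^2 = 1 - w" using nz by (auto simp: w_def)
  have "((%s. sqrt 2 * s/(1 - s\<^sup>2)^2) has_real_derivative
    (sqrt 2*w^2 - sqrt 2*u x*(2*w*(- (2*u x))))/(w^2*w^2)) (at (u x))"
   using nz by (auto intro!: dvi simp: w_def)
  moreover have "(sqrt 2*w^2 - sqrt 2*u x*(2*w*(- (2*u x))))/(w^2*w^2) = sqrt 2*(1 + 3*(u x)^2)/w^3"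
  proof -
   have "(sqrt 2*w^2 - sqrt 2*u x*(2*w*(- (2*u x)))) = sqrt 2*w*(w + 4*(u x)^2)"
    by (simp add: pow2 alg)
   also have "... = sqrt 2*w*(1 + 3*(u x)^2)" using w by simp
   finally show ?thesis using w(1) by (simp only:) (simp add: pow2 power3_eq_cube)
  qed
  ultimately show "((%s. sqrt 2 * s/(1 - s\<^sup>2)^2) has_real_derivative sqrt 2*(1 + 3*(u x)^2)/(1 - (u x)\<^sup>2)^3) (at (u x))"
   by (simp add: w_def)
 next
  have "(1 - s\<^sup>2) ~= 0" if "s : range u" for s
  proof -
   obtain x where "s = u x" using \<open>s : range u\<close> by blast
   then show ?thesis using sg_pos[of x] by (simp add: sg_def)
  qed
  then show "continuous_on (range u) (%s. sqrt 2*(1 + 3 * s^2)/(1 - s\<^sup>2)^3)" by (intro cnt) auto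
 qed
 from C2g_mult[OF this K1] obtain g H where gH: "C2g (%x. Z x $. v) g H"
  by (auto simp: Z_def sg_def)
 from C1g_unique[OF C2gD(1)[OF gH] C2g_partial[OF C2g_z]] have "g = (%x. B x v)" .
 with gH have "\<exists>K. C2g (%x. Z x $. v) (%x. B x v) K" by blast
 then show ?thesis unfolding K_def by (rule someI_ex)
qed

text \<open>\<open>trB\<close> is differentiated in direction \<open>v\<close>. The derivative that
  falls on \<open>Q\<close> equals the drift term of \<open>Mo\<close> and cancels with it, so only
  a zeroth order term is left.\<close>

lemma Mo_Zv: "Mo (%x. B x v) (K v) x = - 4 * sg x*Q x*(Z x $. v)"
proof -
 have "C1g (%x. (-2 * sqrt 2)*(u x*Q x)) (%x. (-2 * sqrt 2) $* (u x $* ((-2) $* B x (Z x)) + Q x $* U x))"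
  by (intro C1g_cmult C1g_mult C2gD(1)[OF u] C1g_Q)
 then have "C1g (%x. tr (B x)) (%x. (-2 * sqrt 2) $* (u x $* ((-2) $* B x (Z x)) + Q x $* U x))"
  by (simp add: trB mult.assoc)
 from third_derivative_swap[OF C2g_z C2g_Zv this, of v x]
 have "tr (K v x) = (-2 * sqrt 2)*(u x*((-2)*(B x (Z x) $. v)) + Q x*(sqrt 2 * sg x*(Z x $. v)))"
  by (simp only: inner_add_left inner_scaleR_left U_eq)
 then show ?thesis
  unfolding Mo_def using B_sym[of x v "Z x"]
  by (simp add: alg inner_commute mult.assoc[of "sqrt 2" "sqrt 2", symmetric])
qed

lemma Mo_add: "Mo (%x. g x + g' x) (%x h. H x h + H' x h) x = Mo g H x + Mo g' H' x"
 by (simp add: Mo_def tr_simps inner_add_right alg)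

lemma Mo_cmult: "Mo (%x. c $* g x) (%x h. c $* H x h) x = c*Mo g H x"
 by (simp add: Mo_def tr_simps alg)

lemma Mo_const: "Mo (%x. 0) (%x h. 0) x = 0"
 by (simp add: Mo_def tr_simps)

lemma Mo_sum: "Mo (%x. \<Sum>i\<in>I. g i x) (%x h. \<Sum>i\<in>I. H i x h) x = (\<Sum>i\<in>I. Mo (g i) (H i) x)"
 by (simp add: Mo_def tr_simps inner_sum_right sum_subtractf sum_distrib_left)

lemma Mo_mult:
 "Mo (%x. f x $* g' x + f' x $* g x)
   (%x h. f x $* H' x h + (g x $. h) $* g' x + f' x $* H x h + (g' x $. h) $* g x) x
  = f x*Mo g' H' x + f' x*Mo g H x + 2*(g x $. g' x)"
 unfolding Mo_def by (simp only: tr_simps inner_add_right inner_scaleR_right) (simp add: inner_commute alg)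

lemma Mo_compose:
 "Mo (%x. k' (f x) $* g x) (%x h. k' (f x) $* H x h + (k'' (f x)*(g x $. h)) $* g x) x
  = k' (f x)*Mo g H x + k'' (f x)*(g x $. g x)"
 unfolding Mo_def by (simp only: tr_simps inner_add_right inner_scaleR_right) (simp add: alg)

lemma Mo_inner: "Mo (%x. v) (%x h. 0) x = - 4 * sqrt 2*u x*(Z x $. v)"
 by (simp add: Mo_def tr_simps)

lemma Mo_z: "Mo Z B x = - 2 * sqrt 2*u x*(2 - Q x)"
 unfolding Mo_def trB by (simp add: Q_def alg)

definition HQ :: "'a => 'a => 'a" where
 "HQ x h = (-1) $* (\<Sum>b\<in>Basis. (Z x $. b) $* K b x h + (B x b $. h) $* B x b + (Z x $. b) $* K b x h + (B x b $. h) $* B x b)"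

text \<open>Bochner's formula: \<open>Q\<close> is one minus the sum of the squared components of
  \<open>Z\<close>, each component satisfies \<open>Mo_Zv\<close>, and the squared gradients of the
  components add up to \<open>(be x)^2\<close>.\<close>

lemma C2g_Q: "C2g Q (%x. (-2) $* B x (Z x)) HQ"
 and Mo_Q: "Mo (%x. (-2) $* B x (Z x)) HQ x = 8 * sg x*(1 - Q x)*Q x - 2*(be x)^2"
proof -
 let ?g = "%b x. (Z x $. b) $* B x b + (Z x $. b) $* B x b"
 let ?H = "%b x h. (Z x $. b) $* K b x h + (B x b $. h) $* B x b + (Z x $. b) $* K b x h + (B x b $. h) $* B x b"
 have 1: "C2g (%x. 1 + (-1)*(\<Sum>b\<in>Basis. (Z x $. b)*(Z x $. b)))
   (%x. 0 + (-1) $* (\<Sum>b\<in>Basis. ?g b x)) (%x h. 0 + (-1) $* (\<Sum>b\<in>Basis. ?H b x h))"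
  by (intro C2g_add C2g_const C2g_cmult C2g_sum C2g_mult C2g_Zv)
 have 2: "(%x. 1 + (-1)*(\<Sum>b\<in>Basis. (Z x $. b)*(Z x $. b))) = Q"
  by (simp add: Q_def fun_eq_iff euclidean_inner[of "Z _" "Z _"])
 have 3: "(%x. 0 + (-1) $* (\<Sum>b\<in>Basis. ?g b x)) = (%x. (-2) $* B x (Z x))"
  using C1g_unique[OF C2gD(1)[OF 1[unfolded 2]] C1g_Q] .
 have 4: "(%x h. 0 + (-1) $* (\<Sum>b\<in>Basis. ?H b x h)) = HQ"
  by (simp add: HQ_def[abs_def])
 show "C2g Q (%x. (-2) $* B x (Z x)) HQ" using 1 unfolding 2 3 4 .
 have "Mo (%x. 0 + (-1) $* (\<Sum>b\<in>Basis. ?g b x)) (%x h. 0 + (-1) $* (\<Sum>b\<in>Basis. ?H b x h)) x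
  = - (\<Sum>b\<in>Basis. 2*(Z x $. b)*(- 4 * sg x*Q x*(Z x $. b)) + 2*(B x b $. B x b))"
 proof -
  have "Mo (%x. 0 + (-1) $* (\<Sum>b\<in>Basis. ?g b x)) (%x h. 0 + (-1) $* (\<Sum>b\<in>Basis. ?H b x h)) x
   = - (\<Sum>b\<in>Basis. Mo (?g b) (?H b) x)"
   unfolding Mo_add[of "%x. 0" _ "%x h. 0"] Mo_cmult Mo_const Mo_sum by simp
  also have "... = - (\<Sum>b\<in>Basis. 2*(Z x $. b)*(- 4 * sg x*Q x*(Z x $. b)) + 2*(B x b $. B x b))"
   unfolding Mo_mult Mo_Zv by (simp add: alg)
  finally show ?thesis .
 qed
 also have "... = 8 * sg x*Q x*(\<Sum>b\<in>Basis. (Z x $. b)*(Z x $. b)) - 2*(\<Sum>b\<in>Basis. B x b $. B x b)"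
  by (simp add: sum.distrib sum_distrib_left alg sum_negf sum_subtractf)
 also have "... = 8 * sg x*(1 - Q x)*Q x - 2*(be x)^2"
  unfolding be_def frob_sq euclidean_inner[of "Z x" "Z x", symmetric] by (simp add: Q_def)
 finally show "Mo (%x. (-2) $* B x (Z x)) HQ x = 8 * sg x*(1 - Q x)*Q x - 2*(be x)^2"
  unfolding 3 4 .
qed

lemma Mo_max:
 assumes "C2g f g H" "open S" "x : S" "!!y. y : S ==> f y <= f x"
 shows "g x = 0" "Mo g H x <= 0"
 using C2g_max[OF assms] by (auto simp: Mo_def)

text \<open>Cauchy-Schwarz for the trace in \<open>trB\<close>: curvature controls the discrepancy
  wherever \<open>u\<close> is not small.\<close>

lemma uQ_le: "8*(u x)^2*(Q x)^2 <= real DIM('a)*(be x)^2"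
 using tr_le_frob[of "B x"] unfolding trB be_def by (simp add: pmd)

lemma C2g_bump: "C2g (%x. 1 + (- c)*((x - x0) $. (x - x0))) (%x. (- 2 * c) $* (x - x0)) (%x h. (- 2 * c) $* h)"
 for x0 :: 'a
 unfolding C2g_def C1g_def
 by (auto intro!: dvi cnt simp: inner_commute alg inner_diff_left inner_diff_right)

text \<open>Modica's gradient bound: \<open>q = -Q\<close> satisfies \<open>M q \<ge> (8/n) q\<^sup>2\<close> where it is positive,
 so a cutoff on a large ball forces \<open>q \<le> O(1/R)\<close>.\<close>
lemma Modica: "Q x0 >= 0"
proof (rule ccontr)
 assume "\<not> Q x0 >= 0"
 define q0 where "q0 = - Q x0"
 have q0: "q0 > 0" using \<open>\<not> Q x0 >= 0\<close> by (simp add: q0_def)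
 define n where "n = real DIM('a)"
 have n: "n >= 1" using DIM_positive[where 'a='a] unfolding n_def by linarith
 \<comment> \<open>\<open>R >= 6*n\<close> makes \<open>24/R <= 4/n\<close>, so that the drift can
   be absorbed; the last summand makes \<open>4/n*q0 <= (4*n + 56)/R\<close> impossible.\<close>
 define R where "R = 1 + 6*n + (4*n + 56)*n/q0"
 have R: "R >= 1" "R >= 6*n" "R >= 1 + (4*n + 56)*n/q0" using q0 n by (auto simp: R_def)
 define c where "c = 1/R^2"
 have c: "c > 0" using R by (simp add: c_def)
 define zt where "zt x = 1 + (- c)*((x - x0) $. (x - x0))" for x
 have Cz: "C2g zt (%x. (- 2 * c) $* (x - x0)) (%x h. (- 2 * c) $* h)"
  unfolding zt_def[abs_def] by (rule C2g_bump)
 note Ce = C2g_mult[OF Cz Cz]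
 note CF = C2g_mult[OF C2g_cmult[OF C2g_Q, of "-1"] Ce]
 define F where "F x = (- 1*Q x)*(zt x*zt x)" for x
 have "continuous_on (cball x0 R) F" unfolding F_def[abs_def] using C2gD(7)[OF CF] .
 then obtain x1 where x1: "x1 : cball x0 R" "!!y. y : cball x0 R ==> F y <= F x1"
  using continuous_attains_sup[of "cball x0 R" F] R by auto
 have Fx0: "F x0 = q0" by (simp add: F_def zt_def q0_def)
 then have X: "F x1 >= q0" using x1(2)[of x0] R by simp
 define y where "y = x1 - x0"
 have ny: "norm y <= R" using x1(1) by (simp add: y_def dist_norm norm_minus_commute)
 have zeta: "zt x1 = 1 - c*(norm y)^2" by (simp add: zt_def y_def nrm2)
 have z0: "zt x1 ~= 0" using X q0 by (auto simp: F_def)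
 have "c*(norm y)^2 <= 1"
  using power_mono[OF ny, of 2] R by (simp add: c_def divide_le_eq)
 then have z1: "0 < zt x1" "zt x1 <= 1" using z0 zeta c by auto
 have "norm y < R"
 proof (rule ccontr)
  assume "\<not> norm y < R"
  then have "norm y = R" using ny by simp
  then have "zt x1 = 0" using R by (simp add: zeta c_def)
  then show False using z0 by simp
 qed
 then have "x1 : ball x0 R" by (simp add: y_def dist_norm norm_minus_commute)
 have mx: "(- 1*Q y)*(zt y*zt y) <= (- 1*Q x1)*(zt x1*zt x1)" if "y : ball x0 R" for y
  using x1(2)[of y] that by (simp add: F_def)
 define q where "q = - Q x1"
 define s where "s = zt x1"
 have Fq: "F x1 = q * s^2" by (simp add: F_def q_def s_def pow2)
 have s01: "0 < s" "s <= 1" using z1 by (auto simp: s_def)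
 have q: "q > 0" using X q0 Fq s01 by (metis less_le_trans zero_less_mult_pos2 zero_less_power)
 note m1 = Mo_max(1)[OF CF open_ball \<open>x1 : ball x0 R\<close> mx]
 note m2 = Mo_max(2)[OF CF open_ball \<open>x1 : ball x0 R\<close> mx]
 let ?gq = "2 $* B x1 (Z x1)"
 let ?ge = "(2 * s) $* ((- 2 * c) $* y)"
 have g0: "q $* ?ge + s^2 $* ?gq = 0"
 proof -
  have 1: "zt x1 $* v + zt x1 $* v = (2 * s) $* v" for v :: 'a
   by (simp add: s_def flip: scaleR_left_distrib)
  have 2: "zt x1*zt x1 = s^2" "- 1*Q x1 = q" "(-1) $* (-2) $* v = 2 $* v" for v :: 'a
   by (simp_all add: s_def q_def pow2)
  show ?thesis using m1 unfolding 1 2 y_def .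
 qed
 have Moz: "Mo (%x. (- 2 * c) $* (x - x0)) (%x h. (- 2 * c) $* h) x1 = - 2 * c*n + 8 * sqrt 2 * c*u x1*(Z x1 $. y)"
  unfolding Mo_def by (simp only: tr_simps n_def) (simp add: y_def)
 have m3: "q*(2 * s*(- 2 * c*n + 8 * sqrt 2 * c*u x1*(Z x1 $. y)) + 2*(4 * c^2*(y $. y)))
   + s^2*(- (8 * sg x1*(1 - Q x1)*Q x1 - 2*(be x1)^2)) + 2*(?gq $. ?ge) <= 0"
  using m2[unfolded Mo_mult, unfolded Moz, unfolded Mo_cmult Mo_Q]
  by (simp add: q_def s_def y_def pow2 alg)
 \<comment> \<open>The first order condition at the maximum expresses the gradient of
   \<open>Q\<close> through that of the cutoff, so the cross term is at most of order
   \<open>q * c\<close>.\<close>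
 have gg: "?gq $. ?ge = - q*(16 * c^2*(y $. y))"
 proof -
  have "s^2*(?gq $. ?ge) = (s^2 $* ?gq) $. ?ge" by simp
  also have "s^2 $* ?gq = - (q $* ?ge)" using g0 by (metis add.commute add_eq_0_iff)
  also have "- (q $* ?ge) $. ?ge = s^2*(- q*(16 * c^2*(y $. y)))"
   by (simp add: pow2)
  finally show ?thesis using s01 by simp
 qed
 have cyy: "c^2*(y $. y) <= c"
  using mlm[OF \<open>c * (norm y)^2 <= 1\<close>, of c] c
  by (simp add: nrm2 pow2[of c] mult.assoc)
 have nZ: "norm (Z x1) <= sqrt (1 + q)" by (simp add: norm_eq_sqrt_inner q_def Q_def)
 \<comment> \<open>Two sources of \<open>q^2\<close> are joined through \<open>u^2 + sg = 1\<close>: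
   the part with \<open>u^2\<close> comes from curvature by \<open>uQ_le\<close>, the part with
   \<open>sg\<close> from the zeroth order term of \<open>Mo_Q\<close>.\<close>
 have lap: "8/n*q^2 <= - (8 * sg x1*(1 - Q x1)*Q x1 - 2*(be x1)^2)"
 proof -
  have "8*(u x1)^2*q^2 <= n*(be x1)^2" using uQ_le[of x1] by (simp add: q_def n_def)
  then have "8/n*((u x1)^2*q^2) <= (be x1)^2" using n by (simp add: field_simps)
  moreover have "8/n*(sg x1*q^2) <= 8*(sg x1*((1 + q)*q))"
  proof -
   have "8/n*(sg x1*q^2) <= 8*(sg x1*q^2)"
    using n sg_pos[of x1] by (intro mrm) (auto simp: divide_le_eq)
   also have "... <= 8*(sg x1*((1 + q)*q))"
    using q sg_pos[of x1] by (intro mlm) (auto simp: pow2)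
   finally show ?thesis .
  qed
  moreover have "8/n*q^2 = 8/n*((u x1)^2*q^2) + 8/n*(sg x1*q^2)"
   by (simp add: u_sq alg)
  moreover have "8*(sg x1*((1 + q)*q)) = - (8 * sg x1*(1 - Q x1)*Q x1)"
   by (simp add: q_def alg)
  ultimately show ?thesis
   using zero_le_power2[of "be x1"] by linarith
 qed
 have drift: "\<bar>8 * sqrt 2 * c*u x1*(Z x1 $. y)\<bar> <= 12 * sqrt (1 + q)/R"
 proof -
  have "\<bar>Z x1 $. y\<bar> <= sqrt (1 + q)*R"
   using CS2[of "Z x1" y] nZ ny by (smt (verit) mult_mono norm_ge_zero)
  then have "\<bar>u x1\<bar>*\<bar>Z x1 $. y\<bar> <= 1*(sqrt (1 + q)*R)"
   using u_bound[of x1] by (intro mult_mono) auto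
  moreover have "8 * sqrt 2 * c <= 12 * c"
   using c real_sqrt_le_iff[of 2 "9/4"] by (simp add: real_sqrt_divide)
  ultimately have "(8 * sqrt 2 * c)*(\<bar>u x1\<bar>*\<bar>Z x1 $. y\<bar>) <= (12 * c)*(1*(sqrt (1 + q)*R))"
   using c by (rule_tac mult_mono) auto
  then show ?thesis using c R by (simp add: abs_mult c_def pow2 mult.assoc)
 qed
 have "8/n*(q * s^2) <= 4 * c*n + 32 * c + 24*(s * sqrt (1 + q))/R"
 proof -
  have "s^2*(8/n*q^2) <= q*(4 * s * c*n + 32*(c^2*(y $. y)) + 2 * s*\<bar>8 * sqrt 2 * c*u x1*(Z x1 $. y)\<bar>)"
  proof -
   have "s^2*(8/n*q^2) <= s^2*(- (8 * sg x1*(1 - Q x1)*Q x1 - 2*(be x1)^2))"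
    by (intro mlm lap) auto
   also have "... <= q*(4 * s * c*n + 24*(c^2*(y $. y)) - 2 * s*(8 * sqrt 2 * c*u x1*(Z x1 $. y)))"
    using m3 unfolding gg by (simp add: alg)
   also have "... <= q*(4 * s * c*n + 32*(c^2*(y $. y)) + 2 * s*\<bar>8 * sqrt 2 * c*u x1*(Z x1 $. y)\<bar>)"
   proof (rule mlm)
    have "- (2 * s*(8 * sqrt 2 * c*u x1*(Z x1 $. y))) <= 2 * s*\<bar>8 * sqrt 2 * c*u x1*(Z x1 $. y)\<bar>"
     using mlm[OF abs_ge_minus_self, of "2 * s" "8 * sqrt 2 * c*u x1*(Z x1 $. y)"] s01 by simp
    moreover have "0 <= c^2*(y $. y)" by simp
    ultimately show "4 * s * c*n + 24*(c^2*(y $. y)) - 2 * s*(8 * sqrt 2 * c*u x1*(Z x1 $. y))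
     <= 4 * s * c*n + 32*(c^2*(y $. y)) + 2 * s*\<bar>8 * sqrt 2 * c*u x1*(Z x1 $. y)\<bar>" by linarith
   qed (use q in simp)
   finally show ?thesis .
  qed
  then have "q*(8/n*(q * s^2)) <= q*(4 * s * c*n + 32*(c^2*(y $. y)) + 2 * s*\<bar>8 * sqrt 2 * c*u x1*(Z x1 $. y)\<bar>)"
   by (simp add: pow2 alg)
  then have "8/n*(q * s^2) <= 4 * s * c*n + 32*(c^2*(y $. y)) + 2 * s*\<bar>8 * sqrt 2 * c*u x1*(Z x1 $. y)\<bar>"
   using q by (simp only: mult_le_cancel_left_pos)
  also have "... <= 4 * c*n + 32 * c + 2 * s*(12 * sqrt (1 + q)/R)"
   using s01 c n cyy drift by (intro add_mono mlm) (auto simp: mult_left_le_one_le)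
  finally show ?thesis by (simp add: alg)
 qed
 \<comment> \<open>The gradient is not yet known to be bounded. One factor \<open>s\<close> of the
   cutoff turns \<open>sqrt (1 + q)\<close> into at most \<open>1 + q * s^2\<close>, which is
   \<open>1 + F x1\<close>.\<close>
 moreover have "24*(s * sqrt (1 + q))/R <= 24*(1 + q * s^2)/R"
 proof -
  have "s * sqrt (1 + q) = sqrt (s^2 + q * s^2)"
  proof -
   have "s^2 + q * s^2 = s^2*(1 + q)" by (simp add: alg)
   then show ?thesis using s01 by (simp add: real_sqrt_mult)
  qed
  also have "... <= sqrt ((1 + q * s^2)^2)"
  proof (rule real_sqrt_le_mono)
   have "s^2 <= 1" using s01 by (simp add: power_le_one)
   moreover have "q * s^2 >= 0" using q by simp
   moreover have "(1 + q * s^2)^2 = 1 + 2*(q * s^2) + (q * s^2)^2" by (simp add: power2_sum)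
   ultimately show "s^2 + q * s^2 <= (1 + q * s^2)^2" using zero_le_power2[of "q * s^2"] by linarith
  qed
  also have "... = 1 + q * s^2" using q by simp
  finally show ?thesis using R by (intro divide_right_mono mlm) auto
 qed
 ultimately have "8/n*F x1 <= (4*n + 32) * c + 24*(1 + F x1)/R"
  unfolding Fq by (simp add: alg)
 moreover have "c <= 1/R" using R by (simp add: c_def pow2 divide_le_eq)
 then have "(4*n + 32) * c <= (4*n + 32)*(1/R)"
  using n by (intro mlm) auto
 ultimately have "8/n*F x1 <= (4*n + 32)*(1/R) + 24*(1 + F x1)/R" by linarith
 then have "8/n*F x1 - 24/R*F x1 <= (4*n + 56)/R" by (simp add: add_divide_distrib alg)
 moreover have "24/R <= 4/n" using R n by (simp add: field_simps)
 then have "4/n*F x1 <= 8/n*F x1 - 24/R*F x1"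
 proof -
  have "24/R*F x1 <= 4/n*F x1" using \<open>24 / R <= 4 / n\<close> X q0 by (intro mrm) auto
  moreover have "8/n*F x1 = 2*(4/n*F x1)" by simp
  ultimately show ?thesis by linarith
 qed
 moreover have "4/n*q0 <= 4/n*F x1" using X n by (intro mlm) auto
 ultimately have "4/n*q0 <= (4*n + 56)/R" by linarith
 then have "4*q0*R <= (4*n + 56)*n" using n R by (simp add: field_simps)
 moreover have "4*q0*R >= q0*(1 + (4*n + 56)*n/q0)"
  using R(3) q0 R(1) n by (intro mult_mono) (auto intro!: add_nonneg_nonneg)
 moreover have "q0*(1 + (4*n + 56)*n/q0) = q0 + (4*n + 56)*n"
  using q0 by (simp add: distrib_left)
 ultimately show False using q0 by linarith
qed

lemma Q_le: "Q x <= 1" by (simp add: Q_def)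

lemma norm_Z: "norm (Z x) <= 1"
 using Modica[of x] by (simp add: Q_def norm_eq_sqrt_inner)

lemma ze_le: "ze x <= 1"
 using CS2[of "Z x" e] norm_Z[of x] by (simp add: ze_def norm_e)

lemma z_lipschitz: "\<bar>z x - z y\<bar> <= norm (x - y)"
proof -
 have "norm (z x - z y) <= 1*norm (x - y)"
 proof (rule differentiable_bound[of UNIV z "%x h. Z x $. h"])
  show "onorm (($.) (Z x)) <= 1" for x
   using norm_Z[of x] by (intro onorm_le) (metis CS2 mrm norm_ge_zero order_trans real_norm_def)
 qed (use C2gD(2)[OF C2g_z] in auto)
 then show ?thesis by simp
qed

end

section \<open>Local minimality\<close>

lemma param_has_derivative:
 fixes pf :: "'a::euclidean_space => real => 'c::euclidean_space"
 assumes d: "!!x t. ((%x. pf x t) has_derivative pf' x t) (at x)"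
  and c': "!!h. continuous_on (UNIV \<times> {0..1}) (%(x, t). pf' x t h)"
  and c: "!!x. continuous_on {0..1} (pf x)"
 shows "((%x. integral {0..1} (pf x)) has_derivative (%h. integral {0..1} (%t. pf' x t h))) (at x)"
  and "continuous_on UNIV (%x. integral {0..1} (%t. pf' x t h))"
proof -
 have bl: "bounded_linear (pf' x t)" for x t using d has_derivative_bounded_linear by blast
 show "continuous_on UNIV (%x. integral {0..1} (%t. pf' x t h))"
  using integral_continuous_on_param[of UNIV 0 1 "%x t. pf' x t h"] c' by simp
 define fx where "fx x t = Blinfun (pf' x t)" for x t
 have fx: "blinfun_apply (fx x t) = pf' x t" for x t
  unfolding fx_def by (rule bounded_linear_Blinfun_apply) (rule bl)
 have cfx: "continuous_on (UNIV \<times> cbox 0 1) (%(x, t). fx x t)"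
  by (rule continuous_on_blinfun_componentwise) (use c' in \<open>auto simp: fx split_beta\<close>)
 have "((%x. integral (cbox 0 1) (pf x)) has_derivative blinfun_apply (integral (cbox 0 1) (fx x))) (at x within UNIV)"
  by (rule leibniz_rule[OF _ _ cfx]) (use d c in \<open>auto simp: fx intro!: integrable_continuous_real\<close>)
 moreover have "blinfun_apply (integral (cbox 0 1) (fx x)) = (%h. integral (cbox 0 1) (%t. pf' x t h))"
 proof
  fix h
  have "fx x integrable_on cbox 0 1"
   by (rule icn) (rule cnt2[OF cfx, of _ "%t. (x, t)", simplified], auto intro!: cnt)
  then have "integral (cbox 0 1) (%t. blinfun_apply (fx x t) h) = blinfun_apply (integral (cbox 0 1) (fx x)) h"
   using integral_linear[of "fx x" "cbox 0 1" "%f. blinfun_apply f h"] by (auto simp: o_def bounded_linear_intros)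
  then show "blinfun_apply (integral (cbox 0 1) (fx x)) h = integral (cbox 0 1) (%t. pf' x t h)"
   by (simp add: fx)
 qed
 ultimately show "((%x. integral {0..1} (pf x)) has_derivative (%h. integral {0..1} (%t. pf' x t h))) (at x)"
  by simp
qed

lemma W_DERIV: "(W has_real_derivative W' s) (at s)"
 unfolding W_def[abs_def] W'_def by (auto intro!: dvi)

lemma W_nonneg: "W s >= 0" by (simp add: W_def)

lemma continuous_on_W: "continuous_on S f ==> continuous_on S (%x. W (f x))"
 unfolding W_def by (intro cnt)

context ac
begin

text \<open>This is the form in which (i) enters the calibration: every line in direction
  \<open>e\<close> meets every level, so the translates of the graph of \<open>u\<close> fill the
  whole strip of values between -1 and 1.\<close>

definition reaches :: bool where "reaches \<longleftrightarrow> (\<forall>x c. \<bar>c\<bar> < 1 --> (\<exists>s. u (x + s $* e) = c))"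

lemma u_line_DERIV: "((%s. u (x + s $* e)) has_real_derivative U (x + s $* e) $. e) (at s)"
 by (rule C1g_DERIV[OF C2gD(1)[OF u]])

lemma u_line_strict_mono: "s < s' ==> u (x + s $* e) < u (x + s' $* e)"
 using DERIV_pos_imp_increasing[of s s' "%s. u (x + s $* e)"] u_line_DERIV mono_e by blast

lemma u_cont: "continuous_on S u" "isCont u x" "continuous_on S U"
 using C2gD(6,7)[OF u, of UNIV] C2gD(6,7)[OF u, of S] by (auto simp: continuous_on_eq_continuous_at)

definition tu :: "'a => real => real" where "tu x c = (THE s. u (x + s $* e) = c)"

lemma tu_unique: "u (x + s $* e) = c ==> tu x c = s"
 unfolding tu_def by (rule the_equality) (metis less_irrefl linorder_neqE_linordered_idom u_line_strict_mono)+

lemma tu_eq: "reaches ==> \<bar>c\<bar> < 1 ==> u (x + tu x c $* e) = c"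
 unfolding reaches_def by (metis tu_unique)

text \<open>Strict monotonicity traps the crossing between \<open>s - d\<close> and
  \<open>s + d\<close> by two strict sign conditions, and these are open in the pair of point and
  level.\<close>

lemma tu_continuous:
 assumes r: "reaches" and c: "\<bar>c\<bar> < 1"
 shows "continuous (at (x, c)) (%(x, c). tu x c)"
 unfolding continuous_at
proof (rule tendstoI)
 fix d :: real assume d: "d > 0"
 define s where "s = tu x c"
 have us: "u (x + s $* e) = c" using tu_eq[OF r c] by (simp add: s_def)
 have lo: "u (x + (s - d) $* e) < c" and hi: "c < u (x + (s + d) $* e)"
  using u_line_strict_mono[of "s - d" s x] u_line_strict_mono[of s "s + d" x] d us by auto
 have t: "((%p. u (fst p + k $* e) - snd p) \<longlongrightarrow> u (x + k $* e) - c) (at (x, c))" for k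
 proof -
  have "((%p. fst p + k $* e) \<longlongrightarrow> x + k $* e) (at (x, c))" "(snd \<longlongrightarrow> c) (at (x, c))"
   by (auto intro!: tendsto_eq_intros)
  then show ?thesis by (intro tendsto_diff isCont_tendsto_compose[OF u_cont(2)])
 qed
 have 1: "\<forall>\<^sub>F p in at (x, c). u (fst p + (s - d) $* e) - snd p < 0"
  by (rule order_tendstoD(2)[OF t]) (use lo in simp)
 have 2: "\<forall>\<^sub>F p in at (x, c). 0 < u (fst p + (s + d) $* e) - snd p"
  by (rule order_tendstoD(1)[OF t]) (use hi in simp)
 have "(snd \<longlongrightarrow> c) (at (x, c))" by (auto intro!: tendsto_eq_intros)
 then have "((%p. \<bar>snd p\<bar>) \<longlongrightarrow> \<bar>c\<bar>) (at (x, c))" by (rule tendsto_rabs)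
 then have 3: "\<forall>\<^sub>F p in at (x, c). \<bar>snd p\<bar> < 1" by (rule order_tendstoD(2)) (rule c)
 show "\<forall>\<^sub>F p in at (x, c). dist (case p of (x, c) => tu x c) (case (x, c) of (x, c) => tu x c) < d"
  using 1 2 3
 proof eventually_elim
  case (elim p)
  obtain y b where p: "p = (y, b)" by (cases p)
  have "u (y + tu y b $* e) = b" by (rule tu_eq[OF r]) (use elim p in simp)
  then have "s - d < tu y b" "tu y b < s + d"
   using elim p u_line_strict_mono[of "tu y b" "s - d" y] u_line_strict_mono[of "s + d" "tu y b" y]
   by (metis diff_gt_0_iff_gt diff_less_0_iff_less fst_conv less_asym linorder_neqE_linordered_idom snd_conv)+
  then show ?case by (simp add: p s_def dist_real_def abs_less_iff)
 qed
qed

text \<open>Inverse function theorem for the map \<open>(x, s)\<close> to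
  \<open>(x, u (x + s $* e))\<close>; its derivative is triangular with nonzero entry
  \<open>p $. e\<close>.\<close>

lemma tu_has_derivative:
 fixes x :: 'a
 assumes r: "reaches" and c: "\<bar>c\<bar> < 1"
 defines "p \<equiv> U (x + tu x c $* e)"
 shows "((%(x, c). (x, tu x c)) has_derivative (%(h, k). (h, (k - p $. h)/(p $. e)))) (at (x, c))"
proof (rule has_derivative_inverse_basic[where f="%(x, s). (x, u (x + s $* e))" and
   f'="%(h, si). (h, p $. h + si*(p $. e))" and T="UNIV \<times> {-1<..<1}"])
 have "((%q. u (fst q + snd q $* e)) has_derivative (%q. p $. (fst q + snd q $* e))) (at (x, tu x c))"
  unfolding p_def
  by (rule hdc[of "%q. fst q + snd q $* e" "%q. fst q + snd q $* e" "(x, tu x c)" UNIV u, simplified])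
    (auto intro!: dvi C2gD(2)[OF u])
 then have "((%q. (fst q, u (fst q + snd q $* e))) has_derivative (%q. (fst q, p $. (fst q + snd q $* e)))) (at (x, tu x c))"
  by (intro has_derivative_Pair has_derivative_fst has_derivative_ident)
 then show "((%(x, s). (x, u (x + s $* e))) has_derivative (%(h, si). (h, p $. h + si*(p $. e)))) (at (case (x, c) of (x, c) => (x, tu x c)))"
  by (simp add: case_prod_beta' inner_add_right)
 have pe: "p $. e > 0" unfolding p_def by (rule mono_e)
 show "bounded_linear (%(h, k). (h, (k - p $. h)/(p $. e)))"
  unfolding split_beta
  by (intro bounded_linear_Pair bounded_linear_fst bounded_linear_compose[OF bounded_linear_divide] bounded_linear_sub
    bounded_linear_snd bounded_linear_compose[OF bounded_linear_inner_right bounded_linear_fst])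
 show "(%(h, k). (h, (k - p $. h)/(p $. e))) \<circ> (%(h, si). (h, p $. h + si*(p $. e))) = id"
  using pe by (auto simp: fun_eq_iff)
 show "continuous (at (x, c)) (%(x, c). (x, tu x c))"
  using tu_continuous[OF r c, of x] unfolding split_beta by (intro continuous_Pair continuous_fst continuous_ident)
 show "open (UNIV \<times> {-1<..<1} :: ('a \<times> real) set)" by (intro open_Times) auto
 show "(x, c) : UNIV \<times> {-1<..<1}" using c by (auto simp: abs_less_iff)
 show "(case case q of (x, c) => (x, tu x c) of (x, s) => (x, u (x + s $* e))) = q" if "q : UNIV \<times> {-1<..<1}" for q
  using that tu_eq[OF r, of "snd q" "fst q"] by (auto simp: abs_less_iff)
qed

lemma C1g_theta:
 assumes r: "reaches" and v: "C1g v g" "!!x. \<bar>v x\<bar> < 1"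
 shows "C1g (%x. tu x (v x)) (%x. (1/(U (x + tu x (v x) $* e) $. e)) $* (g x - U (x + tu x (v x) $* e)))"
 unfolding C1g_def
proof (intro conjI allI)
 have d: "((%x. tu x (v x)) has_derivative ($.) ((1/(U (x + tu x (v x) $* e) $. e)) $* (g x - U (x + tu x (v x) $* e)))) (at x)" for x
 proof -
  have "((%x. (x, v x)) has_derivative (%h. (h, g x $. h))) (at x)"
   by (intro has_derivative_Pair has_derivative_ident C1gD[OF v(1)])
  from hdc[OF this tu_has_derivative[OF r v(2)[of x]]]
  have "((%x. (x, tu x (v x))) has_derivative (%h. (h, (g x $. h - U (x + tu x (v x) $* e) $. h)/(U (x + tu x (v x) $* e) $. e)))) (at x)"
   by simp
  from has_derivative_snd[OF this]
  have "((%x. tu x (v x)) has_derivative (%h. (g x $. h - U (x + tu x (v x) $* e) $. h)/(U (x + tu x (v x) $* e) $. e))) (at x)"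
   by simp
  then show ?thesis
   by (rule has_derivative_eq_rhs) (auto simp: inner_diff_left)
 qed
 then show "((%x. tu x (v x)) has_derivative ($.) ((1/(U (x + tu x (v x) $* e) $. e)) $* (g x - U (x + tu x (v x) $* e)))) (at x)" for x .
 have c: "continuous_on UNIV (%x. tu x (v x))"
  by (intro continuous_at_imp_continuous_on ballI has_derivative_continuous[OF d])
 have cp: "continuous_on UNIV (%x. U (x + tu x (v x) $* e))"
  by (rule cnt2[OF u_cont(3)[of UNIV]]) (auto intro!: cnt c)
 have "U y $. e ~= 0" for y using mono_e[of y] by simp
 then show "continuous_on UNIV (%x. (1/(U (x + tu x (v x) $* e) $. e)) $* (g x - U (x + tu x (v x) $* e)))"
  by (intro cnt cp C1g_cont_grad[OF v(1)]) auto
qed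

definition en :: "'a => real" where "en x = U x $. U x/2 + W (u x)"

lemma en_cont: "continuous_on S en"
 unfolding en_def[abs_def] by (intro cnt continuous_on_W u_cont) auto

lemma en_line_DERIV:
 "((%a. en (x + a $* h)) has_real_derivative (Hu (x + a $* h) (U (x + a $* h)) + W' (u (x + a $* h)) $* U (x + a $* h)) $. h) (at a)"
proof -
 have "C1g (%x. (1/2)*(\<Sum>b\<in>Basis. (U x $. b)*(U x $. b)) + W (u x))
   (%x. (1/2) $* (\<Sum>b\<in>Basis. (U x $. b) $* Hu x b + (U x $. b) $* Hu x b) + W' (u x) $* U x)"
  by (intro C1g_add C1g_cmult C1g_sum C1g_mult C2g_partial[OF u] C1g_compose[OF C2gD(1)[OF u]] W_DERIV)
    (auto simp: W'_def[abs_def] intro!: cnt)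
 moreover have "(%x. (1/2)*(\<Sum>b\<in>Basis. (U x $. b)*(U x $. b)) + W (u x)) = en"
  by (simp add: en_def fun_eq_iff euclidean_inner[of "U _" "U _"])
 moreover have "(1/2) $* (\<Sum>b\<in>Basis. (U x $. b) $* Hu x b + (U x $. b) $* Hu x b) = Hu x (U x)" for x
  using linear_expand[OF C2gD(5)[OF u], of x "U x"] by (simp add: scaleR_sum_right sum.distrib[symmetric] scaleR_left_distrib[symmetric])
 ultimately have "C1g en (%x. Hu x (U x) + W' (u x) $* U x)" by simp
 from C1g_DERIV[OF this] show ?thesis .
qed

text \<open>Symmetry of the Hessian and the equation turn the divergence of the flux into the
  derivative of \<open>en\<close> along \<open>e\<close>, so its integral along a vertical segment
  is a difference of energy densities.\<close>

lemma div_flux: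
 "tr (%h. (Hu y h $. e) $* U y + (U y $. e) $* Hu y h) = (Hu y (U y) + W' (u y) $* U y) $. e"
proof -
 have "tr (%h. (Hu y h $. e) $* U y + (U y $. e) $* Hu y h) = tr (%h. (Hu y e $. h) $* U y + (U y $. e) $* Hu y h)"
  by (simp add: C2g_symmetric[OF u, of y _ e])
 also have "... = Hu y e $. U y + (U y $. e)*W' (u y)" by (simp only: tr_simps pde)
 also have "Hu y e $. U y = Hu y (U y) $. e" by (rule C2g_symmetric[OF u])
 finally show ?thesis by (simp add: inner_add_left)
qed

text \<open>Calibration by the translates of \<open>u\<close>: the flux \<open>\<Xi>\<close> below integrates \<open>u\<^sub>e grad u\<close> from the graph of
 \<open>u\<close> to the graph of the competitor \<open>v\<close>, and its divergence is the null Lagrangian of the foliation.\<close>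
lemma calibration:
 assumes r: "reaches" and v: "C1g v g" "!!x. \<bar>v x\<bar> < 1" "csupp (%x. v x - u x)"
 shows "(LINT x|lborel. (g x $. g x/2 + W (v x)) - en x) >= 0"
  and "integrable lborel (%x. (g x $. g x/2 + W (v x)) - en x)"
proof -
 \<comment> \<open>\<open>th x\<close> is the shift that moves the graph of \<open>u\<close> to the
   leaf through the point of the graph of \<open>v\<close> over \<open>x\<close>; \<open>p x\<close>
   is the slope of that leaf there.\<close>
 define th where "th x = tu x (v x)" for x
 define p where "p x = U (x + th x $* e)" for x
 define q where "q x = (1/(p x $. e)) $* (g x - p x)" for x
 have Ct: "C1g th q" using C1g_theta[OF r v(1,2)] by (simp add: th_def[abs_def] q_def[abs_def] p_def)
 note ct = C1g_cont[OF Ct] and cq = C1g_cont_grad[OF Ct]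
 have ueq: "u (x + th x $* e) = v x" for x using tu_eq[OF r v(2)] by (simp add: th_def)
 define F where "F y = (U y $. e) $* U y" for y
 define F' where "F' y h = (Hu y h $. e) $* U y + (U y $. e) $* Hu y h" for y h
 have dF: "(F has_derivative F' y) (at y)" for y
  unfolding F_def[abs_def] F'_def using C2gD(3)[OF u, of y] by (auto intro!: dvi)
 have linF: "linear (F' y)" for y using dF has_derivative_linear by blast
 have cF: "continuous_on S F" for S unfolding F_def[abs_def] by (intro cnt u_cont)
 have cF': "continuous_on S (%x. F' (k x) (l x))" if "continuous_on S k" "continuous_on S l" for S and k l :: "'b::topological_space => 'a"
 proof -
  have "continuous_on S (%x. F' (k x) b)" for b
   unfolding F'_def
   by (intro cnt cnt2[OF C2gD(4)[OF u, of UNIV]] cnt2[OF u_cont(3)[of UNIV]] that) auto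
  moreover have "F' (k x) (l x) = (\<Sum>b\<in>Basis. (l x $. b) $* F' (k x) b)" for x by (rule linear_expand[OF linF])
  ultimately show ?thesis by (simp only:) (intro cnt that)
 qed
 \<comment> \<open>The segment from 0 to \<open>th x\<close> is rescaled to the unit interval, so
   that \<open>x\<close> enters only the integrand and differentiation under the integral
   applies.\<close>
 define pf where "pf x a = F (x + (a*th x) $* e)" for x a
 define pf' where "pf' x a h = F' (x + (a*th x) $* e) (h + (a*(q x $. h)) $* e)" for x a h
 have dpsi: "((%x. pf x a) has_derivative pf' x a) (at x)" for x a
  unfolding pf_def pf'_def
  by (rule hdc[of "%x. x + (a*th x) $* e" _ x UNIV F, OF _ dF])
    (use C1gD[OF Ct, of x] in \<open>auto intro!: dvi\<close>)
 have cpsi': "continuous_on (UNIV \<times> {0..1}) (%(x, a). pf' x a h)" for h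
  unfolding pf'_def split_beta
  by (intro cF' cnt cnt2[OF ct[of UNIV]] cnt2[OF cq[of UNIV]]) auto
 have cpsi: "continuous_on {0..1} (pf x)" for x
  unfolding pf_def[abs_def] by (intro cnt2[OF cF[of UNIV]] cnt) auto
 note I = param_has_derivative[of pf pf', OF dpsi cpsi' cpsi]
 define Xf where "Xf x = th x $* integral {0..1} (pf x)" for x
 define Xf' where "Xf' x h = th x $* integral {0..1} (%a. pf' x a h) + (q x $. h) $* integral {0..1} (pf x)" for x h
 have dX: "(Xf has_derivative Xf' x) (at x)" for x
  unfolding Xf_def[abs_def] Xf'_def using C1gD[OF Ct, of x] I(1)[of x] by (auto intro!: dvi)
 have cI: "continuous_on UNIV (%x. integral {0..1} (pf x))"
  by (intro continuous_at_imp_continuous_on ballI has_derivative_continuous[OF I(1)])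
 have cX: "continuous_on UNIV (%x. Xf' x h)" for h
  unfolding Xf'_def by (intro cnt ct cq cI I(2))
 obtain R where R: "!!x. norm x > R ==> v x = u x" using v(3) by (force simp: csupp_def)
 have th0: "th x = 0" if "norm x > R" for x
  unfolding th_def by (rule tu_unique) (use R[OF that] in simp)
 then have csX: "csupp Xf" unfolding csupp_def Xf_def by (intro exI[of _ R]) auto
 \<comment> \<open>As a function of the slope \<open>g x\<close> the divergence is affine and
   tangent to the energy density at the slope of the leaf. It therefore lies below the energy of
   \<open>v\<close> by half the square of \<open>g x - p x\<close>.\<close>
 have trX: "tr (Xf' x) = p x $. g x - p x $. p x/2 + W (v x) - en x" for x
 proof -
  let ?y = "%a. x + (a*th x) $* e"
  have i1: "(%a. pf' x a h) integrable_on {0..1}" for h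
   unfolding pf'_def by (intro integrable_continuous_real cF' cnt)
  have ipsi: "pf x integrable_on {0..1}" by (rule integrable_continuous_real[OF cpsi])
  have t1: "tr (%h. integral {0..1} (%a. pf' x a h)) = integral {0..1} (%a. tr (pf' x a))"
  proof -
   have "integral {0..1} (%a. pf' x a b) $. b = integral {0..1} (%a. pf' x a b $. b)" for b
    using integral_linear[OF i1 bounded_linear_inner_left[of b], of b] by (simp add: o_def)
   moreover have "(%a. pf' x a b $. b) integrable_on {0..1}" for b
    using integrable_linear[OF i1 bounded_linear_inner_left[of b], of b] by (simp add: o_def)
   ultimately show ?thesis unfolding tr_def by (simp add: integral_sum)
  qed
  have t2: "tr (pf' x a) = (Hu (?y a) (U (?y a)) + W' (u (?y a)) $* U (?y a)) $. e + a*(q x $. F' (?y a) e)" for a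
  proof -
   have "pf' x a = (%h. F' (?y a) h + (a*(q x $. h)) $* F' (?y a) e)"
    unfolding pf'_def by (simp add: linear_add[OF linF] linear_cmul[OF linF])
   then have "tr (pf' x a) = tr (F' (?y a)) + a*(q x $. F' (?y a) e)" by (simp only: tr_simps)
   then show ?thesis unfolding F'_def[abs_def] div_flux .
  qed
  have E: "((%a. th x*((Hu (?y a) (U (?y a)) + W' (u (?y a)) $* U (?y a)) $. e)) has_integral (en (?y 1) - en (?y 0))) {0..1}"
  proof (rule fundamental_theorem_of_calculus)
   fix a :: real
   show "((%a. en (?y a)) has_vector_derivative th x*((Hu (?y a) (U (?y a)) + W' (u (?y a)) $* U (?y a)) $. e)) (at a within {0..1})"
    using en_line_DERIV[of x "th x $* e" a] has_field_derivative_at_within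
    by (fastforce simp: has_real_derivative_iff_has_vector_derivative[symmetric])
  qed simp
  have G: "((%a. F (?y a) + (a*th x) $* F' (?y a) e) has_integral (1 $* F (?y 1) - 0 $* F (?y 0))) {0..1}"
  proof (rule fundamental_theorem_of_calculus)
   fix a :: real
   have "((%a. F (?y a)) has_derivative (%d. F' (?y a) ((d*th x) $* e))) (at a)"
    by (rule hdc[of "%a. ?y a" _ a UNIV F, OF _ dF]) (auto intro!: dvi)
   then have "((%a. a $* F (?y a)) has_derivative (%d. d $* (F (?y a) + (a*th x) $* F' (?y a) e))) (at a)"
    by (auto intro!: dvi simp: linear_cmul[OF linF] scaleR_add_right alg)
   then show "((%a. a $* F (?y a)) has_vector_derivative F (?y a) + (a*th x) $* F' (?y a) e) (at a within {0..1})"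
    unfolding has_vector_derivative_def by (rule has_derivative_at_withinI)
  qed simp
  have iF: "(%a. a $* F' (?y a) e) integrable_on {0..1}"
   by (intro integrable_continuous_real cnt cF')
  have iE: "(%a. (Hu (?y a) (U (?y a)) + W' (u (?y a)) $* U (?y a)) $. e) integrable_on {0..1}"
   unfolding div_flux[symmetric] F'_def[symmetric] tr_def
   by (intro integrable_continuous_real cnt cF')
  have iq: "(%a. a*(q x $. F' (?y a) e)) integrable_on {0..1}"
   using integrable_linear[OF iF bounded_linear_inner_right[of "q x"]] by (simp add: o_def)
  have qF: "integral {0..1} (%a. a*(q x $. F' (?y a) e)) = q x $. integral {0..1} (%a. a $* F' (?y a) e)"
   using integral_linear[OF iF bounded_linear_inner_right[of "q x"]] by (simp add: o_def)
  have G': "integral {0..1} (pf x) + th x $* integral {0..1} (%a. a $* F' (?y a) e) = F (?y 1)"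
  proof -
   have "integral {0..1} (%a. pf x a + th x $* (a $* F' (?y a) e)) = F (?y 1)"
    using integral_unique[OF G] by (simp add: pf_def mult.commute)
   then show ?thesis
    by (simp only: integral_add[OF ipsi integrable_cmul[OF iF]] integral_cmul)
  qed
  have "tr (Xf' x) = th x*integral {0..1} (%a. tr (pf' x a)) + q x $. integral {0..1} (pf x)"
   unfolding Xf'_def[abs_def] by (simp only: tr_simps t1)
  also have "integral {0..1} (%a. tr (pf' x a)) =
    integral {0..1} (%a. (Hu (?y a) (U (?y a)) + W' (u (?y a)) $* U (?y a)) $. e) + q x $. integral {0..1} (%a. a $* F' (?y a) e)"
   unfolding t2 qF[symmetric] by (rule integral_add[OF iE iq])
  also have "th x*(integral {0..1} (%a. (Hu (?y a) (U (?y a)) + W' (u (?y a)) $* U (?y a)) $. e) + q x $. integral {0..1} (%a. a $* F' (?y a) e))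
    + q x $. integral {0..1} (pf x) = (en (?y 1) - en (?y 0)) + q x $. F (?y 1)"
   using integral_unique[OF E] unfolding G'[symmetric] by (simp add: inner_add_right distrib_left)
  also have "... = p x $. g x - p x $. p x/2 + W (v x) - en x"
  proof -
   have "p x $. e ~= 0" using mono_e[of "x + th x $* e"] by (simp add: p_def)
   then have "q x $. F (?y 1) = (g x - p x) $. p x"
    unfolding q_def F_def by (simp add: p_def)
   moreover have "en (?y 1) = p x $. p x/2 + W (v x)" "?y 0 = x"
    unfolding en_def by (simp_all add: p_def ueq)
   ultimately show ?thesis by (simp add: inner_diff_left inner_diff_right inner_commute)
  qed
  finally show ?thesis .
 qed
 have div0: "(LINT x|lborel. tr (Xf' x)) = 0" by (rule integral_div_zero[OF dX cX csX])
 have cs_g: "csupp (%x. g x - U x)"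
  using csupp_grad[of "%x. v x + (-1)*u x" "%x. g x + (-1) $* U x"] v(3)
   C1g_add[OF v(1) C1g_cmult[OF C2gD(1)[OF u], of "-1"]] by simp
 then obtain R' where R': "!!x. norm x > R' ==> g x = U x" by (force simp: csupp_def)
 have csD: "csupp (%x. (g x $. g x/2 + W (v x)) - en x)"
  unfolding csupp_def by (rule exI[of _ "max R R'"]) (use R R' in \<open>auto simp: en_def\<close>)
 show iD: "integrable lborel (%x. (g x $. g x/2 + W (v x)) - en x)"
  by (intro integrable_csupp csD cnt continuous_on_W en_cont C1g_cont[OF v(1)] C1g_cont_grad[OF v(1)]) auto
 have iX: "integrable lborel (%x. tr (Xf' x))"
 proof (rule integrable_csupp)
  show "continuous_on UNIV (%x. tr (Xf' x))" unfolding tr_def by (intro cnt cX)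
  have "p x = U x" if "norm x > R" for x unfolding p_def using th0[OF that] by simp
  then show "csupp (%x. tr (Xf' x))"
   unfolding csupp_def trX by (intro exI[of _ "max R R'"]) (use R R' in \<open>auto simp: en_def\<close>)
 qed
 have "0 <= (LINT x|lborel. ((g x $. g x/2 + W (v x)) - en x) - tr (Xf' x))"
 proof (rule integral_nonneg_AE, rule AE_I2)
  fix x
  have "((g x $. g x/2 + W (v x)) - en x) - tr (Xf' x) = (g x - p x) $. (g x - p x)/2"
   unfolding trX by (simp add: inner_diff_left inner_diff_right inner_commute field_simps)
  then show "0 <= ((g x $. g x/2 + W (v x)) - en x) - tr (Xf' x)" by (simp only:) simp
 qed
 then show "(LINT x|lborel. (g x $. g x/2 + W (v x)) - en x) >= 0"
  using iD iX div0 by simp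
qed

end

text \<open>A \<open>C\<^sup>1\<close> truncation: the identity on \<open>[-a, a]\<close>, with values in \<open>[-a-d/2, a+d/2]\<close>.\<close>
definition clip :: "real => real => real => real" where
 "clip a d s = s - ((max 0 (s - a))^2 - (max 0 (s - (a + d)))\<^sup>2)/(2*d)
   + ((max 0 (- s - a))^2 - (max 0 (- s - (a + d)))\<^sup>2)/(2*d)"

definition clip' :: "real => real => real => real" where
 "clip' a d s = 1 - (max 0 (s - a) - max 0 (s - (a + d)))/d - (max 0 (- s - a) - max 0 (- s - (a + d)))/d"

lemma clip_DERIV: "d > 0 ==> (clip a d has_real_derivative clip' a d s) (at s)"
proof -
 assume d: "d > 0"
 have p: "((%s. (max 0 (s - c))^2) has_real_derivative 2*max 0 (s - c)) (at s)" for c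
 proof -
  have "((%s. s - c) has_real_derivative 1) (at s)" by (auto intro!: dvi)
  from DERIV_chain2[OF DERIV_pos_part_power[of 0] this] show ?thesis by (simp add: numeral_2_eq_2)
 qed
 have m: "((%s. (max 0 (- s - c))^2) has_real_derivative - 2*max 0 (- s - c)) (at s)" for c
 proof -
  have "((%s. - s - c) has_real_derivative - 1) (at s)" by (auto intro!: dvi)
  from DERIV_chain2[OF DERIV_pos_part_power[of 0] this] show ?thesis by (simp add: numeral_2_eq_2)
 qed
 have "((%s. s - ((max 0 (s - a))^2 - (max 0 (s - (a + d)))\<^sup>2)/(2*d)
   + ((max 0 (- s - a))^2 - (max 0 (- s - (a + d)))\<^sup>2)/(2*d)) has_real_derivative
   1 - (2*max 0 (s - a) - 2*max 0 (s - (a + d)))/(2*d)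
   + (- 2*max 0 (- s - a) - (- 2*max 0 (- s - (a + d))))/(2*d)) (at s)"
  by (intro DERIV_add DERIV_diff DERIV_ident DERIV_cdivide p m)
 moreover have "(2*x - 2*y)/(2*d) = (x - y)/d" "(- 2*x - (- 2*y))/(2*d) = - ((x - y)/d)" for x y
  using d by (simp_all add: field_simps)
 ultimately show ?thesis
  unfolding clip_def[abs_def] clip'_def by (simp only: add_uminus_conv_diff)
qed

lemma clip'_cont: "continuous_on S (clip' a d)"
 unfolding clip'_def[abs_def] divide_inverse by (intro cnt)

lemma clip_cases:
 assumes "0 < a" "0 < d"
 shows "\<bar>s\<bar> <= a ==> clip a d s = s" "\<bar>clip a d s\<bar> <= a + d/2"
  "\<bar>s\<bar> > a ==> \<bar>clip a d s\<bar> >= a" "0 <= clip' a d s" "clip' a d s <= 1" "\<bar>s\<bar> <= a ==> clip' a d s = 1"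
proof -
 define r where "r y = ((max 0 y)^2 - (max 0 (y - d))\<^sup>2)/(2*d)" for y
 have r0: "r y = 0" if "y <= 0" for y using that assms by (simp add: r_def)
 have r1: "0 <= y - r y" "y - r y <= d/2" if "y >= 0" for y
 proof -
  show "0 <= y - r y"
  proof (cases "y <= d")
   case True
   then have "y*y <= y*(2*d)" using that assms by (intro mlm) auto
   with True that assms show ?thesis by (simp add: r_def pow2 divide_le_eq)
  next
   case False
   then show ?thesis using that assms by (simp add: r_def pow2 field_simps)
  qed
  show "y - r y <= d/2"
  proof (cases "y <= d")
   case True
   have "0 <= (y - d)^2" by simp
   with True that assms show ?thesis by (simp add: r_def pow2 field_simps)
  next
   case False
   then show ?thesis using that assms by (simp add: r_def pow2 field_simps)
  qed
 qed
 have c: "clip a d s = s - r (s - a) + r (- s - a)" by (simp add: clip_def r_def diff_diff_eq)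
 show "\<bar>s\<bar> <= a ==> clip a d s = s" unfolding c by (simp add: r0 abs_le_iff)
 show "\<bar>clip a d s\<bar> <= a + d/2"
 proof -
  consider "\<bar>s\<bar> <= a" | "s > a" | "- s > a" by linarith
  then show ?thesis
  proof cases
   case 1 then show ?thesis unfolding c using assms by (simp add: r0 abs_le_iff)
  next
   case 2 then show ?thesis unfolding c using assms r1[of "s - a"] r0[of "- s - a"] by (auto simp: abs_le_iff)
  next
   case 3 then show ?thesis unfolding c using assms r1[of "- s - a"] r0[of "s - a"] by (auto simp: abs_le_iff)
  qed
 qed
 show "\<bar>s\<bar> > a ==> \<bar>clip a d s\<bar> >= a"
 proof -
  assume "\<bar>s\<bar> > a"
  then consider "s > a" | "- s > a" by linarith
  then show ?thesis
  proof cases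
   case 1 then show ?thesis unfolding c using assms r1[of "s - a"] r0[of "- s - a"] by auto
  next
   case 2 then show ?thesis unfolding c using assms r1[of "- s - a"] r0[of "s - a"] by auto
  qed
 qed
 have m: "0 <= max 0 y - max 0 (y - d)" "max 0 y - max 0 (y - d) <= d" for y using assms by auto
 have "0 <= (max 0 y - max 0 (y - d))/d" for y
  by (intro divide_nonneg_pos m assms)
 from this[of "s - a"] this[of "- s - a"] show "clip' a d s <= 1" unfolding clip'_def diff_diff_eq by linarith
 show "0 <= clip' a d s"
 proof (cases "s >= 0")
  case True
  then have "max 0 (- s - a) = 0" "max 0 (- s - (a + d)) = 0" using assms by auto
  then show ?thesis unfolding clip'_def using m[of "s - a", unfolded diff_diff_eq] assms by (simp only:) (simp add: divide_le_eq)
 next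
  case False
  then have "max 0 (s - a) = 0" "max 0 (s - (a + d)) = 0" using assms by auto
  then show ?thesis unfolding clip'_def using m[of "- s - a", unfolded diff_diff_eq] assms by (simp only:) (simp add: divide_le_eq)
 qed
 show "\<bar>s\<bar> <= a ==> clip' a d s = 1" unfolding clip'_def using assms by (simp add: abs_le_iff)
qed

text \<open>Values beyond \<open>1 - d\<close> in modulus are moved to modulus between
  \<open>1 - d\<close> and \<open>1 - d/2\<close>, where \<open>W\<close> is at most
  \<open>(2*d)^2\<close>; other values stay fixed.\<close>

lemma W_le_clip:
 assumes "0 < d" "d < 1"
 shows "W (clip (1 - d) d s) <= W s + 4*d^2"
proof (cases "\<bar>s\<bar> <= 1 - d")
 case True
 then show ?thesis using clip_cases(1)[of "1 - d" d s] assms by simp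
next
 case False
 define k where "k = \<bar>clip (1 - d) d s\<bar>"
 have k: "1 - d <= k" "k <= 1" using clip_cases(2,3)[of "1 - d" d s] False assms by (auto simp: k_def)
 have "(1 - k\<^sup>2)^2 <= (2*d)^2"
 proof (rule power_mono)
  have "1 - k\<^sup>2 = (1 - k)*(1 + k)" by (simp add: pow2 alg)
  also have "... <= d*2" using k assms by (intro mult_mono) auto
  finally show "1 - k\<^sup>2 <= 2*d" by simp
  show "0 <= 1 - k\<^sup>2" using k assms by (simp add: power_le_one)
 qed
 moreover have "W (clip (1 - d) d s) = (1 - k\<^sup>2)^2" by (simp add: W_def k_def)
 ultimately show ?thesis using W_nonneg[of s] by (simp add: pow2)
qed

context ac
begin

text \<open>The foliation covers only values strictly between -1 and 1. A general competitor is
  truncated near \<open>1 - d\<close>; this does not increase its gradient, raises the potential by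
  at most \<open>4*d^2\<close> on a fixed ball, and \<open>d\<close> tends to 0.\<close>

lemma minimal_C1:
 assumes r: "reaches" and v: "C1g v g" "csupp (%x. v x - u x)"
 shows "(LINT x|lborel. (g x $. g x/2 + W (v x)) - en x) >= 0"
  and "integrable lborel (%x. (g x $. g x/2 + W (v x)) - en x)"
proof -
 obtain R0 where R0: "!!x. norm x > R0 ==> v x = u x" using v(2) by (force simp: csupp_def)
 have cs_g: "csupp (%x. g x - U x)"
  using csupp_grad[of "%x. v x + (-1)*u x" "%x. g x + (-1) $* U x"] v(2)
   C1g_add[OF v(1) C1g_cmult[OF C2gD(1)[OF u], of "-1"]] by simp
 then obtain R' where R': "!!x. norm x > R' ==> g x = U x" by (force simp: csupp_def)
 define R where "R = max 1 (max R0 R')"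
 have R: "norm x > R ==> v x = u x" "norm x > R ==> g x = U x" for x
  using R0[of x] R'[of x] by (auto simp: R_def)
 have csD: "csupp (%x. (g x $. g x/2 + W (v x)) - en x)"
  unfolding csupp_def by (rule exI[of _ R]) (use R in \<open>auto simp: en_def\<close>)
 show iD: "integrable lborel (%x. (g x $. g x/2 + W (v x)) - en x)"
  by (intro integrable_csupp csD cnt continuous_on_W en_cont C1g_cont[OF v(1)] C1g_cont_grad[OF v(1)]) auto
 define S where "S = cball (0::'a) R"
 have S: "compact S" "S ~= {}" by (auto simp: S_def R_def)
 obtain xm where xm: "xm : S" "!!y. y : S ==> \<bar>u y\<bar> <= \<bar>u xm\<bar>"
  using continuous_attains_sup[OF S, of "%x. \<bar>u x\<bar>"] u_cont(1) by (auto intro!: cnt)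
 define d0 where "d0 = min (1/2) (1 - \<bar>u xm\<bar>)"
 have d0: "d0 > 0" "d0 < 1" using u_bound[of xm] by (auto simp: d0_def)
 have key: "- (4*d^2)*measure lborel S <= (LINT x|lborel. (g x $. g x/2 + W (v x)) - en x)" if d: "0 < d" "d <= d0" for d
 proof -
  have d1: "0 < 1 - d" "d < 1" using d d0 by auto
  have cu: "clip (1 - d) d (u x) = u x" if "x : S" for x
  proof (rule clip_cases(1)[OF d1(1) d(1)])
   have "d <= 1 - \<bar>u xm\<bar>" using d by (simp add: d0_def)
   then show "\<bar>u x\<bar> <= 1 - d" using xm(2)[OF that] by linarith
  qed
  \<comment> \<open>Truncating \<open>u\<close> as well makes the new competitor agree with
    \<open>u\<close> wherever \<open>v\<close> does. On the ball \<open>S\<close> the choice of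
    \<open>d0\<close> ensures that the truncation leaves \<open>u\<close> unchanged.\<close>
  define cc where "cc x = clip (1 - d) d (v x) - clip (1 - d) d (u x)" for x
  define w where "w x = u x + cc x" for x
  define gw where "gw x = U x + (clip' (1 - d) d (v x) $* g x + (-1) $* (clip' (1 - d) d (u x) $* U x))" for x
  have Cw: "C1g w gw"
  proof -
   have "C1g (%x. u x + (clip (1 - d) d (v x) + (-1) * clip (1 - d) d (u x))) gw"
    unfolding gw_def[abs_def]
    by (intro C1g_add C1g_cmult C1g_compose[OF v(1)] C1g_compose[OF C2gD(1)[OF u]] C2gD(1)[OF u] clip_DERIV clip'_cont d)
   then show ?thesis by (simp add: w_def[abs_def] cc_def)
  qed
  have wout: "w x = u x" "gw x = U x" if "norm x > R" for x using R[OF that] by (auto simp: w_def cc_def gw_def)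
  have win: "w x = clip (1 - d) d (v x)" if "x : S" for x using cu[OF that] by (simp add: w_def cc_def)
  have gwin: "gw x = clip' (1 - d) d (v x) $* g x" if "x : S" for x
  proof -
   have "d <= 1 - \<bar>u xm\<bar>" using d by (simp add: d0_def)
   then have "clip' (1 - d) d (u x) = 1" using clip_cases(6)[OF d1(1) d(1), of "u x"] xm(2)[OF that] by linarith
   then show ?thesis by (simp add: gw_def)
  qed
  have wb: "\<bar>w x\<bar> < 1" for x
  proof (cases "x : S")
   case True
   then show ?thesis using win clip_cases(2)[OF d1(1) d(1), of "v x"] d by simp
  next
   case False
   then show ?thesis using wout u_bound by (simp add: S_def)
  qed
  have csw: "csupp (%x. w x - u x)" unfolding csupp_def by (rule exI[of _ R]) (use wout in auto)
  note cal = calibration[OF r Cw wb csw]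
  have iS: "integrable lborel (%x. indicator S x $* (4*d^2))"
   by (rule borel_integrable_compact[OF S(1)]) auto
  have "0 <= (LINT x|lborel. (gw x $. gw x/2 + W (w x)) - en x)" by (rule cal(1))
  also have "... <= (LINT x|lborel. ((g x $. g x/2 + W (v x)) - en x) + indicator S x $* (4*d^2))"
  proof (rule integral_mono[OF cal(2) Bochner_Integration.integrable_add[OF iD iS]])
   fix x
   show "(gw x $. gw x/2 + W (w x)) - en x <= ((g x $. g x/2 + W (v x)) - en x) + indicator S x $* (4*d^2)"
   proof (cases "x : S")
    case True
    have c01: "0 <= clip' (1 - d) d (v x)" "clip' (1 - d) d (v x) <= 1"
     using clip_cases(4,5)[OF d1(1) d(1)] by auto
    have "gw x $. gw x = (clip' (1 - d) d (v x))^2*(g x $. g x)"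
     unfolding gwin[OF True] by (simp add: pow2)
    also have "... <= g x $. g x"
     using c01 by (intro mult_left_le_one_le) (auto simp: power_le_one)
    finally show ?thesis using W_le_clip[of d "v x"] win[OF True] True d d0 by simp
   next
    case False
    then have "norm x > R" by (simp add: S_def)
    then show ?thesis using wout R False by simp
   qed
  qed
  also have "... = (LINT x|lborel. (g x $. g x/2 + W (v x)) - en x) + measure lborel S*(4*d^2)"
  proof -
   have "emeasure lborel S ~= \<infinity>" using emeasure_compact_finite[OF S(1)] by simp
   then have "(LINT x|lborel. indicator S x $* (4*d^2)) = measure lborel S*(4*d^2)"
    using S(1) by (simp add: borel_compact)
   then show ?thesis using Bochner_Integration.integral_add[OF iD iS] by simp
  qed
  finally show ?thesis by (simp add: alg)
 qed
 show "(LINT x|lborel. (g x $. g x/2 + W (v x)) - en x) >= 0"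
 proof (rule tendsto_le[of "at_right (0::real)"])
  show "((%d. (LINT x|lborel. (g x $. g x/2 + W (v x)) - en x)) \<longlongrightarrow> (LINT x|lborel. (g x $. g x/2 + W (v x)) - en x)) (at_right 0)"
   by simp
  have "((%d::real. - (4*d^2)*measure lborel S) \<longlongrightarrow> - (4*0^2)*measure lborel S) (at_right 0)"
   by (intro tendsto_intros)
  then show "((%d::real. - (4*d^2)*measure lborel S) \<longlongrightarrow> 0) (at_right 0)" by simp
  show "\<forall>\<^sub>F d in at_right 0. - (4*d^2)*measure lborel S <= (LINT x|lborel. (g x $. g x/2 + W (v x)) - en x)"
   unfolding eventually_at_right_field using key d0 by (intro exI[of _ d0]) auto
 qed simp
qed

lemma integral_bounded_open:
 fixes f :: "'a => real"
 assumes "open Om" "bounded Om" "continuous_on UNIV f"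
 shows "f integrable_on Om" "integral Om f = (LINT x|lborel. indicator Om x $* f x)" "integrable lborel (%x. indicator Om x $* f x)"
proof -
 obtain R where R: "Om \<subseteq> cball 0 R" using assms(2) unfolding bounded_iff by (metis mem_cball_0 subsetI)
 have "set_integrable lborel (cball 0 R) f"
  unfolding set_integrable_def by (rule borel_integrable_compact) (auto intro: continuous_on_subset[OF assms(3)])
 then have s: "set_integrable lborel Om f"
  by (rule set_integrable_subset) (use assms(1) R in auto)
 then show "integrable lborel (%x. indicator Om x $* f x)" by (simp add: set_integrable_def)
 show "f integrable_on Om" using set_borel_integral_eq_integral(1)[OF s] .
 show "integral Om f = (LINT x|lborel. indicator Om x $* f x)"
  using set_borel_integral_eq_integral(2)[OF s] by (simp add: set_lebesgue_integral_def)
qed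

lemma reaches_imp_local_minimizer:
 assumes "reaches"
 shows "local_minimizer u"
 unfolding local_minimizer_def
proof (intro allI impI)
 fix Om :: "'a set" and fj :: "'a => real"
 assume *: "open Om & bounded Om & test_fun Om fj"
 then have O: "open Om" "bounded Om" and sm: "smooth fj" and cp: "compact (closure {x. fj x ~= 0})"
  and sub: "closure {x. fj x ~= 0} \<subseteq> Om" by (auto simp: test_fun_def)
 have d0: "(fj has_derivative frechet_derivative fj (at x)) (at x)" for x
  using sm[unfolded smooth_def, rule_format, of "[]"] by (simp add: frechet_derivative_works[symmetric])
 have d1: "partial fj b differentiable (at x)" if "b : Basis" for b x
  using sm[unfolded smooth_def, rule_format, of "[b]"] that by simp
 define G where "G x = (\<Sum>b\<in>Basis. partial fj b x $* b)" for x
 have CG: "C1g fj G"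
  unfolding C1g_def
 proof (intro conjI allI)
  fix x
  have "frechet_derivative fj (at x) = ($.) (G x)"
  proof
   fix h
   show "frechet_derivative fj (at x) h = G x $. h"
    unfolding G_def
    by (subst linear_expand[OF has_derivative_linear[OF d0]])
      (simp add: inner_sum_left partial_def inner_commute[of h] mult.commute)
  qed
  then show "(fj has_derivative ($.) (G x)) (at x)" using d0[of x] by simp
  show "continuous_on UNIV G"
   unfolding G_def[abs_def]
   by (intro cnt continuous_at_imp_continuous_on ballI differentiable_imp_continuous_within[OF d1])
 qed
 have Cv: "C1g (%x. u x + fj x) (%x. U x + G x)" by (intro C1g_add C2gD(1)[OF u] CG)
 obtain R where R: "closure {x. fj x ~= 0} \<subseteq> cball 0 R"
  using compact_imp_bounded[OF cp] unfolding bounded_iff by (metis mem_cball_0 subsetI)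
 have ph0: "fj x = 0" if "x ~: closure {x. fj x ~= 0}" for x
  using that closure_subset[of "{x. fj x ~= 0}"] by auto
 have G0: "G x = 0" if "x ~: closure {x. fj x ~= 0}" for x
 proof -
  have "(fj has_derivative (%h. 0)) (at x within UNIV)"
  proof (rule has_derivative_transform_within_open)
   show "((%_. 0) has_derivative (%h. 0)) (at x within UNIV)" by simp
   show "open (- closure {x. fj x ~= 0})" by (intro open_Compl closed_closure)
   show "x : - closure {x. fj x ~= 0}" using that by simp
   show "0 = fj y" if "y : - closure {x. fj x ~= 0}" for y using ph0[OF ComplD[OF that]] by simp
  qed
  then have "(%h. G x $. h) = (%h. 0)"
   by (intro has_derivative_unique[OF C1gD[OF CG]])
  then show ?thesis by (metis inner_eq_zero_iff)
 qed
 have cs: "csupp (%x. (u x + fj x) - u x)"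
  unfolding csupp_def
 proof (intro exI[of _ R] allI impI)
  fix x :: 'a assume "R < norm x"
  then have "x ~: closure {x. fj x ~= 0}" using subsetD[OF R, of x] unfolding mem_cball_0 by linarith
  from ph0[OF this] show "u x + fj x - u x = 0" by simp
 qed
 note m = minimal_C1[OF assms Cv cs]
 let ?f = "%x. (U x + G x) $. (U x + G x)/2 + W (u x + fj x)"
 have cf: "continuous_on UNIV ?f"
  by (intro cnt continuous_on_W u_cont C1g_cont[OF CG] C1g_cont_grad[OF CG]) auto
 have e1: "energy u Om = (LINT x|lborel. indicator Om x $* en x)"
  unfolding energy_def C1g_grad_sq[OF C2gD(1)[OF u]] en_def[symmetric]
  by (rule integral_bounded_open(2)[OF O en_cont])
 have e2: "energy (%x. u x + fj x) Om = (LINT x|lborel. indicator Om x $* ?f x)"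
  unfolding energy_def C1g_grad_sq[OF Cv] by (rule integral_bounded_open(2)[OF O cf])
 have "(LINT x|lborel. indicator Om x $* ?f x) - (LINT x|lborel. indicator Om x $* en x) = (LINT x|lborel. indicator Om x $* ?f x - indicator Om x $* en x)"
  by (rule Bochner_Integration.integral_diff[symmetric]) (intro integral_bounded_open(3)[OF O] cf en_cont)+
 also have "(%x. indicator Om x $* ?f x - indicator Om x $* en x) = (%x. ?f x - en x)"
 proof
  fix x
  show "indicator Om x $* ?f x - indicator Om x $* en x = ?f x - en x"
  proof (cases "x : Om")
   case False
   then have "x ~: closure {x. fj x ~= 0}" using subsetD[OF sub, of x] by argo
   from ph0[OF this] G0[OF this] False show ?thesis by (simp add: en_def)
  qed simp
 qed
 finally show "energy u Om <= energy (%x. u x + fj x) Om"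
  unfolding e1 e2 using m(1) by simp
qed

end

section \<open>The stress tensor and a mean value inequality\<close>

lemma integral_div_grad':
 assumes a: "C1g a al" and w: "C2g w g H" and cs: "csupp a | csupp g"
 shows "(LINT x|lborel. al x $. g x + a x*tr (H x)) = 0" "integrable lborel (%x. al x $. g x + a x*tr (H x))"
proof -
 let ?X = "%x. a x $* g x" and ?X' = "%x h. a x $* H x h + (al x $. h) $* g x"
 have d: "(?X has_derivative ?X' x) (at x)" for x
  using C1gD[OF a(1)] C2gD(3)[OF w] by (auto intro!: dvi)
 have c: "continuous_on UNIV (%x. ?X' x h)" for h
  using C1g_cont[OF a(1)] C1g_cont_grad[OF a(1)] C2gD(4,6)[OF w] by (intro cnt)
 have X: "csupp ?X" using cs by (force simp: csupp_def)
 have t: "tr (?X' x) = al x $. g x + a x*tr (H x)" for x by (simp only: tr_simps add.commute)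
 show "(LINT x|lborel. al x $. g x + a x*tr (H x)) = 0"
  using integral_div_zero[OF d c X] unfolding t .
 obtain R where R: "!!x. norm x > R ==> ?X x = 0" using X unfolding csupp_def by blast
 have "?X' x h = 0" if "norm x > R" for x h
 proof -
  have "open {x::'a. norm x > R}" by (intro open_Collect_less cnt)
  then have "(?X has_derivative (%h. 0)) (at x)"
   by (intro has_derivative_transform_within_open[of "%_. 0" "%_. 0" x UNIV "{x. norm x > R}" ?X]) (use that R in auto)
  from has_derivative_unique[OF d this] show ?thesis by metis
 qed
 then have "csupp (%x. tr (?X' x))" unfolding csupp_def tr_def by (intro exI[of _ R]) auto
 moreover have "continuous_on UNIV (%x. tr (?X' x))" unfolding tr_def by (intro continuous_on_sum continuous_on_inner c continuous_on_const)
 ultimately show "integrable lborel (%x. al x $. g x + a x*tr (H x))"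
  using integrable_csupp unfolding t by blast
qed

lemma C1g_grad_inner_grad:
 assumes f: "C2g f g H" and f': "C2g f' g' H'"
 shows "C1g (%x. g x $. g' x) (%x. H x (g' x) + H' x (g x))"
 unfolding C1g_def
proof (intro conjI allI)
 fix x
 have "((%x. g x $. g' x) has_derivative (%h. g x $. H' x h + H x h $. g' x)) (at x)"
  using C2gD(3)[OF f, of x] C2gD(3)[OF f', of x] by (rule has_derivative_inner)
 then show "((%x. g x $. g' x) has_derivative ($.) (H x (g' x) + H' x (g x))) (at x)"
 proof (rule has_derivative_eq_rhs)
  show "(%h. g x $. H' x h + H x h $. g' x) = ($.) (H x (g' x) + H' x (g x))"
  proof
   fix h
   show "g x $. H' x h + H x h $. g' x = (H x (g' x) + H' x (g x)) $. h"
    using C2g_symmetric[OF f, of x h "g' x"] C2g_symmetric[OF f', of x h "g x"]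
    by (simp add: inner_add_left inner_add_right inner_commute)
  qed
 qed
 show "continuous_on UNIV (%x. H x (g' x) + H' x (g x))"
  using C2g_cont_apply[OF f C2gD(6)[OF f']] C2g_cont_apply[OF f' C2gD(6)[OF f]] by (intro cnt)
qed

lemma C2g_radial:
 fixes x0 :: "'a::euclidean_space"
 assumes k: "!!s. s >= 0 ==> (k has_real_derivative k' s) (at s)" "!!s. s >= 0 ==> (k' has_real_derivative k'' s) (at s)"
  "continuous_on {0..} k''"
 shows "C2g (%x. k ((x - x0) $. (x - x0))) (%x. (2*k' ((x - x0) $. (x - x0))) $* (x - x0))
  (%x h. (2*k' ((x - x0) $. (x - x0))) $* h + (4*k'' ((x - x0) $. (x - x0))*((x - x0) $. h)) $* (x - x0))"
proof -
 have n: "C2g (%x. (x - x0) $. (x - x0)) (%x. 2 $* (x - x0)) (%x h. 2 $* h)"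
  unfolding C2g_def C1g_def
  by (auto intro!: dvi cnt simp: inner_commute alg inner_diff_left inner_diff_right)
 have "C2g (%x. k ((x - x0) $. (x - x0))) (%x. k' ((x - x0) $. (x - x0)) $* (2 $* (x - x0)))
  (%x h. k' ((x - x0) $. (x - x0)) $* (2 $* h) + (k'' ((x - x0) $. (x - x0))*((2 $* (x - x0)) $. h)) $* (2 $* (x - x0)))"
  by (rule C2g_compose[OF n k(1) k(2)]) (auto intro: continuous_on_subset[OF k(3)])
 then show ?thesis by (simp add: alg)
qed

text \<open>Profiles of the cut-off Green function: \<open>ga\<close> is \<open>(1+s)\<^sup>-\<^sup>k\<close>, \<open>gb\<close> a cutoff at \<open>s = \<rho>\<close>
 which is so flat at \<open>0\<close> that its derivatives only see the scale \<open>\<rho>\<close>.\<close>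

definition ga :: "real => real => real" where "ga k s = (1 + s) powr (- k)"
definition ga' :: "real => real => real" where "ga' k s = - k*(1 + s) powr (- k - 1)"
definition ga'' :: "real => real => real" where "ga'' k s = k*(k + 1)*(1 + s) powr (- k - 2)"
definition gq :: "nat => real => real => real" where "gq m rh s = max 0 (1 - (s/rh)^m)"
definition gb :: "nat => real => real => real" where "gb m rh s = (gq m rh s)^3"
definition gb' :: "nat => real => real => real" where
 "gb' m rh s = 3*(gq m rh s)^2*(- (real m*(s/rh)^(m - 1)/rh))"
definition gb'' :: "nat => real => real => real" where
 "gb'' m rh s = 6*gq m rh s*(real m*(s/rh)^(m - 1)/rh)^2
   - 3*(gq m rh s)^2*(real m*real (m - 1)*(s/rh)^(m - 2)/rh\<^sup>2)"

lemma ga_DERIV: "s >= 0 ==> (ga k has_real_derivative ga' k s) (at s)"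
 and ga'_DERIV: "s >= 0 ==> (ga' k has_real_derivative ga'' k s) (at s)"
proof -
 assume s: "s >= 0"
 have p: "((%s. (1 + s) powr c) has_real_derivative c*(1 + s) powr (c - 1)) (at s)" for c
  using s by (auto intro!: dvi has_real_derivative_powr[THEN DERIV_chain2])
 show "(ga k has_real_derivative ga' k s) (at s)"
  unfolding ga_def[abs_def] ga'_def using p[of "- k"] by simp
 show "(ga' k has_real_derivative ga'' k s) (at s)"
  unfolding ga'_def[abs_def] ga''_def using DERIV_cmult[OF p[of "- k - 1"], of "- k"]
  by (simp add: alg)
qed

lemma gb_DERIV:
 assumes "rh > 0"
 shows "(gb m rh has_real_derivative gb' m rh s) (at s)"
  and "(gb' m rh has_real_derivative gb'' m rh s) (at s)"
proof -
 have i: "((%s. 1 - (s/rh)^m) has_real_derivative - (real m*(s/rh)^(m - 1)/rh)) (at s)"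
  using assms by (auto intro!: dvi)
 have j: "((%s. - (real m*(s/rh)^(m - 1)/rh)) has_real_derivative - (real m*real (m - 1)*(s/rh)^(m - 2)/rh\<^sup>2)) (at s)"
  using assms by (auto intro!: dvi simp: pow2 numeral_2_eq_2)
 show "(gb m rh has_real_derivative gb' m rh s) (at s)"
  unfolding gb_def[abs_def] gb'_def gq_def
  using DERIV_chain2[OF DERIV_pos_part_power[of 1] i] by (simp add: numeral_3_eq_3 numeral_2_eq_2)
 have q: "((%s. 3*(gq m rh s)^2) has_real_derivative 3*(2*gq m rh s*(- (real m*(s/rh)^(m - 1)/rh)))) (at s)"
  unfolding gq_def using DERIV_cmult[OF DERIV_chain2[OF DERIV_pos_part_power[of 0] i], of 3] by (simp add: numeral_2_eq_2)
 show "(gb' m rh has_real_derivative gb'' m rh s) (at s)"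
  unfolding gb'_def[abs_def] by (rule DERIV_cong[OF DERIV_mult[OF q j]]) (simp add: gb''_def pow2 alg)
qed

lemma gq_bounds: "0 <= gq m rh s" "s >= 0 ==> rh > 0 ==> gq m rh s <= 1"
 by (auto simp: gq_def)

lemma gq_zero: "rh > 0 ==> s >= rh ==> gq m rh s = 0"
 using one_le_power[of "s/rh" m] by (simp add: gq_def)

lemma gb_zero: "rh > 0 ==> s >= rh ==> gb m rh s = 0 & gb' m rh s = 0 & gb'' m rh s = 0"
 by (simp add: gb_def gb'_def gb''_def gq_zero)

lemma gb_bounds: "0 <= gb m rh s" "s >= 0 ==> rh > 0 ==> gb m rh s <= 1"
 using gq_bounds(1)[of m rh s] gq_bounds(2)[of s rh m] by (auto simp: gb_def power_le_one)

lemma ga_pos: "s >= 0 ==> ga k s > 0" and ga_le_1: "s >= 0 ==> k >= 0 ==> ga k s <= 1"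
 using powr_mono[of "- k" 0 "1 + s"] by (auto simp: ga_def)

text \<open>A factor \<open>(s/rh)^j\<close> with \<open>j >= k\<close> compensates the size of
  \<open>ga k\<close> at small \<open>s\<close>, so that the product is bounded by the kernel at the
  scale \<open>rh\<close>. A cutoff that is flat at 0 supplies such a factor with each
  derivative.\<close>

lemma ga_power_le:
 assumes "0 <= s" "s <= rh" "rh >= 1" "0 <= k" "k <= real j" "j > 0"
 shows "ga k s*(s/rh)^j <= rh powr (- k)"
proof (cases "s = 0")
 case False
 then have s: "s > 0" using assms by simp
 have "(s/rh)^j = (s/rh) powr real j" using s assms by (simp add: powr_realpow)
 also have "... <= (s/rh) powr k"
  using s assms by (intro powr_mono_both') (auto simp: divide_le_eq)
 also have "... <= ((1 + s)/rh) powr k"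
  using s assms by (intro powr_mono2) (auto simp: divide_right_mono)
 also have "... = (1 + s) powr k*rh powr (- k)"
  using s assms by (simp add: powr_divide powr_minus_divide)
 finally have "ga k s*(s/rh)^j <= ga k s*((1 + s) powr k*rh powr (- k))"
  using ga_pos[of s k] s by (intro mlm) auto
 also have "... = rh powr (- k)" using s by (simp add: ga_def powr_minus field_simps)
 finally show ?thesis .
qed (use assms in \<open>simp add: zero_power\<close>)

text \<open>All terms in which a derivative falls on the cutoff have the size that they have at
  \<open>s = rh\<close>. In the last bound the cube in \<open>gb\<close> leaves a factor
  \<open>gb\<close>, since \<open>gq^4 <= gq^3\<close>; it is needed to compare the squared gradient
  of the kernel with the kernel itself.\<close>

lemma green_profile_bounds:
 assumes s: "0 <= s" and rh: "rh >= 1" and k: "0 <= k" "k <= real (m - 1)" and m: "m >= 2"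
 shows "ga k s*\<bar>gb' m rh s\<bar> <= 3*real m*rh powr (- k - 1)"
  "s*(\<bar>ga' k s\<bar>*\<bar>gb' m rh s\<bar>) <= 3*real m*k*rh powr (- k - 1)"
  "s*(ga k s*\<bar>gb'' m rh s\<bar>) <= 9*(real m)^2*rh powr (- k - 1)"
  "s*(ga k s*(gb' m rh s)^2) <= 9*(real m)^2*rh powr (- k - 1)*gb m rh s"
proof -
 have rh0: "rh > 0" using rh by simp
 define q where "q = gq m rh s"
 define y where "y = s/rh"
 have q: "0 <= q" "q <= 1" using gq_bounds(1)[of m rh s] gq_bounds(2)[of s rh m] s rh0 by (auto simp: q_def)
 have y: "0 <= y" using s rh0 by (simp add: y_def)
 have a0: "ga k s > 0" using ga_pos[OF s] .
 have r0: "rh powr (- k - 1) = rh powr (- k)/rh" using rh0 by (simp add: powr_diff)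
 have b1: "ga k s*\<bar>gb' m rh s\<bar> <= 3*real m*rh powr (- k - 1)"
  and b3: "s*(ga k s*\<bar>gb'' m rh s\<bar>) <= 9*(real m)^2*rh powr (- k - 1)"
  and b4: "s*(ga k s*(gb' m rh s)^2) <= 9*(real m)^2*rh powr (- k - 1)*gb m rh s"
 proof -
  consider "s < rh" | "s >= rh" by linarith
  then have "ga k s*\<bar>gb' m rh s\<bar> <= 3*real m*rh powr (- k - 1) &
   s*(ga k s*\<bar>gb'' m rh s\<bar>) <= 9*(real m)^2*rh powr (- k - 1) &
   s*(ga k s*(gb' m rh s)^2) <= 9*(real m)^2*rh powr (- k - 1)*gb m rh s"
  proof cases
   case 2
   then show ?thesis using gb_zero[OF rh0 2, of m] by simp
  next
   case 1
   have y1: "y <= 1" using 1 rh0 by (simp add: y_def)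
   have key: "ga k s*y^(m - 1) <= rh powr (- k)"
    unfolding y_def using s 1 rh k m by (intro ga_power_le) auto
   have q2: "q^2 <= 1" using q by (simp add: power_le_one)
   have "\<bar>gb' m rh s\<bar> = 3*real m*(q^2*(y^(m - 1)/rh))"
    using y rh0 by (simp add: gb'_def q_def y_def abs_mult)
   also have "... <= 3*real m*(1*(y^(m - 1)/rh))"
    using y rh0 q2 by (intro mlm mrm) auto
   finally have "ga k s*\<bar>gb' m rh s\<bar> <= ga k s*(3*real m*(y^(m - 1)/rh))"
    using a0 by (intro mlm) auto
   also have "... = 3*real m*((ga k s*y^(m - 1))/rh)" by simp
   also have "... <= 3*real m*(rh powr (- k)/rh)"
    using key rh0 by (intro mlm divide_right_mono) auto
   finally have c1: "ga k s*\<bar>gb' m rh s\<bar> <= 3*real m*rh powr (- k - 1)" by (simp add: r0)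
   have mm: "y^(m - 1) = y*y^(m - 2)" 
   proof -
    obtain j where "m = 2 + j" using m le_Suc_ex by blast
    then show ?thesis by simp
   qed
   have yy: "(y^(m - 1))^2 <= y^(m - 2)"
   proof -
    have "(y^(m - 1))^2 = y^(m - 2)*(y*y^(m - 1))" 
     using arg_cong[OF mm, of "%t. t*y^(m - 1)"] by (simp add: pow2 mult_ac)
    also have "... <= y^(m - 2)*(1*1)"
     using y y1 by (intro mlm mult_mono) (auto simp: power_le_one)
    finally show ?thesis by simp
   qed
   have "\<bar>gb'' m rh s\<bar> <= 6*q*((real m)^2*(y^(m - 1))^2/rh\<^sup>2) + 3*q^2*(real m*real (m - 1)*y^(m - 2)/rh\<^sup>2)"
    unfolding gb''_def q_def[symmetric] y_def[symmetric]
    using q y by (intro order_trans[OF abs_triangle_ineq4]) (simp add: abs_mult power_divide pmd)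
   also have "... <= 6*1*((real m)^2*y^(m - 2)/rh\<^sup>2) + 3*1*(real m*real m*y^(m - 2)/rh\<^sup>2)"
    using q q2 y yy by (intro add_mono mult_mono divide_right_mono) auto
   finally have "\<bar>gb'' m rh s\<bar> <= 9*(real m)^2*(y^(m - 2)/rh\<^sup>2)" by (simp add: pow2)
   then have "s*(ga k s*\<bar>gb'' m rh s\<bar>) <= s*(ga k s*(9*(real m)^2*(y^(m - 2)/rh\<^sup>2)))"
    using a0 s by (intro mlm) auto
   also have "... = 9*(real m)^2*((ga k s*y^(m - 1))/rh)"
    unfolding mm using rh0 by (simp add: y_def pow2)
   also have "... <= 9*(real m)^2*(rh powr (- k)/rh)"
    using key rh0 by (intro mlm divide_right_mono) auto
   finally have c3: "s*(ga k s*\<bar>gb'' m rh s\<bar>) <= 9*(real m)^2*rh powr (- k - 1)" by (simp add: r0)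
   have "(gb' m rh s)^2 = 9*(real m)^2*((q*q^3)*((y^(m - 1))^2/rh\<^sup>2))"
    by (simp add: gb'_def q_def y_def pow2 power3_eq_cube alg)
   also have "... <= 9*(real m)^2*((1*q^3)*(y^(m - 2)/rh\<^sup>2))"
    using q yy by (intro mlm mult_mono divide_right_mono) auto
   finally have "s*(ga k s*(gb' m rh s)^2) <= s*(ga k s*(9*(real m)^2*(q^3*(y^(m - 2)/rh\<^sup>2))))"
    using a0 s by (intro mlm) auto
   also have "... = 9*(real m)^2*q^3*((ga k s*y^(m - 1))/rh)"
    unfolding mm using rh0 by (simp add: y_def pow2)
   also have "... <= 9*(real m)^2*q^3*(rh powr (- k)/rh)"
    using key rh0 q by (intro mlm divide_right_mono) auto
   finally have "s*(ga k s*(gb' m rh s)^2) <= 9*(real m)^2*rh powr (- k - 1)*gb m rh s"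
    by (simp add: r0 gb_def q_def mult.commute mult.left_commute)
   with c1 c3 show ?thesis by blast
  qed
  then show "ga k s*\<bar>gb' m rh s\<bar> <= 3*real m*rh powr (- k - 1)"
   "s*(ga k s*\<bar>gb'' m rh s\<bar>) <= 9*(real m)^2*rh powr (- k - 1)"
   "s*(ga k s*(gb' m rh s)^2) <= 9*(real m)^2*rh powr (- k - 1)*gb m rh s" by auto
 qed
 show "ga k s*\<bar>gb' m rh s\<bar> <= 3*real m*rh powr (- k - 1)" by (rule b1)
 show "s*(ga k s*\<bar>gb'' m rh s\<bar>) <= 9*(real m)^2*rh powr (- k - 1)" by (rule b3)
 show "s*(ga k s*(gb' m rh s)^2) <= 9*(real m)^2*rh powr (- k - 1)*gb m rh s" by (rule b4)
 have "s*\<bar>ga' k s\<bar> <= k*ga k s"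
 proof -
  have "s*\<bar>ga' k s\<bar> = k*(s*((1 + s) powr (- k)/(1 + s)))"
   using k s by (simp add: ga'_def abs_mult powr_diff)
  also have "... = k*(ga k s*(s/(1 + s)))" by (simp add: ga_def)
  also have "... <= k*(ga k s*1)" using k s a0 by (intro mlm) (auto simp: divide_le_eq)
  finally show ?thesis by simp
 qed
 then have "(s*\<bar>ga' k s\<bar>)*\<bar>gb' m rh s\<bar> <= (k*ga k s)*\<bar>gb' m rh s\<bar>" by (intro mrm) auto
 also have "... = k*(ga k s*\<bar>gb' m rh s\<bar>)" by simp
 also have "... <= k*(3*real m*rh powr (- k - 1))" using b1 k by (intro mlm) auto
 finally show "s*(\<bar>ga' k s\<bar>*\<bar>gb' m rh s\<bar>) <= 3*real m*k*rh powr (- k - 1)" by (simp add: alg)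
qed

context ac
begin

section \<open>Weighted integration by parts and the stress tensor in the variable
  \<open>z\<close>\<close>

definition wt :: "'a => real" where "wt x = (sg x)^2"

lemma wt_pos: "wt x > 0" using sg_pos[of x] by (simp add: wt_def)
lemma C1g_wt: "C1g wt (%x. (- 4 * sqrt 2*u x*wt x) $* Z x)"
proof -
 have "C1g (%x. W (u x)) (%x. W' (u x) $* U x)"
  by (intro C1g_compose[OF C2gD(1)[OF u]] W_DERIV) (auto simp: W'_def[abs_def] intro!: cnt)
 moreover have "W (u x) = wt x" "W' (u x) $* U x = (- 4 * sqrt 2*u x*wt x) $* Z x" for x
  by (simp_all add: W_def wt_def sg_def W'_def U_eq pow2)
 ultimately show ?thesis by simp
qed

lemma wt_cont: "continuous_on S wt" by (rule C1g_cont[OF C1g_wt])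
lemma Q_cont: "continuous_on S Q" by (rule C1g_cont[OF C1g_Q])
lemma Z_cont: "continuous_on S Z" by (rule C2gD(6)[OF C2g_z])
lemma z_cont: "continuous_on S z" by (rule C2gD(7)[OF C2g_z])
lemma be_cont: "continuous_on S be"
 unfolding be_def[abs_def] frob_def L2_set_def by (intro cnt C2gD(4)[OF C2g_z])
lemma energy_density: "en x = wt x*(2 - Q x)"
proof -
 have "U x $. U x = (sqrt 2 * sg x)^2*(Z x $. Z x)" by (simp add: U_eq pow2)
 also have "... = 2*(wt x*(1 - Q x))" by (simp add: pmd wt_def Q_def)
 finally have "en x = wt x*(1 - Q x) + W (u x)" by (simp add: en_def)
 moreover have "W (u x) = wt x" by (simp add: W_def wt_def sg_def)
 ultimately show ?thesis by (simp add: alg)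
qed

lemma weighted_parts:
 assumes a: "C1g pf G" and w: "C2g w g H" and cs: "csupp pf | csupp g"
 shows "(LINT x|lborel. wt x*(G x $. g x) + wt x*pf x*Mo g H x) = 0"
  "integrable lborel (%x. wt x*(G x $. g x) + wt x*pf x*Mo g H x)"
proof -
 have c: "csupp (%x. wt x*pf x) | csupp g" using cs csupp_mult(2)[of pf wt] by auto
 have e: "(wt x $* G x + pf x $* ((- 4 * sqrt 2*u x*wt x) $* Z x)) $. g x + wt x*pf x*tr (H x)
  = wt x*(G x $. g x) + wt x*pf x*Mo g H x" for x
  by (simp add: Mo_def inner_add_left alg)
 show "(LINT x|lborel. wt x*(G x $. g x) + wt x*pf x*Mo g H x) = 0"
  using integral_div_grad'(1)[OF C1g_mult[OF C1g_wt a] w c] unfolding e .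
 show "integrable lborel (%x. wt x*(G x $. g x) + wt x*pf x*Mo g H x)"
  using integral_div_grad'(2)[OF C1g_mult[OF C1g_wt a] w c] unfolding e .
qed

text \<open>The stress tensor of \<open>u\<close>, that is \<open>en\<close> times the identity
  minus the tensor square of \<open>grad u\<close>, rewritten by \<open>energy_density\<close> and
  \<open>U_eq\<close>. Its contraction with a Hessian is \<open>TH\<close>.\<close>

definition Tb :: "'a => 'a => 'a => real" where
 "Tb x a b = wt x*((2 - Q x)*(a $. b) - 2*(Z x $. a)*(Z x $. b))"

definition TH :: "('a => 'a => 'a) => 'a => real" where
 "TH H x = wt x*((2 - Q x)*tr (H x) - 2*(H x (Z x) $. Z x))"

text \<open>The isotropic and the rank one part each give a vector field of the form scalar times
  gradient, one along \<open>G\<close> and one along \<open>Z\<close>. In the sum of their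
  divergences the derivatives that fall on the tensor cancel by \<open>trB\<close>.\<close>

lemma stress_divergence_free:
 assumes F: "C1g F fj" and p: "C2g pf G H" and cs: "csupp F | csupp G"
 shows "(LINT x|lborel. Tb x (G x) (fj x) + F x*TH H x) = 0"
  "integrable lborel (%x. Tb x (G x) (fj x) + F x*TH H x)"
proof -
 have c2Q: "C1g (%x. 2 + (-1)*Q x) (%x. 0 + (-1) $* ((-2) $* B x (Z x)))"
  by (intro C1g_add C1g_const C1g_cmult C1g_Q)
 note a1 = C1g_mult[OF F C1g_mult[OF C1g_wt c2Q]]
 note a2 = C1g_cmult[OF C1g_mult[OF F C1g_mult[OF C1g_wt C1g_grad_inner_grad[OF C2g_z p]]], of "-2"]
 have cs1: "csupp (%x. F x*(wt x*(2 + (-1)*Q x))) | csupp G" using cs csupp_mult(1)[of F "%x. wt x*(2 + (-1)*Q x)"] by auto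
 have cs2: "csupp (%x. - 2*(F x*(wt x*(Z x $. G x)))) | csupp Z" using cs by (force simp: csupp_def)
 note i1 = integral_div_grad'[OF a1 p cs1] and i2 = integral_div_grad'[OF a2 C2g_z cs2]
 have e: "((F x $* (wt x $* (0 + (-1) $* ((-2) $* B x (Z x))) + (2 + (-1)*Q x) $* ((- 4 * sqrt 2*u x*wt x) $* Z x)) +
    (wt x*(2 + (-1)*Q x)) $* fj x) $. G x + F x*(wt x*(2 + (-1)*Q x))*tr (H x)) +
   (((-2) $* (F x $* (wt x $* (B x (G x) + H x (Z x)) + (Z x $. G x) $* ((- 4 * sqrt 2*u x*wt x) $* Z x)) +
    (wt x*(Z x $. G x)) $* fj x)) $. Z x + - 2*(F x*(wt x*(Z x $. G x)))*tr (B x))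
   = Tb x (G x) (fj x) + F x*TH H x" for x
 proof -
  define a b f h c where "a = Z x $. G x" and "b = B x (Z x) $. G x" and "f = fj x $. G x" and "h = H x (Z x) $. Z x" and "c = fj x $. Z x"
  have b2: "B x (G x) $. Z x = b" unfolding b_def by (rule B_sym)
  have P: "Z x $. Z x = 1 - Q x" by (simp add: Q_def)
  have s: "G x $. fj x = f" "Z x $. fj x = c" by (auto simp: f_def c_def inner_commute)
  show ?thesis
   unfolding Tb_def TH_def trB s
   by (simp only: inner_add_left inner_scaleR_left a_def[symmetric] b_def[symmetric] f_def[symmetric] h_def[symmetric] c_def[symmetric] b2 P inner_zero_left)
     (simp add: alg)
 qed
 from Bochner_Integration.integral_add[OF i1(2) i2(2)] i1(1) i2(1)
 show "(LINT x|lborel. Tb x (G x) (fj x) + F x*TH H x) = 0" unfolding e by simp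
 from Bochner_Integration.integrable_add[OF i1(2) i2(2)]
 show "integrable lborel (%x. Tb x (G x) (fj x) + F x*TH H x)" unfolding e .
qed

end

lemma young_le:
 fixes x y p X c :: real
 assumes "x^2 <= p*X" "p >= 0" "X >= 0" "c > 0"
 shows "\<bar>x*y\<bar> <= c*p*y^2 + X/(4 * c)"
proof (cases "p = 0")
 case True
 then have "x = 0" using assms by simp
 then show ?thesis using True assms by simp
next
 case False
 then have p: "p > 0" using assms by simp
 have "\<bar>x*y\<bar> <= c*p*y^2 + x^2/(4 * c*p)"
 proof -
  have "0 <= (2 * c*p*\<bar>y\<bar> - \<bar>x\<bar>)^2" by simp
  then have "4 * c*p*\<bar>x*y\<bar> <= 4 * c*p*(c*p*y^2) + x^2"
   by (simp add: pow2 alg abs_mult)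
  then have "\<bar>x*y\<bar> <= (4 * c*p*(c*p*y^2) + x^2)/(4 * c*p)"
   using p assms(4) by (simp add: pos_le_divide_eq mult.commute)
  then show ?thesis using p assms(4) by (simp add: add_divide_distrib)
 qed
 also have "x^2/(4 * c*p) <= (p*X)/(4 * c*p)"
  using assms p by (intro divide_right_mono) auto
 also have "(p*X)/(4 * c*p) = X/(4 * c)" using p by simp
 finally show ?thesis by simp
qed

context ac
begin

section \<open>The cut-off Green function of the interface\<close>

definition nn :: real where "nn = real DIM('a)"
text \<open>Half of n - 3: in terms of the squared distance, \<open>ga kk\<close> then decays like
  the Green function of a surface of dimension n - 1.\<close>

definition kk :: real where "kk = (nn - 3)/2"
definition gr :: "real => real => real" where "gr R s = ga kk s*gb DIM('a) (R^2) s"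
definition gr' :: "real => real => real" where
 "gr' R s = ga kk s*gb' DIM('a) (R^2) s + ga' kk s*gb DIM('a) (R^2) s"
definition gr'' :: "real => real => real" where
 "gr'' R s = ga kk s*gb'' DIM('a) (R^2) s + 2*(ga' kk s*gb' DIM('a) (R^2) s) + ga'' kk s*gb DIM('a) (R^2) s"
text \<open>This is \<open>R^(1-n)\<close>, the reciprocal of the growth rate of the energy, as
  \<open>lam_eq\<close> states.\<close>

definition lam :: "real => real" where "lam R = (R^2) powr (- kk - 1)"
definition sq :: "'a => 'a => real" where "sq x0 x = (x - x0) $. (x - x0)"
definition psi :: "'a => real => 'a => real" where "psi x0 R x = gr R (sq x0 x)"
definition psiG :: "'a => real => 'a => 'a" where "psiG x0 R x = (2*gr' R (sq x0 x)) $* (x - x0)"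
definition psiH :: "'a => real => 'a => 'a => 'a" where
 "psiH x0 R x h = (2*gr' R (sq x0 x)) $* h + (4*gr'' R (sq x0 x)*((x - x0) $. h)) $* (x - x0)"
definition gw :: "'a => real => 'a => real" where
 "gw x0 R x = gb DIM('a) (R^2) (sq x0 x)*(1 + sq x0 x) powr (- kk - 2)"
text \<open>\<open>- 2 * kk * Dn\<close> is the part of \<open>TH (psiH x0 R) x / wt x\<close> in
  which no derivative falls on the cutoff; it plays the role of minus the source at
  \<open>x0\<close>. The remaining terms form \<open>Er\<close>.\<close>

definition Dn :: "'a => real => 'a => real" where
 "Dn x0 R x = gw x0 R x*(2*(nn - 1) - (nn - 2)*Q x + sq x0 x*Q x + 2*(nn - 1)*((x - x0) $. Z x)^2)"
definition Er :: "'a => real => 'a => real" where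
 "Er x0 R x = TH (psiH x0 R) x/wt x + 2*kk*Dn x0 R x"
text \<open>A majorant for the square of the normal derivative of \<open>psi\<close>, and for
  \<open>Q\<close> times its squared gradient, after division by \<open>psi\<close>; see
  \<open>psiG_bounds\<close>.\<close>

definition Xe :: "'a => real => 'a => real" where
 "Xe x0 R x = 8*kk^2*Dn x0 R x + 72*nn^2*lam R*indicator (ball x0 R) x"

lemma sq_nonneg: "sq x0 x >= 0" by (simp add: sq_def)
lemma sq_cont: "continuous_on S (sq x0)" unfolding sq_def[abs_def] by (intro cnt)
lemma sq_ball: "R > 0 ==> x : ball x0 R \<longleftrightarrow> sq x0 x < R^2"
proof -
 assume R: "R > 0"
 have "x : ball x0 R \<longleftrightarrow> norm (x - x0) < R" by (simp add: dist_norm norm_minus_commute)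
 also have "... \<longleftrightarrow> (norm (x - x0))^2 < R^2"
  using R power_strict_mono[of "norm (x - x0)" R 2] power2_less_imp_less[of "norm (x - x0)" R] by auto
 finally show ?thesis by (simp add: sq_def nrm2)
qed

lemma C2g_psi: "R > 0 ==> C2g (psi x0 R) (psiG x0 R) (psiH x0 R)"
proof -
 assume R: "R > 0"
 have r: "R^2 > 0" using R by simp
 have 1: "(gr R has_real_derivative gr' R s) (at s)" if "s >= 0" for s
  unfolding gr_def[abs_def] gr'_def
  by (rule DERIV_cong[OF DERIV_mult[OF ga_DERIV[OF that] gb_DERIV(1)[OF r]]]) simp
 have 2: "(gr' R has_real_derivative gr'' R s) (at s)" if "s >= 0" for s
  unfolding gr'_def[abs_def] gr''_def
  by (rule DERIV_cong[OF DERIV_add[OF DERIV_mult[OF ga_DERIV[OF that] gb_DERIV(2)[OF r]] DERIV_mult[OF ga'_DERIV[OF that] gb_DERIV(1)[OF r]]]]) simp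
 have 3: "continuous_on {0..} (gr'' R)"
  unfolding gr''_def[abs_def] ga_def ga'_def ga''_def gb_def gb'_def gb''_def gq_def
  using R by (intro cnt) auto
 show ?thesis
  unfolding psi_def[abs_def] psiG_def[abs_def] psiH_def[abs_def] sq_def by (rule C2g_radial[OF 1 2 3])
qed

lemma gr_zero: "R > 0 ==> s >= R^2 ==> gr R s = 0 & gr' R s = 0 & gr'' R s = 0"
 using gb_zero[of "R^2" s] by (simp add: gr_def gr'_def gr''_def)

lemma csupp_outside_ball:
 fixes x0 :: 'a and f :: "'a => 'b::real_vector"
 assumes "R > 0" "!!x. x ~: ball x0 R ==> f x = 0"
 shows "csupp f"
 unfolding csupp_def
proof (intro exI[of _ "R + norm x0"] allI impI)
 fix x :: 'a assume "norm x > R + norm x0"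
 then have "x ~: ball x0 R" using norm_triangle_ineq2[of x x0] by (simp add: dist_norm norm_minus_commute)
 then show "f x = 0" by (rule assms(2))
qed

lemma psi_outside: "R > 0 ==> x ~: ball x0 R ==> psi x0 R x = 0 & psiG x0 R x = 0 & gw x0 R x = 0 & TH (psiH x0 R) x = 0"
proof -
 assume R: "R > 0" "x ~: ball x0 R"
 then have s: "sq x0 x >= R^2" using sq_ball[of R x x0] by simp
 note g = gr_zero[OF R(1) s]
 have "psiH x0 R x = (%h. 0)" by (simp add: psiH_def[abs_def] g)
 then show ?thesis
  using g gb_zero[of "R^2" "sq x0 x" "DIM('a)"] s R(1) by (simp add: psi_def psiG_def gw_def TH_def tr_zero)
qed

lemma psi_nonneg: "psi x0 R x >= 0"
 using ga_pos[of "sq x0 x" kk] gb_bounds(1) sq_nonneg by (simp add: psi_def gr_def less_imp_le)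

lemma gw_nonneg: "gw x0 R x >= 0" using gb_bounds(1) by (simp add: gw_def)

lemma gw_cont: "R > 0 ==> continuous_on S (gw x0 R)"
proof -
 assume "R > 0"
 have "1 + sq x0 x ~= 0" for x using sq_nonneg[of x0 x] by linarith
 then show ?thesis unfolding gw_def[abs_def] gb_def gq_def using \<open>R > 0\<close>
  by (intro cnt sq_cont) auto
qed

lemma Dn_cont: "R > 0 ==> continuous_on S (Dn x0 R)"
 unfolding Dn_def[abs_def] by (intro cnt gw_cont Q_cont sq_cont Z_cont)

lemma lam_pos: "R > 0 ==> lam R > 0" by (simp add: lam_def)

lemma yZ_le: "((x - x0) $. Z x)^2 <= sq x0 x*(1 - Q x)"
 using Cauchy_Schwarz_ineq[of "x - x0" "Z x"] by (simp add: sq_def Q_def)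

lemma yZ_le': "((x - x0) $. Z x)^2 <= sq x0 x"
proof -
 have "sq x0 x*(1 - Q x) <= sq x0 x*1" using Modica[of x] sq_nonneg by (intro mlm) auto
 then show ?thesis using yZ_le[of x x0] by simp
qed

context
 assumes n4: "DIM('a) >= 4"
begin

lemma nn4: "nn >= 4" using n4 by (simp add: nn_def)
lemma kk: "kk >= 1/2" "2*kk = nn - 3" "kk <= nn/2" using nn4 by (auto simp: kk_def)

lemma Dn_ge: "Dn x0 R x >= gw x0 R x*(1 + ((x - x0) $. Z x)^2 + sq x0 x*Q x)"
 unfolding Dn_def
proof (rule mlm)
 have "(nn - 2)*Q x <= (nn - 2)*1" using Q_le nn4 by (intro mlm) auto
 moreover have "1*((x - x0) $. Z x)^2 <= 2*(nn - 1)*((x - x0) $. Z x)^2"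
  using nn4 by (intro mrm) auto
 ultimately show "1 + ((x - x0) $. Z x)^2 + sq x0 x*Q x
  <= 2*(nn - 1) - (nn - 2)*Q x + sq x0 x*Q x + 2*(nn - 1)*((x - x0) $. Z x)^2"
  using nn4 by (simp add: alg)
qed (rule gw_nonneg)

lemma Dn_nonneg: "Dn x0 R x >= 0"
proof -
 have "0 <= gw x0 R x*(1 + ((x - x0) $. Z x)^2 + sq x0 x*Q x)"
  by (intro mnn gw_nonneg add_nonneg_nonneg sq_nonneg Modica) auto
 then show ?thesis using Dn_ge order_trans by blast
qed

text \<open>The step \<open>main\<close> shows that the terms without derivatives of the cutoff
  combine exactly to \<open>Dn\<close>, which uses \<open>2 * (kk + 1) = nn - 1\<close>. The others
  live at the scale \<open>R\<close> by \<open>green_profile_bounds\<close>.\<close>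

lemma Er_bound:
 assumes R: "R >= 1"
 shows "\<bar>Er x0 R x\<bar> <= 108*nn^2*lam R*indicator (ball x0 R) x"
proof (cases "x : ball x0 R")
 case False
 then have "Er x0 R x = 0" using psi_outside[of R x x0] R by (simp add: Er_def Dn_def)
 then show ?thesis using False by simp
next
 case True
 define s where "s = sq x0 x"
 have s0: "s >= 0" by (simp add: s_def sq_nonneg)
 define a a' a'' where "a = ga kk s" and "a' = ga' kk s" and "a'' = ga'' kk s"
 define b b' b'' where "b = gb DIM('a) (R^2) s" and "b' = gb' DIM('a) (R^2) s" and "b'' = gb'' DIM('a) (R^2) s"
 define tu0 where "tu0 = 2*(nn - 1) - (nn - 2)*Q x"
 define S2 where "S2 = (2 - Q x) * s - 2*((x - x0) $. Z x)^2"
 have P: "Z x $. Z x = 1 - Q x" by (simp add: Q_def)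
 have TH1: "TH (psiH x0 R) x/wt x = 2*(a * b' + a' * b)*tu0 + 4*(a * b'' + 2*(a' * b') + a'' * b)*S2"
 proof -
  have "tr (psiH x0 R x) = 2*gr' R s*nn + 4*gr'' R s * s"
   unfolding psiH_def by (simp only: tr_simps nn_def s_def sq_def)
  moreover have "psiH x0 R x (Z x) $. Z x = 2*gr' R s*(1 - Q x) + 4*gr'' R s*((x - x0) $. Z x)^2"
   unfolding psiH_def by (simp add: inner_add_left P s_def pow2)
  ultimately have "TH (psiH x0 R) x/wt x = (2 - Q x)*(2*gr' R s*nn + 4*gr'' R s * s) - 2*(2*gr' R s*(1 - Q x) + 4*gr'' R s*((x - x0) $. Z x)^2)"
   using wt_pos[of x] by (simp add: TH_def)
  also have "... = 2*gr' R s*tu0 + 4*gr'' R s*S2"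
   by (simp add: tu0_def S2_def alg)
  finally show ?thesis
   unfolding gr'_def gr''_def a_def a'_def a''_def b_def b'_def b''_def .
 qed
 have main: "2*(a' * b)*tu0 + 4*(a'' * b)*S2 = - (2*kk*Dn x0 R x)"
 proof -
  define r where "r = (1 + s) powr (- kk - 2)"
  have a'r: "a' = - kk*((1 + s)*r)"
  proof -
   have "(1 + s) powr (- kk - 1) = (1 + s) powr ((- kk - 2) + 1)" by (rule arg_cong[where f="%t. (1 + s) powr t"]) simp
   also have "... = r*(1 + s)" using s0 by (subst powr_add) (simp add: r_def)
   finally show ?thesis unfolding a'_def ga'_def by (simp only: mult.commute[of r])
  qed
  have a''r: "a'' = kk*(kk + 1)*r" by (simp add: a''_def ga''_def r_def)
  have k1: "2*(kk + 1) = nn - 1" using kk by simp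
  have "2*(a' * b)*tu0 + 4*(a'' * b)*S2 = - (2*kk)*(b*r)*((1 + s)*tu0 - 2*(kk + 1)*S2)"
   unfolding a'r a''r by (simp add: alg)
  also have "(1 + s)*tu0 - 2*(kk + 1)*S2 = 2*(nn - 1) - (nn - 2)*Q x + s*Q x + 2*(nn - 1)*((x - x0) $. Z x)^2"
   unfolding k1 tu0_def S2_def by (simp add: alg)
  finally show ?thesis by (simp add: Dn_def gw_def b_def r_def s_def)
 qed
 have E: "Er x0 R x = 2*(a * b')*tu0 + 4*(a * b'' + 2*(a' * b'))*S2"
  unfolding Er_def TH1 using main by (simp add: alg)
 have t0: "\<bar>tu0\<bar> <= 2*nn"
 proof -
  define t where "t = (nn - 2)*Q x"
  have "0 <= t" using Modica[of x] nn4 by (simp add: t_def)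
  moreover have "t <= (nn - 2)*1" unfolding t_def using Q_le[of x] nn4 by (intro mlm) auto
  ultimately show ?thesis unfolding tu0_def t_def[symmetric] using nn4 by (intro abs_leI) auto
 qed
 have S2b: "\<bar>S2\<bar> <= 2 * s"
 proof -
  have "0 <= Q x * s" "Q x * s <= s" using Modica[of x] Q_le[of x] s0 by (auto simp: mult_left_le_one_le)
  moreover have "((x - x0) $. Z x)^2 <= s - s*Q x" using yZ_le[of x x0] by (simp add: s_def alg)
  moreover have "0 <= ((x - x0) $. Z x)^2" by simp
  ultimately show ?thesis unfolding S2_def by (simp add: alg abs_le_iff)
 qed
 have R2: "R^2 >= 1" using R by simp
 have km: "kk <= real (DIM('a) - 1)" using kk(3) nn4 n4 by (simp add: nn_def of_nat_diff)
 note bd = green_profile_bounds[OF s0 R2 _ km, of, folded a_def a'_def b_def b'_def b''_def lam_def nn_def]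
 have bd1: "a*\<bar>b'\<bar> <= 3*nn*lam R" and bd2: "s*(\<bar>a'\<bar>*\<bar>b'\<bar>) <= 3*nn*kk*lam R" and bd3: "s*(a*\<bar>b''\<bar>) <= 9*nn^2*lam R"
  using bd kk n4 by auto
 have a0: "a > 0" using ga_pos[OF s0] by (simp add: a_def)
 have "\<bar>Er x0 R x\<bar> <= 2*(a*\<bar>b'\<bar>)*\<bar>tu0\<bar> + 4*(a*\<bar>b''\<bar> + 2*(\<bar>a'\<bar>*\<bar>b'\<bar>))*\<bar>S2\<bar>"
 proof -
  have "\<bar>Er x0 R x\<bar> <= \<bar>2*(a * b')*tu0\<bar> + \<bar>4*(a * b'' + 2*(a' * b'))*S2\<bar>" unfolding E by (rule abs_triangle_ineq)
  also have "\<bar>2*(a * b')*tu0\<bar> = 2*(a*\<bar>b'\<bar>)*\<bar>tu0\<bar>" using a0 by (simp add: abs_mult)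
  also have "\<bar>4*(a * b'' + 2*(a' * b'))*S2\<bar> <= 4*(a*\<bar>b''\<bar> + 2*(\<bar>a'\<bar>*\<bar>b'\<bar>))*\<bar>S2\<bar>"
  proof -
   have "\<bar>a * b'' + 2*(a' * b')\<bar> <= a*\<bar>b''\<bar> + 2*(\<bar>a'\<bar>*\<bar>b'\<bar>)"
    using abs_triangle_ineq[of "a * b''" "2*(a' * b')"] a0 by (simp add: abs_mult)
   then show ?thesis by (simp add: abs_mult mrm)
  qed
  finally show ?thesis by simp
 qed
 also have "... <= 2*(a*\<bar>b'\<bar>)*(2*nn) + 4*(a*\<bar>b''\<bar> + 2*(\<bar>a'\<bar>*\<bar>b'\<bar>))*(2 * s)"
  using t0 S2b a0 by (intro add_mono mlm) auto
 also have "... = 4*nn*(a*\<bar>b'\<bar>) + 8*(s*(a*\<bar>b''\<bar>)) + 16*(s*(\<bar>a'\<bar>*\<bar>b'\<bar>))" by (simp add: alg)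
 also have "... <= 4*nn*(3*nn*lam R) + 8*(9*nn^2*lam R) + 16*(3*nn*kk*lam R)"
  using bd1 bd2 bd3 nn4 by (intro add_mono mlm) auto
 also have "... <= 4*nn*(3*nn*lam R) + 8*(9*nn^2*lam R) + 16*(3*nn*(nn/2)*lam R)"
  using kk(3) nn4 lam_pos[of R] R by (intro add_mono mlm mrm) auto
 also have "... = 108*nn^2*lam R" by (simp add: pow2)
 finally show ?thesis using True by simp
qed

lemma Xe_nonneg: "R >= 1 ==> Xe x0 R x >= 0"
 unfolding Xe_def using Dn_nonneg lam_pos[of R] by (intro add_nonneg_nonneg mnn) auto

text \<open>The gradient of \<open>psi\<close> is radial. Its normal part is measured by
  \<open>((x - x0) $. Z x)^2\<close>, its length in the second bound by
  \<open>sq x0 x * Q x\<close>, and both quantities already occur in \<open>Dn\<close> with the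
  right kernel.\<close>

lemma psiG_bounds:
 assumes R: "R >= 1"
 shows "(Z x $. psiG x0 R x)^2 <= psi x0 R x*Xe x0 R x" "Q x*(psiG x0 R x $. psiG x0 R x) <= psi x0 R x*Xe x0 R x"
proof -
 have "(Z x $. psiG x0 R x)^2 <= psi x0 R x*Xe x0 R x & Q x*(psiG x0 R x $. psiG x0 R x) <= psi x0 R x*Xe x0 R x"
 proof (cases "x : ball x0 R")
  case False
  then show ?thesis using psi_outside[of R x x0] R by simp
 next
  case True
  define s where "s = sq x0 x"
  have s0: "s >= 0" by (simp add: s_def sq_nonneg)
  define a a' where "a = ga kk s" and "a' = ga' kk s"
  define b b' where "b = gb DIM('a) (R^2) s" and "b' = gb' DIM('a) (R^2) s"
  define r where "r = (1 + s) powr (- kk - 2)"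
  define Y where "Y = ((x - x0) $. Z x)^2"
  have a0: "a > 0" using ga_pos[OF s0] by (simp add: a_def)
  have b0: "b >= 0" using gb_bounds(1) by (simp add: b_def)
  have R2: "R^2 >= 1" using R by simp
  have km: "kk <= real (DIM('a) - 1)" using kk(3) nn4 n4 by (simp add: nn_def of_nat_diff)
  have bd4: "s*(a * b'^2) <= 9*nn^2*lam R * b"
   using green_profile_bounds(4)[OF s0 R2 _ km] kk n4 by (simp add: a_def b_def b'_def lam_def nn_def)
  have a'2: "a'^2 = kk^2*(a*r)"
  proof -
   have "a'^2 = kk^2*((1 + s) powr (- kk - 1)*(1 + s) powr (- kk - 1))" by (simp add: a'_def ga'_def pow2)
   also have "(1 + s) powr (- kk - 1)*(1 + s) powr (- kk - 1) = a*r"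
    by (simp add: a_def ga_def r_def flip: powr_add)
   finally show ?thesis .
  qed
  \<comment> \<open>\<open>t\<close> stands for either of these two quantities, both of which are at
    most \<open>s\<close>.\<close>
  have g2: "t*(a * b' + a' * b)^2 <= (a * b)*(2*kk^2*(b*r*t) + 18*nn^2*lam R)" if t: "0 <= t" "t <= s" for t
  proof -
   have "(a * b' + a' * b)^2 <= 2*(a * b')^2 + 2*(a' * b)^2"
    using sum_squares_ge_zero[of "a * b' - a' * b" 0] by (simp add: pow2 alg)
   then have "t*(a * b' + a' * b)^2 <= t*(2*(a * b')^2 + 2*(a' * b)^2)" using t by (intro mlm) auto
   also have "... = 2 * a*(t*(a * b'^2)) + 2*t*(a'^2 * b^2)" by (simp add: pow2 alg)
   also have "... <= 2 * a*(s*(a * b'^2)) + 2*t*(a'^2 * b^2)"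
    using t a0 by (intro add_mono mlm mrm) auto
   also have "... <= 2 * a*(9*nn^2*lam R * b) + 2*t*(a'^2 * b^2)"
    using bd4 a0 t by (intro add_mono mlm) auto
   also have "... = (a * b)*(2*kk^2*(b*r*t) + 18*nn^2*lam R)"
    unfolding a'2 by (simp add: pow2 alg)
   finally show ?thesis .
  qed
  have Ys: "0 <= Y" "Y <= s" using yZ_le'[of x x0] by (auto simp: Y_def s_def)
  have sQ: "0 <= s*Q x" "s*Q x <= s" using Modica[of x] Q_le[of x] s0 by (auto simp: mult_left_le)
  have Dge: "b*r*Y <= Dn x0 R x" "b*r*(s*Q x) <= Dn x0 R x"
  proof -
   have "gw x0 R x = b*r" by (simp add: gw_def b_def r_def s_def)
   then have D: "b*r*(1 + Y + s*Q x) <= Dn x0 R x" using Dn_ge[of x0 R x] by (simp add: Y_def s_def)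
   have br: "b*r >= 0" using b0 by (simp add: r_def)
   have "b*r*Y <= b*r*(1 + Y + s*Q x)" "b*r*(s*Q x) <= b*r*(1 + Y + s*Q x)"
    using br Ys sQ by (auto intro!: mlm)
   then show "b*r*Y <= Dn x0 R x" "b*r*(s*Q x) <= Dn x0 R x" using D by linarith+
  qed
  have X: "4*(2*kk^2*D + 18*nn^2*lam R) <= Xe x0 R x" if "D <= Dn x0 R x" for D
  proof -
   have "kk^2*D <= kk^2*Dn x0 R x" using that by (intro mlm) auto
   then show ?thesis using True by (simp add: Xe_def)
  qed
  have ps: "psi x0 R x = a * b" by (simp add: psi_def gr_def a_def b_def s_def)
  have ab: "a * b >= 0" using a0 b0 by simp
  have G: "psiG x0 R x = (2*(a * b' + a' * b)) $* (x - x0)" by (simp add: psiG_def gr'_def a_def b_def a'_def b'_def s_def)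
  have "(Z x $. psiG x0 R x)^2 = 4*(Y*(a * b' + a' * b)^2)"
   unfolding G by (simp add: Y_def pow2 inner_commute alg)
  also have "... <= 4*((a * b)*(2*kk^2*(b*r*Y) + 18*nn^2*lam R))" using g2[OF Ys] by simp
  also have "... = (a * b)*(4*(2*kk^2*(b*r*Y) + 18*nn^2*lam R))" by simp
  also have "... <= (a * b)*Xe x0 R x" by (intro mlm X Dge ab)
  finally have 1: "(Z x $. psiG x0 R x)^2 <= psi x0 R x*Xe x0 R x" by (simp add: ps)
  have "Q x*(psiG x0 R x $. psiG x0 R x) = 4*((s*Q x)*(a * b' + a' * b)^2)"
   unfolding G by (simp add: s_def sq_def pow2 alg)
  also have "... <= 4*((a * b)*(2*kk^2*(b*r*(s*Q x)) + 18*nn^2*lam R))" using g2[OF sQ] by simp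
  also have "... = (a * b)*(4*(2*kk^2*(b*r*(s*Q x)) + 18*nn^2*lam R))" by simp
  also have "... <= (a * b)*Xe x0 R x" by (intro mlm X Dge ab)
  finally show ?thesis using 1 by (simp add: ps)
 qed
 then show "(Z x $. psiG x0 R x)^2 <= psi x0 R x*Xe x0 R x" "Q x*(psiG x0 R x $. psiG x0 R x) <= psi x0 R x*Xe x0 R x" by auto
qed

text \<open>Twice the weighted integration by parts minus the stress identity. The tensors combine
  to \<open>2 I - ((2 - Q) I - 2 Z Z) = Q I + 2 Z Z\<close>, so the coupling of
  \<open>grad psi\<close> and \<open>grad w\<close> along the interface disappears.\<close>

lemma green_identity:
 assumes w: "C2g w g H" and R: "R >= 1"
 shows "(LINT x|lborel. wt x*(2*psi x0 R x*Mo g H x + (Q x*(psiG x0 R x $. g x) + 2*(Z x $. psiG x0 R x)*(Z x $. g x))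
   + w x*(2*kk*Dn x0 R x - Er x0 R x))) = 0" (is "(LINT x|lborel. ?f x) = 0")
  and "integrable lborel (%x. wt x*(2*psi x0 R x*Mo g H x + (Q x*(psiG x0 R x $. g x) + 2*(Z x $. psiG x0 R x)*(Z x $. g x))
   + w x*(2*kk*Dn x0 R x - Er x0 R x)))"
proof -
 have R0: "R > 0" using R by simp
 have csG: "csupp (psiG x0 R)" "csupp (psi x0 R)"
  by (rule csupp_outside_ball[OF R0, of x0], use psi_outside[OF R0] in blast)+
 note p1 = weighted_parts[OF C2gD(1)[OF C2g_psi[OF R0, of x0]] w disjI1[OF csG(2)]]
 note p2 = stress_divergence_free[OF C2gD(1)[OF w] C2g_psi[OF R0, of x0] disjI2[OF csG(1)]]
 have e: "2*(wt x*(psiG x0 R x $. g x) + wt x*psi x0 R x*Mo g H x) - (Tb x (psiG x0 R x) (g x) + w x*TH (psiH x0 R) x) = ?f x" for x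
 proof -
  have t: "TH (psiH x0 R) x = wt x*(Er x0 R x - 2*kk*Dn x0 R x)" using wt_pos[of x] by (simp add: Er_def)
  show ?thesis unfolding Tb_def t by (simp add: alg)
 qed
 have i1: "integrable lborel (%x. 2*(wt x*(psiG x0 R x $. g x) + wt x*psi x0 R x*Mo g H x))" by (intro integrable_mult_right p1(2))
 have "(LINT x|lborel. 2*(wt x*(psiG x0 R x $. g x) + wt x*psi x0 R x*Mo g H x)) = 2*0"
  unfolding p1(1)[symmetric] by (rule integral_mult_right_zero)
 with Bochner_Integration.integral_diff[OF i1 p2(2)] p2(1) show "(LINT x|lborel. ?f x) = 0" unfolding e by (simp only:)
 from Bochner_Integration.integrable_diff[OF i1 p2(2)] show "integrable lborel ?f" unfolding e .
qed

lemma integrable_ball: "continuous_on UNIV (f :: 'a => real) ==> integrable lborel (%x. indicator (ball x0 R) x*f x)"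
 using integral_bounded_open(3)[of "ball x0 R" f] by simp

definition mB :: "('a => real) => 'a => real => real" where
 "mB w x0 R = (LINT x|lborel. indicator (ball x0 R) x*(wt x*w x))"

lemma integrable_Dn:
 assumes "continuous_on UNIV (w :: 'a => real)" "R > 0"
 shows "integrable lborel (%x. wt x*(w x*Dn x0 R x))"
proof (rule integrable_csupp)
 show "continuous_on UNIV (%x. wt x*(w x*Dn x0 R x))" by (intro cnt wt_cont Dn_cont assms)
 show "csupp (%x. wt x*(w x*Dn x0 R x))"
  by (rule csupp_outside_ball[OF assms(2), of x0]) (use psi_outside[OF assms(2)] in \<open>simp add: Dn_def\<close>)
qed

text \<open>For the constant function 1 the Green identity contains only the kernel and its cutoff
  error.\<close>

lemma Dn_mass:
 assumes R: "R >= 1"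
 shows "2*kk*(LINT x|lborel. wt x*Dn x0 R x) <= 108*nn^2*lam R*mB (%_. 1) x0 R"
proof -
 have R0: "R > 0" using R by simp
 note g = green_identity[OF C2g_const[of 1] R, of x0]
 have g1: "(LINT x|lborel. wt x*(2*kk*Dn x0 R x - Er x0 R x)) = 0" "integrable lborel (%x. wt x*(2*kk*Dn x0 R x - Er x0 R x))"
  using g by (simp_all add: Mo_const)
 have iD: "integrable lborel (%x. wt x*Dn x0 R x)" using integrable_Dn[of "%_. 1" R x0] R0 by simp
 have iB: "integrable lborel (%x. indicator (ball x0 R) x*wt x)" by (rule integrable_ball[OF wt_cont])
 have "(LINT x|lborel. 2*kk*(wt x*Dn x0 R x) - 108*nn^2*lam R*(indicator (ball x0 R) x*wt x))
   <= (LINT x|lborel. wt x*(2*kk*Dn x0 R x - Er x0 R x))"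
 proof (rule integral_mono)
  show "integrable lborel (%x. 2*kk*(wt x*Dn x0 R x) - 108*nn^2*lam R*(indicator (ball x0 R) x*wt x))"
   using iD iB by (intro Bochner_Integration.integrable_diff integrable_mult_right) auto
  fix x
  have "Er x0 R x <= 108*nn^2*lam R*indicator (ball x0 R) x" using Er_bound[OF R, of x0 x] by linarith
  from mlm[OF this, of "wt x"] wt_pos[of x]
  show "2*kk*(wt x*Dn x0 R x) - 108*nn^2*lam R*(indicator (ball x0 R) x*wt x) <= wt x*(2*kk*Dn x0 R x - Er x0 R x)"
   by (simp add: alg)
 qed (rule g1(2))
 then show ?thesis using iD iB g1(1) by (simp add: mB_def)
qed

lemma Xe_mass:
 assumes R: "R >= 1"
 shows "integrable lborel (%x. wt x*Xe x0 R x)"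
  "(LINT x|lborel. wt x*Xe x0 R x) <= 900*nn^3*lam R*mB (%_. 1) x0 R"
proof -
 have R0: "R > 0" using R by simp
 have iD: "integrable lborel (%x. wt x*Dn x0 R x)" using integrable_Dn[of "%_. 1" R x0] R0 by simp
 have iB: "integrable lborel (%x. indicator (ball x0 R) x*wt x)" by (rule integrable_ball[OF wt_cont])
 have e: "wt x*Xe x0 R x = 8*kk^2*(wt x*Dn x0 R x) + 72*nn^2*lam R*(indicator (ball x0 R) x*wt x)" for x
  by (simp add: Xe_def alg)
 show "integrable lborel (%x. wt x*Xe x0 R x)" unfolding e using iD iB by auto
 have m0: "mB (%_. 1) x0 R >= 0" unfolding mB_def using wt_pos by (intro integral_nonneg_AE) (auto simp: less_imp_le)
 have "(LINT x|lborel. wt x*Xe x0 R x) = 8*kk^2*(LINT x|lborel. wt x*Dn x0 R x) + 72*nn^2*lam R*mB (%_. 1) x0 R"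
  unfolding e using iD iB by (simp add: mB_def)
 also have "8*kk^2*(LINT x|lborel. wt x*Dn x0 R x) = 4*kk*(2*kk*(LINT x|lborel. wt x*Dn x0 R x))"
  by (simp add: pow2)
 also have "... <= 4*(nn/2)*(108*nn^2*lam R*mB (%_. 1) x0 R)"
 proof (rule mult_mono)
  show "2*kk*(LINT x|lborel. wt x*Dn x0 R x) <= 108*nn^2*lam R*mB (%_. 1) x0 R" by (rule Dn_mass[OF R])
  show "0 <= 2*kk*(LINT x|lborel. wt x*Dn x0 R x)"
   using kk Dn_nonneg wt_pos by (intro mnn integral_nonneg_AE) (auto simp: less_imp_le)
 qed (use kk nn4 in auto)
 also have "4*(nn/2)*(108*nn^2*lam R*mB (%_. 1) x0 R) + 72*nn^2*lam R*mB (%_. 1) x0 R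
   <= 900*nn^3*lam R*mB (%_. 1) x0 R"
 proof -
  define L where "L = lam R*mB (%_. 1) x0 R"
  have L: "L >= 0" using lam_pos[OF R0] m0 by (simp add: L_def)
  have "nn^2*1 <= nn^2*nn" using nn4 by (intro mlm) auto
  then have "72*nn^2 + 216*nn^3 <= 900*nn^3" using nn4 by (simp add: power3_eq_cube pow2)
  from mrm[OF this L] show ?thesis by (simp add: L_def power3_eq_cube pow2 alg)
 qed
 finally show "(LINT x|lborel. wt x*Xe x0 R x) <= 900*nn^3*lam R*mB (%_. 1) x0 R" by simp
qed

text \<open>Young's inequality for the two coupling terms, the second of which counts twice. The
  factor \<open>psi\<close> in \<open>psiG_bounds\<close> makes the price for \<open>v\<close> a
  multiple of \<open>psi\<close>, which the good term can pay.\<close>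

lemma green_error:
 assumes R: "R >= 1" and c: "c > 0"
 shows "\<bar>Q x*(psiG x0 R x $. v) + 2*(Z x $. psiG x0 R x)*(Z x $. v)\<bar> <= 3 * c*psi x0 R x*(v $. v) + 3*Xe x0 R x/(4 * c)"
proof -
 have "\<bar>(Z x $. psiG x0 R x)*(Z x $. v)\<bar> <= c*psi x0 R x*(Z x $. v)^2 + Xe x0 R x/(4 * c)"
  by (rule young_le[OF psiG_bounds(1)[OF R] psi_nonneg Xe_nonneg[OF R] c])
 also have "... <= c*psi x0 R x*(v $. v) + Xe x0 R x/(4 * c)"
 proof -
  have "(Z x $. v)^2 <= (Z x $. Z x)*(v $. v)" by (rule Cauchy_Schwarz_ineq)
  also have "... <= 1*(v $. v)" using Modica[of x] by (intro mrm) (auto simp: Q_def)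
  finally have "c*psi x0 R x*(Z x $. v)^2 <= c*psi x0 R x*(v $. v)" using c psi_nonneg by (intro mlm) auto
  then show ?thesis by simp
 qed
 finally have 1: "\<bar>(Z x $. psiG x0 R x)*(Z x $. v)\<bar> <= c*psi x0 R x*(v $. v) + Xe x0 R x/(4 * c)" .
 have "(Q x*norm (psiG x0 R x))^2 = Q x*(Q x*(psiG x0 R x $. psiG x0 R x))"
  by (simp add: pmd nrm2 pow2[of "Q x"] mult.assoc)
 also have "... <= 1*(Q x*(psiG x0 R x $. psiG x0 R x))" using Q_le Modica by (intro mrm) auto
 also have "... <= psi x0 R x*Xe x0 R x" using psiG_bounds(2)[OF R] by simp
 finally have "\<bar>(Q x*norm (psiG x0 R x))*norm v\<bar> <= c*psi x0 R x*(norm v)^2 + Xe x0 R x/(4 * c)"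
  by (rule young_le[OF _ psi_nonneg Xe_nonneg[OF R] c])
 moreover have "\<bar>Q x*(psiG x0 R x $. v)\<bar> <= \<bar>(Q x*norm (psiG x0 R x))*norm v\<bar>"
  using mlm[OF CS2[of "psiG x0 R x" v], of "Q x"] Modica[of x] by (simp add: abs_mult mult.assoc)
 ultimately have 2: "\<bar>Q x*(psiG x0 R x $. v)\<bar> <= c*psi x0 R x*(v $. v) + Xe x0 R x/(4 * c)"
  by (simp add: nrm2)
 have "\<bar>Q x*(psiG x0 R x $. v) + 2*(Z x $. psiG x0 R x)*(Z x $. v)\<bar> <= \<bar>Q x*(psiG x0 R x $. v)\<bar> + 2*\<bar>(Z x $. psiG x0 R x)*(Z x $. v)\<bar>"
  by (simp add: abs_mult order_trans[OF abs_triangle_ineq] mult.assoc)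
 also have "... <= (c*psi x0 R x*(v $. v) + Xe x0 R x/(4 * c)) + 2*(c*psi x0 R x*(v $. v) + Xe x0 R x/(4 * c))"
  using add_mono[OF 2 mlm[OF 1, of 2]] by simp
 also have "... = 3 * c*psi x0 R x*(v $. v) + 3*Xe x0 R x/(4 * c)" by simp
 finally show ?thesis .
qed

lemma gw_lower:
 assumes "R >= 2" "x : cball x0 1"
 shows "gw x0 R x >= (1/4)*2 powr (- kk - 2)"
proof -
 have s: "0 <= sq x0 x" "sq x0 x <= 1"
 proof -
  have "norm (x - x0) <= 1" using assms(2) by (simp add: dist_norm norm_minus_commute)
  then show "sq x0 x <= 1" by (simp add: sq_def nrm2[symmetric] power_le_one)
 qed (rule sq_nonneg)
 have R2: "R^2 >= 4" using power_mono[OF assms(1), of 2] by simp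
 have y: "0 <= sq x0 x/R^2" "sq x0 x/R^2 <= 1/4" using s R2 by (auto simp: divide_le_eq)
 have "(sq x0 x/R^2)^DIM('a) <= (1/4)^DIM('a)" using y by (intro power_mono) auto
 also have "... <= (1/4)^1" using n4 by (intro power_decreasing) auto
 finally have q: "gq DIM('a) (R^2) (sq x0 x) >= 3/4" by (simp add: gq_def)
 have "gb DIM('a) (R^2) (sq x0 x) >= (3/4)^3" unfolding gb_def by (intro power_mono q) auto
 moreover have "(1 + sq x0 x) powr (- kk - 2) >= 2 powr (- kk - 2)"
  using s kk by (intro powr_mono2') auto
 ultimately have "(1/4)*2 powr (- kk - 2) <= gb DIM('a) (R^2) (sq x0 x)*(1 + sq x0 x) powr (- kk - 2)"
  by (intro mult_mono) (auto simp: power3_eq_cube)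
 then show ?thesis by (simp add: gw_def)
qed

definition Cmv :: real where "Cmv = 8*2 powr (kk + 2)*(900*nn^3*3)"

text \<open>A mean value inequality without iteration. By \<open>sub\<close> the term
  \<open>psi * Mo g H\<close> dominates \<open>psi\<close> times the squared gradient, which absorbs
  the coupling errors. On the unit ball \<open>Dn\<close> is bounded below by a constant, and all
  that is left lives at the scale \<open>R\<close>.\<close>

theorem mean_value:
 assumes w: "C2g w g H" and pos: "!!x. w x >= 0" and sub: "!!x. Mo g H x >= g x $. g x" and R: "R >= 2"
 shows "(LINT x|lborel. indicator (cball x0 1) x*(wt x*w x)) <= Cmv*lam R*(mB w x0 R + mB (%_. 1) x0 R)"
proof -
 have R1: "R >= 1" and R0: "R > 0" using R by auto
 have cw: "continuous_on UNIV w" using C2gD(7)[OF w] .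
 note g = green_identity[OF w R1, of x0]
 have iD: "integrable lborel (%x. wt x*(w x*Dn x0 R x))" by (rule integrable_Dn[OF cw R0])
 have iX: "integrable lborel (%x. wt x*Xe x0 R x)" by (rule Xe_mass(1)[OF R1])
 have iB: "integrable lborel (%x. indicator (ball x0 R) x*(wt x*w x))" by (intro integrable_ball cnt wt_cont cw)
 let ?h = "%x. 2*kk*(wt x*(w x*Dn x0 R x)) - (9/4)*(wt x*Xe x0 R x) - 108*nn^2*lam R*(indicator (ball x0 R) x*(wt x*w x))"
 have "(LINT x|lborel. ?h x) <= 0"
 proof -
  have "(LINT x|lborel. ?h x) <= (LINT x|lborel. wt x*(2*psi x0 R x*Mo g H x + (Q x*(psiG x0 R x $. g x) + 2*(Z x $. psiG x0 R x)*(Z x $. g x))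
   + w x*(2*kk*Dn x0 R x - Er x0 R x)))"
  proof (rule integral_mono)
   show "integrable lborel ?h" using iD iX iB by (intro Bochner_Integration.integrable_diff integrable_mult_right) auto
   fix x
   have "psi x0 R x*(g x $. g x) <= psi x0 R x*Mo g H x" by (intro mlm sub psi_nonneg)
   \<comment> \<open>The value \<open>1/3\<close> makes the gradient term of
     \<open>green_error\<close> exactly \<open>psi x0 R x * (g x $. g x)\<close>; one half of
     \<open>2 * psi * Mo g H\<close> pays for it.\<close>
   moreover have "- (3*(1/3)*psi x0 R x*(g x $. g x) + 3*Xe x0 R x/(4*(1/3))) <= Q x*(psiG x0 R x $. g x) + 2*(Z x $. psiG x0 R x)*(Z x $. g x)"
    using green_error[OF R1, of "1/3" x x0 "g x"] by linarith
   moreover have "0 <= psi x0 R x*(g x $. g x)" using psi_nonneg by simp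
   moreover have "w x*Er x0 R x <= w x*(108*nn^2*lam R*indicator (ball x0 R) x)"
    using Er_bound[OF R1, of x0 x] pos by (intro mlm) auto
   ultimately have "2*kk*(w x*Dn x0 R x) - (9/4)*Xe x0 R x - w x*(108*nn^2*lam R*indicator (ball x0 R) x)
    <= 2*psi x0 R x*Mo g H x + (Q x*(psiG x0 R x $. g x) + 2*(Z x $. psiG x0 R x)*(Z x $. g x)) + w x*(2*kk*Dn x0 R x - Er x0 R x)"
    by (simp add: alg)
   from mlm[OF this, of "wt x"] wt_pos[of x]
   show "?h x <= wt x*(2*psi x0 R x*Mo g H x + (Q x*(psiG x0 R x $. g x) + 2*(Z x $. psiG x0 R x)*(Z x $. g x))
     + w x*(2*kk*Dn x0 R x - Er x0 R x))"
    by (simp add: alg)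
  qed (rule g(2))
  then show ?thesis using g(1) by simp
 qed
 then have A: "2*kk*(LINT x|lborel. wt x*(w x*Dn x0 R x)) <= (9/4)*(LINT x|lborel. wt x*Xe x0 R x) + 108*nn^2*lam R*mB w x0 R"
  using iD iX iB by (simp add: mB_def)
 have mw: "mB w x0 R >= 0" unfolding mB_def using wt_pos pos by (intro integral_nonneg_AE) (auto simp: less_imp_le)
 have m1: "mB (%_. 1) x0 R >= 0" unfolding mB_def using wt_pos by (intro integral_nonneg_AE) (auto simp: less_imp_le)
 have l: "lam R > 0" by (rule lam_pos[OF R0])
 define c0 where "c0 = (1/4)*2 powr (- kk - 2)"
 have c0: "c0 > 0" by (simp add: c0_def)
 have iC: "integrable lborel (%x. indicator (cball x0 1) x*(wt x*w x))"
  using borel_integrable_compact[of "cball x0 1" "%x. wt x*w x"] wt_cont cw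
  by (auto intro!: cnt intro: continuous_on_subset)
 have "c0*(LINT x|lborel. indicator (cball x0 1) x*(wt x*w x)) = (LINT x|lborel. c0*(indicator (cball x0 1) x*(wt x*w x)))"
  by simp
 also have "... <= (LINT x|lborel. wt x*(w x*Dn x0 R x))"
 proof (rule integral_mono)
  show "integrable lborel (%x. c0*(indicator (cball x0 1) x*(wt x*w x)))" using iC by simp
  fix x
  have gD: "gw x0 R x <= Dn x0 R x"
  proof -
   have "gw x0 R x*1 <= gw x0 R x*(1 + ((x - x0) $. Z x)^2 + sq x0 x*Q x)"
    using sq_nonneg[of x0 x] Modica[of x] by (intro mlm gw_nonneg) auto
   then show ?thesis using Dn_ge[of x0 R x] by linarith
  qed
  have "c0*indicator (cball x0 1) x <= Dn x0 R x"
   using gw_lower[OF R, of x x0] gD Dn_nonneg[of x0 R x] by (auto simp: c0_def indicator_def)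
  from mlm[OF this, of "wt x*w x"] wt_pos[of x] pos[of x]
  show "c0*(indicator (cball x0 1) x*(wt x*w x)) <= wt x*(w x*Dn x0 R x)" by (simp add: alg)
 qed (rule iD)
 also have "... <= 2*kk*(LINT x|lborel. wt x*(w x*Dn x0 R x))"
 proof -
  have "0 <= (LINT x|lborel. wt x*(w x*Dn x0 R x))"
   using wt_pos pos Dn_nonneg by (intro integral_nonneg_AE) (auto simp: less_imp_le)
  from mrm[of 1 "2*kk", OF _ this] show ?thesis using kk by simp
 qed
 also have "... <= (9/4)*(900*nn^3*lam R*mB (%_. 1) x0 R) + 108*nn^2*lam R*mB w x0 R"
  using A Xe_mass(2)[OF R1, of x0] by linarith
 also have "... <= (900*nn^3*3)*(lam R*(mB w x0 R + mB (%_. 1) x0 R))"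
 proof -
  have "nn^2*1 <= nn^2*nn" using nn4 by (intro mlm) auto
  then have n3: "108*nn^2 <= 900*nn^3*3" "0 <= nn^3" using nn4 by (simp_all add: power3_eq_cube pow2)
  have "108*nn^2*(lam R*mB w x0 R) <= 900*nn^3*3*(lam R*mB w x0 R)"
   using l mw n3 by (intro mrm) auto
  moreover have "0 <= nn^3*(lam R*mB (%_. 1) x0 R)" using l m1 n3 by simp
  ultimately show ?thesis by (simp add: alg)
 qed
 finally have "c0*(LINT x|lborel. indicator (cball x0 1) x*(wt x*w x)) <= (900*nn^3*3)*(lam R*(mB w x0 R + mB (%_. 1) x0 R))" .
 then have "(LINT x|lborel. indicator (cball x0 1) x*(wt x*w x)) <= (1 / c0)*((900*nn^3*3)*(lam R*(mB w x0 R + mB (%_. 1) x0 R)))"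
  using c0 by (simp add: field_simps)
 also have "... <= Cmv*lam R*(mB w x0 R + mB (%_. 1) x0 R)"
 proof -
  have "(2::real) powr (- kk - 2) = 2 powr (- (kk + 2))" by (rule arg_cong[where f="%t. 2 powr t"]) simp
  also have "... = 1/2 powr (kk + 2)" by (rule powr_minus_divide)
  finally have "1 / c0 = 4*2 powr (kk + 2)" unfolding c0_def by (simp only:) simp
  then have "(1 / c0)*((900*nn^3*3)*(lam R*(mB w x0 R + mB (%_. 1) x0 R))) = (1/2)*(Cmv*lam R*(mB w x0 R + mB (%_. 1) x0 R))"
   by (simp add: Cmv_def)
  moreover have "0 <= Cmv*lam R*(mB w x0 R + mB (%_. 1) x0 R)" using l mw m1 nn4 by (simp add: Cmv_def)
  ultimately show ?thesis by linarith
 qed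
 finally show ?thesis .
qed

text \<open>Here the roles change: for bounded \<open>w\<close> the term with \<open>Dn\<close> is
  an error controlled by \<open>Dn_mass\<close>, and the second order term is what is
  estimated.\<close>

theorem curvature_mass:
 assumes w: "C2g w g H" and wb: "!!x. \<bar>w x\<bar> <= b" and sub: "!!x. Mo g H x >= (be x)^2/2"
  and gb: "!!x. norm (g x) <= Gm * be x" and G: "Gm > 0" and R: "R >= 1"
 shows "(LINT x|lborel. wt x*(psi x0 R x*(be x)^2)) <= (8100*Gm\<^sup>2 + 432 * b)*nn^3*(lam R*mB (%_. 1) x0 R)"
  and "integrable lborel (%x. wt x*(psi x0 R x*(be x)^2))"
proof -
 have R0: "R > 0" using R by simp
 have b0: "b >= 0" using wb[of 0] by linarith
 note g = green_identity[OF w R, of x0]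
 have iD: "integrable lborel (%x. wt x*Dn x0 R x)" using integrable_Dn[of "%_. 1" R x0] R0 by simp
 have iX: "integrable lborel (%x. wt x*Xe x0 R x)" by (rule Xe_mass(1)[OF R])
 have iB: "integrable lborel (%x. indicator (ball x0 R) x*wt x)" by (intro integrable_ball wt_cont)
 have cpsi: "continuous_on UNIV (psi x0 R)" by (rule C2gD(7)[OF C2g_psi[OF R0]])
 show iP: "integrable lborel (%x. wt x*(psi x0 R x*(be x)^2))"
 proof (rule integrable_csupp)
  show "continuous_on UNIV (%x. wt x*(psi x0 R x*(be x)^2))" by (intro cnt wt_cont cpsi be_cont)
  show "csupp (%x. wt x*(psi x0 R x*(be x)^2))"
   by (rule csupp_outside_ball[OF R0, of x0]) (use psi_outside[OF R0] in simp)
 qed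
 let ?h = "%x. (1/2)*(wt x*(psi x0 R x*(be x)^2)) - (9*Gm\<^sup>2/2)*(wt x*Xe x0 R x) - b*(2*kk)*(wt x*Dn x0 R x)
   - b*(108*nn^2*lam R)*(indicator (ball x0 R) x*wt x)"
 have "(LINT x|lborel. ?h x) <= (LINT x|lborel. wt x*(2*psi x0 R x*Mo g H x + (Q x*(psiG x0 R x $. g x) + 2*(Z x $. psiG x0 R x)*(Z x $. g x))
   + w x*(2*kk*Dn x0 R x - Er x0 R x)))"
 proof (rule integral_mono)
  show "integrable lborel ?h" using iD iX iB iP by (intro Bochner_Integration.integrable_diff integrable_mult_right) auto
  fix x
  have 1: "psi x0 R x*((be x)^2/2) <= psi x0 R x*Mo g H x" by (intro mlm sub psi_nonneg)
  \<comment> \<open>Chosen so that \<open>3 * c\<close> times \<open>Gm\<close> squared is one half: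
    half of the curvature term survives.\<close>
  define c where "c = 1/(6*Gm\<^sup>2)"
  have c: "c > 0" using G by (simp add: c_def)
  have "3 * c*psi x0 R x*(g x $. g x) <= 3 * c*psi x0 R x*(Gm * be x)^2"
   using power_mono[OF gb[of x], of 2] c psi_nonneg[of x0 R x] by (intro mlm) (auto simp: nrm2)
  also have "... = (1/2)*(psi x0 R x*(be x)^2)" using G by (simp add: c_def pmd)
  finally have 2: "- ((1/2)*(psi x0 R x*(be x)^2) + 3*Xe x0 R x/(4 * c)) <= Q x*(psiG x0 R x $. g x) + 2*(Z x $. psiG x0 R x)*(Z x $. g x)"
   using green_error[OF R c, of x x0 "g x"] by linarith
  have 3: "3*Xe x0 R x/(4 * c) = 9*Gm\<^sup>2/2*Xe x0 R x" using G by (simp add: c_def)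
  have 4: "- (b*(2*kk*Dn x0 R x + 108*nn^2*lam R*indicator (ball x0 R) x)) <= w x*(2*kk*Dn x0 R x - Er x0 R x)"
  proof -
   have "\<bar>2*kk*Dn x0 R x - Er x0 R x\<bar> <= 2*kk*Dn x0 R x + 108*nn^2*lam R*indicator (ball x0 R) x"
    using Er_bound[OF R, of x0 x] Dn_nonneg[of x0 R x] kk mnn[of "2*kk" "Dn x0 R x"] by linarith
   then have "\<bar>w x*(2*kk*Dn x0 R x - Er x0 R x)\<bar> <= b*(2*kk*Dn x0 R x + 108*nn^2*lam R*indicator (ball x0 R) x)"
    unfolding abs_mult using wb[of x] b0 by (intro mult_mono) auto
   then show ?thesis by linarith
  qed
  have "(1/2)*(psi x0 R x*(be x)^2) - 9*Gm\<^sup>2/2*Xe x0 R x - b*(2*kk*Dn x0 R x + 108*nn^2*lam R*indicator (ball x0 R) x)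
   <= 2*psi x0 R x*Mo g H x + (Q x*(psiG x0 R x $. g x) + 2*(Z x $. psiG x0 R x)*(Z x $. g x)) + w x*(2*kk*Dn x0 R x - Er x0 R x)"
   using 1 2 3 4 by simp
  from mlm[OF this, of "wt x"] wt_pos[of x]
  show "?h x <= wt x*(2*psi x0 R x*Mo g H x + (Q x*(psiG x0 R x $. g x) + 2*(Z x $. psiG x0 R x)*(Z x $. g x)) + w x*(2*kk*Dn x0 R x - Er x0 R x))"
   by (simp add: alg)
 qed (rule g(2))
 then have "(LINT x|lborel. ?h x) <= 0" using g(1) by simp
 moreover have "(LINT x|lborel. ?h x) = (1/2)*(LINT x|lborel. wt x*(psi x0 R x*(be x)^2)) - (9*Gm\<^sup>2/2)*(LINT x|lborel. wt x*Xe x0 R x)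
   - b*(2*kk)*(LINT x|lborel. wt x*Dn x0 R x) - b*(108*nn^2*lam R)*mB (%_. 1) x0 R"
  unfolding mB_def using iD iX iB iP by simp
 ultimately have A: "(1/2)*(LINT x|lborel. wt x*(psi x0 R x*(be x)^2)) <= (9*Gm\<^sup>2/2)*(LINT x|lborel. wt x*Xe x0 R x)
   + b*(2*kk*(LINT x|lborel. wt x*Dn x0 R x)) + b*(108*nn^2*lam R)*mB (%_. 1) x0 R"
  by (simp add: mult.assoc)
 define L where "L = lam R*mB (%_. 1) x0 R"
 have m1: "mB (%_. 1) x0 R >= 0" unfolding mB_def using wt_pos by (intro integral_nonneg_AE) (auto simp: less_imp_le)
 have L: "L >= 0" using lam_pos[OF R0] m1 by (simp add: L_def)
 have B1: "(9*Gm\<^sup>2/2)*(LINT x|lborel. wt x*Xe x0 R x) <= (9*Gm\<^sup>2/2)*(900*nn^3*L)"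
  using Xe_mass(2)[OF R, of x0] by (intro mlm) (auto simp: L_def mult.assoc)
 have B2: "b*(2*kk*(LINT x|lborel. wt x*Dn x0 R x)) <= b*(108*nn^2*L)"
  using Dn_mass[OF R, of x0] b0 by (intro mlm) (auto simp: L_def mult.assoc)
 have B3: "b*(108*nn^2*L) <= b*(108*nn^3*L)"
 proof -
  have "nn^2*1 <= nn^2*nn" using nn4 by (intro mlm) auto
  then show ?thesis using b0 L by (intro mlm mrm) (auto simp: power3_eq_cube pow2)
 qed
 have "(1/2)*(LINT x|lborel. wt x*(psi x0 R x*(be x)^2)) <= (9*Gm\<^sup>2/2)*(900*nn^3*L) + 2*(b*(108*nn^3*L))"
 proof -
  have "b*(108*nn^2*lam R)*mB (%_. 1) x0 R = b*(108*nn^2*L)" by (simp add: L_def)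
  then show ?thesis using A B1 B2 B3 by linarith
 qed
 then show "(LINT x|lborel. wt x*(psi x0 R x*(be x)^2)) <= (8100*Gm\<^sup>2 + 432 * b)*nn^3*(lam R*mB (%_. 1) x0 R)"
  by (simp add: L_def alg)
qed

end

end

section \<open>Growth away from the interface and clearing-out\<close>

lemma artanh_mono: "\<bar>x\<bar> < 1 ==> \<bar>y\<bar> < 1 ==> x <= y ==> artanh x <= artanh (y::real)"
 by (metis artanh_tanh_real linorder_not_le order_less_le tanh_artanh_real tanh_real_less_iff)

definition cutS :: "real => real" where "cutS t = (max 0 (1 - (max 0 t)\<^sup>2))^2"
definition cutS' :: "real => real" where "cutS' t = 2*max 0 (1 - (max 0 t)\<^sup>2)*(- (2*max 0 t))"

lemma cutS_DERIV: "(cutS has_real_derivative cutS' t) (at t)"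
proof -
 have "((%t. 1 - (max 0 t)\<^sup>2) has_real_derivative - (2*max 0 t)) (at t)"
  using DERIV_diff[OF DERIV_const[of 1] DERIV_pos_part_power[of 0 t]] by (simp add: numeral_2_eq_2)
 from DERIV_chain2[OF DERIV_pos_part_power[of 0] this] show ?thesis
  unfolding cutS_def[abs_def] cutS'_def by (simp add: numeral_2_eq_2)
qed

lemma cutS_bounds: "0 <= cutS t" "cutS t <= 1" "t <= 0 ==> cutS t = 1" "t >= 1 ==> cutS t = 0"
 "\<bar>cutS' t\<bar> <= 4" "t <= 0 ==> cutS' t = 0" "t >= 1 ==> cutS' t = 0" "continuous_on S cutS'"
proof -
 show "0 <= cutS t" by (simp add: cutS_def)
 have m: "0 <= max 0 (1 - (max 0 t)\<^sup>2)" "max 0 (1 - (max 0 t)\<^sup>2) <= 1" by auto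
 show "cutS t <= 1" unfolding cutS_def by (intro power_le_one m)
 show "t <= 0 ==> cutS t = 1" by (simp add: cutS_def)
 have o: "t >= 1 ==> max 0 (1 - (max 0 t)\<^sup>2) = 0" using one_le_power[of t 2] by simp
 show "t >= 1 ==> cutS t = 0" unfolding cutS_def using o by simp
 show "t >= 1 ==> cutS' t = 0" unfolding cutS'_def using o by simp
 show "t <= 0 ==> cutS' t = 0" by (simp add: cutS'_def)
 show "\<bar>cutS' t\<bar> <= 4"
 proof (cases "t >= 1")
  case True then show ?thesis unfolding cutS'_def using o by simp
 next
  case False
  have "\<bar>cutS' t\<bar> = 2*(max 0 (1 - (max 0 t)\<^sup>2)*(2*max 0 t))" unfolding cutS'_def by (simp add: abs_mult)
  also have "... <= 2*(1*2)" using False by (intro mlm mult_mono m) auto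
  finally show ?thesis by simp
 qed
 show "continuous_on S cutS'" unfolding cutS'_def[abs_def] by (intro cnt)
qed

context ac
begin

lemma abs_u: "\<bar>u x\<bar> = tanh (sqrt 2*\<bar>z x\<bar>)"
proof (cases "z x >= 0")
 case True
 then have "tanh (sqrt 2*z x) >= 0" by simp
 then show ?thesis using True u_eq_tanh[of x] by simp
next
 case False
 then have "tanh (sqrt 2*z x) < 0" by (simp add: mult_less_0_iff)
 then show ?thesis using False u_eq_tanh[of x] by simp
qed

lemma zu_nonneg: "z x*u x >= 0"
proof (cases "z x >= 0")
 case True
 then have "tanh (sqrt 2*z x) >= 0" by simp
 then show ?thesis using True u_eq_tanh[of x] by simp
next
 case False
 then have "tanh (sqrt 2*z x) < 0" by (simp add: mult_less_0_iff)
 then show ?thesis using False u_eq_tanh[of x] by (simp add: mult_nonpos_nonpos)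
qed

lemma u_ge_half: "\<bar>z x\<bar> >= 1 ==> z x*u x >= 0 & \<bar>u x\<bar> >= 1/2"
proof -
 assume z1: "\<bar>z x\<bar> >= 1"
 note zu = zu_nonneg[of x]
 have a: "artanh (1/2::real) <= 1"
  using ln_le_minus_one[of "3::real"] by (simp add: artanh_def)
 have "\<bar>u x\<bar> >= 1/2"
 proof (rule ccontr)
  assume "\<not> ?thesis"
  then have "artanh \<bar>u x\<bar> <= artanh (1/2::real)" by (intro artanh_mono) auto
  moreover have "\<bar>artanh (u x)\<bar> = artanh \<bar>u x\<bar>"
  proof -
   have "artanh \<bar>u x\<bar> >= artanh 0" using u_bound[of x] by (intro artanh_mono) auto
   then show ?thesis using u_bound[of x] artanh_minus_real[of "u x"] by (cases "u x >= 0") auto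
  qed
  ultimately have "\<bar>z x\<bar> <= sqrt 2/2*1" using a unfolding z_def abs_mult by (intro mult_mono) auto
  then show False using z1 sqrt2_less_2 by simp
 qed
 with zu show ?thesis by simp
qed

text \<open>Comparison with a paraboloid of height \<open>r/4\<close>. At an interior point where
  the difference has its positive maximum both gradients agree and have length at most 1/2, so
  \<open>Q >= 3/4\<close>; then the equation makes the Laplacian of \<open>sn*z\<close> more
  negative than that of the paraboloid, which is at least -1/2 because
  \<open>r >= n\<close>.\<close>

lemma growth:
 assumes far: "!!y. y : cball x0 r ==> sn*z y >= 1" and sn: "sn = 1 | sn = -1" and r: "r >= real DIM('a)"
 shows "sn*z x0 >= r/4"
proof -
 have r0: "r > 0" using r DIM_positive[where 'a='a] by linarith
 define f where "f x = (- sn)*z x + (r/4)*(1 + (- (1/r^2))*((x - x0) $. (x - x0)))" for x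
 have C: "C2g f (%x. (- sn) $* Z x + (r/4) $* ((- 2*(1/r^2)) $* (x - x0)))
   (%x h. (- sn) $* B x h + (r/4) $* ((- 2*(1/r^2)) $* h))"
  unfolding f_def[abs_def] by (intro C2g_add C2g_cmult C2g_z C2g_bump)
 obtain x1 where x1: "x1 : cball x0 r" "!!y. y : cball x0 r ==> f y <= f x1"
  using continuous_attains_sup[of "cball x0 r" f] C2gD(7)[OF C] r0 by auto
 have "f x1 <= 0"
 proof (rule ccontr)
  assume pos: "\<not> f x1 <= 0"
  have "x1 : ball x0 r"
  proof (rule ccontr)
   assume "x1 ~: ball x0 r"
   then have "norm (x1 - x0) = r" using x1(1) by (simp add: dist_norm norm_minus_commute)
   then have "(x1 - x0) $. (x1 - x0) = r^2" by (simp add: nrm2[symmetric])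
   then have "f x1 = (- sn)*z x1" using r0 by (simp add: f_def)
   then show False using far[OF x1(1)] pos by simp
  qed
  note m = C2g_max[OF C open_ball this x1(2)[OF subsetD[OF ball_subset_cball]]]
  have ns: "norm sn = 1" "sn * sn = 1" using sn by auto
  define v where "v = (r/4) $* ((- 2*(1/r^2)) $* (x1 - x0))"
  have "- (sn $* Z x1) + v = 0" using m(1) unfolding v_def scaleR_minus_left .
  then have "sn $* Z x1 = v" by (metis add.inverse_inverse add.inverse_unique)
  then have "norm sn*norm (Z x1) = norm v" by (metis norm_scaleR real_norm_def)
  then have "norm (Z x1) = norm v" using ns(1) by (metis mult_1)
  also have "norm v = (r/4)*(2/r^2)*norm (x1 - x0)" using r0 by (simp add: v_def)
  finally have "norm (Z x1) = (r/4)*(2/r^2)*norm (x1 - x0)" .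
  also have "... <= (r/4)*(2/r^2)*r"
   using x1(1) r0 by (intro mlm) (auto simp: dist_norm norm_minus_commute)
  also have "... = 1/2" using r0 by (simp add: pow2)
  finally have "Z x1 $. Z x1 <= (1/2)^2" unfolding nrm2[symmetric] by (intro power_mono) auto
  then have Q: "Q x1 >= 3/4" by (simp add: Q_def pow2)
  have zx: "sn*z x1 >= 1" by (rule far[OF x1(1)])
  then have "\<bar>z x1\<bar> >= 1" using ns by (metis abs_ge_self abs_mult mult_1 order_trans real_norm_def)
  from u_ge_half[OF this] have "sn*u x1 >= 1/2"
   using zx sn by (auto simp: zero_le_mult_iff abs_if split: if_splits)
  then have "2 * sqrt 2*(sn*u x1)*Q x1 >= 2*1*(1/2)*(3/4)"
   using Q by (intro mult_mono) auto
  moreover have "tr (%h. (- sn) $* B x1 h + (r/4) $* ((- 2*(1/r^2)) $* h)) <= 0" using m(3) .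
  then have "- sn*(- 2 * sqrt 2*u x1*Q x1) + r/4*(- 2*(1/r^2)*real DIM('a)) <= 0"
   by (simp only: tr_simps trB)
  moreover have e1: "r/4*(- 2*(1/r^2)*real DIM('a)) = - (real DIM('a)/r)/2"
   using r0 by (simp add: pow2)
  moreover have "real DIM('a)/r <= 1" using r r0 by simp
  moreover have e2: "- sn*(- 2 * sqrt 2*u x1*Q x1) = 2 * sqrt 2*(sn*u x1)*Q x1" by simp
  moreover define X where "X = 2 * sqrt 2*(sn*u x1)*Q x1"
  ultimately show False unfolding e1 e2 X_def[symmetric] by simp
 qed
 then have "f x0 <= 0" using x1(2)[of x0] r0 by simp
 then show ?thesis by (simp add: f_def)
qed

lemma wt_decay: "wt x <= 16*exp (- 4*\<bar>z x\<bar>)"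
proof -
 define y where "y = sqrt 2*\<bar>z x\<bar>"
 have y0: "y >= 0" by (simp add: y_def)
 have "(u x)^2 = (tanh y)^2"
  using abs_u[of x] by (metis power2_abs y_def)
 then have "sg x = 1 - (tanh y)\<^sup>2" by (simp add: sg_def)
 also have "... = (1 - tanh y)*(1 + tanh y)" by (simp add: pow2 alg)
 also have "... <= (2*exp (- 2*y))*2"
 proof (rule mult_mono)
  define E where "E = exp (- 2*y)"
  have "1 + E > 0" by (simp add: E_def add_pos_pos)
  then have "1 - (1 - E)/(1 + E) = 2*E/(1 + E)" by (simp add: field_simps)
  then have "1 - tanh y = 2*exp (- 2*y)/(1 + exp (- 2*y))"
   unfolding E_def tanh_real_altdef .
  also have "... <= 2*exp (- 2*y)/1" by (intro divide_left_mono) (auto simp: add_pos_pos)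
  finally show "1 - tanh y <= 2*exp (- 2*y)" by simp
  show "1 + tanh y <= 2" using tanh_real_lt_1[of y] by simp
  show "0 <= 1 + tanh y" using tanh_real_gt_neg1[of y] by simp
 qed simp
 finally have "(sg x)^2 <= (4*exp (- 2*y))^2" using sg_pos[of x] by (intro power_mono) auto
 also have "... = 16*exp (- 4*y)" by (simp add: pmd exp_double[symmetric] pow2 exp_add[symmetric])
 also have "... <= 16*exp (- 4*\<bar>z x\<bar>)"
 proof -
  have "1*\<bar>z x\<bar> <= sqrt 2*\<bar>z x\<bar>" by (intro mrm) auto
  then show ?thesis by (simp add: y_def)
 qed
 finally show ?thesis by (simp add: wt_def)
qed

text \<open>The value of \<open>wt\<close> at \<open>|z| = 2\<close>. Since \<open>z\<close> is
  1-Lipschitz, it bounds \<open>wt\<close> from below on the unit ball around any point with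
  \<open>|z| <= 1\<close>.\<close>

definition mu2 :: real where "mu2 = (1 - (tanh (2 * sqrt 2))\<^sup>2)^2"

lemma mu2_pos: "mu2 > 0"
proof -
 have "(tanh (2 * sqrt 2 :: real))^2 < 1"
  using tanh_real_lt_1[of "2 * sqrt 2"] tanh_real_gt_neg1[of "2 * sqrt 2"] by (simp add: abs_square_less_1 abs_less_iff)
 then show ?thesis by (simp add: mu2_def)
qed

lemma wt_lower: "\<bar>z x\<bar> <= 2 ==> wt x >= mu2"
proof -
 assume z2: "\<bar>z x\<bar> <= 2"
 note abs_u[of x]
 also have "tanh (sqrt 2*\<bar>z x\<bar>) <= tanh (2 * sqrt 2)" using z2 by simp
 finally have "(u x)^2 <= (tanh (2 * sqrt 2))^2" by (metis abs_ge_zero power2_abs power_mono)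
 moreover have "(tanh (2 * sqrt 2 :: real))^2 <= 1"
  using tanh_real_lt_1[of "2 * sqrt 2"] tanh_real_gt_neg1[of "2 * sqrt 2"] by (intro abs_square_le_1[THEN iffD2]) (auto simp: abs_le_iff)
 ultimately show ?thesis unfolding mu2_def wt_def sg_def by (intro power_mono) auto
qed

text \<open>Cut and paste: inside the ball \<open>u\<close> is replaced by almost the constant
  \<open>sn\<close>, at a cost of order \<open>d^2\<close>, and the transition in the shell is paid
  by the distance of \<open>u\<close> from \<open>sn\<close>. The parameter \<open>d\<close> keeps
  the competitor strictly between -1 and 1, as \<open>calibration\<close> requires, and finally
  tends to 0.\<close>

lemma ball_energy_le_shell:
 assumes r: "reaches" and sn: "sn = 1 | sn = -1" and rh: "rh >= 0"
 shows "(LINT x|lborel. indicator (ball p rh) x*wt x) <= 152*(LINT x|lborel. indicator (ball p (rh + 1) - ball p rh) x*\<bar>sn - u x\<bar>)"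
proof -
 define L where "L = (rh + 1)^2 - rh\<^sup>2"
 have L: "L = 2*rh + 1" "L > 0" using rh by (auto simp: L_def pow2 alg)
 define T where "T x = (sq p x - rh\<^sup>2)/L" for x
 define cc where "cc x = cutS (T x)" for x
 define gc where "gc x = cutS' (T x) $* ((1/L) $* (2 $* (x - p)))" for x
 have Csq: "C1g (sq p) (%x. 2 $* (x - p))"
  unfolding sq_def[abs_def] C1g_def
  by (auto intro!: dvi cnt simp: inner_commute alg inner_diff_left inner_diff_right)
 have "C1g (%x. (1/L) * sq p x + (- rh\<^sup>2/L)) (%x. (1/L) $* (2 $* (x - p)) + 0)"
  by (intro C1g_add C1g_cmult Csq C1g_const)
 then have CT: "C1g T (%x. (1/L) $* (2 $* (x - p)))"
  by (simp add: T_def[abs_def] diff_divide_distrib)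
 have Cc: "C1g cc gc"
  unfolding cc_def[abs_def] gc_def[abs_def] by (rule C1g_compose[OF CT cutS_DERIV cutS_bounds(8)])
 have c01: "0 <= cc x" "cc x <= 1" for x using cutS_bounds(1,2) by (auto simp: cc_def)
 have inT: "T x <= 0" if "x : ball p rh" for x
 proof -
  have "rh > 0" using that by (metis mem_ball less_le_trans zero_le_dist order_le_less_trans)
  then have "sq p x < rh\<^sup>2" using that sq_ball by blast
  then show ?thesis using L by (simp add: T_def divide_le_0_iff)
 qed
 have outT: "T x >= 1" if "x ~: ball p (rh + 1)" for x
  using that sq_ball[of "rh + 1" x p] rh L by (simp add: T_def L_def)
 have gcn: "norm (gc x) <= 8" for x
 proof (cases "x : ball p (rh + 1)")
  case False
  then show ?thesis using outT cutS_bounds(7) by (simp add: gc_def)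
 next
  case True
  have "norm (gc x) = \<bar>cutS' (T x)\<bar>*(2/L*norm (x - p))" using L by (simp add: gc_def abs_mult)
  also have "... <= 4*(2/L*(rh + 1))"
   using True L cutS_bounds(5)[of "T x"] by (intro mult_mono) (auto simp: dist_norm norm_minus_commute)
  also have "... <= 4*2" using L rh by (intro mlm) (auto simp: divide_le_eq)
  finally show ?thesis by simp
 qed
 define q where "q x = \<bar>sn - u x\<bar>" for x
 have q: "0 <= q x" "q x <= 2" for x using u_bound[of x] sn by (auto simp: q_def)
 have cq: "continuous_on UNIV q" unfolding q_def[abs_def] by (intro cnt u_cont)
 have sgq: "sg x <= 2*q x" for x
 proof -
  have "sg x = (1 - u x)*(1 + u x)" by (simp add: sg_def pow2 alg)
  also have "... <= 2*q x"
  proof (cases "sn = 1")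
   case True
   have "(1 - u x)*(1 + u x) <= (1 - u x)*2" using u_bound[of x] by (intro mlm) auto
   then show ?thesis using True u_bound[of x] by (simp add: q_def)
  next
   case False
   have "(1 - u x)*(1 + u x) <= 2*(1 + u x)" using u_bound[of x] by (intro mrm) auto
   moreover have "1 + u x > 0" using u_bound[of x] by (simp add: abs_less_iff)
   then have "\<bar>- 1 - u x\<bar> = 1 + u x" by simp
   ultimately show ?thesis using False sn by (simp add: q_def)
  qed
  finally show ?thesis .
 qed
 have UU: "U x $. U x <= 8*(q x)^2" for x
 proof -
  have "U x $. U x = (sqrt 2 * sg x)^2*(Z x $. Z x)" by (simp add: U_eq pow2)
  also have "... <= (sqrt 2 * sg x)^2*1" using Modica[of x] by (intro mlm) (auto simp: Q_def)
  also have "... = 2*(sg x)^2" by (simp add: pmd)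
  also have "... <= 2*(2*q x)^2" using sgq[of x] sg_pos[of x] by (intro mlm power_mono) auto
  finally show ?thesis by (simp add: pmd)
 qed
 have WW: "W v <= 4*(sn - v)^2" if "\<bar>v\<bar> <= 1" for v
 proof -
  have "W v = (1 - v)^2*(1 + v)^2" by (simp add: W_def pow2 alg)
  moreover have "(1 - v)^2 <= 2^2" using that by (intro power_mono) (auto simp: abs_le_iff)
  moreover have "(1 + v)^2 <= 2^2" using that by (intro power_mono) (auto simp: abs_le_iff)
  moreover have "(-1 - v)^2 = (1 + v)^2" by (simp add: pow2 alg)
  moreover have "(1 - v)^2*(1 + v)^2 <= 2^2*(1 + v)^2" if "(1 - v)^2 <= 2^2" using that by (rule mrm) simp
  moreover have "(1 - v)^2*(1 + v)^2 <= (1 - v)^2*2^2" if "(1 + v)^2 <= 2^2" using that by (rule mlm) simp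
  ultimately show ?thesis using sn by auto
 qed
 define V where "V = measure lborel (ball p rh)"
 have key: "(LINT x|lborel. indicator (ball p rh) x*wt x) <= 152*(LINT x|lborel. indicator (ball p (rh + 1) - ball p rh) x*q x) + 32*d^2*V"
  if d: "0 < d" "d < 1" for d
 proof -
  define v where "v x = u x + (1 - d)*(cc x*(sn + (-1)*u x))" for x
  define g where "g x = U x + (1 - d) $* (cc x $* (0 + (-1) $* U x) + (sn + (-1)*u x) $* gc x)" for x
  have Cv: "C1g v g" unfolding v_def[abs_def] g_def[abs_def]
   by (intro C1g_add C1g_cmult C1g_mult C1g_const Cc C2gD(1)[OF u])
  define m where "m x = 1 - (1 - d) * cc x" for x
  have m: "d <= m x" "m x <= 1" for x
  proof -
   have "(1 - d) * cc x <= (1 - d)*1" using d c01 by (intro mlm) auto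
   then show "d <= m x" by (simp add: m_def)
   show "m x <= 1" using d c01[of x] by (simp add: m_def)
  qed
  have sv: "sn - v x = m x*(sn - u x)" for x by (simp add: v_def m_def alg)
  have gv: "g x = m x $* U x + ((1 - d)*(sn - u x)) $* gc x" for x
   by (simp add: g_def m_def alg)
  have vb: "\<bar>v x\<bar> < 1" for x
  proof (cases "sn = 1")
   case True
   have "1 - u x > 0" using u_bound[of x] by (simp add: abs_less_iff)
   then have "0 < m x*(1 - u x)" "m x*(1 - u x) <= 1*(1 - u x)"
    using m[of x] d mrm[of "m x" 1 "1 - u x"] by auto
   then show ?thesis using sv[of x] True u_bound[of x] by (auto simp: abs_less_iff)
  next
   case False
   then have s: "sn = -1" using sn by simp
   have "1 + u x > 0" using u_bound[of x] by (simp add: abs_less_iff)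
   then have "0 < m x*(1 + u x)" "m x*(1 + u x) <= 1*(1 + u x)"
    using m[of x] d mrm[of "m x" 1 "1 + u x"] by auto
   moreover have "v x = -1 + m x*(1 + u x)" using sv[of x] s by (simp add: alg)
   ultimately show ?thesis using u_bound[of x] by (auto simp: abs_less_iff)
  qed
  have cs: "csupp (%x. v x - u x)"
   by (rule csupp_outside_ball[of "rh + 1" p]) (use outT cutS_bounds(4) rh in \<open>auto simp: v_def cc_def\<close>)
  note cal = calibration[OF r Cv vb cs]
  have svq: "(sn - v x)^2 <= (q x)^2" for x
  proof -
   have "\<bar>sn - v x\<bar> <= q x" unfolding sv q_def abs_mult using m[of x] d by (intro mult_left_le_one_le) auto
   then show ?thesis by (metis abs_ge_zero power2_abs power_mono)
  qed
  have e_shell: "g x $. g x/2 + W (v x) <= 152*q x" for x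
  proof -
   have n1: "norm (m x $* U x) <= norm (U x)" using m[of x] d by (simp add: mult_left_le_one_le)
   have n2: "norm (((1 - d)*(sn - u x)) $* gc x) <= q x*8"
   proof -
    have "norm (((1 - d)*(sn - u x)) $* gc x) = ((1 - d)*q x)*norm (gc x)" using d by (simp add: q_def abs_mult)
    also have "... <= q x*8" using d q[of x] gcn[of x] by (intro mult_mono) (auto simp: mult_left_le_one_le)
    finally show ?thesis .
   qed
   have "(norm (g x))^2 <= (norm (U x) + q x*8)^2"
    unfolding gv using n1 n2 by (intro power_mono order_trans[OF norm_triangle_ineq]) auto
   also have "... <= 2*(norm (U x))^2 + 2*(q x*8)^2"
    using sum_squares_ge_zero[of "norm (U x) - q x*8" 0] by (simp add: pow2 alg)
   also have "... <= 2*(8*(q x)^2) + 2*(q x*8)^2" using UU[of x] by (simp add: nrm2)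
   finally have "g x $. g x <= 144*(q x)^2" by (simp add: nrm2 pmd)
   moreover have "W (v x) <= 4*(q x)^2" using WW[of "v x"] vb[of x] svq[of x] by simp
   ultimately have "g x $. g x/2 + W (v x) <= 76*(q x)^2" by simp
   \<comment> \<open>The quadratic cost is weakened to a linear one through \<open>q <= 2\<close>,
     because \<open>clearing_out\<close> is phrased with the first power of the distance.\<close>
   also have "... <= 76*(2*q x)" using q[of x] by (intro mlm) (auto simp: pow2 mrm)
   finally show ?thesis by simp
  qed
  have e_in: "g x $. g x/2 + W (v x) <= 32*d^2" if "x : ball p rh" for x
  proof -
   have c1: "cc x = 1" "gc x = 0" using inT[OF that] cutS_bounds(3,6) by (auto simp: cc_def gc_def)
   then have md: "m x = d" by (simp add: m_def)
   have q4: "(q x)^2 <= 4" using power_mono[OF q(2)[of x] q(1), of 2] by simp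
   have "g x $. g x = d^2*(U x $. U x)" unfolding gv md c1 by (simp add: pow2)
   also have "... <= d^2*(8*4)" using UU[of x] q4 by (intro mlm) auto
   finally have "g x $. g x <= 32*d^2" by simp
   moreover have "W (v x) <= 16*d^2"
   proof -
    have "(sn - v x)^2 = d^2*(q x)^2" unfolding sv md q_def by (simp add: pmd)
    also have "... <= d^2*4" using q4 by (intro mlm) auto
    finally show ?thesis using WW[of "v x"] vb[of x] by simp
   qed
   ultimately show ?thesis by simp
  qed
  have i1: "integrable lborel (%x. indicator (ball p rh) x*wt x)" using integral_bounded_open(3)[of "ball p rh" wt] wt_cont by simp
  have i2: "integrable lborel (%x. indicator (ball p (rh + 1) - ball p rh) x*q x)"
  proof -
   have "set_integrable lborel (ball p (rh + 1)) q" unfolding set_integrable_def using integral_bounded_open(3)[of "ball p (rh + 1)" q] cq by simp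
   then have "set_integrable lborel (ball p (rh + 1) - ball p rh) q" by (rule set_integrable_subset) auto
   then show ?thesis by (simp add: set_integrable_def)
  qed
  have i3: "integrable lborel (%x. indicator (ball p rh) x*(32*d^2))" using integral_bounded_open(3)[of "ball p rh" "%_. 32*d^2"] by simp
  have "0 <= (LINT x|lborel. (g x $. g x/2 + W (v x)) - en x)" by (rule cal(1))
  also have "... <= (LINT x|lborel. 152*(indicator (ball p (rh + 1) - ball p rh) x*q x) + indicator (ball p rh) x*(32*d^2) - indicator (ball p rh) x*wt x)"
  proof (rule integral_mono[OF cal(2)])
   show "integrable lborel (%x. 152*(indicator (ball p (rh + 1) - ball p rh) x*q x) + indicator (ball p rh) x*(32*d^2) - indicator (ball p rh) x*wt x)"
    using i1 i2 i3 by (intro Bochner_Integration.integrable_diff Bochner_Integration.integrable_add integrable_mult_right) auto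
   fix x
   have me: "wt x <= en x" unfolding energy_density using Q_le[of x] wt_pos[of x] by simp
   consider "x : ball p rh" | "x ~: ball p rh" "x : ball p (rh + 1)" | "x ~: ball p (rh + 1)" "x ~: ball p rh" using rh by auto
   then show "(g x $. g x/2 + W (v x)) - en x <= 152*(indicator (ball p (rh + 1) - ball p rh) x*q x) + indicator (ball p rh) x*(32*d^2) - indicator (ball p rh) x*wt x"
   proof cases
    case 1
    then show ?thesis using e_in[OF 1] me by (simp add: indicator_def)
   next
    case 2
    have "en x >= 0" using me wt_pos[of x] by linarith
    then show ?thesis using 2 e_shell[of x] by (simp add: indicator_def)
   next
    case 3
    then have "cc x = 0" "gc x = 0" using outT[OF 3(1)] cutS_bounds(4,7) by (auto simp: cc_def gc_def)
    then have "v x = u x" "g x = U x" by (auto simp: v_def g_def)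
    then show ?thesis using 3 by (simp add: en_def indicator_def)
   qed
  qed
  also have "... = 152*(LINT x|lborel. indicator (ball p (rh + 1) - ball p rh) x*q x) + V*(32*d^2) - (LINT x|lborel. indicator (ball p rh) x*wt x)"
  proof -
   have "(LINT x|lborel. indicator (ball p rh) x*(32*d^2)) = V*(32*d^2)"
    unfolding V_def using emeasure_bounded_finite[of "ball p rh"] by simp
   then show ?thesis using i1 i2 i3 by simp
  qed
  finally show ?thesis by (simp add: alg)
 qed
 have "((%d::real. 152*(LINT x|lborel. indicator (ball p (rh + 1) - ball p rh) x*q x) + 32*d^2*V) \<longlongrightarrow>
   152*(LINT x|lborel. indicator (ball p (rh + 1) - ball p rh) x*q x) + 32*0^2*V) (at_right 0)"
  by (intro tendsto_intros)
 moreover have "\<forall>\<^sub>F d in at_right 0. (LINT x|lborel. indicator (ball p rh) x*wt x) <= 152*(LINT x|lborel. indicator (ball p (rh + 1) - ball p rh) x*q x) + 32*d^2*V"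
  unfolding eventually_at_right_field by (intro exI[of _ 1]) (use key in auto)
 ultimately have "(LINT x|lborel. indicator (ball p rh) x*wt x) <= 152*(LINT x|lborel. indicator (ball p (rh + 1) - ball p rh) x*q x) + 32*0^2*V"
  by (intro tendsto_lowerbound[of _ _ "at_right (0::real)"]) auto
 then show ?thesis by (simp add: q_def)
qed

lemma lam_eq: "R > 0 ==> DIM('a) >= 1 ==> lam R*R^(DIM('a) - 1) = 1"
proof -
 assume R: "R > 0" and n: "DIM('a) >= 1"
 have "lam R = (R powr 2) powr (- kk - 1)" using R by (simp add: lam_def)
 also have "... = R powr (2*(- kk - 1))" by (rule powr_powr)
 also have "2*(- kk - 1) = - real (DIM('a) - 1)" using n by (simp add: kk_def nn_def of_nat_diff field_simps)
 finally have "lam R = 1/R^(DIM('a) - 1)" unfolding powr_minus_divide powr_realpow[OF R] .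
 then show ?thesis using R by simp
qed

text \<open>\<open>mean_value\<close> for the constant 1 gives a lower bound of order
  \<open>N^(n-1)\<close> for the energy in the ball of radius \<open>N\<close>. By
  \<open>ball_energy_le_shell\<close> each of the \<open>N\<close> unit shells between
  \<open>N\<close> and \<open>2*N\<close> then contributes that much distance to \<open>sn\<close>,
  and the sum over the shells telescopes.\<close>

lemma clearing_out:
 assumes n4: "DIM('a) >= 4" and r: "reaches" and sn: "sn = 1 | sn = -1" and zp: "\<bar>z p\<bar> <= 1" and N: "N >= (2::nat)"
 shows "mu2*unit_ball_vol (real DIM('a))*real N^DIM('a) <= 304*Cmv*(LINT x|lborel. indicator (ball p (2*real N)) x*\<bar>sn - u x\<bar>)"
proof -
 define q where "q x = \<bar>sn - u x\<bar>" for x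
 have q0: "q x >= 0" for x by (simp add: q_def)
 have cq: "continuous_on UNIV q" unfolding q_def[abs_def] by (intro cnt u_cont)
 have iq: "integrable lborel (%x. indicator (ball p s) x*q x)" for s
  using integral_bounded_open(3)[of "ball p s" q] cq by simp
 have im: "integrable lborel (%x. indicator (ball p s) x*wt x)" for s
  using integral_bounded_open(3)[of "ball p s" wt] wt_cont by simp
 define V1 where "V1 = unit_ball_vol (real DIM('a))"
 define m where "m s = (LINT x|lborel. indicator (ball p s) x*wt x)" for s
 have mBm: "mB (%_. 1) p s = m s" for s by (simp add: mB_def[OF n4] m_def)
 have R2: "real N >= 2" using N by simp
 have low: "mu2*V1 <= Cmv*lam (real N)*(m (real N) + m (real N))"
 proof -
  have "mu2*V1 = mu2*measure lborel (cball p 1)" using content_cball[of 1 p] by (simp add: V1_def)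
  also have "... = (LINT x|lborel. indicator (cball p 1) x*mu2)"
   using emeasure_bounded_finite[of "cball p 1"] by simp
  also have "... <= (LINT x|lborel. indicator (cball p 1) x*(wt x*1))"
  proof (rule integral_mono)
   show "integrable lborel (%x. indicator (cball p 1) x*mu2)"
    using borel_integrable_compact[of "cball p 1" "%_. mu2"] by simp
   show "integrable lborel (%x. indicator (cball p 1) x*(wt x*1))"
    using borel_integrable_compact[of "cball p 1" wt] wt_cont by simp
   fix x
   have "mu2 <= wt x" if "x : cball p 1"
   proof (rule wt_lower)
    have "norm (x - p) <= 1" using that by (simp add: dist_norm norm_minus_commute)
    then show "\<bar>z x\<bar> <= 2" using z_lipschitz[of x p] zp by linarith
   qed
   then show "indicator (cball p 1) x*mu2 <= indicator (cball p 1) x*(wt x*1)" by (auto simp: indicator_def)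
  qed
  also have "... <= Cmv*lam (real N)*(mB (%_. 1) p (real N) + mB (%_. 1) p (real N))"
   by (rule mean_value[OF n4 C2g_const[of 1] _ _ R2]) (auto simp: Mo_const)
  finally show ?thesis by (simp add: mBm)
 qed
 have sh: "m (real N) <= 152*(LINT x|lborel. indicator (ball p (real (N + Suc k))) x*q x - indicator (ball p (real (N + k))) x*q x)" for k
 proof -
  have "m (real N) <= m (real (N + k))" unfolding m_def
  proof (rule integral_mono[OF im im])
   fix x
   have "indicator (ball p (real N)) x <= (indicator (ball p (real (N + k))) x :: real)" by (auto simp: indicator_def)
   then show "indicator (ball p (real N)) x*wt x <= indicator (ball p (real (N + k))) x*wt x"
    using wt_pos[of x] by (intro mrm) auto
  qed
  also have "m (real (N + k)) <= 152*(LINT x|lborel. indicator (ball p (real (N + k) + 1) - ball p (real (N + k))) x*\<bar>sn - u x\<bar>)"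
   unfolding m_def by (rule ball_energy_le_shell[OF r sn]) simp
  also have "(%x. indicator (ball p (real (N + k) + 1) - ball p (real (N + k))) x*\<bar>sn - u x\<bar>) =
    (%x. indicator (ball p (real (N + Suc k))) x*q x - indicator (ball p (real (N + k))) x*q x)"
   by (auto simp: fun_eq_iff indicator_def q_def)
  finally show ?thesis .
 qed
 have "real N*m (real N) = (\<Sum>k<N. m (real N))" by simp
 also have "... <= (\<Sum>k<N. 152*(LINT x|lborel. indicator (ball p (real (N + Suc k))) x*q x - indicator (ball p (real (N + k))) x*q x))"
  by (intro sum_mono sh)
 also have "... = 152*(\<Sum>k<N. (LINT x|lborel. indicator (ball p (real (N + Suc k))) x*q x) - (LINT x|lborel. indicator (ball p (real (N + k))) x*q x))"
  using iq by (simp add: sum_distrib_left)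
 also have "... = 152*((LINT x|lborel. indicator (ball p (real (N + N))) x*q x) - (LINT x|lborel. indicator (ball p (real (N + 0))) x*q x))"
  by (subst sum_lessThan_telescope[of "%k. LINT x|lborel. indicator (ball p (real (N + k))) x*q x"]) simp
 also have "... <= 152*(LINT x|lborel. indicator (ball p (2*real N)) x*q x)"
 proof -
  have "0 <= (LINT x|lborel. indicator (ball p (real (N + 0))) x*q x)" using q0 by (intro integral_nonneg_AE) auto
  moreover have e: "real (N + N) = 2*real N" by simp
  ultimately show ?thesis unfolding e by (intro mlm) simp_all
 qed
 finally have up: "real N*m (real N) <= 152*(LINT x|lborel. indicator (ball p (2*real N)) x*q x)" .
 have Cm: "Cmv >= 0" using nn4[OF n4] by (simp add: Cmv_def[OF n4])
 have NN: "real N^DIM('a) = real N*real N^(DIM('a) - 1)" using n4 by (simp add: power_eq_if)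
 have "mu2*V1*real N^DIM('a) = (mu2*V1)*(real N*real N^(DIM('a) - 1))" by (simp add: NN)
 also have "... <= (Cmv*lam (real N)*(m (real N) + m (real N)))*(real N*real N^(DIM('a) - 1))"
  by (intro mrm low) auto
 also have "... = 2*Cmv*(lam (real N)*real N^(DIM('a) - 1))*(real N*m (real N))" by (simp add: alg)
 also have "lam (real N)*real N^(DIM('a) - 1) = 1" using n4 R2 by (intro lam_eq) auto
 also have "2*Cmv*1*(real N*m (real N)) <= 2*Cmv*1*(152*(LINT x|lborel. indicator (ball p (2*real N)) x*q x))"
  using up Cm by (intro mlm) auto
 finally show ?thesis by (simp add: V1_def q_def)
qed

end

section \<open>Level sets are uniformly Lipschitz\<close>

context ac
begin

lemma C2g_ze: "C2g ze (%x. B x e) (K e)"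
 unfolding ze_def[abs_def] by (rule C2g_Zv)

lemma Mo_ze: "Mo (%x. B x e) (K e) x = - 4 * sg x*Q x*ze x"
 unfolding ze_def by (rule Mo_Zv)

text \<open>A regularised \<open>- ln (ze x)\<close>: the parameter \<open>dl\<close> makes it
  bounded, and the constant \<open>ln (1 + dl)\<close> makes it nonnegative because
  \<open>ze <= 1\<close>.\<close>

definition wd :: "real => 'a => real" where "wd dl x = ln (1 + dl) - ln (ze x + dl)"
definition gd :: "real => 'a => 'a" where "gd dl x = (- (1/(ze x + dl))) $* B x e"
definition Hd :: "real => 'a => 'a => 'a" where
 "Hd dl x h = (- (1/(ze x + dl))) $* K e x h + ((1/(ze x + dl)^2)*(B x e $. h)) $* B x e"

lemma wd_facts:
 assumes d: "dl >= 0"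
 shows "C2g (wd dl) (gd dl) (Hd dl)" "Mo (gd dl) (Hd dl) x = 4 * sg x*Q x*(ze x/(ze x + dl)) + gd dl x $. gd dl x"
  "Mo (gd dl) (Hd dl) x >= gd dl x $. gd dl x" "wd dl x >= 0" "wd dl x*ze x <= 1 + dl" "dl > 0 ==> wd dl x <= ln ((1 + dl)/dl)"
proof -
 have p: "ze x + dl > 0" for x using ze_pos[of x] d by simp
 show "C2g (wd dl) (gd dl) (Hd dl)"
  unfolding wd_def[abs_def] gd_def[abs_def] Hd_def[abs_def]
 proof (rule C2g_compose[OF C2g_ze, of "%s. ln (1 + dl) - ln (s + dl)" "%s. - (1/(s + dl))" "%s. 1/(s + dl)^2"])
  fix x
  show "((%s. ln (1 + dl) - ln (s + dl)) has_real_derivative - (1/(ze x + dl))) (at (ze x))"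
   using p[of x] by (auto intro!: dvi)
  show "((%s. - (1/(s + dl))) has_real_derivative 1/(ze x + dl)^2) (at (ze x))"
   using p[of x] by (auto intro!: dvi simp: pow2)
 next
  have "s + dl ~= 0" if "s : range ze" for s
  proof -
   obtain x where "s = ze x" using \<open>s : range ze\<close> by blast
   then show ?thesis using p[of x] by simp
  qed
  then show "continuous_on (range ze) (%s. 1/(s + dl)^2)" by (intro cnt) auto
 qed
 have "Mo (gd dl) (Hd dl) x = - (1/(ze x + dl))*Mo (%x. B x e) (K e) x + (1/(ze x + dl)^2)*(B x e $. B x e)"
  unfolding gd_def[abs_def] Hd_def[abs_def] by (rule Mo_compose)
 then show M: "Mo (gd dl) (Hd dl) x = 4 * sg x*Q x*(ze x/(ze x + dl)) + gd dl x $. gd dl x"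
  unfolding Mo_ze gd_def by (simp add: pow2)
 have "0 <= 4 * sg x*Q x*(ze x/(ze x + dl))"
  using sg_pos[of x] Modica[of x] ze_pos[of x] p[of x] by (intro mnn divide_nonneg_nonneg) auto
 then show "Mo (gd dl) (Hd dl) x >= gd dl x $. gd dl x" unfolding M by simp
 show "wd dl x >= 0" unfolding wd_def using ze_le[of x] p[of x] by simp
 have "wd dl x = ln ((1 + dl)/(ze x + dl))" unfolding wd_def using p[of x] d by (simp add: ln_div)
 also have "... <= (1 + dl)/(ze x + dl) - 1" using p[of x] d by (intro ln_le_minus_one) simp
 finally have "wd dl x <= (1 + dl)/(ze x + dl)" by simp
 then have "wd dl x*(ze x + dl) <= 1 + dl" using p[of x] by (simp add: pos_le_divide_eq)
 moreover have "wd dl x*ze x <= wd dl x*(ze x + dl)" using \<open>wd dl x >= 0\<close> d by (intro mlm) auto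
 ultimately show "wd dl x*ze x <= 1 + dl" by linarith
 show "dl > 0 ==> wd dl x <= ln ((1 + dl)/dl)" unfolding wd_def using ze_pos[of x] by (simp add: ln_div)
qed

text \<open>Testing \<open>sub\<close> with \<open>et^2\<close>, the squared gradient on its right
  side absorbs the cross term. The resulting bound does not involve the size of \<open>w\<close> at
  all.\<close>

lemma caccioppoli:
 assumes w: "C2g w g H" and sub: "!!x. Mo g H x >= g x $. g x" and c: "C1g et gm" "csupp et"
 shows "(LINT x|lborel. wt x*((et x)^2*(g x $. g x))) <= 4*(LINT x|lborel. wt x*(gm x $. gm x))"
  "integrable lborel (%x. wt x*((et x)^2*(g x $. g x)))" "integrable lborel (%x. wt x*(gm x $. gm x))"
proof -
 have cg: "continuous_on UNIV g" using C2gD(6)[OF w] .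
 show i1: "integrable lborel (%x. wt x*((et x)^2*(g x $. g x)))"
 proof (rule integrable_csupp)
  show "continuous_on UNIV (%x. wt x*((et x)^2*(g x $. g x)))" by (intro cnt wt_cont C1g_cont[OF c(1)] cg)
  show "csupp (%x. wt x*((et x)^2*(g x $. g x)))" unfolding pow2 mult.assoc
   using csupp_mult(2)[OF csupp_mult(1)[OF c(2), of "%x. et x*(g x $. g x)"], of wt] by simp
 qed
 show i2: "integrable lborel (%x. wt x*(gm x $. gm x))"
 proof (rule integrable_csupp)
  show "continuous_on UNIV (%x. wt x*(gm x $. gm x))" by (intro cnt wt_cont C1g_cont_grad[OF c(1)])
  show "csupp (%x. wt x*(gm x $. gm x))" 
  proof -
   obtain R where "!!x. norm x > R ==> gm x = 0" using csupp_grad[OF c] unfolding csupp_def by blast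
   then show ?thesis unfolding csupp_def by (intro exI[of _ R]) simp
  qed
 qed
 note C = C1g_mult[OF c(1) c(1)]
 have cs: "csupp (%x. et x*et x) | csupp g" using csupp_mult(1)[OF c(2)] by blast
 note p = weighted_parts[OF C w cs]
 have "(LINT x|lborel. (1/2)*(wt x*((et x)^2*(g x $. g x))) - 2*(wt x*(gm x $. gm x)))
  <= (LINT x|lborel. wt x*((et x $* gm x + et x $* gm x) $. g x) + wt x*(et x*et x)*Mo g H x)"
 proof (rule integral_mono)
  show "integrable lborel (%x. (1/2)*(wt x*((et x)^2*(g x $. g x))) - 2*(wt x*(gm x $. gm x)))"
   using i1 i2 by (intro Bochner_Integration.integrable_diff integrable_mult_right) auto
  fix x
  have "0 <= (et x $* g x + 2 $* gm x) $. (et x $* g x + 2 $* gm x)" by simp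
  then have "- ((et x)^2*(g x $. g x))/2 - 2*(gm x $. gm x) <= 2*et x*(gm x $. g x)"
   by (simp add: inner_add_left inner_add_right inner_commute pow2 alg)
  moreover have "(et x)^2*(g x $. g x) <= (et x)^2*Mo g H x" by (intro mlm sub) auto
  ultimately have "(1/2)*((et x)^2*(g x $. g x)) - 2*(gm x $. gm x) <= 2*et x*(gm x $. g x) + (et x)^2*Mo g H x" by linarith
  from mlm[OF this, of "wt x"] wt_pos[of x]
  show "(1/2)*(wt x*((et x)^2*(g x $. g x))) - 2*(wt x*(gm x $. gm x))
   <= wt x*((et x $* gm x + et x $* gm x) $. g x) + wt x*(et x*et x)*Mo g H x"
   by (simp add: inner_add_left pow2 alg)
 qed (rule p(2))
 then show "(LINT x|lborel. wt x*((et x)^2*(g x $. g x))) <= 4*(LINT x|lborel. wt x*(gm x $. gm x))"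
  using p(1) i1 i2 by simp
qed

definition pr :: "'a => 'a" where "pr x = x - (x $. e) $* e"

lemma ee: "e $. e = 1" using norm_e by (simp add: norm_eq_1)
lemma pr_e: "pr x $. e = 0" "e $. pr x = 0" by (simp_all add: pr_def inner_diff_left inner_diff_right ee inner_commute)
lemma pr_norm: "pr x $. pr x = x $. x - (x $. e)\<^sup>2"
 by (simp add: pr_def inner_diff_left inner_diff_right ee inner_commute pow2)
lemma norm_pr_le: "norm (pr x) <= norm x"
proof (rule power2_le_imp_le)
 show "(norm (pr x))^2 <= (norm x)^2" by (simp add: nrm2 pr_norm)
qed simp
lemma norm_le_pr: "norm x <= norm (pr x) + \<bar>x $. e\<bar>"
proof -
 have "norm x = norm (pr x + (x $. e) $* e)" by (simp add: pr_def)
 also have "... <= norm (pr x) + norm ((x $. e) $* e)" by (rule norm_triangle_ineq)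
 finally show ?thesis by (simp add: norm_e)
qed
lemma pr_diff: "pr (x - y) = pr x - pr y" by (simp add: pr_def inner_diff_left alg)
lemma abs_inner_e: "\<bar>x $. e\<bar> <= norm x" using CS2[of x e] by (simp add: norm_e)

text \<open>Confinement at the scale \<open>R\<close>: over the disc of radius \<open>a*R\<close>
  the interface lies between the heights \<open>- k*R\<close> and \<open>k*R\<close>, with the
  negative phase below and the positive phase above.\<close>

definition conf :: "real => real => real => bool" where
 "conf a k R \<longleftrightarrow> (\<forall>x. norm (pr x) <= a*R --> (x $. e <= - k*R --> z x <= -1) & (x $. e >= k*R --> z x >= 1))"

text \<open>The ball of radius \<open>a/4*R\<close> around such a point stays in one phase, so
  \<open>growth\<close> applies; by \<open>wt_decay\<close> the weight is exponentially small
  there.\<close>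

lemma conf_growth:
 assumes c: "conf a k R" and a: "a > 0" and R: "a/4*R >= real DIM('a)" and x: "norm (pr x) <= a/2*R" "\<bar>x $. e\<bar> >= (k + a/4)*R"
 shows "\<bar>z x\<bar> >= a*R/16"
proof -
 define r where "r = a/4*R"
 have r: "r >= real DIM('a)" using R by (simp add: r_def)
 have kr: "(k + a/4)*R = k*R + r" by (simp add: r_def alg)
 have near: "norm (pr y) <= a*R" "\<bar>y $. e - x $. e\<bar> <= r" if "y : cball x r" for y
 proof -
  have n: "norm (y - x) <= r" using that by (simp add: dist_norm norm_minus_commute)
  have "norm (pr y) <= norm (pr x) + norm (pr (y - x))" unfolding pr_diff using norm_triangle_ineq[of "pr x" "pr y - pr x"] by simp
  also have "... <= a/2*R + r" using x(1) norm_pr_le[of "y - x"] n by linarith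
  also have "... <= a*R" using r by (simp add: r_def alg)
  finally show "norm (pr y) <= a*R" .
  have "\<bar>(y - x) $. e\<bar> <= r" using abs_inner_e[of "y - x"] n by linarith
  then show "\<bar>y $. e - x $. e\<bar> <= r" by (simp add: inner_diff_left)
 qed
 have "x $. e >= (k + a/4)*R | x $. e <= - (k + a/4)*R" using x(2) by linarith
 then have "z x*1 >= r/4 | z x*(-1) >= r/4"
 proof
  assume xe: "x $. e >= (k + a/4)*R"
  have "1*z y >= 1" if "y : cball x r" for y
  proof -
   have "y $. e >= k*R" using near(2)[OF that] xe unfolding kr by linarith
   then show ?thesis using c near(1)[OF that] unfolding conf_def by simp
  qed
  from growth[OF this _ r] show ?thesis by simp
 next
  assume xe: "x $. e <= - (k + a/4)*R"
  have "-1*z y >= 1" if "y : cball x r" for y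
  proof -
   have "y $. e <= - k*R" using near(2)[OF that] xe kr by (simp only: mult_minus_left)
   then have "z y <= -1" using c near(1)[OF that] unfolding conf_def by blast
   then show ?thesis by simp
  qed
  from growth[OF this _ r] show ?thesis by simp
 qed
 then show ?thesis by (auto simp: r_def)
qed

definition cutR :: "real => real => real" where "cutR r s = cutS (s/r^2 - 1)"

lemma cutR_facts:
 assumes "r > 0"
 shows "(cutR r has_real_derivative cutS' (s/r^2 - 1)*(1/r^2)) (at s)"
  "0 <= cutR r s" "cutR r s <= 1" "s <= r^2 ==> cutR r s = 1" "s >= 2*r^2 ==> cutR r s = 0"
  "continuous_on S (%s. cutS' (s/r^2 - 1)*(1/r^2))"
  "s <= r^2 ==> cutS' (s/r^2 - 1) = 0" "s >= 2*r^2 ==> cutS' (s/r^2 - 1) = 0"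
proof -
 have "((%s. s/r^2 - 1) has_real_derivative 1/r^2 - 0) (at s)" by (intro DERIV_diff DERIV_cdivide DERIV_ident DERIV_const)
 then have "((%s. s/r^2 - 1) has_real_derivative 1/r^2) (at s)" by simp
 from DERIV_chain2[OF cutS_DERIV this] show "(cutR r has_real_derivative cutS' (s/r^2 - 1)*(1/r^2)) (at s)"
  unfolding cutR_def[abs_def] .
 show "0 <= cutR r s" "cutR r s <= 1" unfolding cutR_def using cutS_bounds by auto
 have r2: "r^2 > 0" using assms by simp
 show "s <= r^2 ==> cutR r s = 1" "s <= r^2 ==> cutS' (s/r^2 - 1) = 0"
  unfolding cutR_def using r2 by (auto intro!: cutS_bounds(3) cutS_bounds(6))
 show "s >= 2*r^2 ==> cutR r s = 0" "s >= 2*r^2 ==> cutS' (s/r^2 - 1) = 0"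
  unfolding cutR_def using r2 by (auto intro!: cutS_bounds(4) cutS_bounds(7) simp: field_simps)
 show "continuous_on S (%s. cutS' (s/r^2 - 1)*(1/r^2))"
  by (intro cnt cnt2[OF cutS_bounds(8)[of UNIV]]) (use assms in auto)
qed

lemma C1g_cut_ball:
 assumes "r > 0"
 shows "C1g (%x. cutR r (x $. x)) (%x. (cutS' (x $. x/r^2 - 1)*(1/r^2)) $* (2 $* x))"
  "csupp (%x::'a. cutR r (x $. x))"
  "norm ((cutS' (x $. x/r^2 - 1)*(1/r^2)) $* (2 $* x)) <= 12/r*indicator (ball 0 (2*r)) (x::'a)"
proof -
 show "C1g (%x. cutR r (x $. x)) (%x. (cutS' (x $. x/r^2 - 1)*(1/r^2)) $* (2 $* x))"
  by (rule C1g_compose[OF C2gD(1)[OF C2g_norm2] cutR_facts(1)[OF assms] cutR_facts(6)[OF assms]])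
 have big: "x $. x >= 2*r^2" if "norm x >= 2*r" for x :: 'a
 proof -
  have "(norm x)^2 >= (2*r)^2" using that assms by (intro power_mono) auto
  then have "x $. x >= 4*r^2" by (simp add: nrm2 pmd)
  then show ?thesis using zero_le_power2[of r] by linarith
 qed
 show "csupp (%x::'a. cutR r (x $. x))"
  unfolding csupp_def by (intro exI[of _ "2*r"]) (use big cutR_facts(5)[OF assms] in auto)
 show "norm ((cutS' (x $. x/r^2 - 1)*(1/r^2)) $* (2 $* x)) <= 12/r*indicator (ball 0 (2*r)) x"
 proof (cases "x $. x >= 2*r^2")
  case True
  then show ?thesis using cutR_facts(8)[OF assms True] assms by simp
 next
  case False
  then have "norm x < 2*r" using big[of x] by linarith
  then have i: "indicator (ball 0 (2*r)) x = (1::real)" by simp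
  have "x $. x <= 9/4*r^2" using False zero_le_power2[of r] by linarith
  then have n2: "(norm x)^2 <= (3/2*r)^2"
   by (simp add: nrm2 pmd power_divide)
  have nx: "norm x <= 3/2*r" by (rule power2_le_imp_le[OF n2]) (use assms in simp)
  have "norm ((cutS' (x $. x/r^2 - 1)*(1/r^2)) $* (2 $* x)) = \<bar>cutS' (x $. x/r^2 - 1)\<bar>*(2/r^2*norm x)"
   by (simp add: abs_mult)
  also have "... <= 4*(2/r^2*(3/2*r))"
   using cutS_bounds(5) nx assms by (intro mult_mono mlm) auto
  also have "... = 12/r" using assms by (simp add: pow2)
  finally show ?thesis by (simp add: i)
 qed
qed

lemma C1g_pr2: "C1g (%x. pr x $. pr x) (%x. 2 $* pr x)"
proof -
 have "C1g (%x. x $. x + (-1)*((x $. e)*(x $. e))) (%x. 2 $* x + (-1) $* ((x $. e) $* e + (x $. e) $* e))"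
  by (intro C1g_add C1g_cmult C1g_mult C1g_inner C2gD(1)[OF C2g_norm2])
 moreover have "2 $* x + (-1) $* ((x $. e) $* e + (x $. e) $* e) = 2 $* pr x" for x
  by (simp add: pr_def scaleR_diff_right flip: scaleR_2)
 ultimately show ?thesis unfolding pr_norm by (simp add: pow2)
qed

lemma Tb_e_bounds: "\<bar>Tb x e g\<bar> <= 4*wt x*norm g" "Tb x e e >= wt x*(1 - (ze x)\<^sup>2)" "0 <= Tb x e e" "Tb x e e <= 2*wt x"
proof -
 have q: "0 <= Q x" "Q x <= 1" using Modica Q_le by auto
 have "\<bar>(2 - Q x)*(e $. g) - 2*ze x*(Z x $. g)\<bar> <= \<bar>2 - Q x\<bar>*\<bar>e $. g\<bar> + 2*\<bar>ze x\<bar>*\<bar>Z x $. g\<bar>"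
  by (metis abs_mult abs_numeral abs_triangle_ineq4)
 also have "... <= 2*norm g + 2*1*norm g"
 proof (intro add_mono mult_mono)
  show "\<bar>e $. g\<bar> <= norm g" using abs_inner_e[of g] by (simp add: inner_commute)
  have "\<bar>Z x $. g\<bar> <= norm (Z x)*norm g" by (rule CS2)
  also have "... <= norm g" using norm_Z[of x] by (simp add: mult_left_le_one_le)
  finally show "\<bar>Z x $. g\<bar> <= norm g" .
 qed (use q ze_le[of x] ze_pos[of x] in auto)
 finally have "\<bar>(2 - Q x)*(e $. g) - 2*ze x*(Z x $. g)\<bar> <= 4*norm g" by simp
 from mlm[OF this, of "wt x"] show "\<bar>Tb x e g\<bar> <= 4*wt x*norm g"
  using wt_pos[of x] by (simp add: Tb_def ze_def abs_mult mult_ac)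
 have A: "Tb x e e = wt x*((2 - Q x) - 2*(ze x)^2)" by (simp add: Tb_def ee ze_def pow2)
 have "(ze x)^2 <= (norm (Z x))^2" using abs_inner_e[of "Z x"] abs_le_square_iff[of "ze x" "norm (Z x)"] by (simp add: ze_def)
 then have zZ: "(ze x)^2 <= 1 - Q x" by (simp add: Q_def nrm2)
 then show B: "Tb x e e >= wt x*(1 - (ze x)\<^sup>2)" unfolding A using wt_pos[of x] by (intro mlm) auto
 have "0 <= 1 - (ze x)\<^sup>2" using zZ q by linarith
 then have "0 <= wt x*(1 - (ze x)\<^sup>2)" using wt_pos[of x] by simp
 then show "0 <= Tb x e e" using B by linarith
 have "(2 - Q x) - 2*(ze x)^2 <= 2" using q zero_le_power2[of "ze x"] by linarith
 from mlm[OF this, of "wt x"] show "Tb x e e <= 2*wt x" unfolding A using wt_pos[of x] by (simp add: mult.commute)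
qed

lemma sq_lt_imp: "s^2 < 2*r^2 ==> r > 0 ==> \<bar>s\<bar> <= 3/2*(r::real)"
proof -
 assume a: "s^2 < 2*r^2" "r > 0"
 have "s^2 <= 9/4*r^2" using a zero_le_power2[of r] by linarith
 then have s2: "\<bar>s\<bar>\<^sup>2 <= (3/2*r)^2" by (simp add: pmd power_divide)
 show ?thesis by (rule power2_le_imp_le[OF s2]) (use a(2) in simp)
qed

definition hcut :: "real => real => real" where "hcut r t = t * cutR r (t^2)"
definition hcut' :: "real => real => real" where "hcut' r t = cutR r (t^2) + t*(cutS' (t^2/r^2 - 1)*(1/r^2)*(2*t))"

lemma hcut_facts:
 assumes r: "r > 0"
 shows "(hcut r has_real_derivative hcut' r t) (at t)" "continuous_on S (hcut' r)" "\<bar>t\<bar> <= r ==> hcut r t = t & hcut' r t = 1"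
  "t^2 >= 2*r^2 ==> hcut r t = 0 & hcut' r t = 0" "t^2 < 2*r^2 ==> \<bar>hcut r t\<bar> <= 2*r & \<bar>hcut' r t\<bar> <= 17"
proof -
 define h where "h = hcut r"
 define h' where "h' = hcut' r"
 note h_def = h_def[unfolded hcut_def[abs_def]] and h'_def = h'_def[unfolded hcut'_def[abs_def]]
 have "(h has_real_derivative h' t) (at t) & continuous_on S h' & (\<bar>t\<bar> <= r --> h t = t & h' t = 1)
  & (t^2 >= 2*r^2 --> h t = 0 & h' t = 0) & (t^2 < 2*r^2 --> \<bar>h t\<bar> <= 2*r & \<bar>h' t\<bar> <= 17)"
 proof (intro conjI impI)
 have "((%t. t^2) has_real_derivative 2*t) (at t)" by (auto intro!: dvi)
 from DERIV_mult[OF DERIV_ident DERIV_chain2[OF cutR_facts(1)[OF r] this]]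
 show "(h has_real_derivative h' t) (at t)" unfolding h_def h'_def by (simp add: alg)
 have c: "continuous_on UNIV (cutR r)" using cutR_facts(1)[OF r] by (meson DERIV_continuous_on has_field_derivative_at_within)
 show "continuous_on S h'" unfolding h'_def
  by (intro cnt cnt2[OF c] cnt2[OF cutR_facts(6)[OF r, of UNIV], of _ "%t. t^2"]) auto
 { assume "\<bar>t\<bar> <= r"
  then have "t^2 <= r^2" using r abs_le_square_iff[of t r] by simp
  then show "h t = t" "h' t = 1" unfolding h_def h'_def using cutR_facts(4,7)[OF r] by simp_all }
 show "t^2 >= 2*r^2 ==> h t = 0" "t^2 >= 2*r^2 ==> h' t = 0" unfolding h_def h'_def using cutR_facts(5,8)[OF r] by simp_all
 assume t: "t^2 < 2*r^2"
 have c01: "0 <= cutR r (t^2)" "cutR r (t^2) <= 1" using cutR_facts(2,3)[OF r] by auto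
 have "\<bar>h t\<bar> <= \<bar>t\<bar>" unfolding h_def using c01 by (simp add: abs_mult mult_left_le)
 also have "... <= 2*r" using sq_lt_imp[OF t r] r by simp
 finally show 1: "\<bar>h t\<bar> <= 2*r" .
 have tr: "t^2/r^2 <= 2" using t r by (simp add: divide_le_eq)
 have "\<bar>t*(cutS' (t^2/r^2 - 1)*(1/r^2)*(2*t))\<bar> = \<bar>cutS' (t^2/r^2 - 1)\<bar>*(2*(t^2/r^2))"
  by (simp add: abs_mult pow2)
 also have "... <= 4*(2*2)" using tr cutS_bounds(5) by (intro mult_mono) auto
 finally have "\<bar>t*(cutS' (t^2/r^2 - 1)*(1/r^2)*(2*t))\<bar> <= 16" by simp
 then show "\<bar>h' t\<bar> <= 17" unfolding h'_def using c01 by linarith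
 qed
 then show "(hcut r has_real_derivative hcut' r t) (at t)" "continuous_on S (hcut' r)" "\<bar>t\<bar> <= r ==> hcut r t = t & hcut' r t = 1"
  "t^2 >= 2*r^2 ==> hcut r t = 0 & hcut' r t = 0" "t^2 < 2*r^2 ==> \<bar>hcut r t\<bar> <= 2*r & \<bar>hcut' r t\<bar> <= 17"
  unfolding h_def h'_def hcut_def[abs_def] hcut'_def[abs_def] by blast+
qed

text \<open>Testing the vertical component of the conservation law for the stress tensor against
 \<open>\<eta>\<^sup>2 x\<^sub>n w\<close>: the confinement makes the boundary term in the vertical direction exponentially small.\<close>
lemma average_log_slope:
 assumes n4: "DIM('a) >= 4" and a: "a > 0" and k: "k > 0" and CE: "CE > 0"
  and EB: "!!R. R > 1 ==> mB (%_. 1) 0 R <= CE*R^(DIM('a) - 1)"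
 shows "\<exists>C>0. \<forall>dl R. 0 < dl & dl < 1 & conf a k R & R >= 1 & a/4*R >= real DIM('a) -->
  mB (wd dl) 0 (a/4*R) <= C*R^(DIM('a) - 1)*(1 + R*ln ((1 + dl)/dl)*exp (- (a*R/4)))"
proof -
 define rh where "rh = a/4"
 define K2 where "K2 = k + a/4"
 define c1 where "c1 = 2*(rh + K2)"
 have pos: "rh > 0" "K2 > 0" "c1 > 0" "rh <= K2" "c1 >= rh" using a k by (auto simp: rh_def K2_def c1_def)
 define C1 where "C1 = 2 + 192*K2/rh + 4*K2"
 have C1: "C1 > 0" using pos by (simp add: C1_def add_pos_nonneg)
 define V where "V = measure lborel (ball (0::'a) 1)"
 define D1 where "D1 = C1*CE * c1^(DIM('a) - 1) + 4*K2*(4*((12 / c1)^2*(CE*(2 * c1)^(DIM('a) - 1))))"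
 define D2 where "D2 = 34*16*(V * c1^DIM('a))"
 have V: "V >= 0" by (simp add: V_def)
 have D: "D1 > 0" "D2 >= 0" using pos C1 CE V by (auto simp: D1_def D2_def intro!: add_pos_nonneg mult_pos_pos mnn)
 have main: "mB (wd dl) 0 (rh*R) <= D1*R^(DIM('a) - 1) + D2*(R^(DIM('a) - 1)*(R*ln ((1 + dl)/dl)*exp (- (a*R/4))))"
  if d: "0 < dl" "dl < 1" and cf: "conf a k R" and R: "R >= 1" "rh*R >= real DIM('a)" for dl R
 proof -
  define r1 where "r1 = rh*R"
  define r2 where "r2 = K2*R"
  define r3 where "r3 = c1*R"
  have r12: "r1 > 0" "r2 > 0" using pos R by (auto simp: r1_def r2_def)
  have "r3 = 2*(r1 + r2)" by (simp add: r1_def r2_def r3_def c1_def alg)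
  moreover have "r1 <= r2" using pos R by (simp add: r1_def r2_def)
  ultimately have r: "r1 > 0" "r2 > 0" "r3 > 0" "r1 <= r2" "r3 = 2*(r1 + r2)" using r12 by auto
  have r31: "r3 > 1" using r R n4 by (simp add: r1_def)
  define et where "et x = cutR r1 (pr x $. pr x)" for x
  define etg where "etg x = (cutS' (pr x $. pr x/r1^2 - 1)*(1/r1^2)) $* (2 $* pr x)" for x
  have Cet: "C1g et etg" unfolding et_def[abs_def] etg_def[abs_def]
   by (rule C1g_compose[OF C1g_pr2 cutR_facts(1)[OF r(1)] cutR_facts(6)[OF r(1)]])
  define h where "h = hcut r2"
  define h' where "h' = hcut' r2"
  note hf = hcut_facts[OF r(2), folded h_def h'_def]
  have Ch: "C1g (%x. h (x $. e)) (%x. h' (x $. e) $* e)" by (rule C1g_compose[OF C1g_inner hf(1) hf(2)])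
  note wf = wd_facts[of dl]
  have d0: "dl >= 0" using d by simp
  \<comment> \<open>The test function: squared horizontal cutoff, truncated height, regularised log
    slope. The vertical cutoff sits in \<open>h\<close>.\<close>
  define F where "F x = (et x*et x)*(h (x $. e)*wd dl x)" for x
  define fj where "fj x = (et x*et x) $* (h (x $. e) $* gd dl x + wd dl x $* (h' (x $. e) $* e))
    + (h (x $. e)*wd dl x) $* (et x $* etg x + et x $* etg x)" for x
  have CF: "C1g F fj" unfolding F_def[abs_def] fj_def[abs_def]
   by (intro C1g_mult Cet Ch C2gD(1)[OF wf(1)[OF d0]])
  \<comment> \<open>A second cutoff, equal to 1 on the support of \<open>F\<close>, to be used in
    \<open>caccioppoli\<close>.\<close>
  define zt where "zt x = cutR r3 (x $. x)" for x :: 'a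
  define ztg where "ztg x = (cutS' (x $. x/r3^2 - 1)*(1/r3^2)) $* (2 $* x)" for x :: 'a
  have Cz: "C1g zt ztg" "csupp zt" "!!x. norm (ztg x) <= 12/r3*indicator (ball 0 (2*r3)) x"
   unfolding zt_def[abs_def] ztg_def[abs_def] using C1g_cut_ball[OF r(3)] by auto
  have inner: "\<bar>x $. e\<bar> <= 3/2*r2 & norm (pr x) <= 3/2*r1 & x : ball 0 r3 & zt x = 1"
   if "et x ~= 0" "(x $. e)^2 < 2*r2^2" for x
  proof -
   have t: "\<bar>x $. e\<bar> <= 3/2*r2" by (rule sq_lt_imp[OF that(2) r(2)])
   have "(norm (pr x))^2 < 2*r1^2" using that(1) cutR_facts(5)[OF r(1), of "pr x $. pr x"] unfolding et_def
    by (cases "pr x $. pr x < 2*r1^2") (auto simp: nrm2)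
   from sq_lt_imp[OF this r(1)] have p: "norm (pr x) <= 3/2*r1" by simp
   have "norm x <= 3/2*r1 + 3/2*r2" using norm_le_pr[of x] t p by linarith
   also have "... < r3" unfolding r(5) using r(1,2) by simp
   finally have nx: "norm x < r3" .
   then have "(norm x)^2 <= r3^2" by (intro power_mono) auto
   then have "zt x = 1" unfolding zt_def using cutR_facts(4)[OF r(3)] by (simp add: nrm2)
   with t p nx show ?thesis by simp
  qed
  have out: "F x = 0 & fj x = 0" if "et x = 0 | (x $. e)^2 >= 2*r2^2" for x
   using that hf(4)[of "x $. e"] unfolding F_def fj_def by auto
  have csF: "csupp F"
  proof (rule csupp_outside_ball[OF r(3)])
   fix x :: 'a assume "x ~: ball 0 r3"
   then show "F x = 0" using inner[of x] out[of x] by force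
  qed
  have TH0: "TH (%x h. 0) x = 0" for x by (simp add: TH_def tr_zero)
  note SD = stress_divergence_free[OF CF C2g_inner[of e] disjI1[OF csF], unfolded TH0 mult_zero_right add_0_right]
  define L where "L = ln ((1 + dl)/dl)"
  define T where "T = 34*16*L*exp (- (a*R/4))"
  have L: "L >= 0" using d by (simp add: L_def)
  have T: "T >= 0" using L by (simp add: T_def)
  have pw: "indicator (ball 0 r1) x*(wt x*wd dl x) <= Tb x e (fj x)
    + (C1*(indicator (ball 0 r3) x*(wt x*1)) + T*indicator (ball 0 r3) x) + 4*K2*R^2*(wt x*((zt x)^2*(gd dl x $. gd dl x)))" for x
  proof (cases "et x = 0 | (x $. e)^2 >= 2*r2^2")
   case True
   have "x ~: ball 0 r1"
   proof
    assume "x : ball 0 r1"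
    then have nx: "norm x <= r1" by simp
    have "(norm (pr x))^2 <= r1^2" using norm_pr_le[of x] nx by (intro power_mono) auto
    then have "et x = 1" unfolding et_def using cutR_facts(4)[OF r(1)] by (simp add: nrm2)
    moreover have "\<bar>x $. e\<bar>\<^sup>2 <= r2^2" using abs_inner_e[of x] nx r by (intro power_mono) auto
    then have "(x $. e)^2 <= r2^2" by simp
    moreover have "r2^2 > 0" using r by simp
    ultimately show False using True by (smt (verit))
   qed
   moreover have "Tb x e (fj x) = 0" using out[OF True] by (simp add: Tb_def)
   moreover have "0 <= C1*(indicator (ball 0 r3) x*(wt x*1)) + T*indicator (ball 0 r3) x"
    using C1 T wt_pos[of x] by (intro add_nonneg_nonneg mnn) auto
   moreover have "0 <= 4*K2*R^2*(wt x*((zt x)^2*(gd dl x $. gd dl x)))"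
    using pos wt_pos[of x] by (intro mnn) auto
   ultimately show ?thesis by simp
  next
   case False
   then have t2: "(x $. e)^2 < 2*r2^2" and e0: "et x ~= 0" by auto
   from inner[OF e0 t2] have I: "norm (pr x) <= 3/2*r1" "x : ball 0 r3" "zt x = 1" by auto
   have i3: "indicator (ball 0 r3) x = (1::real)" using I by simp
   have e01: "0 <= et x" "et x <= 1" "0 <= et x*et x" "et x*et x <= 1" unfolding et_def using cutR_facts(2,3)[OF r(1), of "pr x $. pr x"]
    by (auto simp: mult_le_one)
   define t where "t = x $. e"
   define w where "w = wd dl x"
   define m where "m = wt x"
   have m: "m > 0" by (simp add: m_def wt_pos)
   have w: "w >= 0" "w*ze x <= 2" "w <= L" using wf(4)[OF d0, of x] wf(5)[OF d0, of x] wf(6)[OF d0 d(1), of x] d by (auto simp: w_def L_def)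
   have hb: "\<bar>h t\<bar> <= 2*r2" "\<bar>h' t\<bar> <= 17" using hf(5)[OF t2] by (auto simp: t_def)
   have pe: "e $. etg x = 0" by (simp add: etg_def pr_e)
   have TbE: "Tb x e (fj x) = (et x*et x)*(h t*Tb x e (gd dl x)) + (et x*et x)*(w*(h' t*Tb x e e)) + 2*et x*(h t*(w*(- 2*m*ze x*(Z x $. etg x))))"
    unfolding fj_def Tb_def t_def[symmetric] w_def[symmetric] m_def[symmetric] ze_def
    by (simp add: inner_add_right pe alg)
   have ng: "norm (etg x) <= 12/r1"
   proof -
    have "norm (etg x) = \<bar>cutS' (pr x $. pr x/r1^2 - 1)\<bar>*(2/r1^2*norm (pr x))" by (simp add: etg_def abs_mult)
    also have "... <= 4*(2/r1^2*(3/2*r1))"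
     using cutS_bounds(5) I(1) r by (intro mult_mono mlm) auto
    also have "... = 12/r1" using r by (simp add: pow2)
    finally show ?thesis .
   qed
   \<comment> \<open>The height is of order \<open>R\<close>, while \<open>R\<close> times the
     gradient of the log slope is of order one in the mean square by
     \<open>caccioppoli\<close>.\<close>
   have s1: "(et x*et x)*(h t*Tb x e (gd dl x)) >= - (4*K2*m + 4*K2*R^2*(m*(gd dl x $. gd dl x)))"
   proof -
    define G where "G = norm (gd dl x)"
    have "\<bar>(et x*et x)*(h t*Tb x e (gd dl x))\<bar> = (et x*et x)*(\<bar>h t\<bar>*\<bar>Tb x e (gd dl x)\<bar>)" using e01 by (simp add: abs_mult)
    also have "... <= 1*(2*r2*(4*m*G))" unfolding m_def G_def
     using e01 hb Tb_e_bounds(1)[of x "gd dl x"] r by (intro mult_mono) auto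
    also have "... = 4*K2*m*(2*(R*G))" by (simp add: r2_def)
    also have "... <= 4*K2*m*(1 + (R*G)^2)"
    proof (intro mlm)
     have "0 <= (R*G - 1)^2" by simp
     then show "2*(R*G) <= 1 + (R*G)^2" by (simp add: power2_diff)
    qed (use pos m in auto)
    also have "... = 4*K2*m + 4*K2*R^2*(m*(gd dl x $. gd dl x))"
     by (simp add: alg pmd G_def nrm2)
    finally show ?thesis by linarith
   qed
   \<comment> \<open>The gradient of the horizontal cutoff is orthogonal to \<open>e\<close>, so in
     the stress tensor only \<open>ze x * (Z x $. etg x)\<close> remains; \<open>w*ze x <= 2\<close>
     removes the unbounded factor.\<close>
   have s2: "2*et x*(h t*(w*(- 2*m*ze x*(Z x $. etg x)))) >= - (192*K2/rh*m)"
   proof -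
    have "\<bar>2*et x*(h t*(w*(- 2*m*ze x*(Z x $. etg x))))\<bar> = 4*m*(et x*\<bar>h t\<bar>*(w*ze x)*\<bar>Z x $. etg x\<bar>)"
     using e01 w m ze_pos[of x] by (simp add: abs_mult)
    also have "... <= 4*m*(1*(2*r2)*2*(12/r1))"
    proof (intro mlm mult_mono)
     have "\<bar>Z x $. etg x\<bar> <= norm (Z x)*norm (etg x)" by (rule CS2)
     also have "... <= 1*(12/r1)" using norm_Z[of x] ng by (intro mult_mono) auto
     finally show "\<bar>Z x $. etg x\<bar> <= 12/r1" by simp
    qed (use e01 hb w m r ze_pos[of x] in auto)
    also have "... = 192*K2/rh*m" using R by (simp add: r1_def r2_def)
    finally show ?thesis by linarith
   qed
   \<comment> \<open>The defect \<open>(ze x)^2\<close> in the lower bound for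
     \<open>Tb x e e\<close> is again paid by \<open>w*ze x <= 2\<close>. Where \<open>h'\<close>
     may differ from 1, confinement makes the weight exponentially small, and the crude bound
     \<open>L\<close> for \<open>w\<close> suffices.\<close>
   have s3: "indicator (ball 0 r1) x*(m*w) - 2*m - T <= (et x*et x)*(w*(h' t*Tb x e e))"
   proof (cases "\<bar>t\<bar> <= r2")
    case True
    then have h1: "h' t = 1" using hf(3) by simp
    have "indicator (ball 0 r1) x <= et x*et x"
    proof (cases "x : ball 0 r1")
     case True
     then have "(norm (pr x))^2 <= r1^2" using norm_pr_le[of x] by (intro power_mono) auto
     then have "et x = 1" unfolding et_def using cutR_facts(4)[OF r(1)] by (simp add: nrm2)
     then show ?thesis by (simp add: indicator_def)
    qed (use e01 in simp)
    from mrm[OF this, of "m*w"] have "indicator (ball 0 r1) x*(m*w) <= et x*et x*(m*w)" using m w by simp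
    moreover have "et x*et x*(m*w) - 2*m <= et x*et x*(w*(m*(1 - (ze x)\<^sup>2)))"
    proof -
     have "(et x*et x)*((w*ze x)*ze x) <= 1*(2*1)" using e01 w ze_pos[of x] ze_le[of x] by (intro mult_mono) auto
     from mlm[OF this, of m] m have "m*(et x*et x*(w*ze x*ze x)) <= m*2" by simp
     then show ?thesis by (simp add: alg pow2)
    qed
    moreover have "et x*et x*(w*(m*(1 - (ze x)\<^sup>2))) <= et x*et x*(w*(1*Tb x e e))"
     using e01 w Tb_e_bounds(2)[of x] unfolding m_def by (intro mlm) auto
    ultimately show ?thesis using T unfolding h1 by linarith
   next
    case False
    then have ni: "indicator (ball 0 r1) x = (0::real)" using abs_inner_e[of x] r by (simp add: t_def)
    have "\<bar>z x\<bar> >= a*R/16"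
    proof (rule conf_growth[OF cf a])
     show "a/4*R >= real DIM('a)" using R by (simp add: rh_def)
     have "3/2*r1 <= a/2*R" using a R by (simp add: r1_def rh_def)
     then show "norm (pr x) <= a/2*R" using I(1) by linarith
     show "\<bar>x $. e\<bar> >= (k + a/4)*R" using False by (simp add: t_def r2_def K2_def)
    qed
    then have "16*exp (- 4*\<bar>z x\<bar>) <= 16*exp (- (a*R/4))" by simp
    then have mT: "m <= 16*exp (- (a*R/4))" using wt_decay[of x] unfolding m_def by linarith
    have "\<bar>(et x*et x)*(w*(h' t*Tb x e e))\<bar> = (et x*et x)*(w*(\<bar>h' t\<bar>*Tb x e e))" using e01 w Tb_e_bounds(3)[of x] by (simp add: abs_mult)
    also have "... <= 1*(L*(17*(2*(16*exp (- (a*R/4))))))"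
    proof (intro mult_mono)
     show "Tb x e e <= 2*(16*exp (- (a*R/4)))" using Tb_e_bounds(4)[of x] mT unfolding m_def by linarith
    qed (use e01 w hb Tb_e_bounds(3)[of x] L in auto)
    also have "... = T" by (simp add: T_def)
    finally show ?thesis using ni m by simp
   qed
   have "C1*m = 2*m + 192*K2/rh*m + 4*K2*m" by (simp add: C1_def alg)
   then show ?thesis using s1 s2 s3 unfolding TbE m_def[symmetric] w_def[symmetric] i3 I(3) by simp
  qed
  note cac = caccioppoli[OF wf(1)[OF d0] wf(3)[OF d0] Cz(1) Cz(2)]
  have iB: "integrable lborel (%x::'a. indicator (ball 0 r3) x :: real)" using integrable_ball[OF n4, of "%_. 1" 0 r3] by simp
  have int1: "integrable lborel (%x. C1*(indicator (ball 0 r3) x*(wt x*1)) + T*indicator (ball 0 r3) x)"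
   by (intro Bochner_Integration.integrable_add integrable_mult_right integrable_ball[OF n4])
    (auto intro!: cnt wt_cont iB)
  have "mB (wd dl) 0 r1 <= (LINT x|lborel. Tb x e (fj x)
    + (C1*(indicator (ball 0 r3) x*(wt x*1)) + T*indicator (ball 0 r3) x) + 4*K2*R^2*(wt x*((zt x)^2*(gd dl x $. gd dl x))))"
   unfolding mB_def[OF n4]
  proof (rule integral_mono)
   show "integrable lborel (%x. indicator (ball 0 r1) x*(wt x*wd dl x))"
    by (intro integrable_ball[OF n4] cnt wt_cont C2gD(7)[OF wf(1)[OF d0]])
  qed (use pw int1 SD(2) cac(2) in \<open>auto intro!: Bochner_Integration.integrable_add\<close>)
  also have "... = (C1*mB (%_. 1) 0 r3 + T*measure lborel (ball (0::'a) r3)) + 4*K2*R^2*(LINT x|lborel. wt x*((zt x)^2*(gd dl x $. gd dl x)))"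
  proof -
   have "(LINT x|lborel. C1*(indicator (ball 0 r3) x*(wt x*1)) + T*indicator (ball 0 r3) x) = C1*mB (%_. 1) 0 r3 + T*measure lborel (ball (0::'a) r3)"
    unfolding mB_def[OF n4]
    by (subst Bochner_Integration.integral_add)
     (auto intro!: integrable_mult_right integrable_ball[OF n4] cnt wt_cont iB)
   then show ?thesis using SD int1 cac(2) by (subst Bochner_Integration.integral_add) (auto intro!: Bochner_Integration.integrable_add)
  qed
  also have "... <= (C1*(CE*r3^(DIM('a) - 1)) + T*(V*r3^DIM('a))) + 4*K2*R^2*(4*((12/r3)^2*(CE*(2*r3)^(DIM('a) - 1))))"
  proof (intro add_mono mlm)
   show "mB (%_. 1) 0 r3 <= CE*r3^(DIM('a) - 1)" by (rule EB[OF r31])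
   show "measure lborel (ball (0::'a) r3) <= V*r3^DIM('a)" using r by (simp add: V_def content_ball)
   have "(LINT x|lborel. wt x*(ztg x $. ztg x)) <= (LINT x|lborel. (12/r3)^2*(indicator (ball 0 (2*r3)) x*(wt x*1)))"
   proof (rule integral_mono)
    show "integrable lborel (%x. (12/r3)^2*(indicator (ball 0 (2*r3)) x*(wt x*1)))"
     by (intro integrable_mult_right integrable_ball[OF n4] cnt wt_cont)
    fix x
    have "(norm (ztg x))^2 <= (12/r3*indicator (ball 0 (2*r3)) x)^2" using Cz(3)[of x] by (intro power_mono) auto
    also have "... = (12/r3)^2*indicator (ball 0 (2*r3)) x" by (simp add: indicator_def)
    finally have "ztg x $. ztg x <= (12/r3)^2*indicator (ball 0 (2*r3)) x" by (simp add: nrm2)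
    from mlm[OF this, of "wt x"] wt_pos[of x]
    show "wt x*(ztg x $. ztg x) <= (12/r3)^2*(indicator (ball 0 (2*r3)) x*(wt x*1))" by (simp add: mult_ac)
   qed (rule cac(3))
   also have "... = (12/r3)^2*mB (%_. 1) 0 (2*r3)" unfolding mB_def[OF n4] by simp
   also have "... <= (12/r3)^2*(CE*(2*r3)^(DIM('a) - 1))" using r31 by (intro mlm EB) auto
   finally show "(LINT x|lborel. wt x*((zt x)^2*(gd dl x $. gd dl x))) <= 4*((12/r3)^2*(CE*(2*r3)^(DIM('a) - 1)))"
    using cac(1) by linarith
  qed (use C1 T pos in auto)
  also have "... = D1*R^(DIM('a) - 1) + D2*(R^(DIM('a) - 1)*(R*L*exp (- (a*R/4))))"
  proof -
   have "R^DIM('a) = R*R^(DIM('a) - 1)" using DIM_positive[where 'a='a] by (metis Suc_pred' power_Suc)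
   then show ?thesis using R pos unfolding r3_def D1_def D2_def T_def
    by (simp add: pmd power_divide alg)
  qed
  finally show ?thesis by (simp add: r1_def L_def)
 qed
 show ?thesis
 proof (intro exI[of _ "D1 + D2"] conjI allI impI)
  show "D1 + D2 > 0" using D by simp
  fix dl R :: real assume A: "0 < dl & dl < 1 & conf a k R & R >= 1 & a/4*R >= real DIM('a)"
  define X where "X = R*ln ((1 + dl)/dl)*exp (- (a*R/4))"
  define P where "P = R^(DIM('a) - 1)"
  have X: "X >= 0" "P >= 0" using A by (auto simp: X_def P_def)
  have "mB (wd dl) 0 (rh*R) <= D1*P + D2*(P*X)" unfolding X_def P_def using A by (intro main) (auto simp: rh_def)
  also have "... <= (D1 + D2)*P*(1 + X)"
  proof -
   have "0 <= D2*P" "0 <= D1*P*X" using D X by auto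
   then show ?thesis by (simp add: alg)
  qed
  finally show "mB (wd dl) 0 (a/4*R) <= (D1 + D2)*R^(DIM('a) - 1)*(1 + R*ln ((1 + dl)/dl)*exp (- (a*R/4)))"
   by (simp add: X_def P_def rh_def)
 qed
qed

text \<open>The averages over large balls are inserted into \<open>mean_value\<close>. Because the
  radius is chosen after \<open>dl\<close> and \<open>x0\<close>, the term with
  \<open>ln ((1 + dl)/dl)\<close> is harmless and the bound is uniform in both.\<close>

lemma log_slope_integral_bound:
 assumes n4: "DIM('a) >= 4" and a: "a > 0" and k: "k > 0" and CE: "CE > 0"
  and EB: "!!R. R > 1 ==> mB (%_. 1) 0 R <= CE*R^(DIM('a) - 1)"
  and cf: "!!M. \<exists>R\<ge>M. conf a k R"
 shows "\<exists>C>0. \<forall>x0 dl. 0 < dl & dl < 1 --> (LINT x|lborel. indicator (cball x0 1) x*(wt x*wd dl x)) <= C"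
proof -
 obtain C where C: "C > 0" and avg: "!!dl R. 0 < dl ==> dl < 1 ==> conf a k R ==> R >= 1 ==> a/4*R >= real DIM('a) ==>
  mB (wd dl) 0 (a/4*R) <= C*R^(DIM('a) - 1)*(1 + R*ln ((1 + dl)/dl)*exp (- (a*R/4)))"
  using average_log_slope[OF n4 a k CE EB] by blast
 define m where "m = DIM('a) - 1"
 define C3 where "C3 = Cmv*((8 / a)^m*(2*C) + CE*2^m)"
 have cmv: "Cmv > 0" unfolding Cmv_def[OF n4] using nn4[OF n4] by simp
 have C3: "C3 > 0" using a C CE cmv by (simp add: C3_def add_pos_pos)
 have "(LINT x|lborel. indicator (cball x0 1) x*(wt x*wd dl x)) <= C3" if d: "0 < dl" "dl < 1" for x0 dl
 proof -
  define L where "L = ln ((1 + dl)/dl)"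
  have L: "L >= 0" using d by (simp add: L_def)
  \<comment> \<open>The summands ensure, in this order, \<open>R >= 1\<close>, the size needed in
    \<open>conf_growth\<close>, a radius of at least 2 in \<open>mean_value\<close>, that
    \<open>x0\<close> lies in the inner ball, and that the exponential term is at most 1.\<close>
  obtain R where R: "R >= 1 + 4*real DIM('a) / a + 16 / a + 8*norm x0 / a + 32*L / a^2" and cR: "conf a k R" using cf by blast
  have ge: "0 <= 4*real DIM('a) / a" "0 <= 16 / a" "0 <= 8*norm x0 / a" "0 <= 32*L / a^2" using a L by auto
  have "R >= 1" "R >= 4*real DIM('a) / a" "R >= 16 / a" "R >= 8*norm x0 / a" "R >= 32*L / a^2" using R ge by linarith+
  then have Rs: "R >= 1" "a/4*R >= real DIM('a)" "a/8*R >= 2" "norm x0 <= a/8*R" "32*L <= a^2*R"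
   using a by (simp_all add: divide_le_eq mult.commute)
  define y where "y = a*R/4"
  have y: "y > 0" using a Rs by (simp add: y_def)
  have "y^2/2 <= exp y" using exp_lower_Taylor_quadratic[of y] y by linarith
  then have "exp (- y) <= 2/y^2" using y by (simp add: exp_minus field_simps)
  then have "R*L*exp (- y) <= R*L*(2/y^2)" using Rs L by (intro mlm) auto
  also have "... = 32*L/(a^2*R)" using a Rs by (simp add: y_def pow2 mult_ac)
  also have "... <= 1" using Rs a by (simp add: divide_le_eq)
  finally have small: "R*L*exp (- (a*R/4)) <= 1" by (simp add: y_def)
  define r where "r = a/8*R"
  have r: "r >= 2" "2*r = a/4*R" "norm x0 <= r" using Rs by (auto simp: r_def)
  have d0: "dl >= 0" using d by simp
  note wf = wd_facts[OF d0]
  have sub: "mB w x0 r <= mB w 0 (2*r)" if w: "!!x. w x >= 0" "continuous_on UNIV w" for w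
   unfolding mB_def[OF n4]
  proof (rule integral_mono)
   show "integrable lborel (%x. indicator (ball x0 r) x*(wt x*w x))" "integrable lborel (%x. indicator (ball 0 (2*r)) x*(wt x*w x))"
    by (intro integrable_ball[OF n4] cnt wt_cont w)+
   fix x
   have "x : ball 0 (2*r)" if "x : ball x0 r"
    using that r(3) norm_triangle_ineq[of x0 "x - x0"] by (simp add: dist_norm norm_minus_commute)
   then show "indicator (ball x0 r) x*(wt x*w x) <= indicator (ball 0 (2*r)) x*(wt x*w x)"
    using w(1)[of x] wt_pos[of x] by (auto simp: indicator_def)
  qed
  have "mB (wd dl) 0 (2*r) <= C*R^m*(1 + R*L*exp (- (a*R/4)))" unfolding r(2) L_def m_def by (rule avg[OF d cR Rs(1,2)])
  also have "... <= C*R^m*2" using small C Rs by (intro mlm) auto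
  finally have b1: "mB (wd dl) x0 r <= C*R^m*2" using sub[OF wf(4) C2gD(7)[OF wf(1)]] by linarith
  have b2: "mB (%_. 1) x0 r <= CE*(2*r)^m" using sub[of "%_. 1"] EB[of "2*r"] r unfolding m_def by fastforce
  have R8: "R = 8 / a*r" using a by (simp add: r_def)
  have "(LINT x|lborel. indicator (cball x0 1) x*(wt x*wd dl x)) <= Cmv*lam r*(mB (wd dl) x0 r + mB (%_. 1) x0 r)"
   by (rule mean_value[OF n4 wf(1) wf(4) wf(3) r(1)])
  also have "... <= Cmv*lam r*(C*R^m*2 + CE*(2*r)^m)"
   using b1 b2 cmv lam_pos[of r] r(1) by (intro mlm add_mono mnn) linarith+
  also have "... = Cmv*((8 / a)^m*(2*C) + CE*2^m)*(lam r*r^m)" unfolding R8 pmd by (simp add: alg)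
  also have "... = C3" using lam_eq[of r] r unfolding C3_def m_def by simp
  finally show ?thesis .
 qed
 with C3 show ?thesis by blast
qed

text \<open>\<open>U x $. e\<close> solves the linearised equation, whose zeroth order coefficient
  \<open>-4 + 12*(u x)^2\<close> is at most 8; this is the hypothesis of
  \<open>weak_Harnack\<close>.\<close>

lemma C2g_Ue: "\<exists>Kf. C2g (%x. U x $. e) (%x. Hu x e) Kf & (\<forall>x. tr (Kf x) <= 8*(U x $. e))"
proof -
 have d: "(W' has_real_derivative -4 + 12 * s^2) (at s)" for s
  unfolding W'_def[abs_def] by (auto intro!: dvi simp: pow2 alg)
 have "\<exists>K. C2g (%x. U x $. v) (%x. Hu x v) K" for v
 proof (rule solution_C3[OF u pde d])
  show "((%s. -4 + 12 * s^2) has_real_derivative 24 * s) (at s)" for s :: real by (auto intro!: dvi)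
 qed (intro cnt)
 then obtain Kf where Kf: "!!v. C2g (%x. U x $. v) (%x. Hu x v) (Kf v)" by metis
 have "C1g (%x. W' (u x)) (%x. (-4 + 12*(u x)^2) $* U x)"
  by (rule C1g_compose[OF C2gD(1)[OF u] d]) (intro cnt)
 then have t: "C1g (%x. tr (Hu x)) (%x. (-4 + 12*(u x)^2) $* U x)" unfolding pde .
 have "tr (Kf e x) <= 8*(U x $. e)" for x
 proof -
  have "tr (Kf e x) = (-4 + 12*(u x)^2)*(U x $. e)" using third_derivative_swap[OF u Kf t, of e x] by simp
  also have "... <= 8*(U x $. e)" using mono_e[of x] u_sq[of x] sg_pos[of x] by (intro mrm) auto
  finally show ?thesis .
 qed
 with Kf show ?thesis by blast
qed

text \<open>An integral bound on \<open>- ln ze\<close> keeps the mean of \<open>U x $. e\<close>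
  over a unit ball away from 0, and \<open>weak_Harnack\<close> turns the mean into a bound at the
  centre.\<close>

lemma slope_near_interface:
 assumes n4: "DIM('a) >= 4" and C: "C > 0"
  and bd: "!!x0 dl. 0 < dl ==> dl < 1 ==> (LINT x|lborel. indicator (cball x0 1) x*(wt x*wd dl x)) <= C"
 shows "\<exists>c>0. \<forall>x. \<bar>z x\<bar> <= 1 --> ze x >= c"
proof -
 define m where "m = integral (cb::'a set) kr"
 have m: "m > 0" unfolding m_def by (rule kr_mass_pos)
 \<comment> \<open>With this value \<open>c5*m - C/mu2 = m\<close>. Hence the lower bound
   \<open>T*(c5 - wd dl x)\<close> for \<open>U x $. e\<close>, which comes from
   \<open>ln t <= t - 1\<close>, has mean at least \<open>T*m\<close> against the kernel.\<close>
 define c5 where "c5 = 1 + C/(mu2*m)"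
 define T where "T = exp (- c5) * sqrt mu2"
 have T: "T > 0" using mu2_pos by (simp add: T_def)
 have lnT: "ln T = - c5 + ln (sqrt mu2)" using mu2_pos by (simp add: T_def ln_mult)
 have krc: "continuous_on S (%x. kr (x - x0))" for S and x0 :: 'a
  by (intro cnt2[OF C1g_cont[OF C1g_kr, of UNIV]] cnt) auto
 have "ze x0 >= T*exp (-(8/12)) / sqrt 2" if z0: "\<bar>z x0\<bar> <= 1" for x0
 proof -
  have lev: "wt x >= mu2" if "x : cball x0 1" for x
   using z_lipschitz[of x x0] that z0 by (intro wt_lower) (simp add: dist_norm norm_minus_commute)
  have "continuous_on (cball x0 1) ze" by (rule C2gD(7)[OF C2g_ze])
  moreover have "cball x0 1 ~= {}" by simp
  ultimately obtain x1 where x1': "\<forall>x\<in>cball x0 1. ze x1 <= ze x"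
   using continuous_attains_inf[OF compact_cball] by blast
  then have x1: "!!x. x : cball x0 1 ==> ze x1 <= ze x" by blast
  \<comment> \<open>Since \<open>dl\<close> is at most the minimum of \<open>ze\<close> on the ball,
    \<open>wd dl\<close> underestimates \<open>- ln ze\<close> there by at most 1.\<close>
  define dl where "dl = min (1/2) (ze x1)"
  have d: "0 < dl" "dl < 1" "dl <= ze x1" using ze_pos[of x1] by (auto simp: dl_def)
  have d0: "dl >= 0" using d by simp
  note wf = wd_facts[OF d0]
  obtain Kf where Kf: "C2g (%x. U x $. e) (%x. Hu x e) Kf" "!!x. tr (Kf x) <= 8*(U x $. e)" using C2g_Ue by blast
  have cU: "continuous_on S (%x. U x $. e)" for S by (rule C2gD(7)[OF Kf(1)])
  have "integral cb (%y. kr y*(U (x0 + y) $. e)) <= exp (8/12)*(m*(U x0 $. e))"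
   unfolding m_def by (rule weak_Harnack[OF Kf(1) mono_e Kf(2)]) simp
  moreover have "integral cb (%y. kr y*(U (x0 + y) $. e)) = (LINT y|lborel. kr y*(U (x0 + y) $. e))"
   using kr_zero by (intro integral_cb_eq_LINT cnt C1g_cont[OF C1g_kr] cnt2[OF cU[of UNIV]]) auto
  moreover have "... = (LINT x|lborel. kr (x - x0)*(U x $. e))"
   using lborel_integral_shift[of "%x. kr (x - x0)*(U x $. e)" x0] krc cU by (simp add: continuous_on_mult add.commute)
  moreover have "(LINT x|lborel. T*(c5*kr (x - x0) - (1/mu2)*(indicator (cball x0 1) x*(wt x*wd dl x)))) <= (LINT x|lborel. kr (x - x0)*(U x $. e))"
   and "(LINT x|lborel. T*(c5*kr (x - x0) - (1/mu2)*(indicator (cball x0 1) x*(wt x*wd dl x)))) >= T*(c5*m - (1/mu2)*C)"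
  proof -
   have cs: "csupp (%x. kr (x - x0))"
   proof (rule csupp_outside_ball[of 1 x0])
    show "x ~: ball x0 1 ==> kr (x - x0) = 0" for x using kr_zero[of "x - x0"] by (simp add: dist_norm norm_minus_commute)
   qed simp
   have i1: "integrable lborel (%x. kr (x - x0))" by (rule integrable_csupp[OF krc cs])
   have i2: "integrable lborel (%x. kr (x - x0)*(U x $. e))"
    by (rule integrable_csupp[OF _ csupp_mult(1)[OF cs]]) (intro cnt krc cU)
   have i3: "integrable lborel (%x. indicator (cball x0 1) x*(wt x*wd dl x))"
    using borel_integrable_compact[of "cball x0 1" "%x. wt x*wd dl x"] wt_cont C2gD(7)[OF wf(1)]
    by (simp add: continuous_on_mult)
   have "(LINT x|lborel. kr (x - x0)) = m"
    using lborel_integral_shift[OF krc, of x0 x0] kr_zero C1g_cont[OF C1g_kr, of UNIV]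
    unfolding m_def by (subst integral_cb_eq_LINT) (auto simp: C1g_cont[OF C1g_kr])
   then have "(LINT x|lborel. T*(c5*kr (x - x0) - (1/mu2)*(indicator (cball x0 1) x*(wt x*wd dl x))))
     = T*(c5*m - (1/mu2)*(LINT x|lborel. indicator (cball x0 1) x*(wt x*wd dl x)))"
    using i1 i3 by simp
   also have "... >= T*(c5*m - (1/mu2)*C)"
   proof -
    have "(1/mu2)*(LINT x|lborel. indicator (cball x0 1) x*(wt x*wd dl x)) <= (1/mu2)*C"
     using mu2_pos bd[OF d(1,2), of x0] by (intro mlm) auto
    then show ?thesis using T by (intro mlm) auto
   qed
   finally show "(LINT x|lborel. T*(c5*kr (x - x0) - (1/mu2)*(indicator (cball x0 1) x*(wt x*wd dl x)))) >= T*(c5*m - (1/mu2)*C)" .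
   show "(LINT x|lborel. T*(c5*kr (x - x0) - (1/mu2)*(indicator (cball x0 1) x*(wt x*wd dl x)))) <= (LINT x|lborel. kr (x - x0)*(U x $. e))"
   proof (rule integral_mono)
    show "integrable lborel (%x. T*(c5*kr (x - x0) - (1/mu2)*(indicator (cball x0 1) x*(wt x*wd dl x))))"
     using i1 i3 by (intro integrable_mult_right Bochner_Integration.integrable_diff) auto
    fix x
    show "T*(c5*kr (x - x0) - (1/mu2)*(indicator (cball x0 1) x*(wt x*wd dl x))) <= kr (x - x0)*(U x $. e)"
    proof (cases "x : cball x0 1")
     case False
     then show ?thesis using kr_zero[of "x - x0"] by (simp add: dist_norm norm_minus_commute)
    next
     case True
     have kr1: "0 <= kr (x - x0)" "kr (x - x0) <= 1" by (auto simp: kr_def power_le_one)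
     define fj where "fj = U x $. e"
     have fj: "fj = sqrt 2 * sg x*ze x" "fj > 0" using mono_e[of x] by (auto simp: fj_def U_eq ze_def)
     have "sg x = sqrt (wt x)" using sg_pos[of x] by (simp add: wt_def)
     then have "sg x >= sqrt mu2" using lev[OF True] by simp
     then have l1: "ln (sg x) >= ln (sqrt mu2)" using mu2_pos sg_pos[of x] by simp
     have "ze x + dl <= 2*ze x" using x1[OF True] d by linarith
     then have "ln (ze x + dl) <= ln (2*ze x)" using ze_pos[of x] d by simp
     also have "... <= 1 + ln (ze x)" using ze_pos[of x] ln_le_minus_one[of 2] by (simp add: ln_mult)
     moreover have "ln (1 + dl) >= 0" using d by simp
     ultimately have l2: "- ln (ze x) <= wd dl x + 1" unfolding wd_def by linarith
     have "ln (fj/T) <= fj/T - 1" using fj T by (intro ln_le_minus_one) simp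
     moreover have "ln (fj/T) = ln (sqrt 2) + ln (sg x) + ln (ze x) - ln T"
      unfolding fj(1) using T sg_pos[of x] ze_pos[of x] by (simp add: ln_div ln_mult)
     moreover have "ln (sqrt 2) >= (0::real)" by simp
     ultimately have "c5 - wd dl x <= fj/T" using l1 l2 lnT by linarith
     then have "T*(c5 - wd dl x) <= fj" using T by (simp add: pos_le_divide_eq mult.commute)
     then have k1: "kr (x - x0)*(T*(c5 - wd dl x)) <= kr (x - x0)*fj" using kr1 by (intro mlm)
     have w0: "wd dl x >= 0" by (rule wf(4))
     have "kr (x - x0)*wd dl x <= 1*wd dl x" using kr1 w0 by (intro mrm)
     also have "1*wd dl x <= (1/mu2)*(wt x*wd dl x)" using lev[OF True] mu2_pos w0 by (simp add: field_simps mrm)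
     finally have "T*(kr (x - x0)*wd dl x) <= T*((1/mu2)*(wt x*wd dl x))" using T by (intro mlm) auto
     with k1 show ?thesis using True unfolding fj_def by (simp add: alg)
    qed
   qed (rule i2)
  qed
  moreover have "c5*m - (1/mu2)*C = m" using m mu2_pos by (simp add: c5_def field_simps)
  ultimately have "T*m <= exp (8/12)*(m*(U x0 $. e))" by simp
  then have "m*T <= m*(exp (8/12)*(U x0 $. e))" by (simp add: mult_ac)
  then have T1: "T <= exp (8/12)*(U x0 $. e)" using m by simp
  have "exp (-(8/12))*T <= exp (-(8/12))*(exp (8/12)*(U x0 $. e))" using T1 by (intro mlm) auto
  also have "... = U x0 $. e" by (simp add: mult.assoc[symmetric] exp_add[symmetric])
  also have "... = sqrt 2 * sg x0*ze x0" by (simp add: U_eq ze_def)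
  also have "... <= sqrt 2*1*ze x0" using sg_le[of x0] ze_pos[of x0] by (intro mrm mlm) auto
  finally show ?thesis by (simp add: divide_le_eq mult.commute)
 qed
 then show ?thesis using T by (intro exI[of _ "T*exp (-(8/12)) / sqrt 2"]) auto
qed

text \<open>By \<open>Mo_ze\<close> the function \<open>ze\<close> is a positive supersolution, so
  its smallest values should occur near the interface. The barrier supplies compactness:
  \<open>N\<close> grows like the distance, and a multiple of \<open>sn*z\<close>, on which
  \<open>Mo\<close> is at most -1 where \<open>|z| >= 1\<close>, compensates \<open>Mo\<close> of
  \<open>N\<close>.\<close>

lemma slope_everywhere:
 assumes c: "c > 0" and lev: "!!x. \<bar>z x\<bar> <= 1 ==> ze x >= c"
 shows "ze x >= c"
proof (cases "\<bar>z x\<bar> <= 1")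
 case False
 define sn where "sn = sgn (z x)"
 have sn: "sn = 1 | sn = -1" "sn*z x >= 1" using False by (auto simp: sn_def sgn_if)
 \<comment> \<open>This is \<open>sqrt (1 + y $. y)\<close>, written with \<open>ga\<close> so that
   \<open>C2g_radial\<close> provides its Hessian.\<close>
 define N where "N y = ga (-1/2) ((y - 0) $. (y - (0::'a)))" for y
 define gN where "gN y = (2*ga' (-1/2) ((y - 0) $. (y - (0::'a)))) $* (y - 0)" for y
 define HN where "HN y h = (2*ga' (-1/2) ((y - 0) $. (y - (0::'a)))) $* h + (4*ga'' (-1/2) ((y - 0) $. (y - 0))*((y - 0) $. h)) $* (y - 0)" for y h
 have CN: "C2g N gN HN" unfolding N_def[abs_def] gN_def[abs_def] HN_def[abs_def]
  by (rule C2g_radial[OF ga_DERIV ga'_DERIV]) (auto simp: ga''_def[abs_def] intro!: cnt)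
 have Nge: "N y >= norm y" "N y > 0" for y
 proof -
  have "N y = sqrt (1 + (norm y)^2)" by (simp add: N_def ga_def powr_half_sqrt nrm2)
  moreover have "norm y <= sqrt (1 + (norm y)^2)" by (rule real_le_rsqrt) simp
  moreover have "sqrt (1 + (norm y)^2) > 0" by (simp add: add_pos_nonneg)
  ultimately show "N y >= norm y" "N y > 0" by auto
 qed
 have MN: "Mo gN HN y <= real DIM('a) + 6" for y
 proof -
  define k1 where "k1 = 2*ga' (-1/2) (y $. y)"
  define s where "s = 1 + y $. y"
  have s: "s >= 1" by (simp add: s_def)
  have "k1 = s powr (- (1/2))" by (simp add: k1_def ga'_def s_def)
  also have "... = 1 / sqrt s" using s powr_minus_divide[of s "1/2"] powr_half_sqrt[of s] by simp
  finally have k1: "k1 = 1 / sqrt s" .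
  have k01: "0 <= k1" "k1 <= 1" using s by (auto simp: k1)
  have t: "tr (HN y) <= k1*real DIM('a)"
  proof -
   have "tr (HN y) = k1*real DIM('a) + 4*ga'' (-1/2) (y $. y)*(y $. y)"
    by (simp add: HN_def[abs_def] tr_add tr_scale tr_id tr_rank1' k1_def)
   moreover have "4*ga'' (-1/2) (y $. y)*(y $. y) <= 0" by (simp add: ga''_def mnn)
   ultimately show ?thesis by linarith
  qed
  have "norm (gN y) = k1*norm y" using k01 by (simp add: gN_def k1_def)
  also have "... <= 1"
  proof -
   have "norm y <= sqrt s" by (rule real_le_rsqrt) (simp add: s_def nrm2)
   then show ?thesis using s by (simp add: k1 divide_le_eq)
  qed
  finally have g1: "norm (gN y) <= 1" .
  have "\<bar>u y*(Z y $. gN y)\<bar> <= 1*(1*1)" unfolding abs_mult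
  proof (intro mult_mono)
   show "\<bar>u y\<bar> <= 1" using u_bound[of y] by simp
   show "\<bar>Z y $. gN y\<bar> <= 1*1" using CS2[of "Z y" "gN y"] norm_Z[of y] g1 mult_mono[of "norm (Z y)" 1 "norm (gN y)" 1] by simp
  qed auto
  then have "- (4 * sqrt 2*(u y*(Z y $. gN y))) <= 4 * sqrt 2*1"
   unfolding mult_minus_right[symmetric] by (intro mlm) auto
  moreover have "sqrt 2 <= 3/2" by (rule real_le_lsqrt) (simp_all add: pow2)
  then have "4 * sqrt 2 <= (6::real)" by simp
  moreover have "k1*real DIM('a) <= 1*real DIM('a)" using k01 by (intro mrm) auto
  moreover have "Mo gN HN y = tr (HN y) - 4 * sqrt 2*(u y*(Z y $. gN y))" by (simp only: Mo_def mult.assoc)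
  ultimately show ?thesis using t by linarith
 qed
 \<comment> \<open>One more than the bound in \<open>MN\<close>, so that \<open>Mo\<close> of the
   barrier is at most \<open>- evq\<close>.\<close>
 define A where "A = real DIM('a) + 7"
 have "ze x + evq*(N x + A*(sn*z x)) >= c" if ep: "evq > 0" for evq
 proof (rule ccontr)
  assume neg: "\<not> ze x + evq*(N x + A*(sn*z x)) >= c"
  define f where "f y = (-1)*ze y + (- evq)*(N y + (A * sn)*z y)" for y
  define g where "g y = (-1) $* B y e + (- evq) $* (gN y + (A * sn) $* Z y)" for y
  define H where "H y h = (-1) $* K e y h + (- evq) $* (HN y h + (A * sn) $* B y h)" for y h
  have Cf: "C2g f g H" unfolding f_def[abs_def] g_def[abs_def] H_def[abs_def]
   by (intro C2g_add C2g_cmult C2g_ze CN C2g_z)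
  have Mf: "Mo g H y = (-1)*Mo (%x. B x e) (K e) y + (- evq)*(Mo gN HN y + (A * sn)*Mo Z B y)" for y
   unfolding g_def[abs_def] H_def[abs_def] by (simp only: Mo_add Mo_cmult)
  have fx: "f x > - c" using neg by (simp add: f_def alg)
  have small: "norm y < c/evq" if "sn*z y >= 1" "f y > - c" for y
  proof -
   have "A*(sn*z y) >= 0" using that by (simp add: A_def)
   then have "norm y <= N y + A*(sn*z y)" using Nge(1)[of y] by linarith
   then have "evq*norm y <= evq*(N y + A*(sn*z y))" using ep by (intro mlm) auto
   also have "... < c" using that(2) ze_pos[of y] by (simp add: f_def mult.assoc)
   finally show ?thesis using ep by (simp add: pos_less_divide_eq mult.commute)
  qed
  define S where "S = {y. sn*z y >= 1} \<inter> cball 0 (c/evq)"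
  have "closed {y. sn*z y >= 1}" by (intro closed_Collect_le cnt z_cont)
  then have "compact S" unfolding S_def by (intro closed_Int_compact) auto
  moreover have "x : S" using small[OF sn(2) fx] sn by (simp add: S_def)
  ultimately obtain y0 where y0: "y0 : S" "!!y. y : S ==> f y <= f y0"
   using continuous_attains_sup[of S f] C2gD(7)[OF Cf] by blast
  have fy: "f y0 > - c" using y0(2)[OF \<open>x : S\<close>] fx by simp
  have s0: "sn*z y0 >= 1" using y0(1) by (simp add: S_def)
  have "sn*z y0 ~= 1"
  proof
   assume e1: "sn*z y0 = 1"
   then have "\<bar>z y0\<bar> <= 1" using sn(1) by auto
   then have "ze y0 >= c" by (rule lev)
   moreover have "evq*(N y0 + A*(sn*z y0)) >= 0" using ep Nge(2)[of y0] by (intro mnn) (auto simp: e1 A_def)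
   ultimately show False using fy by (simp add: f_def mult.assoc)
  qed
  then have s1: "sn*z y0 > 1" using s0 by simp
  define V where "V = {y. sn*z y > 1} \<inter> ball 0 (c/evq)"
  have oV: "open V" unfolding V_def by (intro open_Int open_Collect_less cnt z_cont open_ball)
  have yV: "y0 : V" using s1 small[OF s0 fy] by (simp add: V_def)
  have "V \<subseteq> S" unfolding V_def S_def by auto
  then have "Mo g H y0 <= 0" using Mo_max(2)[OF Cf oV yV] y0(2) by blast
  moreover have "Mo g H y0 > 0"
  proof -
   have "\<bar>z y0\<bar> >= 1" using s1 sn(1) by auto
   from u_ge_half[OF this] have su: "sn*u y0 >= 1/2" using sn(1) s1 by (auto simp: zero_le_mult_iff)
   have q: "0 <= Q y0" "Q y0 <= 1" using Modica Q_le by auto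
   have "(sn*u y0)*(2 - Q y0) >= (1/2)*1" using su q by (intro mult_mono) auto
   then have "2 * sqrt 2*((sn*u y0)*(2 - Q y0)) >= 2 * sqrt 2*(1/2)" by (intro mlm) auto
   moreover have "sqrt 2 >= (1::real)" by simp
   moreover have "sn*Mo Z B y0 = - (2 * sqrt 2*((sn*u y0)*(2 - Q y0)))" unfolding Mo_z by (simp add: alg)
   ultimately have "sn*Mo Z B y0 <= -1" by linarith
   from mlm[OF this, of A] have "A * sn*Mo Z B y0 <= - A" by (simp add: A_def mult.assoc)
   then have "Mo gN HN y0 + A * sn*Mo Z B y0 <= -1" using MN[of y0] by (simp add: A_def)
   from mlm[OF this, of evq] have "evq*(Mo gN HN y0 + A * sn*Mo Z B y0) <= - evq" using ep by simp
   moreover have "4 * sg y0*Q y0*ze y0 >= 0" using sg_pos[of y0] q ze_pos[of y0] by (intro mnn) auto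
   ultimately show ?thesis unfolding Mf Mo_ze using ep by simp
  qed
  ultimately show False by simp
 qed
 note lim = this
 show ?thesis
 proof (rule field_le_epsilon)
  fix et :: real assume "et > 0"
  define M where "M = N x + A*(sn*z x)"
  have "M > 0" using Nge(2)[of x] sn by (simp add: M_def A_def add_pos_nonneg)
  then show "c <= ze x + et" using lim[of "et/M"] \<open>et > 0\<close> unfolding M_def[symmetric] by simp
 qed
qed (rule lev)

theorem slope_lower_bound:
 assumes n4: "DIM('a) >= 4" and a: "a > 0" and k: "k > 0" and CE: "CE > 0"
  and EB: "!!R. R > 1 ==> mB (%_. 1) 0 R <= CE*R^(DIM('a) - 1)"
  and cf: "!!M. \<exists>R\<ge>M. conf a k R"
 shows "\<exists>c>0. \<forall>x. ze x >= c"
proof -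
 obtain C where "C > 0" "!!x0 dl. 0 < dl ==> dl < 1 ==> (LINT x|lborel. indicator (cball x0 1) x*(wt x*wd dl x)) <= C"
  using log_slope_integral_bound[OF n4 a k CE EB cf] by blast
 from slope_near_interface[OF n4 this] obtain c where "c > 0" "!!x. \<bar>z x\<bar> <= 1 ==> ze x >= c" by blast
 with slope_everywhere[OF this] show ?thesis by blast
qed

end

section \<open>Flatness of the interface at large scales\<close>

lemma lborel_integral_affine:
 fixes f :: "'a::euclidean_space => real"
 assumes f: "f : borel_measurable borel" and c: "c > 0"
 shows "(LINT x|lborel. f x) = c^DIM('a)*(LINT x|lborel. f (t + c $* x))"
proof -
 have "(LINT x|lborel. f x) = (LINT x|density (distr lborel borel (%x. t + c $* x)) (%_. ennreal (\<bar>c\<bar>^DIM('a))). f x)"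
  using lborel_affine[of c t] c by simp
 also have "... = (LINT x|distr lborel borel (%x. t + c $* x). (c^DIM('a)) $* f x)"
  using f c by (subst integral_density) auto
 also have "... = (LINT x|lborel. (c^DIM('a)) $* f (t + c $* x))"
  using f by (subst integral_distr) auto
 finally show ?thesis by simp
qed

text \<open>The primitive of a quadratic B-spline supported in \<open>[0, 3/2]\<close>.\<close>
definition Gs :: "real => real" where
 "Gs t = ((max 0 (2*t))^3 - 3*(max 0 (2*t - 1))^3 + 3*(max 0 (2*t - 2))^3 - (max 0 (2*t - 3))^3)/6"
definition Gs1 :: "real => real" where
 "Gs1 t = (max 0 (2*t))^2 - 3*(max 0 (2*t - 1))^2 + 3*(max 0 (2*t - 2))^2 - (max 0 (2*t - 3))\<^sup>2"
definition Gs2 :: "real => real" where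
 "Gs2 t = 4*(max 0 (2*t) - 3*max 0 (2*t - 1) + 3*max 0 (2*t - 2) - max 0 (2*t - 3))"

lemma Gs_DERIV: "(Gs has_real_derivative Gs1 t) (at t)" and Gs1_DERIV: "(Gs1 has_real_derivative Gs2 t) (at t)"
proof -
 have l: "((%t. 2*t - a) has_real_derivative 2) (at t)" for a :: real by (auto intro!: dvi)
 have 3: "((%t. (max 0 (2*t - a))^3) has_real_derivative (3*(max 0 (2*t - a))^2)*2) (at t)" for a :: real
  using DERIV_chain2[OF DERIV_pos_part_power[of 1] l[of a]] by (simp add: eval_nat_numeral)
 have 2: "((%t. (max 0 (2*t - a))^2) has_real_derivative (2*max 0 (2*t - a))*2) (at t)" for a :: real
  using DERIV_chain2[OF DERIV_pos_part_power[of 0] l[of a]] by (simp add: eval_nat_numeral)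
 have 30: "((%t. (max 0 (2*t))^3) has_real_derivative (3*(max 0 (2*t))^2)*2) (at t)" using 3[of 0] by simp
 have 20: "((%t. (max 0 (2*t))^2) has_real_derivative (2*max 0 (2*t))*2) (at t)" using 2[of 0] by simp
 have "(Gs has_real_derivative ((3*(max 0 (2*t))^2)*2 - 3*((3*(max 0 (2*t - 1))^2)*2) + 3*((3*(max 0 (2*t - 2))^2)*2) - (3*(max 0 (2*t - 3))^2)*2)/6) (at t)"
  unfolding Gs_def[abs_def] by (intro DERIV_cdivide DERIV_diff DERIV_add DERIV_cmult 3 30)
 then show "(Gs has_real_derivative Gs1 t) (at t)" by (rule back_subst[where P="%d. (Gs has_real_derivative d) (at t)"]) (simp add: Gs1_def)
 have "(Gs1 has_real_derivative ((2*max 0 (2*t))*2 - 3*((2*max 0 (2*t - 1))*2) + 3*((2*max 0 (2*t - 2))*2) - (2*max 0 (2*t - 3))*2)) (at t)"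
  unfolding Gs1_def[abs_def] by (intro DERIV_diff DERIV_add DERIV_cmult 2 20)
 then show "(Gs1 has_real_derivative Gs2 t) (at t)" by (simp add: Gs2_def)
qed

lemma Gs2_cont: "continuous_on S Gs2" unfolding Gs2_def[abs_def] by (intro cnt)
lemma Gs1_cont: "continuous_on S Gs1" unfolding Gs1_def[abs_def] by (intro cnt)

lemma Gs_outside: "t <= 0 ==> Gs t = 0 & Gs1 t = 0" "t >= 3/2 ==> Gs t = 1 & Gs1 t = 0"
 by (simp_all add: Gs_def Gs1_def) (simp add: pow2 power3_eq_cube alg)

lemma Gs1_bounds: "0 <= Gs1 t" "Gs1 t <= 3"
proof -
 define s where "s = 2*t"
 consider "s <= 0" | "0 <= s" "s <= 1" | "1 <= s" "s <= 2" | "2 <= s" "s <= 3" | "3 <= s" by linarith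
 then have "0 <= Gs1 t & Gs1 t <= 3"
 proof cases
  case 1
  then show ?thesis using Gs_outside(1)[of t] by (simp add: s_def)
 next
  case 2
  then have "Gs1 t = s^2" by (simp add: Gs1_def s_def)
  moreover have "s^2 <= 1" using 2 by (simp add: power_le_one)
  ultimately show ?thesis by simp
 next
  case 3
  then have "Gs1 t = 1 + 2*((s - 1)*(2 - s))" by (simp add: Gs1_def s_def pow2 alg)
  moreover have "0 <= (s - 1)*(2 - s)" "(s - 1)*(2 - s) <= 1*1" using 3 by (intro mnn mult_mono; simp)+
  ultimately show ?thesis by simp
 next
  case 4
  then have "Gs1 t = (3 - s)^2" by (simp add: Gs1_def s_def pow2 alg)
  moreover have "(3 - s)^2 <= 1" using 4 by (simp add: power_le_one)
  ultimately show ?thesis by simp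
 next
  case 5
  then show ?thesis using Gs_outside(2)[of t] by (simp add: s_def)
 qed
 then show "0 <= Gs1 t" "Gs1 t <= 3" by auto
qed

lemma Gs_bounds: "0 <= Gs t" "Gs t <= 1"
proof -
 have mono: "Gs a <= Gs b" if "a <= b" for a b
  using DERIV_nonneg_imp_nondecreasing[OF that, of Gs] Gs_DERIV Gs1_bounds(1) by blast
 show "0 <= Gs t" using mono[of "min t 0" t] Gs_outside(1)[of "min t 0"] by simp
 show "Gs t <= 1" using mono[of t "max t (3/2)"] Gs_outside(2)[of "max t (3/2)"] by simp
qed

context ac
begin

text \<open>\<open>curvature_mass\<close> is applied to \<open>- ln ze - Q/4\<close>. The slope
  bound makes this function bounded, with gradient controlled by \<open>be\<close>; in
  \<open>Mo\<close> the terms with \<open>sg*Q\<close> add up to something nonnegative, so the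
  \<open>(be x)^2/2\<close> from Bochner's formula survives.\<close>

lemma curvature_ball_bound:
 assumes n4: "DIM('a) >= 4" and c0: "c0 > 0" "!!x. ze x >= c0" and CE: "CE > 0"
  and EB: "!!R. R > 1 ==> mB (%_. 1) 0 R <= CE*R^(DIM('a) - 1)"
 shows "\<exists>C. \<forall>R\<ge>1. (LINT x|lborel. indicator (ball 0 R) x*(wt x*(ga kk (x $. x)*(be x)^2))) <= C"
proof -
 define w where "w x = wd 0 x + (-1/4)*Q x" for x
 define g where "g x = gd 0 x + (-1/4) $* ((-2) $* B x (Z x))" for x
 define H where "H x h = Hd 0 x h + (-1/4) $* HQ x h" for x h
 have Cw: "C2g w g H" unfolding w_def[abs_def] g_def[abs_def] H_def[abs_def]
  by (intro C2g_add C2g_cmult wd_facts(1) C2g_Q) simp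
 have Mw: "Mo g H x >= (be x)^2/2" for x
 proof -
  have "Mo g H x = Mo (gd 0) (Hd 0) x + (-1/4)*Mo (%x. (-2) $* B x (Z x)) HQ x"
   unfolding g_def[abs_def] H_def[abs_def] by (simp only: Mo_add Mo_cmult)
  also have "... = 4 * sg x*Q x + gd 0 x $. gd 0 x - 2 * sg x*(1 - Q x)*Q x + (be x)^2/2"
   unfolding wd_facts(2)[of 0, simplified] Mo_Q using ze_pos[of x] by (simp add: alg)
  also have "... = 2*(sg x*Q x) + 2*(sg x*(Q x)^2) + gd 0 x $. gd 0 x + (be x)^2/2"
   by (simp add: alg pow2)
  also have "... >= (be x)^2/2" using sg_pos[of x] Modica[of x] by simp
  finally show ?thesis .
 qed
 have c1: "c0 <= 1" using c0(2)[of 0] ze_le[of 0] by linarith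
 have wb: "\<bar>w x\<bar> <= 1 - ln c0" for x
 proof -
  have "wd 0 x = - ln (ze x)" by (simp add: wd_def)
  moreover have "ln c0 <= ln (ze x)" "ln (ze x) <= 0" using c0 ze_le[of x] ze_pos[of x] by auto
  ultimately show ?thesis unfolding w_def using Modica[of x] Q_le[of x] by auto
 qed
 have gb: "norm (g x) <= (1 / c0 + 1) * be x" for x
 proof -
  have "norm (g x) <= norm (gd 0 x) + norm ((-1/4) $* ((-2) $* B x (Z x)))" unfolding g_def by (rule norm_triangle_ineq)
  also have "... = norm (B x e)/ze x + norm (B x (Z x))/2" using ze_pos[of x] by (simp add: gd_def)
  also have "... <= be x / c0 + be x"
  proof (intro add_mono frac_le)
   show "norm (B x e) <= be x" using norm_B[of x e] norm_e by simp
   have "be x*norm (Z x) <= be x*1" using norm_Z[of x] be_nonneg[of x] by (intro mlm) auto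
   then show "norm (B x (Z x))/2 <= be x" using norm_B[of x "Z x"] be_nonneg[of x] by linarith
  qed (use c0 be_nonneg in auto)
  finally show ?thesis by (simp add: alg)
 qed
 define C where "C = (8100*(1 / c0 + 1)^2 + 432*(1 - ln c0))*nn^3"
 have C: "C >= 0" unfolding C_def using c0(1) c1 ln_le_minus_one[OF c0(1)] nn4[OF n4] by (intro mnn add_nonneg_nonneg) auto
 have "(LINT x|lborel. indicator (ball 0 R) x*(wt x*(ga kk (x $. x)*(be x)^2))) <= 4*(C*CE)" if R: "R >= 1" for R
 proof -
  have cga: "continuous_on UNIV (%x::'a. ga kk (x $. x))" unfolding ga_def by (intro cnt) (auto simp: add_nonneg_eq_0_iff)
  have G: "1 / c0 + 1 > 0" using c0 by (simp add: add_pos_pos)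
  have R2: "2*R >= 1" using R by simp
  note cm = curvature_mass[OF n4 Cw wb Mw gb G R2, of 0]
  have "(LINT x|lborel. indicator (ball 0 R) x*(wt x*(ga kk (x $. x)*(be x)^2))) <= (LINT x|lborel. 4*(wt x*(psi 0 (2*R) x*(be x)^2)))"
  proof (rule integral_mono)
   show "integrable lborel (%x. indicator (ball 0 R) x*(wt x*(ga kk (x $. x)*(be x)^2)))"
    by (intro integrable_ball[OF n4] cnt wt_cont be_cont cga)
   fix x
   show "indicator (ball 0 R) x*(wt x*(ga kk (x $. x)*(be x)^2)) <= 4*(wt x*(psi 0 (2*R) x*(be x)^2))"
   proof (cases "x : ball 0 R")
    case True
    define q where "q = (x $. x)/(2*R)^2"
    have "x $. x < R^2" using True sq_ball[of R x 0] R by (simp add: sq_def)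
    then have q: "0 <= q" "q <= 1/4" using R by (auto simp: q_def pmd divide_le_eq)
    have "q^DIM('a) <= q^1" using q n4 by (intro power_decreasing) auto
    then have "3/4 <= 1 - q^DIM('a)" using q by simp
    then have "(3/4)^3 <= gb DIM('a) ((2*R)^2) (x $. x)" unfolding gb_def gq_def q_def[symmetric] by (intro power_mono) auto
    then have "1 <= 4*gb DIM('a) ((2*R)^2) (x $. x)" by (simp add: power3_eq_cube)
    from mlm[OF this, of "ga kk (x $. x)"] ga_pos[of "x $. x" kk]
    have "ga kk (x $. x) <= 4*psi 0 (2*R) x" by (simp add: psi_def gr_def sq_def)
    from mrm[OF this, of "wt x*(be x)^2"] wt_pos[of x]
    show ?thesis using True by (simp add: mult_ac)
   next
    case False
    then show ?thesis using wt_pos[of x] psi_nonneg[of 0 "2*R" x] by simp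
   qed
  qed (use cm(2) in simp)
  also have "... <= 4*(C*(lam (2*R)*mB (%_. 1) 0 (2*R)))" using cm(1) unfolding C_def by simp
  also have "... <= 4*(C*(lam (2*R)*(CE*(2*R)^(DIM('a) - 1))))"
   using C lam_pos[of "2*R"] R EB[of "2*R"] by (intro mlm) auto
  also have "... = 4*(C*CE*(lam (2*R)*(2*R)^(DIM('a) - 1)))" by (simp only: mult_ac)
  also have "... = 4*(C*CE)" using lam_eq[of "2*R"] R by simp
  finally show ?thesis .
 qed
 then show ?thesis by blast
qed

text \<open>The weighted integrals increase with the radius and are bounded, so beyond a fixed
  \<open>rh\<close> they grow by less than \<open>t\<close>. Removing the weight there costs the
  factor \<open>P\<close>, of order \<open>R^(n-3)\<close>; the fixed part inside \<open>rh\<close>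
  is absorbed because n - 3 is at least 1.\<close>

lemma curvature_decay:
 assumes n4: "DIM('a) >= 4" and c0: "c0 > 0" "!!x. ze x >= c0" and CE: "CE > 0"
  and EB: "!!R. R > 1 ==> mB (%_. 1) 0 R <= CE*R^(DIM('a) - 1)" and xj: "xj > 0"
 shows "\<exists>R0\<ge>1. \<forall>R\<ge>R0. (LINT x|lborel. indicator (ball 0 R) x*(wt x*(be x)^2)) <= xj*R^(DIM('a) - 3)"
proof -
 define f where "f x = wt x*(ga kk (x $. x)*(be x)^2)" for x
 define A where "A R = (LINT x|lborel. indicator (ball 0 R) x*f x)" for R
 have cga: "continuous_on UNIV (%x::'a. ga kk (x $. x))" unfolding ga_def by (intro cnt) (auto simp: add_nonneg_eq_0_iff)
 have cf: "continuous_on UNIV f" unfolding f_def[abs_def] by (intro cnt wt_cont be_cont cga)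
 obtain C where C: "!!R. R >= 1 ==> A R <= C" using curvature_ball_bound[OF n4 c0 CE EB] unfolding A_def f_def by blast
 define S where "S = (SUP R\<in>{1..}. A R)"
 have bdd: "bdd_above (A ` {1..})" using C by (intro bdd_aboveI[of _ C]) auto
 have k0: "kk >= 0" using kk(1)[OF n4] by simp
 define t where "t = xj/(2*2 powr kk)"
 have t: "t > 0" using xj by (simp add: t_def)
 have "\<exists>rh\<in>{1..}. S - t < A rh" using less_cSUP_iff[OF _ bdd, of "S - t"] t unfolding S_def by auto
 then obtain rh where rh: "rh >= 1" "S - t < A rh" by auto
 define D where "D = (LINT x|lborel. indicator (ball 0 rh) x*(wt x*(be x)^2))"
 have c2: "continuous_on UNIV (%x. wt x*(be x)^2)" by (intro cnt wt_cont be_cont)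
 have "(LINT x|lborel. indicator (ball 0 R) x*(wt x*(be x)^2)) <= xj*R^(DIM('a) - 3)" if R: "R >= max rh (2*D/xj)" for R
 proof -
  have R1: "R >= 1" "R >= rh" "2*D/xj <= R" using R rh by auto
  define P where "P = (1 + R^2) powr kk"
  have P: "P > 0" using zero_le_power2[of R] unfolding P_def powr_gt_zero by linarith
  have "(LINT x|lborel. indicator (ball 0 R) x*(wt x*(be x)^2)) \<le>
    (LINT x|lborel. indicator (ball 0 rh) x*(wt x*(be x)^2) + P*(indicator (ball 0 R) x*f x - indicator (ball 0 rh) x*f x))"
  proof (rule integral_mono)
   show "integrable lborel (%x. indicator (ball 0 R) x*(wt x*(be x)^2))" by (rule integrable_ball[OF n4 c2])
   show "integrable lborel (%x. indicator (ball 0 rh) x*(wt x*(be x)^2) + P*(indicator (ball 0 R) x*f x - indicator (ball 0 rh) x*f x))"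
    by (intro Bochner_Integration.integrable_add Bochner_Integration.integrable_diff integrable_mult_right integrable_ball[OF n4] c2 cf)
   fix x :: 'a
   have f0: "f x >= 0" unfolding f_def using wt_pos[of x] ga_pos[of "x $. x" kk] by (simp add: less_imp_le)
   show "indicator (ball 0 R) x*(wt x*(be x)^2) <= indicator (ball 0 rh) x*(wt x*(be x)^2) + P*(indicator (ball 0 R) x*f x - indicator (ball 0 rh) x*f x)"
   proof (cases "x : ball 0 R & x ~: ball 0 rh")
    case True
    have "x $. x < R^2" using True sq_ball[of R x 0] R1 by (simp add: sq_def)
    then have "(1 + x $. x) powr kk <= P" unfolding P_def using k0 by (intro powr_mono2) auto
    moreover have "(1 + x $. x) powr kk*ga kk (x $. x) = 1"
     using inner_ge_zero[of x] unfolding ga_def by (subst powr_add[symmetric]) (simp add: add_nonneg_eq_0_iff)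
    ultimately have "1 <= P*ga kk (x $. x)" using ga_pos[of "x $. x" kk] mrm[of "(1 + x $. x) powr kk" P "ga kk (x $. x)"] by simp
    from mrm[OF this, of "wt x*(be x)^2"] wt_pos[of x] have "wt x*(be x)^2 <= P*f x" by (simp add: f_def mult_ac)
    with True show ?thesis by simp
   next
    case False
    then show ?thesis using R1 f0 P wt_pos[of x] by (auto simp: indicator_def)
   qed
  qed
  also have "... = D + P*(A R - A rh)" unfolding D_def A_def
   by (subst Bochner_Integration.integral_add)
    (auto simp: integrable_ball[OF n4 cf] integrable_ball[OF n4 c2] intro!: integrable_mult_right Bochner_Integration.integrable_diff)
  also have "... <= xj/2*R^(DIM('a) - 3) + 2 powr kk*R^(DIM('a) - 3)*t"
  proof (intro add_mono mult_mono)
   have "D <= xj/2*R" using R1(3) xj by (simp add: divide_le_eq mult.commute)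
   also have "R <= R^(DIM('a) - 3)" using power_increasing[of 1 "DIM('a) - 3" R] R1 n4 by simp
   finally show "D <= xj/2*R^(DIM('a) - 3)" using xj by simp
   have "A R <= S" unfolding S_def using R1 bdd by (intro cSUP_upper) auto
   then show "A R - A rh <= t" using rh by linarith
   have "1 + R^2 <= 2*R^2" using R1 by simp
   then have "P <= (2*R^2) powr kk" unfolding P_def using k0 by (intro powr_mono2) auto
   also have "... = 2 powr kk*(R^2) powr kk" by (simp add: powr_mult)
   also have "(R^2) powr kk = (R powr 2) powr kk" using R1 by (simp add: powr_numeral)
   also have "... = R powr (2*kk)" by (rule powr_powr)
   also have "2*kk = real (DIM('a) - 3)" using n4 by (simp add: kk_def nn_def of_nat_diff)
   also have "R powr ... = R^(DIM('a) - 3)" using R1 by (simp add: powr_realpow)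
   finally show "P <= 2 powr kk*R^(DIM('a) - 3)" by simp
   show "0 <= A R - A rh" unfolding A_def
   proof -
    have "(LINT x|lborel. indicator (ball 0 rh) x*f x) <= (LINT x|lborel. indicator (ball 0 R) x*f x)"
    proof (rule integral_mono[OF integrable_ball[OF n4 cf] integrable_ball[OF n4 cf]])
     fix x :: 'a
     have "f x >= 0" unfolding f_def using wt_pos[of x] ga_pos[of "x $. x" kk] by (simp add: less_imp_le)
     then show "indicator (ball 0 rh) x*f x <= indicator (ball 0 R) x*f x" using R1 by (auto simp: indicator_def)
    qed
    then show "0 <= (LINT x|lborel. indicator (ball 0 R) x*f x) - (LINT x|lborel. indicator (ball 0 rh) x*f x)" by simp
   qed
  qed (use R1 in auto)
  also have "... = xj*R^(DIM('a) - 3)" by (simp add: t_def)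
  finally show ?thesis .
 qed
 then show ?thesis using rh by (intro exI[of _ "max rh (2*D/xj)"]) auto
qed

text \<open>Young's inequality with weight \<open>k/R\<close> balances the energy, of order
  \<open>R^(n-1)\<close>, against the squared curvature, which is small compared with
  \<open>R^(n-3)\<close>.\<close>

lemma curvature_first_moment:
 assumes n4: "DIM('a) >= 4" and c0: "c0 > 0" "!!x. ze x >= c0" and CE: "CE > 0"
  and EB: "!!R. R > 1 ==> mB (%_. 1) 0 R <= CE*R^(DIM('a) - 1)" and xj: "xj > 0"
 shows "\<exists>R0\<ge>1. \<forall>R\<ge>R0. (LINT x|lborel. indicator (ball 0 R) x*(wt x * be x)) <= xj*R^(DIM('a) - 2)"
proof -
 define k where "k = xj/(2*CE)"
 have k: "k > 0" using xj CE by (simp add: k_def)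
 obtain R0 where R0: "R0 >= 1" and d: "!!R. R >= R0 ==> (LINT x|lborel. indicator (ball 0 R) x*(wt x*(be x)^2)) <= 2*k*xj*R^(DIM('a) - 3)"
  using curvature_decay[OF n4 c0 CE EB, of "2*k*xj"] k xj by auto
 have "(LINT x|lborel. indicator (ball 0 R) x*(wt x * be x)) <= xj*R^(DIM('a) - 2)" if R: "R >= R0 + 1" for R
 proof -
  have R1: "R > 1" "R >= R0" using R R0 by auto
  have i1: "integrable lborel (%x. indicator (ball 0 R) x*(wt x*1))" "integrable lborel (%x. indicator (ball 0 R) x*(wt x*(be x)^2))"
   by (intro integrable_ball[OF n4] cnt wt_cont be_cont)+
  have "(LINT x|lborel. indicator (ball 0 R) x*(wt x * be x)) <= (LINT x|lborel. (k/R)*(indicator (ball 0 R) x*(wt x*1)) + (R/(4*k))*(indicator (ball 0 R) x*(wt x*(be x)^2)))"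
  proof (rule integral_mono)
   show "integrable lborel (%x. indicator (ball 0 R) x*(wt x * be x))" by (intro integrable_ball[OF n4] cnt wt_cont be_cont)
   fix x :: 'a
   have "0 <= (R/(4*k))*(be x - 2*k/R)^2" using R1 k by simp
   also have "... = (R/(4*k))*(be x)^2 - be x + k/R" using R1 k by (simp add: pow2 field_simps)
   finally have "be x <= k/R + (R/(4*k))*(be x)^2" by simp
   from mlm[OF this, of "indicator (ball 0 R) x*wt x"] wt_pos[of x]
   show "indicator (ball 0 R) x*(wt x * be x) <= (k/R)*(indicator (ball 0 R) x*(wt x*1)) + (R/(4*k))*(indicator (ball 0 R) x*(wt x*(be x)^2))"
    by (simp add: indicator_def alg)
  qed (use i1 in \<open>auto intro!: Bochner_Integration.integrable_add\<close>)
  also have "... = (k/R)*mB (%_. 1) 0 R + (R/(4*k))*(LINT x|lborel. indicator (ball 0 R) x*(wt x*(be x)^2))"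
   unfolding mB_def[OF n4] using i1 by simp
  also have "... <= (k/R)*(CE*R^(DIM('a) - 1)) + (R/(4*k))*(2*k*xj*R^(DIM('a) - 3))"
   using R1 k by (intro add_mono mlm EB d) auto
  also have "... = xj*R^(DIM('a) - 2)"
  proof -
   have e1: "R^(DIM('a) - 1) = R*R^(DIM('a) - 2)" "R^(DIM('a) - 2) = R*R^(DIM('a) - 3)"
   proof -
    have "DIM('a) = (DIM('a) - 3) + 3" using n4 by simp
    then obtain q where "DIM('a) = q + 3" by blast
    then show "R^(DIM('a) - 1) = R*R^(DIM('a) - 2)" "R^(DIM('a) - 2) = R*R^(DIM('a) - 3)" by (simp_all add: numeral_eq_Suc)
   qed
   show ?thesis unfolding e1(1) unfolding e1(2) using R1 k CE by (simp add: k_def field_simps)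
  qed
  finally show ?thesis .
 qed
 then show ?thesis using R0 by (intro exI[of _ "R0 + 1"]) auto
qed

text \<open>Integration along the line replaces the implicit function whose graph is a level set:
  derivatives of \<open>hF\<close> are integrals with explicit integrands, and no level has to be
  solved for.\<close>

definition hF :: "real => 'a => real" where "hF X x = integral (cbox (- X) X) (%t. 1*Gs (z (x + t $* e)))"
definition gF :: "real => 'a => 'a" where "gF X x = integral (cbox (- X) X) (%t. 1 $* (Gs1 (z (x + t $* e)) $* Z (x + t $* e)))"
definition HF :: "real => 'a => 'a => 'a" where
 "HF X x h = integral (cbox (- X) X) (%t. 1 $* (Gs1 (z (x + t $* e)) $* B (x + t $* e) h + (Gs2 (z (x + t $* e))*(Z (x + t $* e) $. h)) $* Z (x + t $* e)))"
definition kF :: "'a => real" where "kF y = Gs1 (z y) * be y"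

lemma C2g_hF: "C2g (hF X) (gF X) (HF X)"
 unfolding hF_def[abs_def] gF_def[abs_def] HF_def[abs_def]
 by (rule conv_C2g[OF C2g_compose[OF C2g_z Gs_DERIV Gs1_DERIV Gs2_cont]]) (intro cnt)+

lemma Gs1z_cont: "continuous_on S (%y. Gs1 (z y))"
 by (rule cnt2[OF Gs1_cont[of UNIV] z_cont]) auto

lemma kF_cont: "continuous_on S kF" unfolding kF_def[abs_def] by (intro cnt Gs1z_cont be_cont)

lemma kF_nonneg: "kF y >= 0" unfolding kF_def using Gs1_bounds(1) be_nonneg by simp

lemma kF_le: "kF y <= 3/mu2*(wt y * be y)"
proof (cases "\<bar>z y\<bar> <= 2")
 case True
 have "Gs1 (z y) <= 3/mu2*wt y"
 proof -
  have "3*mu2 <= 3*wt y" using wt_lower[OF True] by simp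
  then have "3 <= 3/mu2*wt y" using mu2_pos by (simp add: field_simps)
  then show ?thesis using Gs1_bounds(2)[of "z y"] by linarith
 qed
 from mrm[OF this be_nonneg[of y]] show ?thesis by (simp add: kF_def mult.assoc)
next
 case False
 then have "Gs1 (z y) = 0" using Gs_outside(1)[of "z y"] Gs_outside(2)[of "z y"] by (cases "z y <= 0") auto
 then show ?thesis using mu2_pos wt_pos[of y] be_nonneg[of y] by (simp add: kF_def)
qed

lemma on_line: "continuous_on UNIV f ==> continuous_on S (%t. f (x + t $* e))"
 by (rule cnt2) (auto intro!: cnt)

lemma line_FTC:
 assumes "C1g q g'" "X >= 0"
 shows "((%t. g' (x + t $* e) $. e) has_integral (q (x + X $* e) - q (x + (- X) $* e))) (cbox (- X) X)"
 unfolding cbox_interval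
 by (rule fundamental_theorem_of_calculus)
  (use assms(2) C1g_DERIV[OF assms(1), of x e] in \<open>auto simp: has_real_derivative_iff_has_vector_derivative has_vector_derivative_at_within\<close>)

context
 fixes c0 :: real
 assumes c0: "c0 > 0" "!!x. ze x >= c0"
begin

lemma z_line_le:
 assumes "s <= t"
 shows "z (x + s $* e) + c0*(t - s) <= z (x + t $* e)"
proof -
 have "z (x + s $* e) - c0 * s <= z (x + t $* e) - c0*t"
 proof (rule DERIV_nonneg_imp_nondecreasing[OF assms])
  fix r
  have "((%t. z (x + t $* e) - c0*t) has_real_derivative (Z (x + r $* e) $. e - c0*1)) (at r)"
   by (intro DERIV_diff C1g_DERIV[OF C2gD(1)[OF C2g_z]] DERIV_cmult DERIV_ident)
  then show "\<exists>y. ((%t. z (x + t $* e) - c0*t) has_real_derivative y) (at r) & 0 <= y" using c0(2)[of "x + r $* e"] by (auto simp: ze_def)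
 qed
 then show ?thesis by (simp add: alg)
qed

lemma gF_inner:
 "gF X x $. v = integral (cbox (- X) X) (%t. Gs1 (z (x + t $* e))*(Z (x + t $* e) $. v))"
proof -
 have "(%t. 1 $* (Gs1 (z (x + t $* e)) $* Z (x + t $* e))) integrable_on (cbox (- X) X)"
  by (intro icn cnt on_line[OF Gs1z_cont] on_line[OF Z_cont])
 from integral_linear[OF this bounded_linear_inner_left[of v]] show ?thesis by (simp add: gF_def comp_def)
qed

text \<open>The slope bound gives \<open>|Z $. v| <= norm v / c0 * ze\<close>, and the line integral
  of \<open>Gs1 z * ze\<close> is a difference of values of \<open>Gs\<close>, hence at most
  1.\<close>

lemma gF_facts:
 assumes X: "X >= 0"
 shows "norm (gF X x) <= 1 / c0" "z (x + X $* e) >= 3/2 ==> z (x + (- X) $* e) <= 0 ==> gF X x $. e = 1"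
proof -
 have C: "C1g (%x. Gs (z x)) (%x. Gs1 (z x) $* Z x)" by (rule C1g_compose[OF C2gD(1)[OF C2g_z] Gs_DERIV Gs1_cont])
 note hi = line_FTC[OF C X, of x]
 have ee: "gF X x $. e = Gs (z (x + X $* e)) - Gs (z (x + (- X) $* e))"
  unfolding gF_inner using integral_unique[OF hi] by (simp add: mult.commute)
 then show "z (x + X $* e) >= 3/2 ==> z (x + (- X) $* e) <= 0 ==> gF X x $. e = 1" using Gs_outside by simp
 have e1: "gF X x $. e <= 1" unfolding ee using Gs_bounds(2)[of "z (x + X $* e)"] Gs_bounds(1)[of "z (x + (- X) $* e)"] by linarith
 have "\<bar>gF X x $. v\<bar> <= norm v / c0" for v
 proof -
  have "norm (gF X x $. v) <= integral (cbox (- X) X) (%t. (norm v / c0)*(Gs1 (z (x + t $* e))*(Z (x + t $* e) $. e)))"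
   unfolding gF_inner
  proof (rule Henstock_Kurzweil_Integration.integral_norm_bound_integral)
   show "(%t. Gs1 (z (x + t $* e))*(Z (x + t $* e) $. v)) integrable_on cbox (- X) X"
    "(%t. (norm v / c0)*(Gs1 (z (x + t $* e))*(Z (x + t $* e) $. e))) integrable_on cbox (- X) X"
    by (intro icn cnt on_line[OF Gs1z_cont] on_line[OF Z_cont])+
   fix t
   define y where "y = x + t $* e"
   have "\<bar>Z y $. v\<bar> <= norm (Z y)*norm v" by (rule CS2)
   also have "... <= 1*norm v" using norm_Z[of y] by (intro mrm) auto
   also have "1*norm v <= norm v / c0*ze y" using mlm[OF c0(2)[of y], of "norm v / c0"] c0(1) by simp
   finally have "\<bar>Z y $. v\<bar> <= norm v / c0*ze y" .
   from mlm[OF this Gs1_bounds(1)[of "z y"]]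
   show "norm (Gs1 (z (x + t $* e))*(Z (x + t $* e) $. v)) <= (norm v / c0)*(Gs1 (z (x + t $* e))*(Z (x + t $* e) $. e))"
    unfolding y_def[symmetric] ze_def using Gs1_bounds(1)[of "z y"] by (simp add: abs_mult mult_ac)
  qed
  also have "... = norm v / c0*(gF X x $. e)" unfolding gF_inner by (simp add: integral_mult_right)
  also have "... <= norm v / c0*1" using e1 c0(1) by (intro mlm) auto
  finally show ?thesis by simp
 qed
 from this[of "gF X x"] have "(norm (gF X x))^2 <= (1 / c0)*norm (gF X x)" by (simp add: nrm2)
 then have "norm (gF X x)*norm (gF X x) <= (1 / c0)*norm (gF X x)" by (simp add: pow2)
 then show "norm (gF X x) <= 1 / c0" using c0(1) mult_right_le_imp_le[of "norm (gF X x)" "norm (gF X x)" "1 / c0"] by (cases "gF X x = 0") auto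
qed

text \<open>The Hessian of \<open>hF\<close> contains \<open>Gs2 z * (Z $. h)^2\<close>, which is
  not a curvature. Up to terms with \<open>B\<close> it is the derivative of \<open>q\<close> along
  \<open>e\<close>, so integration along the line trades it for curvature; the conditions at the end
  points make \<open>q\<close> vanish there.\<close>

lemma HF_bound:
 assumes X: "X >= 0" and b: "z (x + X $* e) >= 3/2" "z (x + (- X) $* e) <= 0"
 shows "\<bar>HF X x h $. h\<bar> <= (1 + 1 / c0)^2*(norm h)^2*integral (cbox (- X) X) (%t. kF (x + t $* e))"
proof -
 define q where "q y = Gs1 (z y)*((Z y $. h)*((Z y $. h)*(1/ze y)))" for y
 define p where "p y = 2*(Z y $. h)*(B y h $. e)/ze y - (Z y $. h)\<^sup>2*(B y e $. e)/(ze y)^2" for y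
 have Ci: "C1g (%y. 1/ze y) (%y. (- (1/(ze y)^2)) $* B y e)"
 proof (rule C1g_compose[OF C2gD(1)[OF C2g_ze]])
  fix y show "((%s. 1 / s) has_real_derivative - (1/(ze y)^2)) (at (ze y))"
   using ze_pos[of y] by (auto intro!: dvi simp: pow2)
  have "s ~= 0" if "s : range ze" for s using that ze_pos by (metis rangeE less_irrefl)
  then show "continuous_on (range ze) (%s. - (1 / s^2))" by (intro cnt) auto
 qed
 have CG: "C1g (%y. Gs1 (z y)) (%y. Gs2 (z y) $* Z y)" by (rule C1g_compose[OF C2gD(1)[OF C2g_z] Gs1_DERIV Gs2_cont])
 note CZ = C2gD(1)[OF C2g_Zv[of h]]
 note Cq = C1g_mult[OF CG C1g_mult[OF CZ C1g_mult[OF CZ Ci]]]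
 have hi: "((%t. Gs2 (z (x + t $* e))*(Z (x + t $* e) $. h)^2 + Gs1 (z (x + t $* e))*p (x + t $* e)) has_integral 0) (cbox (- X) X)"
 proof -
  have "q (x + X $* e) = 0" "q (x + (- X) $* e) = 0" using Gs_outside b by (simp_all add: q_def)
  with line_FTC[OF Cq X, of x, folded q_def] have "((%t. (Gs1 (z (x + t $* e)) $* ((Z (x + t $* e) $. h) $* ((Z (x + t $* e) $. h) $* (- (1/(ze (x + t $* e))^2)) $* B (x + t $* e) e + (1/ze (x + t $* e)) $* B (x + t $* e) h)
    + ((Z (x + t $* e) $. h)*(1/ze (x + t $* e))) $* B (x + t $* e) h)
    + ((Z (x + t $* e) $. h)*((Z (x + t $* e) $. h)*(1/ze (x + t $* e)))) $* (Gs2 (z (x + t $* e)) $* Z (x + t $* e))) $. e) has_integral 0) (cbox (- X) X)"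
   by simp
  then show ?thesis
  proof (rule has_integral_eq[rotated])
   fix t
   define y where "y = x + t $* e"
   have "Z y $. e = ze y" "ze y ~= 0" using ze_pos[of y] by (auto simp: ze_def)
   then show "(Gs1 (z (x + t $* e)) $* ((Z (x + t $* e) $. h) $* ((Z (x + t $* e) $. h) $* (- (1/(ze (x + t $* e))^2)) $* B (x + t $* e) e + (1/ze (x + t $* e)) $* B (x + t $* e) h)
    + ((Z (x + t $* e) $. h)*(1/ze (x + t $* e))) $* B (x + t $* e) h)
    + ((Z (x + t $* e) $. h)*((Z (x + t $* e) $. h)*(1/ze (x + t $* e)))) $* (Gs2 (z (x + t $* e)) $* Z (x + t $* e))) $. e
    = Gs2 (z (x + t $* e))*(Z (x + t $* e) $. h)^2 + Gs1 (z (x + t $* e))*p (x + t $* e)"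
    unfolding y_def[symmetric] p_def by (simp only: inner_add_left inner_scaleR_left) (simp add: pow2 field_simps)
  qed
 qed
 have Hc: "continuous_on UNIV (%y. B y h)" by (rule C2gD(4)[OF C2g_z])
 have i0: "(%t. 1 $* (Gs1 (z (x + t $* e)) $* B (x + t $* e) h + (Gs2 (z (x + t $* e))*(Z (x + t $* e) $. h)) $* Z (x + t $* e))) integrable_on (cbox (- X) X)"
  by (intro icn cnt on_line[OF Gs1z_cont] on_line[OF Z_cont] on_line[OF Hc]
    on_line[OF cnt2[OF Gs2_cont[of UNIV] z_cont]]) auto
 from integrable_integral[OF integrable_linear[OF i0 bounded_linear_inner_left[of h]]] integral_linear[OF i0 bounded_linear_inner_left[of h]]
 have h1: "((%t. Gs1 (z (x + t $* e))*(B (x + t $* e) h $. h) + Gs2 (z (x + t $* e))*(Z (x + t $* e) $. h)^2) has_integral (HF X x h $. h)) (cbox (- X) X)"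
  by (simp add: HF_def comp_def inner_add_left pow2 mult.assoc)
 from has_integral_diff[OF this hi]
 have h2: "((%t. Gs1 (z (x + t $* e))*(B (x + t $* e) h $. h - p (x + t $* e))) has_integral (HF X x h $. h)) (cbox (- X) X)"
  by (simp add: alg)
 have kc: "(%t. kF (x + t $* e)) integrable_on (cbox (- X) X)" by (intro icn on_line[OF kF_cont])
 have "norm (HF X x h $. h) <= integral (cbox (- X) X) (%t. (1 + 1 / c0)^2*(norm h)^2*kF (x + t $* e))"
  unfolding integral_unique[OF h2, symmetric]
 proof (rule Henstock_Kurzweil_Integration.integral_norm_bound_integral)
  show "(%t. Gs1 (z (x + t $* e))*(B (x + t $* e) h $. h - p (x + t $* e))) integrable_on cbox (- X) X" using h2 by blast
  show "(%t. (1 + 1 / c0)^2*(norm h)^2*kF (x + t $* e)) integrable_on cbox (- X) X" using integrable_cmul[OF kc, of "(1 + 1 / c0)^2*(norm h)^2"] by simp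
  fix t
  define y where "y = x + t $* e"
  define a where "a = norm h"
  have zy: "ze y > 0" "c0 <= ze y" using ze_pos c0(2) by auto
  have Bb: "\<bar>B y k $. l\<bar> <= be y*(norm k*norm l)" for k l
   using CS2[of "B y k" l] mrm[OF norm_B[of y k] norm_ge_zero[of l]] by (simp add: mult.assoc)
  have Zh: "\<bar>Z y $. h\<bar> <= a" using CS2[of "Z y" h] mrm[OF norm_Z[of y] norm_ge_zero[of h]] by (simp add: a_def)
  have "\<bar>B y h $. h - p y\<bar> <= \<bar>B y h $. h\<bar> + (2*(\<bar>Z y $. h\<bar>*\<bar>B y h $. e\<bar>)*(1/ze y) + (\<bar>Z y $. h\<bar>)^2*\<bar>B y e $. e\<bar>*(1/(ze y)^2))"
  proof -
   have "\<bar>p y\<bar> <= \<bar>2*(Z y $. h)*(B y h $. e)/ze y\<bar> + \<bar>(Z y $. h)^2*(B y e $. e)/(ze y)^2\<bar>" unfolding p_def by (rule abs_triangle_ineq4)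
   also have "... = 2*(\<bar>Z y $. h\<bar>*\<bar>B y h $. e\<bar>)*(1/ze y) + (\<bar>Z y $. h\<bar>)^2*\<bar>B y e $. e\<bar>*(1/(ze y)^2)"
    using zy by (simp add: abs_mult)
   finally show ?thesis by linarith
  qed
  also have "... <= be y*(a * a) + (2*(a*(be y * a))*(1 / c0) + a^2 * be y*(1 / c0^2))"
  proof (intro add_mono mult_mono mlm power_mono)
   show "\<bar>B y h $. h\<bar> <= be y*(a * a)" using Bb[of h h] by (simp add: a_def)
   show "\<bar>B y h $. e\<bar> <= be y * a" using Bb[of h e] by (simp add: a_def norm_e)
   show "\<bar>B y e $. e\<bar> <= be y" using Bb[of e e] by (simp add: norm_e)
   show "1/ze y <= 1 / c0" using zy c0 by (simp add: frac_le)
   have "c0^2 <= (ze y)^2" using zy c0 by (intro power_mono) auto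
   then show "1/(ze y)^2 <= 1 / c0^2" using c0 by (intro frac_le) auto
  qed (use Zh zy be_nonneg[of y] in \<open>auto simp: a_def\<close>)
  also have "... = (1 + 1 / c0)^2 * a^2 * be y" using c0(1) by (simp add: pow2 field_simps)
  finally have "\<bar>B y h $. h - p y\<bar> <= (1 + 1 / c0)^2 * a^2 * be y" .
  from mlm[OF this Gs1_bounds(1)[of "z y"]]
  show "norm (Gs1 (z (x + t $* e))*(B (x + t $* e) h $. h - p (x + t $* e))) <= (1 + 1 / c0)^2*(norm h)^2*kF (x + t $* e)"
   unfolding y_def[symmetric] a_def kF_def using Gs1_bounds(1)[of "z y"] by (simp add: abs_mult mult_ac)
 qed
 also have "... = (1 + 1 / c0)^2*(norm h)^2*integral (cbox (- X) X) (%t. kF (x + t $* e))" by (simp add: integral_mult_right)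
 finally show ?thesis by simp
qed

text \<open>At distance \<open>s\<close> from \<open>x\<close> along the line the slope bound has
  driven \<open>z\<close> out of the transition range of \<open>Gs\<close>, which is therefore 0
  below and 1 above.\<close>

lemma hF_value:
 assumes X: "(\<bar>z x\<bar> + 3/2) / c0 <= X"
 shows "\<bar>X - hF X x\<bar> <= (\<bar>z x\<bar> + 3/2) / c0"
proof -
 define s where "s = (\<bar>z x\<bar> + 3/2) / c0"
 have s: "0 <= s" "s <= X" "c0 * s = \<bar>z x\<bar> + 3/2" using X c0 by (auto simp: s_def)
 define f where "f t = Gs (z (x + t $* e))" for t
 have Gc: "continuous_on UNIV (%y. Gs (z y))" by (rule C1g_cont[OF C1g_compose[OF C2gD(1)[OF C2g_z] Gs_DERIV Gs1_cont]])
 have fi: "f integrable_on {a..b}" for a b unfolding f_def[abs_def] by (intro integrable_continuous_interval on_line[OF Gc])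
 have lo: "f t = 0" if "t : {-X..-s}" for t
 proof -
  have "c0*t <= c0*(- s)" using that c0(1) by (intro mlm) auto
  then have "c0*t <= - (\<bar>z x\<bar> + 3/2)" using s by simp
  then have "z (x + t $* e) <= 0" using z_line_le[of t 0 x] that s by (simp add: alg)
  then show ?thesis using Gs_outside(1) by (simp add: f_def)
 qed
 have hi: "f t = 1" if "t : {s..X}" for t
 proof -
  have "c0 * s <= c0*t" using that c0(1) by (intro mlm) auto
  then have "z (x + t $* e) >= 3/2" using z_line_le[of 0 t x] that s by simp
  then show ?thesis using Gs_outside(2) by (simp add: f_def)
 qed
 have "hF X x = integral {-X..X} f" by (simp add: hF_def f_def[abs_def] cbox_interval)
 also have "... = integral {-X..-s} f + (integral {-s..s} f + integral {s..X} f)"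
  using s by (simp add: Henstock_Kurzweil_Integration.integral_combine[OF _ _ fi])
 also have "integral {-X..-s} f = integral {-X..-s} (%_. 0)" by (rule Henstock_Kurzweil_Integration.integral_cong[OF lo])
 also have "integral {s..X} f = integral {s..X} (%_. 1)" by (rule Henstock_Kurzweil_Integration.integral_cong[OF hi])
 finally have e: "hF X x = integral {-s..s} f + (X - s)" using s by simp
 have "0 <= integral {-s..s} f" by (rule integral_nonneg[OF fi]) (simp add: f_def Gs_bounds)
 moreover have "integral {-s..s} f <= integral {-s..s} (%_. 1)" by (rule integral_le[OF fi]) (auto simp: f_def Gs_bounds)
 ultimately show ?thesis unfolding e s_def[symmetric] using s by simp
qed

lemma hF_lipschitz: "X >= 0 ==> \<bar>hF X a - hF X b\<bar> <= norm (a - b) / c0"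
proof -
 assume X: "X >= 0"
 obtain t where "hF X (b + 1 $* (a - b)) - hF X (b + 0 $* (a - b)) = (1 - 0)*(gF X (b + t $* (a - b)) $. (a - b))"
  using MVT2[of 0 1 "%t. hF X (b + t $* (a - b))", OF _ C1g_DERIV[OF C2gD(1)[OF C2g_hF]]] by auto
 then have "\<bar>hF X a - hF X b\<bar> <= norm (gF X (b + t $* (a - b)))*norm (a - b)"
  using CS2[of "gF X (b + t $* (a - b))" "a - b"] by simp
 also have "... <= 1 / c0*norm (a - b)" by (intro mrm gF_facts(1) X) auto
 finally show ?thesis by simp
qed

lemma taylor2:
 assumes f: "C2g f g H" and b: "!!t. 0 <= t ==> t <= 1 ==> \<bar>H (t $* x) x $. x\<bar> <= b"
 shows "\<bar>f x - f 0 - g 0 $. (x::'a)\<bar> <= b"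
proof -
 obtain t where t: "0 < t" "t < 1" "f (0 + 1 $* x) - f (0 + 0 $* x) = (1 - 0)*(g (0 + t $* x) $. x)"
  using MVT2[of 0 1 "%t. f (0 + t $* x)", OF _ C1g_DERIV[OF C2gD(1)[OF f]]] by auto
 obtain s where s: "0 < s" "s < t" "g (0 + t $* x) $. x - g (0 + 0 $* x) $. x = (t - 0)*(H (0 + s $* x) x $. x)"
  using MVT2[of 0 t "%t. g (0 + t $* x) $. x", OF t(1) C1g_DERIV[OF C2g_partial[OF f]]] by auto
 have "f x - f 0 - g 0 $. x = t*(H (s $* x) x $. x)" using s(3) t(3) by simp
 then have "\<bar>f x - f 0 - g 0 $. x\<bar> = t*\<bar>H (s $* x) x $. x\<bar>" using t by (simp add: abs_mult)
 also have "... <= 1 * b" using t s b[of s] by (intro mult_mono) auto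
 finally show ?thesis by simp
qed

lemma lin4: "\<bar>a - b - g\<bar> <= b1 ==> \<bar>p - q\<bar> <= b3 ==> \<bar>a - p\<bar> <= b2 ==> \<bar>b - q\<bar> <= b2 ==> \<bar>g\<bar> <= b1 + 2 * b2 + (b3::real)"
 by linarith

lemma kernel_mean_kF:
 assumes n4: "DIM('a) >= 4" and rh: "rh > 0" and R: "norm p + rh <= R"
 shows "integral cb (%y. kr y*kF (p + rh $* y)) <= (1/rh^DIM('a))*(3/mu2*(LINT x|lborel. indicator (ball 0 R) x*(wt x * be x)))"
proof -
 define f where "f x = kr ((1/rh) $* (x - p))*kF x" for x
 have krU: "continuous_on UNIV (kr :: 'a => real)" by (rule C1g_cont[OF C1g_kr])
 have cf: "continuous_on UNIV f" unfolding f_def[abs_def] by (intro cnt cnt2[OF krU] kF_cont) auto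
 have ec: "continuous_on UNIV (%y. kr y*kF (p + rh $* y))" by (intro cnt krU cnt2[OF kF_cont[of UNIV]]) auto
 have "integral cb (%y. kr y*kF (p + rh $* y)) = (LINT y|lborel. kr y*kF (p + rh $* y))"
  by (rule integral_cb_eq_LINT[OF ec]) (simp add: kr_zero)
 also have "... = (1/rh^DIM('a))*(LINT x|lborel. f x)"
  using lborel_integral_affine[of f rh p] cf rh by (simp add: f_def borel_measurable_continuous_onI)
 also have "... <= (1/rh^DIM('a))*(LINT x|lborel. 3/mu2*(indicator (ball 0 R) x*(wt x * be x)))"
 proof (intro mlm integral_mono)
  have z: "f x = 0" if "norm (x - p) >= rh" for x using that rh kr_zero[of "(1/rh) $* (x - p)"] by (simp add: f_def)
  have "csupp f" using z rh by (intro csupp_outside_ball[OF rh, of p]) (auto simp: dist_norm norm_minus_commute)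
  then show "integrable lborel f" by (rule integrable_csupp[OF cf])
  show "integrable lborel (%x. 3/mu2*(indicator (ball 0 R) x*(wt x * be x)))"
   by (intro integrable_mult_right integrable_ball[OF n4] cnt wt_cont be_cont)
  fix x
  show "f x <= 3/mu2*(indicator (ball 0 R) x*(wt x * be x))"
  proof (cases "norm (x - p) >= rh")
   case True
   then show ?thesis using z[OF True] mu2_pos wt_pos[of x] be_nonneg[of x] by simp
  next
   case False
   then have "norm x < R" using R norm_triangle_ineq[of p "x - p"] by simp
   moreover have "kr ((1/rh) $* (x - p))*kF x <= 1*kF x" using kF_nonneg by (intro mrm) (auto simp: kr_def power_le_one)
   ultimately show ?thesis using kF_le[of x] by (simp add: f_def)
  qed
 qed (use rh in auto)
 finally show ?thesis by simp
qed

text \<open>The heights \<open>X - hF X x\<close> of the level sets above \<open>x\<close>, averaged over the levels in \<open>[0, 3/2]\<close>, are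
 mollified at a small multiple of the scale \<open>r\<close>; the Hessian of the result is controlled pointwise by the
 mean curvature mass, so that it is almost affine.\<close>
lemma interface_flat:
 assumes n4: "DIM('a) >= 4" and CE: "CE > 0"
  and EB: "!!R. R > 1 ==> mB (%_. 1) 0 R <= CE*R^(DIM('a) - 1)"
 shows "\<exists>C>0. \<forall>xj>0. \<exists>R0\<ge>1. \<forall>r\<ge>R0. \<exists>nv. nv $. e = 1 & norm nv <= C & (\<forall>x. norm x <= r --> \<bar>nv $. x\<bar> <= xj*r + C*(\<bar>z x\<bar> + 1))"
proof -
 define C where "C = (\<bar>z 0\<bar> + 3) / c0 + 1 / c0"
 define m where "m = integral (cb::'a set) kr"
 have m: "m > 0" unfolding m_def by (rule kr_mass_pos)
 have C: "C > 0" "1 / c0 <= C" "(\<bar>z 0\<bar> + 3) / c0 <= C" using c0(1) by (auto simp: C_def add_nonneg_pos)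
 have krc: "continuous_on S (kr :: 'a => real)" for S by (rule C1g_cont[OF C1g_kr])
 have "\<exists>R0\<ge>1. \<forall>r\<ge>R0. \<exists>nv. nv $. e = 1 & norm nv <= C & (\<forall>x. norm x <= r --> \<bar>nv $. x\<bar> <= xj*r + C*(\<bar>z x\<bar> + 1))" if xj: "xj > 0" for xj
 proof -
  \<comment> \<open>The fraction of \<open>r\<close> at which \<open>hF\<close> is mollified. With
    the Lipschitz constant \<open>1 / c0\<close> the mollification errors at \<open>x\<close> and at
    0 together stay below \<open>xj/2*r\<close>, up to the kernel mass \<open>m\<close>.\<close>
  define l where "l = min 1 (xj * c0/4)"
  have l: "l > 0" "l <= 1" "2*l / c0 <= xj/2" using xj c0(1) by (auto simp: l_def min_def field_simps)
  define c3 where "c3 = 3 + 5 / c0"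
  have c3: "c3 >= 1" using c0(1) by (simp add: c3_def)
  \<comment> \<open>The product of the constant of \<open>HF_bound\<close>, the bound
    \<open>10*r / c0\<close> for the length of the lines, the factor \<open>3/mu2\<close> of
    \<open>kF_le\<close>, the power of the radius \<open>c3*r\<close> and the kernel at scale
    \<open>l*r\<close>, without the powers of \<open>r\<close>.\<close>
  define kp where "kp = (1 + 1 / c0)^2*(10 / c0)*(3/mu2) * c3^(DIM('a) - 2)/l^DIM('a)"
  have kp: "kp > 0" using c0(1) mu2_pos c3 l by (auto simp: kp_def intro!: divide_pos_pos mult_pos_pos zero_less_power add_pos_pos)
  define xj1 where "xj1 = xj*m/(2*kp)"
  have xj1: "xj1 > 0" using xj m kp by (simp add: xj1_def)
  obtain R1 where R1: "R1 >= 1" "!!R. R >= R1 ==> (LINT x|lborel. indicator (ball 0 R) x*(wt x * be x)) <= xj1*R^(DIM('a) - 2)"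
   using curvature_first_moment[OF n4 c0 CE EB xj1] by blast
  have "\<exists>nv. nv $. e = 1 & norm nv <= C & (\<forall>x. norm x <= r --> \<bar>nv $. x\<bar> <= xj*r + C*(\<bar>z x\<bar> + 1))" if r: "r >= max R1 (\<bar>z 0\<bar> + 2)" for r
  proof -
   have r1: "r >= 1" "r >= R1" "\<bar>z 0\<bar> + 2 <= r" "r > 0" using r R1 by auto
   \<comment> \<open>Long enough that, by the slope bound, every line through a point of norm at
     most \<open>2*r\<close> runs from \<open>z <= 0\<close> to \<open>z >= 3/2\<close>.\<close>
   define X where "X = (4*r + \<bar>z 0\<bar> + 2) / c0"
   have X: "X > 0" "c0*X = 4*r + \<bar>z 0\<bar> + 2" using c0(1) r1 by (auto simp: X_def add_pos_nonneg)
   have X5: "X <= 5*r / c0" unfolding X_def using r1 c0(1) by (intro divide_right_mono) auto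
   have X0: "X >= 0" using X by simp
   define rh where "rh = l*r"
   have rh: "rh > 0" "rh <= r" using l r1 by (auto simp: rh_def mult_left_le_one_le)
   have zb: "\<bar>z y\<bar> <= \<bar>z 0\<bar> + 2*r" if "norm y <= 2*r" for y using z_lipschitz[of y 0] that by simp
   have bc: "z (y + X $* e) >= 3/2" "z (y + (- X) $* e) <= 0" if "norm y <= 2*r" for y
    using z_line_le[of 0 X y] z_line_le[of "- X" 0 y] X zb[OF that] r1 by auto
   define hM where "hM x = integral cb (%y. kr y*hF X (x + rh $* y))" for x
   define gM where "gM x = integral cb (%y. kr y $* gF X (x + rh $* y))" for x
   define HM where "HM x h = integral cb (%y. kr y $* HF X (x + rh $* y) h)" for x h
   have CM: "C2g hM gM HM" unfolding hM_def[abs_def] gM_def[abs_def] HM_def[abs_def]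
    by (rule conv_C2g[OF C2g_hF krc]) (intro cnt)
   have shc: "continuous_on S (%y. f (x + rh $* y))" if "continuous_on UNIV f" for S x and f :: "'a => 'b::topological_space"
    by (rule cnt2[OF that]) (auto intro!: cnt)
   have near: "norm (x + rh $* y) <= 2*r" if "norm x <= r" "norm y <= 1" for x y :: 'a
   proof -
    have "norm (x + rh $* y) <= norm x + rh*norm y" using norm_triangle_ineq[of x "rh $* y"] rh by simp
    also have "... <= r + rh*1" using that rh by (intro add_mono mlm) auto
    finally show ?thesis using rh by simp
   qed
   have kr_or: "kr y = 0 | norm y <= 1" for y :: 'a using kr_zero[of y] by linarith
   have gi: "(%y. kr y $* gF X (x + rh $* y)) integrable_on cb" for x
    by (intro icn cnt krc shc C2gD(6)[OF C2g_hF])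
   have gMe: "gM 0 $. e = m"
   proof -
    have "gM 0 $. e = integral cb (%y. kr y*(gF X (0 + rh $* y) $. e))"
     unfolding gM_def using integral_linear[OF gi bounded_linear_inner_left[of e], of 0] by (simp add: comp_def)
    also have "... = m" unfolding m_def
    proof (rule Henstock_Kurzweil_Integration.integral_cong)
     fix y :: 'a
     show "kr y*(gF X (0 + rh $* y) $. e) = kr y"
      using kr_or[of y] gF_facts(2)[OF X0 bc] near[of 0 y] r1 by auto
    qed
    finally show ?thesis .
   qed
   have kri: "(%y. kr y * c) integrable_on (cb::'a set)" for c by (intro icn cnt krc)
   have gMn: "norm (gM 0) <= m*(1 / c0)"
   proof -
    have "norm (gM 0) <= integral (cb::'a set) (%y. kr y*(1 / c0))" unfolding gM_def
    proof (rule Henstock_Kurzweil_Integration.integral_norm_bound_integral[OF gi kri])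
     fix y :: 'a
     show "norm (kr y $* gF X (0 + rh $* y)) <= kr y*(1 / c0)"
      using mlm[OF gF_facts(1)[OF X0, of "0 + rh $* y"] kr_nonneg[of y]] kr_nonneg[of y] by simp
    qed
    also have "... = m*(1 / c0)" unfolding m_def by (rule integral_mult_left)
    finally show ?thesis .
   qed
   have HMb: "\<bar>HM y h $. h\<bar> <= m*(xj/2*r)" if y: "norm y <= r" and h: "norm h <= r" for y h
   proof -
    define D where "D = (1 + 1 / c0)^2*(norm h)^2"
    have D: "0 <= D" "D <= (1 + 1 / c0)^2*r^2" unfolding D_def using h by (auto intro!: mlm power_mono)
    define I where "I p = integral (cbox (- X) X) (%t. kF (p + t $* e))" for p
    have Ic: "continuous_on UNIV I" unfolding I_def[abs_def]
     by (rule integral_continuous_on_param) (auto simp: case_prod_beta' intro!: cnt2[OF kF_cont[of UNIV]] cnt)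
    have hi: "(%y'. kr y' $* HF X (y + rh $* y') h) integrable_on cb"
     by (intro icn cnt krc shc C2gD(4)[OF C2g_hF])
    \<comment> \<open>Exchanging the integrals turns mollified line integrals of curvature into ball
      means, one for each position \<open>t\<close> on the line, and \<open>kernel_mean_kF\<close>
      bounds them uniformly.\<close>
    have "integral cb (%y'. integral (cbox (- X) X) (%t. kr y'*kF (y + rh $* y' + t $* e)))
      = integral (cbox (- X) X) (%t. integral cb (%y'. kr y'*kF (y + rh $* y' + t $* e)))"
     by (rule integral_swap_continuous)
      (auto simp: case_prod_beta' intro!: cnt cnt2[OF kF_cont[of UNIV]] cnt2[OF krc[of UNIV]])
    also have "... <= integral (cbox (- X) X) (%t. (1/rh^DIM('a))*(3/mu2*(xj1*(c3*r)^(DIM('a) - 2))))"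
    proof (rule integral_le)
     show "(%t. integral cb (%y'. kr y'*kF (y + rh $* y' + t $* e))) integrable_on cbox (- X) X"
      by (intro icn integral_continuous_on_param)
       (auto simp: case_prod_beta' intro!: cnt cnt2[OF kF_cont[of UNIV]] cnt2[OF krc[of UNIV]])
     fix t assume t: "t : cbox (- X) X"
     have "norm (y + t $* e) <= r + X" using norm_triangle_ineq[of y "t $* e"] y t by (auto simp: norm_e)
     then have "norm (y + t $* e) + rh <= c3*r" using X5 rh r1 by (simp add: c3_def alg)
     from kernel_mean_kF[OF n4 rh(1) this]
     have "integral cb (%y'. kr y'*kF (y + rh $* y' + t $* e)) <= (1/rh^DIM('a))*(3/mu2*(LINT x|lborel. indicator (ball 0 (c3*r)) x*(wt x * be x)))"
      by (simp add: add_ac)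
     also have "... <= (1/rh^DIM('a))*(3/mu2*(xj1*(c3*r)^(DIM('a) - 2)))"
     proof (intro mlm R1(2))
      have "1*r <= c3*r" using c3 r1 by (intro mrm) auto
      then show "c3*r >= R1" using r1(2) by linarith
     qed (use rh mu2_pos in auto)
     finally show "integral cb (%y'. kr y'*kF (y + rh $* y' + t $* e)) <= (1/rh^DIM('a))*(3/mu2*(xj1*(c3*r)^(DIM('a) - 2)))" .
    qed (rule Henstock_Kurzweil_Integration.integrable_const)
    also have "... = (2*X)*((1/rh^DIM('a))*(3/mu2*(xj1*(c3*r)^(DIM('a) - 2))))" using X0 by simp
    finally have SL: "integral cb (%y'. integral (cbox (- X) X) (%t. kr y'*kF (y + rh $* y' + t $* e))) <= (2*X)*((1/rh^DIM('a))*(3/mu2*(xj1*(c3*r)^(DIM('a) - 2))))" .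
    have "\<bar>HM y h $. h\<bar> = norm (integral cb (%y'. kr y'*(HF X (y + rh $* y') h $. h)))"
     unfolding HM_def using integral_linear[OF hi bounded_linear_inner_left[of h]] by (simp add: comp_def)
    also have "... <= integral cb (%y'. D*(kr y'*I (y + rh $* y')))"
    proof (rule Henstock_Kurzweil_Integration.integral_norm_bound_integral)
     show "(%y'. kr y'*(HF X (y + rh $* y') h $. h)) integrable_on cb" using integrable_linear[OF hi bounded_linear_inner_left[of h]] by (simp add: comp_def)
     show "(%y'. D*(kr y'*I (y + rh $* y'))) integrable_on cb" by (intro icn cnt krc shc Ic)
     fix y' :: 'a
     show "norm (kr y'*(HF X (y + rh $* y') h $. h)) <= D*(kr y'*I (y + rh $* y'))"
     proof (cases "kr y' = 0")
      case False
      then have "norm (y + rh $* y') <= 2*r" using kr_or[of y'] near[OF y] by blast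
      from HF_bound[OF X0 bc[OF this], of h] have "\<bar>HF X (y + rh $* y') h $. h\<bar> <= D*I (y + rh $* y')" by (simp add: D_def I_def)
      from mlm[OF this kr_nonneg[of y']] show ?thesis using kr_nonneg[of y'] by (simp add: abs_mult mult_ac)
     qed simp
    qed
    also have "... = D*integral cb (%y'. integral (cbox (- X) X) (%t. kr y'*kF (y + rh $* y' + t $* e)))"
     unfolding I_def by (simp add: integral_mult_right)
    also have "... <= D*((2*X)*((1/rh^DIM('a))*(3/mu2*(xj1*(c3*r)^(DIM('a) - 2)))))"
     by (rule mlm[OF SL D(1)])
    also have "... <= ((1 + 1 / c0)^2*r^2)*((2*(5*r / c0))*((1/rh^DIM('a))*(3/mu2*(xj1*(c3*r)^(DIM('a) - 2)))))"
     using D X5 X0 rh mu2_pos xj1 c3 r1 by (intro mult_mono mrm) auto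
    also have "... = kp*xj1*r"
    proof -
     have "r^DIM('a) = r^2*r^(DIM('a) - 2)" 
     proof -
      have "2 + (DIM('a) - 2) = DIM('a)" using n4 by simp
      then show ?thesis using power_add[of r 2 "DIM('a) - 2"] by simp
     qed
     then show ?thesis unfolding rh_def kp_def pmd using r1 by (simp add: field_simps)
    qed
    also have "... = m*(xj/2*r)" using kp by (simp add: xj1_def)
    finally show ?thesis .
   qed
   have hMd: "\<bar>hM x - m*hF X x\<bar> <= m*(rh / c0)" for x
   proof -
    have i1: "(%y. kr y*hF X (x + rh $* y)) integrable_on cb" by (intro icn cnt krc shc C2gD(7)[OF C2g_hF])
    have "hM x - m*hF X x = integral cb (%y. kr y*hF X (x + rh $* y) - kr y*hF X x)"
     unfolding hM_def m_def using Henstock_Kurzweil_Integration.integral_diff[OF i1 kri[of "hF X x"]] by (simp add: integral_mult_left)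
    also have "norm ... <= integral (cb::'a set) (%y. kr y*(rh / c0))"
    proof (rule Henstock_Kurzweil_Integration.integral_norm_bound_integral[OF integrable_diff[OF i1 kri] kri])
     fix y :: 'a
     have "\<bar>hF X (x + rh $* y) - hF X x\<bar> <= rh*norm y / c0" using hF_lipschitz[OF X0, of "x + rh $* y" x] rh by simp
     then have "kr y*\<bar>hF X (x + rh $* y) - hF X x\<bar> <= kr y*(rh*norm y / c0)" using kr_nonneg by (intro mlm)
     also have "... <= kr y*(rh / c0)"
     proof (cases "kr y = 0")
      case False
      then have "norm y <= 1" using kr_or[of y] by blast
      then have "rh*norm y <= rh*1" using rh by (intro mlm) auto
      then show ?thesis using kr_nonneg[of y] c0(1) by (intro mlm divide_right_mono) auto
     qed simp
     finally show "norm (kr y*hF X (x + rh $* y) - kr y*hF X x) <= kr y*(rh / c0)"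
      using kr_nonneg[of y] by (simp add: abs_mult right_diff_distrib[symmetric])
    qed
    also have "... = m*(rh / c0)" unfolding m_def by (rule integral_mult_left)
    finally show ?thesis by simp
   qed
   define nv where "nv = (1/m) $* gM 0"
   have "nv $. e = 1" using gMe m by (simp add: nv_def)
   moreover have "norm nv <= C"
   proof -
    have "norm nv = norm (gM 0)/m" using m by (simp add: nv_def)
    also have "... <= 1 / c0" using gMn m by (simp add: divide_le_eq mult.commute)
    finally show ?thesis using C by simp
   qed
   moreover have "\<bar>nv $. x\<bar> <= xj*r + C*(\<bar>z x\<bar> + 1)" if x: "norm x <= r" for x
   proof -
    have "\<bar>hM x - hM 0 - gM 0 $. x\<bar> <= m*(xj/2*r)"
    proof (rule taylor2[OF CM])
     fix t :: real assume t: "0 <= t" "t <= 1"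
     have "norm (t $* x) <= r" using t x mult_left_le_one_le[of "norm x" t] by simp
     then show "\<bar>HM (t $* x) x $. x\<bar> <= m*(xj/2*r)" by (rule HMb[OF _ x])
    qed
    moreover have "\<bar>m*hF X x - m*hF X 0\<bar> <= m*((\<bar>z x\<bar> + 3/2) / c0 + (\<bar>z 0\<bar> + 3/2) / c0)"
    proof -
     have v: "(\<bar>z x\<bar> + 3/2) / c0 <= X" "(\<bar>z 0\<bar> + 3/2) / c0 <= X" unfolding X_def
      using zb[of x] x r1 c0(1) by (auto intro!: divide_right_mono)
     have "\<bar>hF X x - hF X 0\<bar> <= (\<bar>z x\<bar> + 3/2) / c0 + (\<bar>z 0\<bar> + 3/2) / c0" using hF_value[OF v(1)] hF_value[OF v(2)] by linarith
     from mlm[OF this, of m] m show ?thesis by (simp add: abs_mult right_diff_distrib[symmetric])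
    qed
    ultimately have "\<bar>gM 0 $. x\<bar> <= m*(xj/2*r) + 2*(m*(rh / c0)) + m*((\<bar>z x\<bar> + 3/2) / c0 + (\<bar>z 0\<bar> + 3/2) / c0)"
     using lin4 hMd[of x] hMd[of 0] by blast
    also have "... = m*(xj/2*r + 2*(rh / c0) + ((\<bar>z x\<bar> + 3/2) / c0 + (\<bar>z 0\<bar> + 3/2) / c0))" by (simp add: alg)
    finally have "\<bar>nv $. x\<bar> <= xj/2*r + 2*(rh / c0) + ((\<bar>z x\<bar> + 3/2) / c0 + (\<bar>z 0\<bar> + 3/2) / c0)"
     using m by (simp add: nv_def divide_le_eq mult.commute)
    moreover have "2*(rh / c0) <= xj/2*r" using mrm[OF l(3), of r] r1 by (simp add: rh_def mult_ac)
    moreover have "(\<bar>z x\<bar> + 3/2) / c0 + (\<bar>z 0\<bar> + 3/2) / c0 = (1 / c0)*\<bar>z x\<bar> + (\<bar>z 0\<bar> + 3) / c0" by (simp add: add_divide_distrib)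
    moreover have "(1 / c0)*\<bar>z x\<bar> <= C*\<bar>z x\<bar>" using C by (intro mrm) auto
    moreover have "xj/2*r + xj/2*r = xj*r" "C*(\<bar>z x\<bar> + 1) = C*\<bar>z x\<bar> + C" by (simp_all add: alg)
    ultimately show ?thesis using C(3) by linarith
   qed
   ultimately show ?thesis by blast
  qed
  then show ?thesis using R1 by (intro exI[of _ "max R1 (\<bar>z 0\<bar> + 2)"]) auto
 qed
 with C show ?thesis by blast
qed

end

end

section \<open>Rigidity\<close>

context ac
begin

lemma parallel_gradient_imp_one_dim:
 assumes w: "w ~= 0" and p: "!!x. \<exists>k. U x = k $* w"
 shows "one_dim u"
proof -
 define om where "om = (1/norm w) $* w"
 have n: "norm om = 1" using w by (simp add: om_def)
 have eq: "u x = u y" if "om $. x = om $. y" for x y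
 proof -
  obtain t where t: "u (x + 1 $* (y - x)) - u (x + 0 $* (y - x)) = (1 - 0)*(U (x + t $* (y - x)) $. (y - x))"
   using MVT2[of 0 1 "%t. u (x + t $* (y - x))", OF _ C1g_DERIV[OF C2gD(1)[OF u]]] by auto
  obtain k where "U (x + t $* (y - x)) = k $* w" using p by blast
  moreover have "w $. (y - x) = 0" using that w by (simp add: om_def inner_diff_right)
  ultimately show ?thesis using t by simp
 qed
 have h: "u x = u ((om $. x) $* om)" for x
  using n by (intro eq) (simp add: norm_eq_1)
 show ?thesis unfolding one_dim_def
  by (intro exI[of _ om] exI[of _ "%t. u (t $* om)"] conjI n allI h)
qed

text \<open>The operator \<open>L f = (sg ze)\<^sup>-\<^sup>2 div ((sg ze)\<^sup>2 grad f)\<close>, which annihilates the components of \<open>Z / ze\<close>.\<close>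
definition Lo :: "('a => 'a) => ('a => 'a => 'a) => 'a => real" where
 "Lo g H x = Mo g H x + 2/ze x*(B x e $. g x)"

lemma Lo_add: "Lo (%x. g x + g' x) (%x h. H x h + H' x h) x = Lo g H x + Lo g' H' x"
 by (simp add: Lo_def Mo_add inner_add_right alg)
lemma Lo_cmult: "Lo (%x. c $* g x) (%x h. c $* H x h) x = c*Lo g H x"
 by (simp add: Lo_def Mo_cmult alg)
lemma Lo_const: "Lo (%x. 0) (%x h. 0) x = 0" by (simp add: Lo_def Mo_const)
lemma Lo_mult:
 "Lo (%x. f x $* g' x + f' x $* g x)
   (%x h. f x $* H' x h + (g x $. h) $* g' x + f' x $* H x h + (g' x $. h) $* g x) x
  = f x*Lo g' H' x + f' x*Lo g H x + 2*(g x $. g' x)"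
 unfolding Lo_def Mo_mult by (simp add: inner_add_right alg)
lemma Lo_compose:
 "Lo (%x. k' (f x) $* g x) (%x h. k' (f x) $* H x h + (k'' (f x)*(g x $. h)) $* g x) x
  = k' (f x)*Lo g H x + k'' (f x)*(g x $. g x)"
 by (simp add: Lo_def Mo_compose alg)
lemma Lo_max:
 assumes "C2g f g H" "open S" "x : S" "!!y. y : S ==> f y <= f x"
 shows "Lo g H x <= 0"
 using Mo_max[OF assms] by (simp add: Lo_def)

section \<open>Subsolutions for the operator \<open>L\<close>\<close>

definition vv :: "'a => real" where "vv x = 1/ze x"
definition gv :: "'a => 'a" where "gv x = (- (1/(ze x)^2)) $* B x e"
definition Hv :: "'a => 'a => 'a" where
 "Hv x h = (- (1/(ze x)^2)) $* K e x h + ((2/(ze x)^3)*(B x e $. h)) $* B x e"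

lemma gv_eq: "gv x = (- (vv x)\<^sup>2) $* B x e" by (simp add: gv_def vv_def power_divide)
lemma vv_pos: "vv x > 0" using ze_pos[of x] by (simp add: vv_def)
lemma vv_ge: "vv x >= 1" using ze_pos[of x] ze_le[of x] by (simp add: vv_def)

lemma C2g_v: "C2g vv gv Hv"
 unfolding vv_def[abs_def] gv_def[abs_def] Hv_def[abs_def]
proof (rule C2g_compose[OF C2g_ze, of "%s. 1 / s" "%s. - (1 / s^2)" "%s. 2 / s^3"])
 fix x
 have z0: "ze x ~= 0" using ze_pos[of x] by simp
 show "((%s. 1 / s) has_real_derivative - (1/(ze x)^2)) (at (ze x))"
  using z0 by (auto intro!: dvi simp: pow2)
 show "((%s. - (1 / s^2)) has_real_derivative 2/(ze x)^3) (at (ze x))"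
  using z0 by (auto intro!: dvi simp: pow2 power3_eq_cube)
next
 have "s ~= 0" if "s : range ze" for s using that ze_pos by (metis rangeE less_irrefl)
 then show "continuous_on (range ze) (%s. 2 / s^3)" by (intro cnt) auto
qed

text \<open>The drift of \<open>Lo\<close> removes the squared gradient which composition with the
  convex function \<open>1 / s\<close> produces; only the zeroth order term of \<open>Mo_ze\<close>
  is left, with reversed sign.\<close>

lemma Lo_v: "Lo gv Hv x = 4 * sg x*Q x * vv x"
proof -
 have z0: "ze x ~= 0" using ze_pos[of x] by simp
 have "Mo gv Hv x = - (1/(ze x)^2)*Mo (%x. B x e) (K e) x + (2/(ze x)^3)*(B x e $. B x e)"
  unfolding gv_def[abs_def] Hv_def[abs_def] by (rule Mo_compose)
 then have "Lo gv Hv x = - (1/(ze x)^2)*(- 4 * sg x*Q x*ze x) + (2/(ze x)^3)*(B x e $. B x e)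
   + 2/ze x*(- (1/(ze x)^2)*(B x e $. B x e))"
  by (simp add: Lo_def gv_def Mo_ze)
 also have "... = 4 * sg x*Q x * vv x" using z0 by (simp add: vv_def pow2 power3_eq_cube)
 finally show ?thesis .
qed

lemma Lo_Q: "Lo (%x. (-2) $* B x (Z x)) HQ x = 8 * sg x*(1 - Q x)*Q x - 2*(be x)^2 - 4 * vv x*(B x e $. B x (Z x))"
 unfolding Lo_def Mo_Q by (simp add: vv_def)

lemma Lo_Zv: "Lo (%x. B x w) (K w) x = - 4 * sg x*Q x*(Z x $. w) + 2 * vv x*(B x e $. B x w)"
 unfolding Lo_def Mo_Zv by (simp add: vv_def)

lemma B_Z_bound: "norm (B x (Z x)) <= be x*norm (Z x)" "norm (B x e) <= be x" "norm (B x (Z x)) <= be x"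
 using norm_B[of x "Z x"] norm_B[of x e] norm_e mult_left_le[OF norm_Z be_nonneg, of x x] by auto

lemma uQ_le': "\<bar>u x\<bar>*Q x <= real DIM('a) * be x"
proof (rule power2_le_imp_le)
 have "1*1 <= real DIM('a)*real DIM('a)" using DIM_positive[where 'a='a] by (intro mult_mono) auto
 have "(\<bar>u x\<bar>*Q x)^2 <= 8*(u x)^2*(Q x)^2" by (simp add: pmd)
 also have "... <= real DIM('a)*(be x)^2" by (rule uQ_le)
 also have "... <= (real DIM('a))^2*(be x)^2" using DIM_positive[where 'a='a] by (intro mrm) (auto simp: pow2)
 finally show "(\<bar>u x\<bar>*Q x)^2 <= (real DIM('a) * be x)^2" by (simp add: pmd)
qed (use be_nonneg in simp)

text \<open>Since \<open>sg + u^2 = 1\<close>, either the weight \<open>sg\<close> sees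
  \<open>Q\<close>, or \<open>u\<close> is not small and curvature controls \<open>Q\<close> by
  \<open>uQ_le'\<close>. The absorbing term in the Bernstein argument handles both summands.\<close>

lemma Q_split: "Q x <= sg x*Q x + real DIM('a) * be x"
proof -
 have "\<bar>u x\<bar>*(\<bar>u x\<bar>*Q x) = (u x)^2*Q x" by (simp add: pow2 mult.assoc[symmetric])
 also have "... = Q x - sg x*Q x" unfolding u_sq by (simp add: alg)
 finally have "Q x - sg x*Q x = \<bar>u x\<bar>*(\<bar>u x\<bar>*Q x)" by simp
 also have "... <= 1*(real DIM('a) * be x)" using u_bound[of x] uQ_le'[of x] Modica[of x]
   mult_mono[of "\<bar>u x\<bar>" 1 "\<bar>u x\<bar>*Q x" "real DIM('a) * be x"] by simp
 finally show ?thesis by simp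
qed

text \<open>Expanded form of the squared distance between \<open>vv x $* Z x\<close> and
  \<open>w\<close>, so that the product rules for \<open>Lo\<close> apply; the compact form is
  \<open>fS_eq\<close>.\<close>

definition fS :: "'a => 'a => real" where
 "fS w x = (1 + (-1)*Q x)*(vv x * vv x) + ((-2)*((Z x $. w) * vv x) + w $. w)"

lemma fS_eq: "fS w x = (norm (vv x $* Z x - w))^2"
 unfolding fS_def nrm2 Q_def by (simp add: inner_diff_left inner_diff_right inner_commute alg)

text \<open>The components of \<open>vv x $* Z x\<close> are annihilated by \<open>Lo\<close>, which
  is the step \<open>L3\<close>. What is left of the squared distance is a quadratic form in the
  curvature, at least \<open>2 * v^2\<close> times the square of \<open>be x - v * (m*p)\<close> by
  Cauchy-Schwarz.\<close>

lemma fS_sub: "\<exists>g H. C2g (fS w) g H & (\<forall>x. Lo g H x >= 0)"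
proof -
 define gP where "gP x = 0 + (-1) $* ((-2) $* B x (Z x))" for x
 define HP where "HP x h = 0 + (-1) $* HQ x h" for x h
 have CP: "C2g (%x. 1 + (-1)*Q x) gP HP" unfolding gP_def[abs_def] HP_def[abs_def] by (intro C2g_add C2g_const C2g_cmult C2g_Q)
 define g2 where "g2 x = vv x $* gv x + vv x $* gv x" for x
 define H2 where "H2 x h = vv x $* Hv x h + (gv x $. h) $* gv x + vv x $* Hv x h + (gv x $. h) $* gv x" for x h
 have C2: "C2g (%x. vv x * vv x) g2 H2" unfolding g2_def[abs_def] H2_def[abs_def] by (rule C2g_mult[OF C2g_v C2g_v])
 define g3 where "g3 x = (Z x $. w) $* gv x + vv x $* B x w" for x
 define H3 where "H3 x h = (Z x $. w) $* Hv x h + (B x w $. h) $* gv x + vv x $* K w x h + (gv x $. h) $* B x w" for x h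
 have C3: "C2g (%x. (Z x $. w) * vv x) g3 H3" unfolding g3_def[abs_def] H3_def[abs_def] by (rule C2g_mult[OF C2g_Zv C2g_v])
 define g4 where "g4 x = (1 + (-1)*Q x) $* g2 x + (vv x * vv x) $* gP x" for x
 define H4 where "H4 x h = (1 + (-1)*Q x) $* H2 x h + (gP x $. h) $* g2 x + (vv x * vv x) $* HP x h + (g2 x $. h) $* gP x" for x h
 have C4: "C2g (%x. (1 + (-1)*Q x)*(vv x * vv x)) g4 H4" unfolding g4_def[abs_def] H4_def[abs_def] by (rule C2g_mult[OF CP C2])
 define g where "g x = g4 x + ((-2) $* g3 x + 0)" for x
 define H where "H x h = H4 x h + ((-2) $* H3 x h + 0)" for x h
 have Cf: "C2g (fS w) g H" unfolding fS_def[abs_def] g_def[abs_def] H_def[abs_def] by (intro C2g_add C2g_cmult C4 C3 C2g_const)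
 have "Lo g H x >= 0" for x
 proof -
  define s where "s = 4 * sg x*Q x"
  define v where "v = vv x"
  define b where "b = B x e $. B x e"
  define c where "c = B x e $. B x (Z x)"
  define d where "d = B x e $. B x w"
  have LP: "Lo gP HP x = - (8 * sg x*(1 - Q x)*Q x - 2*(be x)^2 - 4 * vv x*(B x e $. B x (Z x)))"
   unfolding gP_def[abs_def] HP_def[abs_def] by (simp only: Lo_add Lo_const Lo_cmult Lo_Q) simp
  have L2: "Lo g2 H2 x = 2 * s * v^2 + 2 * v ^ 4 * b"
   unfolding g2_def[abs_def] H2_def[abs_def] Lo_mult Lo_v by (simp add: gv_eq s_def v_def b_def pow2 eval_nat_numeral alg)
  have L3: "Lo g3 H3 x = 0"
   unfolding g3_def[abs_def] H3_def[abs_def] Lo_mult Lo_v Lo_Zv by (simp add: gv_eq pow2 inner_commute alg)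
  have gg: "gP x $. g2 x = - 4 * v ^ 3 * c"
   by (simp add: gP_def g2_def gv_eq v_def c_def inner_add_right inner_diff_right inner_commute pow2 power3_eq_cube)
  have L4: "Lo g4 H4 x = (1 - Q x)*Lo g2 H2 x + (v * v)*Lo gP HP x + 2*(gP x $. g2 x)"
   unfolding g4_def[abs_def] H4_def[abs_def] Lo_mult v_def by simp
  have "Lo g H x = Lo g4 H4 x" unfolding g_def[abs_def] H_def[abs_def] by (simp only: Lo_add Lo_cmult Lo_const L3 mult_zero_right add_0_right)
  also have "... = 2 * v^2*((be x)^2 - 2 * v * c + v^2*((1 - Q x) * b))"
   unfolding L4 LP L2 gg by (simp add: s_def v_def[symmetric] c_def[symmetric] pow2 eval_nat_numeral alg)
  also have "... >= 0"
  proof (intro mnn)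
   define p where "p = norm (Z x)"
   define m where "m = norm (B x e)"
   have "c <= m*norm (B x (Z x))" unfolding c_def m_def by (rule norm_cauchy_schwarz)
   also have "... <= m*(be x*p)" using B_Z_bound(1)[of x] by (intro mlm) (auto simp: m_def p_def)
   finally have "v * c <= v * (m*(be x*p))" using vv_pos[of x] by (simp add: v_def)
   moreover have "0 <= (be x - v * (m*p))^2" by simp
   moreover have bm: "b = m^2" "1 - Q x = p^2" by (auto simp: b_def m_def p_def Q_def nrm2)
   ultimately show "0 <= (be x)^2 - 2 * v * c + v^2*((1 - Q x) * b)" unfolding bm by (simp add: pow2 alg)
  qed simp_all
  finally show ?thesis .
 qed
 with Cf show ?thesis by blast
qed

text \<open>The absorbing function: the slope bound makes it bounded, and \<open>Lo\<close> of it
  controls both error quantities. The coefficient -1/4 keeps the unfavourable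
  \<open>2*sg*Q*(1 - Q)\<close> from Bochner's formula below the gain \<open>8*sg*Q\<close> from
  \<open>vv^2\<close>.\<close>

definition GS :: "'a => real" where "GS x = vv x * vv x + (-1/4)*Q x"

lemma GS_sub: "\<exists>g H. C2g GS g H & (\<forall>x. Lo g H x >= 6*(sg x*Q x) + (be x)^2/4)"
proof -
 define g2 where "g2 x = vv x $* gv x + vv x $* gv x" for x
 define H2 where "H2 x h = vv x $* Hv x h + (gv x $. h) $* gv x + vv x $* Hv x h + (gv x $. h) $* gv x" for x h
 have C2: "C2g (%x. vv x * vv x) g2 H2" unfolding g2_def[abs_def] H2_def[abs_def] by (rule C2g_mult[OF C2g_v C2g_v])
 define g where "g x = g2 x + (-1/4) $* ((-2) $* B x (Z x))" for x
 define H where "H x h = H2 x h + (-1/4) $* HQ x h" for x h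
 have C: "C2g GS g H" unfolding GS_def[abs_def] g_def[abs_def] H_def[abs_def] by (intro C2g_add C2g_cmult C2 C2g_Q)
 have "Lo g H x >= 6*(sg x*Q x) + (be x)^2/4" for x
 proof -
  define v where "v = vv x"
  define m where "m = norm (B x e)"
  define c where "c = B x e $. B x (Z x)"
  define q where "q = sg x*Q x"
  have q: "q >= 0" using sg_pos[of x] Modica[of x] by (simp add: q_def)
  have m2: "B x e $. B x e = m*m" using nrm2[of "B x e"] by (simp add: m_def pow2)
  have L2: "Lo g2 H2 x = 8*q * v^2 + 2*(v ^ 4*m^2)"
   unfolding g2_def[abs_def] H2_def[abs_def] Lo_mult Lo_v
   by (simp add: gv_eq v_def q_def m2 pow2 eval_nat_numeral alg)
  have "Lo g H x = Lo g2 H2 x + (-1/4)*(8 * sg x*(1 - Q x)*Q x - 2*(be x)^2 - 4 * vv x*(B x e $. B x (Z x)))"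
   unfolding g_def[abs_def] H_def[abs_def] by (simp only: Lo_add Lo_cmult Lo_Q)
  also have "... = 8*(q * v^2) + 2*(v ^ 4*m^2) - 2*(q*(1 - Q x)) + (be x)^2/2 + v * c"
   unfolding L2 by (simp add: q_def v_def c_def alg)
  finally have L: "Lo g H x = 8*(q * v^2) + 2*(v ^ 4*m^2) - 2*(q*(1 - Q x)) + (be x)^2/2 + v * c" .
  have v1: "v >= 1" by (simp add: v_def vv_ge)
  have "q*1 <= q * v^2" using q v1 by (intro mlm) auto
  moreover have "q*(1 - Q x) <= q*1" using q Modica[of x] by (intro mlm) auto
  moreover have "- (v * c) <= v ^ 4*m^2 + (be x)^2/4"
  proof -
   have "- c <= m*norm (B x (Z x))" using CS2[of "B x e" "B x (Z x)"] by (simp add: c_def m_def)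
   also have "... <= m * be x" using B_Z_bound(3)[of x] by (intro mlm) (auto simp: m_def)
   finally have "v * (- c) <= v * (m * be x)" using v1 by (intro mlm) auto
   also have "... <= v^2*(m * be x)"
    using v1 be_nonneg[of x] by (intro mrm) (auto simp: m_def pow2)
   also have "... <= v ^ 4*m^2 + (be x)^2/4"
   proof -
    have "0 <= (v^2*m - be x/2)^2" by simp
    then show ?thesis by (simp add: pow2 eval_nat_numeral alg)
   qed
   finally show ?thesis by simp
  qed
  moreover have "0 <= v ^ 4*m^2" using v1 by simp
  ultimately show ?thesis unfolding L q_def[symmetric] by linarith
 qed
 with C show ?thesis by blast
qed

text \<open>\<open>Z - ze w\<close> is, up to sign, the contraction of the bivector of
  \<open>Z\<close> and \<open>w\<close> with the unit vector \<open>e\<close>, hence not longer than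
  that bivector; the proof is Cauchy-Schwarz for the projections, together with
  \<open>|Z| <= 1\<close>.\<close>

lemma wedge_inequality:
 assumes "w $. e = 1"
 shows "(norm (Z x - ze x $* w))^2 <= w $. w - (Z x $. w)\<^sup>2"
proof -
 define A where "A = pr (Z x) $. pr (Z x)"
 define b where "b = pr w $. pr w"
 define c where "c = pr (Z x) $. pr w"
 have "c^2 <= A * b" unfolding A_def b_def c_def by (rule Cauchy_Schwarz_ineq)
 moreover have "Z x $. Z x = A + (ze x)^2" "w $. w = b + 1" unfolding A_def b_def pr_norm using assms by (auto simp: ze_def)
 moreover have "Z x $. w = c + ze x" unfolding c_def pr_def ze_def using assms
  by (simp add: inner_diff_left inner_diff_right inner_commute ee)
 moreover have "(norm (Z x - ze x $* w))^2 = Z x $. Z x - 2*ze x*(Z x $. w) + (ze x)^2*(w $. w)"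
  unfolding nrm2 by (simp add: inner_diff_left inner_diff_right inner_commute pow2 alg)
 moreover have "(Z x $. Z x)*(w $. w) <= 1*(w $. w)" using Modica[of x] by (intro mrm) (auto simp: Q_def)
 ultimately show ?thesis by (simp add: pow2 alg)
qed

lemma sqrt2_bounds: "1 <= sqrt 2" "2 * sqrt 2 <= 3" "sqrt 2 >= 7/5"
proof -
 have "sqrt 2 <= 3/2" by (rule real_le_lsqrt) (simp_all add: pow2)
 then show "2 * sqrt 2 <= 3" by simp
 show "sqrt 2 >= 7/5" by (rule real_le_rsqrt) (simp add: pow2)
qed simp

lemma Lo_z: "Lo Z B x = - 2 * sqrt 2*u x*(2 - Q x) + 2 * vv x*(B x e $. Z x)"
 unfolding Lo_def Mo_z by (simp add: vv_def)

text \<open>The linear function \<open>w\<close> at \<open>x - z Z\<close>, the approximate foot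
  point of \<open>x\<close> on the zero level. For \<open>x $. w\<close> alone the drift of
  \<open>Mo\<close> leaves a term of order one; with the correction every term carries discrepancy
  or curvature.\<close>

definition el :: "'a => 'a => real" where "el w x = x $. w + (-1)*(z x*(Z x $. w))"

text \<open>Where \<open>Q\<close> vanishes this is the squared length of the foot point plus
  \<open>z^2\<close>. The correction cancels the drift term with \<open>x $. Z x\<close>, which
  would grow with the distance.\<close>

definition NN :: "'a => real" where "NN x = x $. x + ((-2)*(z x*(\<Sum>b\<in>Basis. (x $. b)*(Z x $. b))) + 2*(z x*z x))"

lemma NN_eq: "NN x = x $. x - 2*z x*(x $. Z x) + 2*(z x)^2"
 unfolding NN_def euclidean_inner[of x "Z x", symmetric] by (simp add: pow2)

lemma NN_ge: "NN x >= (norm x)^2/2"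
proof -
 have "\<bar>x $. Z x\<bar> <= norm x" using CS2[of x "Z x"] mlm[OF norm_Z[of x], of "norm x"] by simp
 then have "\<bar>z x\<bar>*\<bar>x $. Z x\<bar> <= \<bar>z x\<bar>*norm x" by (intro mlm) auto
 then have "z x*(x $. Z x) <= \<bar>z x\<bar>*norm x" using abs_ge_self[of "z x*(x $. Z x)"] by (simp add: abs_mult)
 moreover have "0 <= (norm x - 2*\<bar>z x\<bar>)^2" by simp
 moreover have "\<bar>z x\<bar>\<^sup>2 = (z x)^2" by simp
 moreover have "(norm x - 2*\<bar>z x\<bar>)^2 = (norm x)^2 - 4*(\<bar>z x\<bar>*norm x) + 4*\<bar>z x\<bar>\<^sup>2" by (simp add: pow2 alg)
 ultimately show ?thesis unfolding NN_eq nrm2[symmetric] by linarith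
qed

context
 fixes c0 :: real
 assumes c0: "c0 > 0" "!!x. ze x >= c0"
begin

lemma vv_le: "vv x <= 1 / c0" unfolding vv_def using c0(1) c0(2)[of x] by (simp add: frac_le)

lemma drift_bound: "\<bar>2/ze x*(B x e $. h)\<bar> <= 2 / c0*(be x*norm h)"
proof -
 have "\<bar>2/ze x*(B x e $. h)\<bar> = 2 * vv x*\<bar>B x e $. h\<bar>" using ze_pos[of x] by (simp add: abs_mult vv_def)
 also have "... <= 2*(1 / c0)*(be x*norm h)"
 proof (intro mult_mono)
  show "\<bar>B x e $. h\<bar> <= be x*norm h" using CS2[of "B x e" h] mrm[OF B_Z_bound(2)[of x], of "norm h"] by simp
 qed (use vv_le[of x] vv_pos[of x] c0(1) be_nonneg[of x] in auto)
 finally show ?thesis by simp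
qed

text \<open>The bound on \<open>Lo\<close> consists of errors that \<open>GS\<close> can absorb. The
  main part of the gradient is \<open>w - (Z x $. w) $* Z x\<close>, whose length dominates
  \<open>fS\<close> by \<open>wedge_inequality\<close>; this makes the square of \<open>el\<close>
  the main term of the Bernstein argument.\<close>

lemma el_facts:
 assumes w: "w $. e = 1"
 shows "\<exists>g H. C2g (el w) g H & (\<forall>x. \<bar>Lo g H x\<bar> <= norm w*(4*\<bar>z x\<bar>*(sg x*Q x) + (3*real DIM('a) + 2 + 4 / c0) * be x + 2 / c0*\<bar>z x\<bar>*(be x)^2)
  & g x $. g x >= c0^2*fS w x/2 - (norm w)\<^sup>2*Q x/2 - (norm w)\<^sup>2*((z x)^2*(be x)^2))"
proof -
 define g1 where "g1 x = z x $* B x w + (Z x $. w) $* Z x" for x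
 define H1 where "H1 x h = z x $* K w x h + (Z x $. h) $* B x w + (Z x $. w) $* B x h + (B x w $. h) $* Z x" for x h
 have C1: "C2g (%x. z x*(Z x $. w)) g1 H1" unfolding g1_def[abs_def] H1_def[abs_def] by (rule C2g_mult[OF C2g_z C2g_Zv])
 have M1: "Mo g1 H1 x = z x*Mo (%x. B x w) (K w) x + (Z x $. w)*Mo Z B x + 2*(Z x $. B x w)" for x
  unfolding g1_def[abs_def] H1_def[abs_def] by (rule Mo_mult)
 define g where "g x = w + (-1) $* g1 x" for x
 define H where "H x h = 0 + (-1) $* H1 x h" for x h
 have C: "C2g (el w) g H" unfolding el_def[abs_def] g_def[abs_def] H_def[abs_def]
  by (intro C2g_add C2g_inner C2g_cmult C1)
 have "\<bar>Lo g H x\<bar> <= norm w*(4*\<bar>z x\<bar>*(sg x*Q x) + (3*real DIM('a) + 2 + 4 / c0) * be x + 2 / c0*\<bar>z x\<bar>*(be x)^2)" for x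
 proof -
  define a where "a = norm w"
  define zw where "zw = Z x $. w"
  define q where "q = sg x*Q x"
  have q: "q >= 0" using sg_pos[of x] Modica[of x] by (simp add: q_def)
  have a0: "a >= 0" by (simp add: a_def)
  have zw: "\<bar>zw\<bar> <= a" using CS2[of "Z x" w] mrm[OF norm_Z[of x], of a] by (simp add: zw_def a_def)
  have "Mo g H x = - 4 * sqrt 2*u x*(Z x $. w) + (-1)*(z x*(- 4 * sg x*Q x*(Z x $. w)) + (Z x $. w)*(- 2 * sqrt 2*u x*(2 - Q x)) + 2*(Z x $. B x w))"
   unfolding g_def[abs_def] H_def[abs_def] by (simp only: Mo_add Mo_cmult Mo_inner M1 Mo_Zv Mo_z)
  also have "... = 4*(z x*(q*zw)) - 2 * sqrt 2*((u x*Q x)*zw) - 2*(B x (Z x) $. w)"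
   using B_sym[of x w "Z x"] by (simp add: q_def zw_def inner_commute alg)
  finally have M: "Mo g H x = 4*(z x*(q*zw)) - 2 * sqrt 2*((u x*Q x)*zw) - 2*(B x (Z x) $. w)" .
  have m1: "\<bar>z x*(q*zw)\<bar> <= a*(\<bar>z x\<bar>*q)"
   using mlm[OF zw, of "\<bar>z x\<bar>*q"] q by (simp add: abs_mult mult_ac)
  have m2: "2 * sqrt 2*\<bar>(u x*Q x)*zw\<bar> <= 3*(real DIM('a) * be x * a)"
  proof (rule mult_mono)
   show "\<bar>u x*Q x*zw\<bar> <= real DIM('a) * be x * a" unfolding abs_mult
    using mult_mono[OF uQ_le'[of x] zw] Modica[of x] be_nonneg[of x] by simp
  qed (use sqrt2_bounds in auto)
  have m3: "\<bar>B x (Z x) $. w\<bar> <= be x * a"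
   using CS2[of "B x (Z x)" w] mrm[OF B_Z_bound(3)[of x], of a] by (simp add: a_def)
  have gn: "norm (g x) <= 2 * a + \<bar>z x\<bar>*(be x * a)"
  proof -
   have "norm (g x) <= norm w + (norm (z x $* B x w) + norm ((Z x $. w) $* Z x))"
    unfolding g_def g1_def scaleR_minus1_left using norm_triangle_ineq4[of w "z x $* B x w + (Z x $. w) $* Z x"] norm_triangle_ineq[of "z x $* B x w" "(Z x $. w) $* Z x"] by (simp only: diff_conv_add_uminus)
   also have "norm (z x $* B x w) <= \<bar>z x\<bar>*(be x * a)" using mlm[OF norm_B[of x w], of "\<bar>z x\<bar>"] by (simp add: a_def)
   also have "norm ((Z x $. w) $* Z x) <= a*1" using mult_mono[OF zw norm_Z[of x]] a0 by (simp add: zw_def)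
   finally show ?thesis by (simp add: a_def)
  qed
  have m4: "\<bar>2/ze x*(B x e $. g x)\<bar> <= a*(4 / c0 * be x + 2 / c0*\<bar>z x\<bar>*(be x)^2)"
  proof -
   have "\<bar>2/ze x*(B x e $. g x)\<bar> <= 2 / c0*(be x*norm (g x))" by (rule drift_bound)
   also have "... <= 2 / c0*(be x*(2 * a + \<bar>z x\<bar>*(be x * a)))"
    using gn be_nonneg[of x] c0(1) by (intro mlm) auto
   finally show ?thesis by (simp add: alg pow2)
  qed
  have "\<bar>Lo g H x\<bar> <= 4*\<bar>z x*(q*zw)\<bar> + 2 * sqrt 2*\<bar>(u x*Q x)*zw\<bar> + 2*\<bar>B x (Z x) $. w\<bar> + \<bar>2/ze x*(B x e $. g x)\<bar>"
  proof -
   have "\<bar>2 * sqrt 2*((u x*Q x)*zw)\<bar> = 2 * sqrt 2*\<bar>(u x*Q x)*zw\<bar>" by (simp add: abs_mult)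
   then show ?thesis unfolding Lo_def M by linarith
  qed
  also have "... <= 4*(a*(\<bar>z x\<bar>*q)) + 3*(real DIM('a) * be x * a) + 2*(be x * a) + a*(4 / c0 * be x + 2 / c0*\<bar>z x\<bar>*(be x)^2)"
   using m1 m2 m3 m4 by linarith
  also have "... = a*(4*\<bar>z x\<bar>*q + (3*real DIM('a) + 2 + 4 / c0) * be x + 2 / c0*\<bar>z x\<bar>*(be x)^2)"
   by (simp add: alg)
  finally show ?thesis by (simp add: a_def q_def)
 qed
 moreover have "g x $. g x >= c0^2*fS w x/2 - (norm w)\<^sup>2*Q x/2 - (norm w)\<^sup>2*((z x)^2*(be x)^2)" for x
 proof -
  define a where "a = w - (Z x $. w) $* Z x"
  define b where "b = z x $* B x w"
  have ge: "g x = a - b" by (simp add: g_def g1_def a_def b_def)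
  have "0 <= (a - 2 $* b) $. (a - 2 $* b)" by simp
  then have "g x $. g x >= (a $. a)/2 - b $. b"
   unfolding ge by (simp add: inner_diff_left inner_diff_right inner_commute alg)
  moreover have "b $. b <= (norm w)^2*((z x)^2*(be x)^2)"
  proof -
   have "norm b <= \<bar>z x\<bar>*(be x*norm w)" unfolding b_def using mlm[OF norm_B[of x w], of "\<bar>z x\<bar>"] by simp
   then have "(norm b)^2 <= (\<bar>z x\<bar>*(be x*norm w))^2" by (intro power_mono) auto
   then show ?thesis by (simp add: nrm2 pmd mult_ac)
  qed
  moreover have "a $. a >= c0^2*fS w x - (norm w)\<^sup>2*Q x"
  proof -
   have zw2: "(Z x $. w)^2 <= (norm w)^2"
   proof -
    have "\<bar>Z x $. w\<bar> <= norm w" using CS2[of "Z x" w] mrm[OF norm_Z[of x], of "norm w"] by simp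
    then show ?thesis using abs_le_square_iff[of "Z x $. w" "norm w"] by simp
   qed
   have "a $. a = w $. w - (Z x $. w)\<^sup>2 - Q x*(Z x $. w)^2"
    by (simp add: a_def Q_def inner_diff_left inner_diff_right inner_commute pow2 alg)
   moreover have "Q x*(Z x $. w)^2 <= Q x*(norm w)^2" using zw2 Modica[of x] by (intro mlm)
   moreover have "c0^2*fS w x <= (norm (Z x - ze x $* w))^2"
   proof -
    have "Z x - ze x $* w = ze x $* (vv x $* Z x - w)" using ze_pos[of x] by (simp add: vv_def scaleR_diff_right)
    then have "(norm (Z x - ze x $* w))^2 = (ze x)^2*fS w x" by (simp add: fS_eq pmd)
    moreover have "c0^2*fS w x <= (ze x)^2*fS w x" using c0(1) c0(2)[of x] by (intro mrm power_mono) (auto simp: fS_eq)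
    ultimately show ?thesis by simp
   qed
   ultimately show ?thesis using wedge_inequality[OF w, of x] by (simp add: mult.commute)
  qed
  ultimately show ?thesis by linarith
 qed
 ultimately show ?thesis using C by blast
qed

text \<open>After the cancellation only the dimension and terms with \<open>sg*Q\<close> or
  \<open>be\<close> remain, apart from \<open>m5\<close>, which has a good sign because
  \<open>z\<close> and \<open>u\<close> have the same sign.\<close>

lemma NN_facts:
 "\<exists>g H. C2g NN g H & (\<forall>x. Lo g H x <= 2*real DIM('a) + norm x*(8*(\<bar>z x\<bar>*(sg x*Q x)) + 6*(real DIM('a) * be x)) + 4*(be x*norm x)
   + 2 / c0*(be x*(4*norm x + 2*\<bar>z x\<bar> + 2*(\<bar>z x\<bar>*(be x*norm x)))))"
proof -
 define gy where "gy x = (\<Sum>b\<in>Basis. (x $. b) $* B x b + (Z x $. b) $* b)" for x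
 define Hy where "Hy x h = (\<Sum>b\<in>Basis. (x $. b) $* K b x h + (b $. h) $* B x b + (Z x $. b) $* 0 + (B x b $. h) $* b)" for x h
 have Cy: "C2g (%x. \<Sum>b\<in>Basis. (x $. b)*(Z x $. b)) gy Hy" unfolding gy_def[abs_def] Hy_def[abs_def]
  by (intro C2g_sum C2g_mult C2g_inner C2g_Zv)
 have gy: "gy x = B x x + Z x" for x
  unfolding gy_def sum.distrib using linear_expand[OF linB, of x x] euclidean_representation[of "Z x"] by simp
 have My: "Mo gy Hy x = - 4*(sg x*Q x)*(x $. Z x) - 4 * sqrt 2*u x*(1 - Q x) + 2*tr (B x)" for x
 proof -
  have "Mo gy Hy x = (\<Sum>b\<in>Basis. (x $. b)*(- 4 * sg x*Q x*(Z x $. b)) + (Z x $. b)*(- 4 * sqrt 2*u x*(Z x $. b)) + 2*(b $. B x b))"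
   unfolding gy_def[abs_def] Hy_def[abs_def] Mo_sum by (simp only: Mo_mult Mo_Zv Mo_inner)
  also have "... = - 4*(sg x*Q x)*(\<Sum>b\<in>Basis. (x $. b)*(Z x $. b)) - 4 * sqrt 2*u x*(\<Sum>b\<in>Basis. (Z x $. b)*(Z x $. b)) + 2*tr (B x)"
   unfolding tr_def sum_distrib_left diff_conv_add_uminus sum_negf[symmetric] sum.distrib[symmetric]
   by (rule sum.cong) (auto simp: inner_commute alg)
  finally show ?thesis unfolding euclidean_inner[symmetric] by (simp add: Q_def)
 qed
 define g1 where "g1 x = z x $* gy x + (\<Sum>b\<in>Basis. (x $. b)*(Z x $. b)) $* Z x" for x
 define H1 where "H1 x h = z x $* Hy x h + (Z x $. h) $* gy x + (\<Sum>b\<in>Basis. (x $. b)*(Z x $. b)) $* B x h + (gy x $. h) $* Z x" for x h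
 have C1: "C2g (%x. z x*(\<Sum>b\<in>Basis. (x $. b)*(Z x $. b))) g1 H1" unfolding g1_def[abs_def] H1_def[abs_def] by (rule C2g_mult[OF C2g_z Cy])
 have M1: "Mo g1 H1 x = z x*Mo gy Hy x + (\<Sum>b\<in>Basis. (x $. b)*(Z x $. b))*Mo Z B x + 2*(Z x $. gy x)" for x
  unfolding g1_def[abs_def] H1_def[abs_def] by (rule Mo_mult)
 define g2 where "g2 x = z x $* Z x + z x $* Z x" for x
 define H2 where "H2 x h = z x $* B x h + (Z x $. h) $* Z x + z x $* B x h + (Z x $. h) $* Z x" for x h
 have C2: "C2g (%x. z x*z x) g2 H2" unfolding g2_def[abs_def] H2_def[abs_def] by (rule C2g_mult[OF C2g_z C2g_z])
 have M2: "Mo g2 H2 x = z x*Mo Z B x + z x*Mo Z B x + 2*(Z x $. Z x)" for x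
  unfolding g2_def[abs_def] H2_def[abs_def] by (rule Mo_mult)
 define g where "g x = 2 $* x + ((-2) $* g1 x + 2 $* g2 x)" for x
 define H where "H x h = 2 $* h + ((-2) $* H1 x h + 2 $* H2 x h)" for x h
 have C: "C2g NN g H" unfolding NN_def[abs_def] g_def[abs_def] H_def[abs_def]
  by (intro C2g_add C2g_norm2 C2g_cmult C1 C2)
 have "Lo g H x <= 2*real DIM('a) + norm x*(8*(\<bar>z x\<bar>*(sg x*Q x)) + 6*(real DIM('a) * be x)) + 4*(be x*norm x)
   + 2 / c0*(be x*(4*norm x + 2*\<bar>z x\<bar> + 2*(\<bar>z x\<bar>*(be x*norm x))))" for x
 proof -
  define y where "y = x $. Z x"
  define q where "q = sg x*Q x"
  have q: "q >= 0" using sg_pos[of x] Modica[of x] by (simp add: q_def)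
  have y: "\<bar>y\<bar> <= norm x" using CS2[of x "Z x"] mlm[OF norm_Z[of x], of "norm x"] by (simp add: y_def)
  have Mn: "Mo (%x. 2 $* x) (%x h. 2 $* h) x = 2*real DIM('a) - 8 * sqrt 2*u x*y"
   by (simp add: Mo_def tr_scale tr_id y_def inner_commute)
  have "Mo g H x = Mo (%x. 2 $* x) (%x h. 2 $* h) x + ((-2)*Mo g1 H1 x + 2*Mo g2 H2 x)"
   unfolding g_def[abs_def] H_def[abs_def] by (subst Mo_add) (simp only: Mo_add Mo_cmult)
  also have "... = 2*real DIM('a) - 8 * sqrt 2*u x*y
   + ((-2)*(z x*(- 4*q*y - 4 * sqrt 2*u x*(1 - Q x) + 2*tr (B x)) + y*(- 2 * sqrt 2*u x*(2 - Q x)) + 2*(Z x $. gy x))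
   + 2*(z x*(- 2 * sqrt 2*u x*(2 - Q x)) + z x*(- 2 * sqrt 2*u x*(2 - Q x)) + 2*(Z x $. Z x)))"
   unfolding Mn M1 M2 My Mo_z euclidean_inner[of x "Z x", symmetric] y_def q_def ..
  also have "... = 2*real DIM('a) + (8*(z x*(q*y)) - 4 * sqrt 2*((u x*Q x)*y)) - 8 * sqrt 2*((z x*u x)*(1 - Q x)) - 4*(B x (Z x) $. x)"
   unfolding gy trB using B_sym[of x x "Z x"] by (simp add: Q_def inner_add_right inner_commute alg)
  finally have M: "Mo g H x = 2*real DIM('a) + (8*(z x*(q*y)) - 4 * sqrt 2*((u x*Q x)*y)) - 8 * sqrt 2*((z x*u x)*(1 - Q x)) - 4*(B x (Z x) $. x)" .
  have m1: "z x*(q*y) <= norm x*(\<bar>z x\<bar>*q)"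
   using mlm[OF y, of "\<bar>z x\<bar>*q"] q abs_ge_self[of "z x*(q*y)"] by (simp add: abs_mult mult_ac)
  have m2: "- (4 * sqrt 2*((u x*Q x)*y)) <= norm x*(6*(real DIM('a) * be x))"
  proof -
   have "\<bar>(u x*Q x)*y\<bar> <= real DIM('a) * be x*norm x" unfolding abs_mult
    using mult_mono[OF uQ_le'[of x] y] Modica[of x] be_nonneg[of x] by simp
   then have "2 * sqrt 2*\<bar>(u x*Q x)*y\<bar> <= 3*(real DIM('a) * be x*norm x)" using sqrt2_bounds by (intro mult_mono) auto
   moreover have "- (4 * sqrt 2*((u x*Q x)*y)) <= 2*(2 * sqrt 2*\<bar>(u x*Q x)*y\<bar>)"
    using abs_ge_minus_self[of "4 * sqrt 2*((u x*Q x)*y)"] by (simp add: abs_mult)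
   ultimately show ?thesis by (simp add: mult_ac)
  qed
  have m3: "- (B x (Z x) $. x) <= be x*norm x"
   using CS2[of "B x (Z x)" x] mrm[OF B_Z_bound(3)[of x], of "norm x"] by simp
  have m5: "8 * sqrt 2*((z x*u x)*(1 - Q x)) >= 0" using zu_nonneg[of x] Q_le[of x] by simp
  have gn: "norm (g x) <= 4*norm x + 2*\<bar>z x\<bar> + 2*(\<bar>z x\<bar>*(be x*norm x))"
  proof -
   have "g x = 2 $* x + ((- 2*z x) $* B x x + ((- 2*y) $* Z x + (2*z x) $* Z x))"
    unfolding g_def g1_def g2_def gy euclidean_inner[of x "Z x", symmetric] y_def by (simp add: alg scaleR_2)
   then have "norm (g x) <= norm (2 $* x) + (norm ((- 2*z x) $* B x x) + (norm ((- 2*y) $* Z x) + norm ((2*z x) $* Z x)))"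
    by (metis norm_triangle_mono norm_triangle_ineq order_refl)
   also have "... <= 2*norm x + (2*(\<bar>z x\<bar>*(be x*norm x)) + (2*norm x + 2*\<bar>z x\<bar>))"
   proof (intro add_mono)
    show "norm ((- 2*z x) $* B x x) <= 2*(\<bar>z x\<bar>*(be x*norm x))" using mlm[OF norm_B[of x x], of "\<bar>z x\<bar>"] by (simp add: abs_mult)
    show "norm ((- 2*y) $* Z x) <= 2*norm x" using mult_mono[OF y norm_Z[of x]] by (simp add: abs_mult)
    show "norm ((2*z x) $* Z x) <= 2*\<bar>z x\<bar>" using mlm[OF norm_Z[of x], of "\<bar>z x\<bar>"] by (simp add: abs_mult)
   qed simp
   finally show ?thesis by simp
  qed
  have "2/ze x*(B x e $. g x) <= 2 / c0*(be x*norm (g x))" using drift_bound[of x "g x"] by linarith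
  also have "... <= 2 / c0*(be x*(4*norm x + 2*\<bar>z x\<bar> + 2*(\<bar>z x\<bar>*(be x*norm x))))"
   using gn be_nonneg[of x] c0(1) by (intro mlm) auto
  finally have m4: "2/ze x*(B x e $. g x) <= 2 / c0*(be x*(4*norm x + 2*\<bar>z x\<bar> + 2*(\<bar>z x\<bar>*(be x*norm x))))" .
  have "norm x*(8*(\<bar>z x\<bar>*q) + 6*(real DIM('a) * be x)) = 8*(norm x*(\<bar>z x\<bar>*q)) + norm x*(6*(real DIM('a) * be x))"
   by (simp add: alg)
  then show ?thesis unfolding Lo_def M q_def[symmetric] using m1 m2 m3 m4 m5 by linarith
 qed
 with C show ?thesis by blast
qed

text \<open>For \<open>|z| >= 4\<close> the drift towards the interface gives a negative cubic term
  that beats both the gradient term and the linear part of the curvature coupling. For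
  \<open>|z| <= 4\<close> all powers of \<open>z\<close> are bounded.\<close>

lemma z4_facts:
 "\<exists>g H. C2g (%x. z x^4) g H & (\<forall>x. Lo g H x <= (192 + 512 / c0 + 7 / c0^2)*(1 + (1 + \<bar>z x\<bar>^3)*(be x)^2))"
proof -
 define g where "g x = (4*z x^3) $* Z x" for x
 define H where "H x h = (4*z x^3) $* B x h + ((12*(z x)^2)*(Z x $. h)) $* Z x" for x h
 have C: "C2g (%x. z x^4) g H" unfolding g_def[abs_def] H_def[abs_def]
  by (rule C2g_compose[OF C2g_z]) (auto intro!: dvi cnt simp: eval_nat_numeral)
 have "Lo g H x <= (192 + 512 / c0 + 7 / c0^2)*(1 + (1 + \<bar>z x\<bar>^3)*(be x)^2)" for x
 proof -
  define a where "a = \<bar>z x\<bar>"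
  define b where "b = be x"
  define k where "k = 1 / c0"
  have k: "k > 0" using c0(1) by (simp add: k_def)
  have ab: "a >= 0" "b >= 0" using be_nonneg by (auto simp: a_def b_def)
  have "Lo g H x = (4*z x^3)*Lo Z B x + (12*(z x)^2)*(Z x $. Z x)"
   unfolding g_def[abs_def] H_def[abs_def] by (rule Lo_compose)
  also have "... = - (8 * sqrt 2*((z x*u x)*(z x)^2*(2 - Q x))) + 8*(z x^3*(vv x*(B x e $. Z x))) + 12*(z x)^2*(Z x $. Z x)"
   unfolding Lo_z by (simp add: pow2 power3_eq_cube alg)
  also have "... <= - (8 * sqrt 2*(a*\<bar>u x\<bar> * a^2)) + 8*(a^3*(k * b)) + 12 * a^2"
  proof (intro add_mono)
   have "z x*u x = a*\<bar>u x\<bar>" using zu_nonneg[of x] by (simp add: a_def abs_mult[symmetric])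
   moreover have "a*\<bar>u x\<bar> * a^2*1 <= a*\<bar>u x\<bar> * a^2*(2 - Q x)" using ab Q_le[of x] by (intro mlm) auto
   ultimately show "- (8 * sqrt 2*((z x*u x)*(z x)^2*(2 - Q x))) <= - (8 * sqrt 2*(a*\<bar>u x\<bar> * a^2))" by (simp add: a_def)
   have "\<bar>B x e $. Z x\<bar> <= b" using CS2[of "B x e" "Z x"] mult_mono[OF B_Z_bound(2)[of x] norm_Z[of x]] ab by (simp add: b_def)
   then have "\<bar>vv x*(B x e $. Z x)\<bar> <= k * b" unfolding abs_mult using vv_le[of x] vv_pos[of x] k by (intro mult_mono) (auto simp: k_def)
   then have "\<bar>z x^3\<bar>*\<bar>vv x*(B x e $. Z x)\<bar> <= a^3*(k * b)" unfolding a_def power_abs by (intro mlm) auto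
   then show "8*(z x^3*(vv x*(B x e $. Z x))) <= 8*(a^3*(k * b))" using abs_ge_self[of "z x^3*(vv x*(B x e $. Z x))"] unfolding abs_mult[symmetric] by linarith
   have "a^2*(Z x $. Z x) <= a^2*1" using Modica[of x] by (intro mlm) (auto simp: Q_def)
   then show "12*(z x)^2*(Z x $. Z x) <= 12 * a^2" by (simp add: a_def)
  qed
  also have "... <= (192 + 512*k + 7*k^2)*(1 + (1 + a^3) * b^2)"
  proof (cases "a <= 4")
   case True
   have "a^2 <= 16" "a^3 <= 64" using power_mono[of a 4 2] power_mono[of a 4 3] ab True by auto
   moreover from this have "a^3*(k * b) <= 64*(k * b)" using ab k by (intro mrm) auto
   moreover have "b <= 1 + b^2"
   proof -
    have "0 <= (b - 1/2)^2" by simp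
    then show ?thesis by (simp add: pow2 alg)
   qed
   then have "k * b <= k*(1 + b^2)" using k by (intro mlm) auto
   moreover have "0 <= 8 * sqrt 2*(a*\<bar>u x\<bar> * a^2)" using ab by simp
   ultimately have "- (8 * sqrt 2*(a*\<bar>u x\<bar> * a^2)) + 8*(a^3*(k * b)) + 12 * a^2 <= 192 + 512*(k*(1 + b^2))" by linarith
   also have "... <= (192 + 512*k + 7*k^2)*(1 + b^2)" using k by (simp add: alg)
   also have "... <= (192 + 512*k + 7*k^2)*(1 + (1 + a^3) * b^2)" using k ab by (intro mlm) (auto simp: alg)
   finally show ?thesis .
  next
   case False
   then have a4: "a >= 4" by simp
   then have u2: "\<bar>u x\<bar> >= 1/2" using u_ge_half[of x] by (simp add: a_def)
   have a3: "a^3 = a * a^2" by (simp add: pow2 power3_eq_cube)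
   have "sqrt 2*\<bar>u x\<bar> >= (7/5)*(1/2)" using u2 sqrt2_bounds by (intro mult_mono) auto
   then have "a^3*(8*(sqrt 2*\<bar>u x\<bar>)) >= a^3*(8*(7/10))" using ab by (intro mlm) auto
   then have s1: "8 * sqrt 2*(a*\<bar>u x\<bar> * a^2) >= a^3*(28/5)" unfolding a3 by (simp add: mult_ac)
   have s2: "4 * a^2 <= a^3" unfolding a3 using a4 by (intro mrm) auto
   have "0 <= (8*(k * b) - 5)^2" by simp
   then have "8*(k * b) <= 5/2 + (32/5)*(k * b)^2" by (simp add: pow2 alg)
   then have s3: "a^3*(8*(k * b)) <= a^3*(5/2 + (32/5)*(k * b)^2)" using ab by (intro mlm) auto
   have "- (8 * sqrt 2*(a*\<bar>u x\<bar> * a^2)) + 8*(a^3*(k * b)) + 12 * a^2 <= (32/5)*(a^3*(k * b)^2)"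
   proof -
    have "a^3 >= 0" using ab by simp
    moreover have "a^3*(5/2 + (32/5)*(k * b)^2) = 5/2 * a^3 + (32/5)*(a^3*(k * b)^2)" by (simp add: alg)
    ultimately show ?thesis using s1 s2 s3 by linarith
   qed
   also have "... <= 7*k^2*(a^3 * b^2)" using ab k by (simp add: pmd mult_ac)
   also have "... <= (192 + 512*k + 7*k^2)*(1 + (1 + a^3) * b^2)"
    using ab k by (intro mult_mono) (auto simp: alg)
   finally show ?thesis .
  qed
  finally show ?thesis by (simp add: a_def b_def k_def power_divide)
 qed
 with C show ?thesis by blast
qed

end

end

text \<open>Bookkeeping at the maximum: \<open>q\<close> and \<open>b\<close> stand for
  \<open>sg*Q\<close> and the curvature, and the letters \<open>p\<close>, \<open>w\<close>,
  \<open>s\<close> mark the coefficients of \<open>q\<close>, \<open>b\<close> and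
  \<open>b^2\<close> in the errors. The term with \<open>6*q + b^2/4\<close> absorbs all errors
  except the linear ones, which cost \<open>2*w^2/evq\<close> by completing the square.\<close>

lemma bernstein_arith:
 fixes evq :: real
 assumes "al*f - p1*q - w1 * b - s1 * b^2 - p2*q - w2 * b - s2 * b^2 + evq*(6*q + b^2/4) - (e1 + p3*q + w3 * b + s3 * b^2) - (e2 + s4 * b^2) <= 0"
  and q: "q >= 0" and evq: "evq > 0" and p: "p1 <= evq" "p2 <= evq" "p3 <= evq" and s: "s1 <= evq/32" "s2 <= evq/32" "s3 <= evq/32" "s4 <= evq/32"
 shows "al*f <= 2*(w1 + w2 + w3)^2/evq + e1 + e2"
proof -
 define w where "w = w1 + w2 + w3"
 have "p1*q <= evq*q" "p2*q <= evq*q" "p3*q <= evq*q" using p q by (auto intro: mrm)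
 moreover have "s1 * b^2 <= evq/32 * b^2" "s2 * b^2 <= evq/32 * b^2" "s3 * b^2 <= evq/32 * b^2" "s4 * b^2 <= evq/32 * b^2" by (intro mrm s zero_le_power2)+
 moreover have "0 <= evq*q" using q evq by simp
 moreover have "evq*(6*q + b^2/4) = 6*(evq*q) + evq/32 * b^2*8" by (simp add: alg)
 moreover have "w1 * b + w2 * b + w3 * b = w * b" by (simp add: w_def alg)
 ultimately have "al*f <= w * b - 4*(evq/32 * b^2) + e1 + e2" using assms(1) by linarith
 moreover have "w * b - 4*(evq/32 * b^2) <= 2*w^2/evq"
 proof -
  have "0 <= evq/8*(b - 4*w/evq)^2" using evq by simp
  also have "... = evq/8 * b^2 - w * b + 2*w^2/evq" using evq by (simp add: pow2 field_simps)
  finally show ?thesis by simp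
 qed
 ultimately show ?thesis by (simp add: w_def)
qed

context ac
begin

context
 fixes c0 :: real
 assumes c0: "c0 > 0" "!!x. ze x >= c0"
begin

text \<open>Bernstein's method: \<open>f = |Z / ze - \<nu>|\<^sup>2\<close> is estimated in the interior by the oscillation of \<open>el \<nu>\<close>,
 the term \<open>GS\<close> absorbs the curvature errors and \<open>NN\<close>, \<open>z\<^sup>4\<close> serve as cutoffs.\<close>
lemma bernstein_estimate:
 assumes C1: "C1 >= 1" and flat: "!!xj. xj > 0 ==> \<exists>R0\<ge>1. \<forall>r\<ge>R0. \<exists>nv. nv $. e = 1 & norm nv <= C1 & (\<forall>x. norm x <= r --> \<bar>nv $. x\<bar> <= xj*r + C1*(\<bar>z x\<bar> + 1))"
  and evq: "evq > 0"
 shows "\<exists>nv. fS nv x0 <= evq*(4 + 1 / c0^2) & fS nv x1 <= evq*(4 + 1 / c0^2)"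
proof -
 define n where "n = real DIM('a)"
 have n: "n >= 1" using DIM_positive[where 'a='a] by (simp add: n_def)
 define Cf where "Cf = (1 / c0 + C1)^2"
 define D where "D = 2*Cf"
 define k1 where "k1 = 3*n + 2 + 4 / c0"
 define d1 where "d1 = 6*n + 4 + 12 / c0"
 define C5 where "C5 = 192 + 512 / c0 + 7 / c0^2"
 define b0 where "b0 = 2 + D*d1"
 \<comment> \<open>Chosen so that the sum of the remaining errors is
   \<open>A * c0^2/r^2*evq\<close>, which gives \<open>fS <= evq\<close> at an interior maximum.
   This is not circular: \<open>b0\<close> does not depend on \<open>A\<close>, because
   \<open>t\<close> is taken so small that \<open>2*A*t*C1*k1 <= 1\<close>.\<close>
 define A where "A = (2 * b0^2/evq + 2*n*D + 1)/(c0^2*evq)"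
 have c: "c0 > 0" by (rule c0(1))
 have "1 / c0 + C1 > 0" using c C1 by (intro add_pos_pos) auto
 then have Cf: "Cf > 0" by (simp add: Cf_def)
 have D: "D > 0" using Cf by (simp add: D_def)
 have k1: "k1 > 0" "d1 > 0" "C5 > 0" using c n by (auto simp: k1_def d1_def C5_def intro!: add_pos_pos)
 have b0: "b0 > 0" using D k1 by (simp add: b0_def add_pos_pos)
 have A: "A > 0" using b0 evq n D c by (auto simp: A_def intro!: divide_pos_pos add_nonneg_pos add_nonneg_nonneg mult_pos_pos)
 have Ac: "A * c0^2*evq = 2 * b0^2/evq + 2*n*D + 1" using c evq by (simp add: A_def)
 define t where "t = min 1 (min (1/(2*A*C1*k1)) (evq/A))"
 have t: "t > 0" "t <= 1" "t <= 1/(2*A*C1*k1)" "t <= evq/A" using A C1 k1 evq by (auto simp: t_def)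
 have tA: "2*A*t*C1*k1 <= 1" using t(3) A C1 k1 by (simp add: field_simps)
 have tA2: "A*t^2 <= evq"
 proof -
  have "A*t <= evq" using t(4) A by (simp add: field_simps)
  moreover have "A*(t*t) <= A*(t*1)" using t A by (intro mlm) auto
  ultimately show ?thesis by (simp add: pow2)
 qed
 define M where "M = 8*A*C1 + 8*D + 2*A*C1^2 + 4*A*C1 / c0 + 4*D / c0"
 have Mp: "0 <= 8*A*C1" "0 <= 8*D" "0 <= 2*A*C1^2" "0 <= 4*A*C1 / c0" "0 <= 4*D / c0" using A C1 D c by auto
 have M: "M > 0" using A C1 D c Mp unfolding M_def by (intro add_pos_nonneg) auto
 \<comment> \<open>The aperture of the region \<open>|z| <= zt*r\<close>: it keeps the coefficients
   bounded by \<open>M*zt\<close> below \<open>evq/32\<close> and the correction term of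
   \<open>el\<close> below \<open>t/6*r\<close>.\<close>
 define zt where "zt = min 1 (min (t/(6*C1)) (evq/(32*M)))"
 have zt: "zt > 0" "zt <= 1" "zt <= t/(6*C1)" "zt <= evq/(32*M)" using t C1 evq M by (auto simp: zt_def)
 have ztM: "M*zt <= evq/32" using zt(4) M by (simp add: field_simps)
 have ztC: "C1*zt <= t/6" using zt(3) C1 by (simp add: field_simps)
 have le: "y*zt <= evq/32" if "y <= M" for y using mrm[OF that, of zt] zt(1) ztM by linarith
 have cz: "8*A*C1*zt <= evq/32" "8*D*zt <= evq/32" "2*A*C1^2*zt <= evq/32" "4*A*C1 / c0*zt <= evq/32" "4*D / c0*zt <= evq/32"
  using Mp by (intro le; simp add: M_def)+
 obtain R0 where R0: "R0 >= 1" "!!r. r >= R0 ==> \<exists>nv. nv $. e = 1 & norm nv <= C1 & (\<forall>x. norm x <= r --> \<bar>nv $. x\<bar> <= t/3*r + C1*(\<bar>z x\<bar> + 1))"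
  using flat[of "t/3"] t by auto
 \<comment> \<open>Once \<open>r\<close> exceeds \<open>T y\<close>, the point \<open>y\<close> lies
   in \<open>S\<close> and both cutoff terms are at most \<open>evq\<close> there.\<close>
 define T where "T y = 1 + norm y + \<bar>z y\<bar>/zt + D*NN y/evq + Cf*z y^4/(zt^4*evq)" for y
 have "\<forall>\<^sub>F r in at_top. r >= R0 & r >= A*C1^2/evq & r >= A*C1^2*n & r >= Cf*C5*(1/zt^4 + 1/zt)*32/evq & r >= Cf*C5/zt^4 & r >= 6*C1/t & r >= T x0 & r >= T x1"
  by (intro eventually_conj eventually_ge_at_top)
 then obtain r where rr: "r >= R0" "r >= A*C1^2/evq" "r >= A*C1^2*n" "r >= Cf*C5*(1/zt^4 + 1/zt)*32/evq" "r >= Cf*C5/zt^4" "r >= 6*C1/t" "r >= T x0" "r >= T x1"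
  using eventually_happens'[OF trivial_limit_at_top_linorder] by blast
 have r1: "r >= 1" using rr(1) R0(1) by simp
 have r0: "r > 0" using r1 by simp
 have rsq: "r <= r^2" using mrm[OF r1, of r] r0 by (simp add: pow2)
 have x4: "r^4 = r^2*r^2" by (simp add: pow2 eval_nat_numeral)
 have r4: "r <= r^4" using power_increasing[of 1 4 r] r1 by simp
 obtain nv where nv: "nv $. e = 1" "norm nv <= C1" "!!x. norm x <= r ==> \<bar>nv $. x\<bar> <= t/3*r + C1*(\<bar>z x\<bar> + 1)"
  using R0(2)[OF rr(1)] by blast
 obtain gf Hf where f: "C2g (fS nv) gf Hf" "!!x. Lo gf Hf x >= 0" using fS_sub by blast
 obtain gl Hl where l: "C2g (el nv) gl Hl"
  "!!x. \<bar>Lo gl Hl x\<bar> <= norm nv*(4*\<bar>z x\<bar>*(sg x*Q x) + (3*real DIM('a) + 2 + 4 / c0) * be x + 2 / c0*\<bar>z x\<bar>*(be x)^2)"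
  "!!x. gl x $. gl x >= c0^2*fS nv x/2 - (norm nv)\<^sup>2*Q x/2 - (norm nv)\<^sup>2*((z x)^2*(be x)^2)" using el_facts[OF c0 nv(1)] by blast
 obtain gG HG where G: "C2g GS gG HG" "!!x. Lo gG HG x >= 6*(sg x*Q x) + (be x)^2/4" using GS_sub by blast
 obtain gN HN where N: "C2g NN gN HN" "!!x. Lo gN HN x <= 2*real DIM('a) + norm x*(8*(\<bar>z x\<bar>*(sg x*Q x)) + 6*(real DIM('a) * be x)) + 4*(be x*norm x)
   + 2 / c0*(be x*(4*norm x + 2*\<bar>z x\<bar> + 2*(\<bar>z x\<bar>*(be x*norm x))))" using NN_facts[OF c0] by blast
 obtain gz Hz where z4: "C2g (%x. z x^4) gz Hz" "!!x. Lo gz Hz x <= C5*(1 + (1 + \<bar>z x\<bar>^3)*(be x)^2)"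
  using z4_facts[OF c0] unfolding C5_def by blast
 \<comment> \<open>\<open>D\<close> and \<open>E\<close> make the cutoff terms reach
   \<open>Cf\<close>, the bound for \<open>fS\<close>, on \<open>|x| = r\<close> and on
   \<open>|z| = zt*r\<close>, so that \<open>Ph\<close> is small on the boundary of the
   region.\<close>
 define E where "E = Cf/(zt*r)^4"
 have E: "E > 0" using Cf zt r0 by (simp add: E_def)
 define g2 where "g2 x = el nv x $* gl x + el nv x $* gl x" for x
 define H2 where "H2 x h = el nv x $* Hl x h + (gl x $. h) $* gl x + el nv x $* Hl x h + (gl x $. h) $* gl x" for x h
 have l2: "C2g (%x. el nv x*el nv x) g2 H2" unfolding g2_def[abs_def] H2_def[abs_def] by (rule C2g_mult[OF l(1) l(1)])
 have Ll2: "Lo g2 H2 x = el nv x*Lo gl Hl x + el nv x*Lo gl Hl x + 2*(gl x $. gl x)" for x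
  unfolding g2_def[abs_def] H2_def[abs_def] by (rule Lo_mult)
 define Ph where "Ph x = fS nv x + ((A/r^2)*(el nv x*el nv x) + (evq*GS x + ((- (D/r^2))*NN x + (- E)*z x^4)))" for x
 define gP where "gP x = gf x + ((A/r^2) $* g2 x + (evq $* gG x + ((- (D/r^2)) $* gN x + (- E) $* gz x)))" for x
 define HP where "HP x h = Hf x h + ((A/r^2) $* H2 x h + (evq $* HG x h + ((- (D/r^2)) $* HN x h + (- E) $* Hz x h)))" for x h
 have CP: "C2g Ph gP HP" unfolding Ph_def[abs_def] gP_def[abs_def] HP_def[abs_def] by (intro C2g_add C2g_cmult f l2 G N z4)
 have LP: "Lo gP HP x = Lo gf Hf x + ((A/r^2)*Lo g2 H2 x + (evq*Lo gG HG x + ((- (D/r^2))*Lo gN HN x + (- E)*Lo gz Hz x)))" for x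
  unfolding gP_def[abs_def] HP_def[abs_def] by (simp only: Lo_add Lo_cmult)
 define S where "S = {x. \<bar>z x\<bar> <= zt*r} \<inter> cball 0 r"
 have "closed {x. \<bar>z x\<bar> <= zt*r}" by (intro closed_Collect_le cnt z_cont)
 then have cS: "compact S" unfolding S_def by (intro closed_Int_compact) auto
 have T0: "y : S & D/r^2*NN y <= evq & E*z y^4 <= evq" if "r >= T y" for y
 proof -
  have Ny: "0 <= NN y" using NN_ge[of y] zero_le_power2[of "norm y"] by linarith
  have nn: "0 <= \<bar>z y\<bar>/zt" "0 <= D*NN y/evq" "0 <= Cf*z y^4/(zt^4*evq)"
   using zt D evq Cf Ny by (auto intro!: divide_nonneg_pos mnn)
  have a: "norm y <= r" "\<bar>z y\<bar>/zt <= r" "D*NN y/evq <= r" "Cf*z y^4/(zt^4*evq) <= r"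
   using that nn norm_ge_zero[of y] unfolding T_def by linarith+
  have "\<bar>z y\<bar> <= zt*r" using a(2) zt by (simp add: divide_le_eq mult.commute)
  moreover have "D*NN y <= evq*r^2"
  proof -
   have "D*NN y <= evq*r" using a(3) evq by (simp add: divide_le_eq mult.commute)
   also have "... <= evq*r^2" using rsq evq by simp
   finally show ?thesis .
  qed
  moreover have "Cf*z y^4 <= evq*(zt*r)^4"
  proof -
   have "Cf*z y^4 <= r*(zt^4*evq)" using a(4) zt evq by (simp add: divide_le_eq)
   also have "... <= r^4*(zt^4*evq)" using r4 zt evq by (intro mrm) auto
   finally show ?thesis by (simp add: pmd mult_ac)
  qed
  ultimately show ?thesis using a(1) r0 zt by (simp add: S_def E_def divide_le_eq)
 qed
 have elb: "\<bar>el nv x\<bar> <= t*r" if x: "x : S" for x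
 proof -
  have zx: "\<bar>z x\<bar> <= zt*r" "norm x <= r" using x by (auto simp: S_def)
  have "\<bar>Z x $. nv\<bar> <= norm (Z x)*norm nv" by (rule CS2)
  also have "... <= 1*C1" using norm_Z[of x] nv(2) by (intro mult_mono) auto
  finally have "\<bar>z x*(Z x $. nv)\<bar> <= \<bar>z x\<bar>*C1" unfolding abs_mult by (intro mlm) auto
  then have "\<bar>el nv x\<bar> <= \<bar>nv $. x\<bar> + \<bar>z x\<bar>*C1" unfolding el_def by (simp add: inner_commute)
  moreover have "\<bar>z x\<bar>*C1 <= t/6*r"
  proof -
   have "\<bar>z x\<bar>*C1 <= (zt*r)*C1" using zx C1 by (intro mrm) auto
   also have "... = (C1*zt)*r" by simp
   also have "... <= t/6*r" using ztC r0 by (intro mrm) auto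
   finally show ?thesis .
  qed
  moreover have "C1 <= t/6*r" using rr(6) t by (simp add: divide_le_eq mult.commute)
  moreover have "C1*(\<bar>z x\<bar> + 1) = \<bar>z x\<bar>*C1 + C1" "t/3*r = 2*(t/6*r)" "t*r = 6*(t/6*r)" by (simp_all add: alg)
  moreover have "0 <= t/6*r" using t r0 by simp
  ultimately show ?thesis using nv(3)[OF zx(2)] by linarith
 qed
 have el2: "(A/r^2)*(el nv x*el nv x) <= evq" if x: "x : S" for x
 proof -
  have "el nv x*el nv x <= (t*r)^2" using elb[OF x] abs_le_square_iff[of "el nv x" "t*r"] t r0 by (simp add: pow2)
  then have "(A/r^2)*(el nv x*el nv x) <= (A/r^2)*(t*r)^2" using A by (intro mlm) auto
  also have "... = A*t^2" using r0 by (simp add: pmd)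
  finally show ?thesis using tA2 by simp
 qed
 have Gb: "0 <= GS x" "GS x <= 1 / c0^2" for x
 proof -
  have "vv x * vv x >= 1*1" using vv_ge[of x] by (intro mult_mono) auto
  then show "0 <= GS x" unfolding GS_def using Q_le[of x] by simp
  have "vv x * vv x <= (1 / c0)*(1 / c0)" using vv_le[OF c0, of x] vv_pos[of x] c by (intro mult_mono) auto
  then show "GS x <= 1 / c0^2" unfolding GS_def using Modica[of x] by (simp add: pow2)
 qed
 have fb: "0 <= fS nv x" "fS nv x <= Cf" for x
 proof -
  show "0 <= fS nv x" by (simp add: fS_eq)
  have "norm (vv x $* Z x - nv) <= norm (vv x $* Z x) + norm nv" by (rule norm_triangle_ineq4)
  also have "... <= 1 / c0 + C1"
  proof (intro add_mono nv(2))
   have "vv x*norm (Z x) <= (1 / c0)*1" using vv_le[OF c0, of x] vv_pos[of x] norm_Z[of x] c by (intro mult_mono) auto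
   then show "norm (vv x $* Z x) <= 1 / c0" using vv_pos[of x] by simp
  qed
  finally show "fS nv x <= Cf" unfolding fS_eq Cf_def by (intro power_mono) auto
 qed
 have "T x0 <= r" by (rule rr(7))
 then have x0S: "x0 : S" using T0 by blast
 obtain y where y: "y : S" "!!x. x : S ==> Ph x <= Ph y"
  using continuous_attains_sup[OF cS _ C2gD(7)[OF CP]] x0S by blast
 have ny: "norm y <= r" "\<bar>z y\<bar> <= zt*r" using y(1) by (auto simp: S_def)
 have N0: "NN y >= 0" using NN_ge[of y] zero_le_power2[of "norm y"] by linarith
 have z0: "z y^4 >= 0" by simp
 define X where "X = 1 / c0^2"
 have eG: "evq*GS y <= evq*X" unfolding X_def using Gb(2)[of y] evq by (intro mlm) auto
 have X0: "0 <= evq*X" using evq by (simp add: X_def)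
 have Py: "Ph y <= 2*evq + evq*X"
 proof -
  have P0: "Ph y = fS nv y + (A/r^2)*(el nv y*el nv y) + evq*GS y - D/r^2*NN y - E*z y^4" by (simp add: Ph_def)
  have nN: "0 <= D/r^2*NN y" "0 <= E*z y^4" using D N0 E by auto
  consider (a) "norm y = r" | (b) "\<bar>z y\<bar> = zt*r" | (c) "norm y < r" "\<bar>z y\<bar> < zt*r" using ny by linarith
  then show ?thesis
  proof cases
   case a
   have "D/r^2*(r^2/2) <= D/r^2*NN y" using NN_ge[of y] D unfolding a by (intro mlm) auto
   then have "Cf <= D/r^2*NN y" using r0 by (simp add: D_def)
   then show ?thesis using P0 fb(2)[of y] el2[OF y(1)] eG nN evq by linarith
  next
   case b
   have "z y^4 = (zt*r)^4" using b power_even_abs[of 4 "z y"] by simp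
   then have "E*z y^4 = Cf" using zt r0 by (simp add: E_def)
   then show ?thesis using P0 fb(2)[of y] el2[OF y(1)] eG nN evq by linarith
  next
   case c
   define V where "V = {x. \<bar>z x\<bar> < zt*r} \<inter> ball 0 r"
   have oV: "open V" unfolding V_def by (intro open_Int open_Collect_less cnt z_cont open_ball)
   have yV: "y : V" using c by (simp add: V_def)
   have "V \<subseteq> S" unfolding V_def S_def by auto
   then have L0: "Lo gP HP y <= 0" using Lo_max[OF CP oV yV] y(2) by blast
   define q where "q = sg y*Q y"
   define b where "b = be y"
   define ff where "ff = fS nv y"
   have q: "q >= 0" using sg_pos[of y] Modica[of y] by (simp add: q_def)
   have b: "b >= 0" by (simp add: b_def be_nonneg)
   have nu2: "(norm nv)^2 <= C1^2" using nv(2) by (intro power_mono) auto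
   have i3: "(A/r^2)*Lo g2 H2 y >= (A * c0^2/r^2)*ff - (A*C1^2/r^2)*q - (A*C1^2*n/r/r) * b - (2*A*zt\<^sup>2*C1^2) * b^2
     - (8*A*t*C1*zt)*q - (2*A*t*C1*k1/r) * b - (4*A*t*C1*zt / c0) * b^2"
   proof -
    have "(norm nv)^2*Q y <= C1^2*(q + n * b)"
     using Q_split[of y] Modica[of y] nu2 by (intro mult_mono) (auto simp: q_def b_def n_def)
    moreover have "(norm nv)^2*((z y)^2 * b^2) <= C1^2*((zt*r)^2 * b^2)"
    proof (intro mult_mono nu2 mrm)
     show "(z y)^2 <= (zt*r)^2" using ny(2) abs_le_square_iff[of "z y" "zt*r"] zt r0 by simp
    qed auto
    ultimately have gg: "2*(gl y $. gl y) >= c0^2*ff - C1\<^sup>2*(q + n * b) - 2*(C1^2*((zt*r)^2 * b^2))"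
     using l(3)[of y] unfolding ff_def b_def by linarith
    have Ll: "\<bar>Lo gl Hl y\<bar> <= C1*(4*(zt*r)*q + k1 * b + 2 / c0*(zt*r) * b^2)"
    proof -
     define S1 where "S1 = 4*\<bar>z y\<bar>*q + k1 * b + 2 / c0*\<bar>z y\<bar> * b^2"
     have "4*\<bar>z y\<bar>*q <= 4*(zt*r)*q" using ny(2) q by (intro mrm) auto
     moreover have "2 / c0*\<bar>z y\<bar> * b^2 <= 2 / c0*(zt*r) * b^2" using ny(2) c0(1) by (intro mrm mlm) auto
     ultimately have "S1 <= 4*(zt*r)*q + k1 * b + 2 / c0*(zt*r) * b^2" unfolding S1_def by linarith
     moreover have "0 <= S1" unfolding S1_def using q b k1 c0(1) by (intro add_nonneg_nonneg mnn) auto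
     ultimately have "norm nv*S1 <= C1*(4*(zt*r)*q + k1 * b + 2 / c0*(zt*r) * b^2)" using nv(2) C1 by (intro mult_mono) auto
     then show ?thesis using l(2)[of y] unfolding S1_def k1_def n_def q_def b_def by linarith
    qed
    have "\<bar>el nv y*Lo gl Hl y\<bar> <= (t*r)*(C1*(4*(zt*r)*q + k1 * b + 2 / c0*(zt*r) * b^2))"
     unfolding abs_mult using elb[OF y(1)] Ll t r0 by (intro mult_mono) auto
    then have "Lo g2 H2 y >= c0^2*ff - C1\<^sup>2*(q + n * b) - 2*(C1^2*((zt*r)^2 * b^2)) - 2*((t*r)*(C1*(4*(zt*r)*q + k1 * b + 2 / c0*(zt*r) * b^2)))"
     unfolding Ll2 using gg by linarith
    from mlm[OF this, of "A/r^2"] A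
    have "(A/r^2)*(c0^2*ff - C1\<^sup>2*(q + n * b) - 2*(C1^2*((zt*r)^2 * b^2)) - 2*((t*r)*(C1*(4*(zt*r)*q + k1 * b + 2 / c0*(zt*r) * b^2)))) <= (A/r^2)*Lo g2 H2 y" by simp
    moreover have "(A/r^2)*(c0^2*ff - C1\<^sup>2*(q + n * b) - 2*(C1^2*((zt*r)^2 * b^2)) - 2*((t*r)*(C1*(4*(zt*r)*q + k1 * b + 2 / c0*(zt*r) * b^2))))
     = (A * c0^2/r^2)*ff - (A*C1^2/r^2)*q - (A*C1^2*n/r/r) * b - (2*A*zt\<^sup>2*C1^2) * b^2
     - (8*A*t*C1*zt)*q - (2*A*t*C1*k1/r) * b - (4*A*t*C1*zt / c0) * b^2"
     using r0 c0(1) by (simp add: pow2 field_simps)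
    ultimately show ?thesis by simp
   qed
   have i4: "(D/r^2)*Lo gN HN y <= 2*n*D/r^2 + (8*D*zt)*q + (D*d1/r) * b + (4*D*zt / c0) * b^2"
   proof -
    have zr: "zt*r <= r" using zt r0 by (simp add: mult_left_le_one_le)
    have "Lo gN HN y <= 2*n + r*(8*((zt*r)*q) + 6*(n * b)) + 4*(b*r) + 2 / c0*(b*(4*r + 2*r + 2*((zt*r)*(b*r))))"
    proof -
     define a where "a = norm y"
     define m where "m = \<bar>z y\<bar>"
     have am: "0 <= a" "a <= r" "0 <= m" "m <= zt*r" using ny by (auto simp: a_def m_def)
     have "m*q <= (zt*r)*q" using am q by (intro mrm) auto
     then have "8*(m*q) + 6*(n * b) <= 8*((zt*r)*q) + 6*(n * b)" by simp
     then have t1: "a*(8*(m*q) + 6*(n * b)) <= r*(8*((zt*r)*q) + 6*(n * b))"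
      using am q b n r0 by (intro mult_mono) auto
     have t2: "b * a <= b*r" using am b by (intro mlm) auto
     have "m*(b * a) <= (zt*r)*(b*r)" using am t2 b r0 by (intro mult_mono) auto
     then have "4 * a + 2*m + 2*(m*(b * a)) <= 4*r + 2*r + 2*((zt*r)*(b*r))" using am zr by linarith
     then have "2 / c0*(b*(4 * a + 2*m + 2*(m*(b * a)))) <= 2 / c0*(b*(4*r + 2*r + 2*((zt*r)*(b*r))))"
      using b c0(1) by (intro mlm) auto
     then show ?thesis using N(2)[of y] t1 t2 unfolding n_def[symmetric] q_def[symmetric] b_def[symmetric] a_def[symmetric] m_def[symmetric] by linarith
    qed
    from mlm[OF this, of "D/r^2"] D
    have "(D/r^2)*Lo gN HN y <= (D/r^2)*(2*n + r*(8*((zt*r)*q) + 6*(n * b)) + 4*(b*r) + 2 / c0*(b*(4*r + 2*r + 2*((zt*r)*(b*r)))))" by simp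
    also have "... = 2*n*D/r^2 + (8*D*zt)*q + (D*d1/r) * b + (4*D*zt / c0) * b^2"
     using r0 c0(1) by (simp add: d1_def pow2 field_simps)
    finally show ?thesis .
   qed
   have i5: "E*Lo gz Hz y <= Cf*C5/(zt*r)^4 + (Cf*C5*(1/(zt*r)^4 + 1/(zt*r))) * b^2"
   proof -
    have "\<bar>z y\<bar>^3 <= (zt*r)^3" using ny(2) by (intro power_mono) auto
    then have "C5*(1 + (1 + \<bar>z y\<bar>^3) * b^2) <= C5*(1 + (1 + (zt*r)^3) * b^2)" using k1 by (intro mlm add_mono mrm) auto
    then have "Lo gz Hz y <= C5*(1 + (1 + (zt*r)^3) * b^2)" using z4(2)[of y] unfolding b_def by linarith
    then have "E*Lo gz Hz y <= E*(C5*(1 + (1 + (zt*r)^3) * b^2))" using E by (intro mlm) auto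
    also have "... = Cf*C5/(zt*r)^4 + (Cf*C5*(1/(zt*r)^4 + 1/(zt*r))) * b^2"
    proof -
     have "zt*r ~= 0" using zt r0 by simp
     then show ?thesis unfolding E_def by (simp add: eval_nat_numeral field_simps)
    qed
    finally show ?thesis .
   qed
   have i2: "evq*(6*q + b^2/4) <= evq*Lo gG HG y" using G(2)[of y] evq by (simp add: q_def b_def)
   have "(A * c0^2/r^2)*ff <= 2*(A*C1^2*n/r/r + 2*A*t*C1*k1/r + D*d1/r)^2/evq + 2*n*D/r^2 + Cf*C5/(zt*r)^4"
   proof (rule bernstein_arith[where q = q and b = b and ?p1.0 = "A*C1^2/r^2" and ?s1.0 = "2*A*zt\<^sup>2*C1^2" and ?p2.0 = "8*A*t*C1*zt"
      and ?s2.0 = "4*A*t*C1*zt / c0" and ?p3.0 = "8*D*zt" and ?s3.0 = "4*D*zt / c0" and ?s4.0 = "Cf*C5*(1/(zt*r)^4 + 1/(zt*r))"])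
    show "(A * c0^2/r^2)*ff - (A*C1^2/r^2)*q - (A*C1^2*n/r/r) * b - (2*A*zt\<^sup>2*C1^2) * b^2
     - (8*A*t*C1*zt)*q - (2*A*t*C1*k1/r) * b - (4*A*t*C1*zt / c0) * b^2 + evq*(6*q + b^2/4)
     - (2*n*D/r^2 + (8*D*zt)*q + (D*d1/r) * b + (4*D*zt / c0) * b^2)
     - (Cf*C5/(zt*r)^4 + (Cf*C5*(1/(zt*r)^4 + 1/(zt*r))) * b^2) <= 0"
     using L0 f(2)[of y] i2 i3 i4 i5 unfolding LP mult_minus_left by linarith
    have "A*C1^2 <= evq*r" using rr(2) evq by (simp add: divide_le_eq mult.commute)
    also have "... <= evq*r^2" using rsq evq by simp
    finally show "A*C1^2/r^2 <= evq" using r0 by (simp add: divide_le_eq)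
    have "t*(8*A*C1*zt) <= 1*(8*A*C1*zt)" using t A C1 zt by (intro mrm) auto
    then show "8*A*t*C1*zt <= evq" using cz(1) evq by (simp add: mult_ac)
    show "8*D*zt <= evq" using cz(2) evq by linarith
    have "zt*(2*A*C1^2*zt) <= 1*(2*A*C1^2*zt)" using A zt by (intro mrm) auto
    then show "2*A*zt\<^sup>2*C1^2 <= evq/32" using cz(3) by (simp add: mult_ac pow2)
    have "t*(4*A*C1 / c0*zt) <= 1*(4*A*C1 / c0*zt)" using t A C1 zt c0(1) by (intro mrm) auto
    moreover have "4*A*t*C1*zt / c0 = t*(4*A*C1 / c0*zt)" "4*D*zt / c0 = 4*D / c0*zt" by simp_all
    ultimately show "4*A*t*C1*zt / c0 <= evq/32" "4*D*zt / c0 <= evq/32" using cz(4,5) by linarith+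
    have "1/(zt*r)^4 + 1/(zt*r) <= (1/zt^4 + 1/zt)/r"
    proof -
     have "1/(zt^4*r^4) <= 1/(zt^4*r)" using r4 zt r0 by (intro divide_left_mono mlm mult_pos_pos) auto
     then show ?thesis by (simp add: pmd add_divide_distrib)
    qed
    then have "Cf*C5*(1/(zt*r)^4 + 1/(zt*r)) <= Cf*C5*((1/zt^4 + 1/zt)/r)" using Cf k1 by (intro mlm) auto
    also have "... = Cf*C5*(1/zt^4 + 1/zt)/r" by simp
    also have "... <= evq/32"
    proof -
     have "Cf*C5*(1/zt^4 + 1/zt)*32 <= r*evq" using rr(4) evq by (simp only: pos_divide_le_eq)
     then show ?thesis unfolding pos_divide_le_eq[OF r0] by (simp add: mult.commute)
    qed
    finally show "Cf*C5*(1/(zt*r)^4 + 1/(zt*r)) <= evq/32" .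
   qed (use q evq in auto)
   also have "... <= 2*(b0/r)^2/evq + 2*n*D/r^2 + 1/r^2"
   proof (intro add_mono order_refl divide_right_mono mlm power_mono)
    have "A*C1^2*n/r <= 1" using rr(3) r0 by (simp add: divide_le_eq)
    then have "A*C1^2*n/r + 2*A*t*C1*k1 + D*d1 <= b0" using tA unfolding b0_def by linarith
    from divide_right_mono[OF this, of r] r0
    show "A*C1^2*n/r/r + 2*A*t*C1*k1/r + D*d1/r <= b0/r" by (simp add: add_divide_distrib)
    show "0 <= A*C1^2*n/r/r + 2*A*t*C1*k1/r + D*d1/r" using A C1 n t k1 D r0 by (intro add_nonneg_nonneg divide_nonneg_pos mnn) auto
    have "Cf*C5/zt^4 <= r^2" using rr(5) rsq by linarith
    then have i: "Cf*C5/zt^4/r^4 <= r^2/r^4" using r0 by (intro divide_right_mono) auto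
    have ii: "Cf*C5/(zt*r)^4 = Cf*C5/zt^4/r^4" by (simp add: pmd)
    have iii: "r^2/r^4 = 1/r^2" unfolding x4 divide_divide_eq_left[symmetric] using r0 by simp
    show "Cf*C5/(zt*r)^4 <= 1/r^2" unfolding ii iii[symmetric] by (rule i)
   qed (use evq in auto)
   also have "... = (A * c0^2/r^2)*evq"
   proof -
    have "(A * c0^2/r^2)*evq = (A * c0^2*evq)/r^2" by simp
    then show ?thesis unfolding Ac by (simp add: power_divide add_divide_distrib)
   qed
   finally have F: "(A * c0^2/r^2)*ff <= (A * c0^2/r^2)*evq" .
   have "A * c0^2/r^2 > 0" using A c0(1) r0 by simp
   from mult_left_le_imp_le[OF F this] have "ff <= evq" .
   then show ?thesis using P0 el2[OF y(1)] eG nN unfolding ff_def by linarith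
  qed
 qed
 have "fS nv x <= evq*(4 + X)" if "T x <= r" for x
 proof -
  have tx: "x : S" "D/r^2*NN x <= evq" "E*z x^4 <= evq" using T0[OF that] by auto
  have "0 <= (A/r^2)*(el nv x*el nv x)" using A by simp
  moreover have "0 <= evq*GS x" using evq Gb(1)[of x] by simp
  moreover have "Ph x = fS nv x + (A/r^2)*(el nv x*el nv x) + evq*GS x - D/r^2*NN x - E*z x^4" by (simp add: Ph_def)
  moreover have "evq*(4 + X) = 4*evq + evq*X" by (simp add: alg)
  ultimately show ?thesis using y(2)[OF tx(1)] Py tx by linarith
 qed
 then show ?thesis using rr(7,8) unfolding X_def by blast
qed

text \<open>The normal \<open>nv\<close> varies with the scale, but
  \<open>bernstein_estimate\<close> uses one and the same for two given points. The triangle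
  inequality therefore compares \<open>Z / ze\<close> at these points directly.\<close>

theorem flat_imp_one_dim:
 assumes "\<exists>C>0. \<forall>xj>0. \<exists>R0\<ge>1. \<forall>r\<ge>R0. \<exists>nv. nv $. e = 1 & norm nv <= C & (\<forall>x. norm x <= r --> \<bar>nv $. x\<bar> <= xj*r + C*(\<bar>z x\<bar> + 1))"
 shows "one_dim u"
proof -
 obtain C where C: "C > 0" and fl: "!!xj. xj > 0 ==> \<exists>R0\<ge>1. \<forall>r\<ge>R0. \<exists>nv. nv $. e = 1 & norm nv <= C & (\<forall>x. norm x <= r --> \<bar>nv $. x\<bar> <= xj*r + C*(\<bar>z x\<bar> + 1))"
  using assms by blast
 define C1 where "C1 = C + 1"
 have C1: "C1 >= 1" using C by (simp add: C1_def)
 have flat: "\<exists>R0\<ge>1. \<forall>r\<ge>R0. \<exists>nv. nv $. e = 1 & norm nv <= C1 & (\<forall>x. norm x <= r --> \<bar>nv $. x\<bar> <= xj*r + C1*(\<bar>z x\<bar> + 1))" if xi: "xj > 0" for xj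
 proof -
  have le1: "C*(\<bar>z x\<bar> + 1) <= C1*(\<bar>z x\<bar> + 1)" for x unfolding C1_def by (intro mrm) auto
  obtain R0 where "R0 >= 1" and R0: "!!r. r >= R0 ==> \<exists>nv. nv $. e = 1 & norm nv <= C & (\<forall>x. norm x <= r --> \<bar>nv $. x\<bar> <= xj*r + C*(\<bar>z x\<bar> + 1))"
   using fl[OF xi] by blast
  show ?thesis
  proof (intro exI[of _ R0] conjI allI impI)
   show "1 <= R0" by fact
   fix r assume "r >= R0"
   from R0[OF this] obtain nv where nu: "nv $. e = 1" "norm nv <= C" "!!x. norm x <= r ==> \<bar>nv $. x\<bar> <= xj*r + C*(\<bar>z x\<bar> + 1)" by blast
   have "\<bar>nv $. x\<bar> <= xj*r + C1*(\<bar>z x\<bar> + 1)" if "norm x <= r" for x using nu(3)[OF that] le1[of x] by linarith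
   moreover have "norm nv <= C1" using nu(2) by (simp add: C1_def)
   ultimately show "\<exists>nv. nv $. e = 1 & norm nv <= C1 & (\<forall>x. norm x <= r --> \<bar>nv $. x\<bar> <= xj*r + C1*(\<bar>z x\<bar> + 1))" using nu(1) by blast
  qed
 qed
 have eq: "vv x $* Z x = vv 0 $* Z 0" for x
 proof (rule ccontr)
  assume "vv x $* Z x ~= vv 0 $* Z 0"
  then have pos: "norm (vv x $* Z x - vv 0 $* Z 0) > 0" by simp
  define d where "d = norm (vv x $* Z x - vv 0 $* Z 0)"
  define k where "k = 4 + 1 / c0^2"
  have k: "k > 0" unfolding k_def by (intro add_pos_nonneg) auto
  have "(d/4)^2/k > 0" using pos k by (simp add: d_def)
  then obtain nv where nu: "fS nv x <= (d/4)^2/k*k" "fS nv 0 <= (d/4)^2/k*k"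
   using bernstein_estimate[OF C1 flat, of "(d/4)^2/k" x 0] unfolding k_def[symmetric] by blast
  have b: "norm (vv y $* Z y - nv) <= d/4" if "fS nv y <= (d/4)^2/k*k" for y
  proof (rule power2_le_imp_le)
   show "(norm (vv y $* Z y - nv))^2 <= (d/4)^2" using that k unfolding fS_eq by simp
  qed (simp add: d_def)
  have "d <= norm (vv x $* Z x - nv) + norm (vv 0 $* Z 0 - nv)"
   unfolding d_def using norm_triangle_ineq4[of "vv x $* Z x - nv" "vv 0 $* Z 0 - nv"] by simp
  then show False using b[OF nu(1)] b[OF nu(2)] pos by (simp add: d_def)
 qed
 show ?thesis
 proof (rule parallel_gradient_imp_one_dim)
  have "(vv 0 $* Z 0) $. e = 1" using ze_pos[of 0] by (simp add: vv_def ze_def)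
  then show "vv 0 $* Z 0 ~= 0" by auto
  fix x
  have "Z x = ze x $* (vv x $* Z x)" using ze_pos[of x] by (simp add: vv_def)
  then have "Z x = ze x $* (vv 0 $* Z 0)" unfolding eq[of x] .
  then have "U x = (sqrt 2 * sg x*ze x) $* (vv 0 $* Z 0)" using U_eq[of x] by (metis scaleR_scaleR)
  then show "\<exists>k. U x = k $* (vv 0 $* Z 0)" by blast
 qed
qed

end

end

section \<open>Low dimensions\<close>

context ac
begin

lemma zero_of_integral_le:
 assumes f: "continuous_on UNIV f" "!!x. f x >= 0" and i: "!!evq. evq > 0 ==> (LINT x|lborel. indicator (ball 0 R) x $* f x) <= (evq::real)" and x: "x : ball 0 R"
 shows "f (x::'a) = 0"
proof (rule ccontr)
 assume nz: "f x ~= 0"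
 have int: "integrable lborel (%x. indicator (ball 0 R) x $* f x)" by (rule integral_bounded_open(3)[OF open_ball bounded_ball f(1)])
 have nn: "0 <= indicator (ball 0 R) x $* f x" for x using f(2) by simp
 have "(LINT x|lborel. indicator (ball 0 R) x $* f x) <= 0" by (rule field_le_epsilon) (use i in simp)
 moreover have "0 <= (LINT x|lborel. indicator (ball 0 R) x $* f x)" by (rule integral_nonneg_AE) (use nn in auto)
 ultimately have "AE x in lborel. indicator (ball 0 R) x $* f x = 0"
  using integral_nonneg_eq_0_iff_AE[OF int] nn by force
 then have AE0: "AE x in lborel. x ~: ball 0 R \<inter> {x. f x ~= 0}" by (rule eventually_mono) auto
 have op: "open (ball 0 R \<inter> {x. f x ~= 0})" using f(1) by (intro open_Int open_ball open_Collect_neq cnt)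
 have "ball 0 R \<inter> {x. f x ~= 0} : null_sets lborel" using AE0 op by (subst AE_iff_null_sets) auto
 then have "negligible (ball 0 R \<inter> {x. f x ~= 0})" by (simp add: negligible_iff_null_sets null_sets_completionI)
 then show False using open_not_negligible[OF op] x nz by blast
qed

text \<open>With energy growth at most quadratic, the mean of \<open>N\<close> cutoffs at dyadic
  radii makes the right side of \<open>caccioppoli\<close> for \<open>- ln ze\<close> of order
  \<open>1/N\<close>. Hence \<open>ze\<close> is constant, its equation forces \<open>Q = 0\<close>,
  and Bochner's formula then forces the Hessian of \<open>z\<close> to vanish.\<close>

theorem low_dimension_one_dim:
 assumes n3: "DIM('a) <= 3" and CE: "CE > 0" and EB: "!!R. R > 1 ==> (LINT x|lborel. indicator (ball 0 R) x*wt x) <= CE*R^(DIM('a) - 1)"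
 shows "one_dim u"
proof -
 define r where "r j = (2::real)^j" for j
 have r: "r j > 0" "r j >= 1" for j by (auto simp: r_def)
 define gm where "gm j x = (cutS' (x $. x/(r j)^2 - 1)*(1/(r j)^2)) $* (2 $* x)" for j and x :: 'a
 define g where "g x = gd 0 x $. gd 0 x" for x
 have w: "C2g (wd 0) (gd 0) (Hd 0)" "!!x. Mo (gd 0) (Hd 0) x >= gd 0 x $. gd 0 x" using wd_facts[of 0] by auto
 have cg: "continuous_on UNIV (%x. wt x*g x)" unfolding g_def by (intro cnt wt_cont C2gD(6)[OF w(1)])
 \<comment> \<open>\<open>gm j\<close> lives where \<open>x $. x\<close> is between
   \<open>(r j)^2\<close> and twice this value, while the squared radii grow by factors of
   4.\<close>
 have disj: "gm j x = 0" if "gm k x ~= 0" "j ~= k" for j k x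
 proof (rule ccontr)
  assume nj: "gm j x ~= 0"
  have s: "(r i)^2 < x $. x" "x $. x < 2*(r i)^2" if "gm i x ~= 0" for i
   using that cutR_facts(7)[OF r(1)[of i], of "x $. x"] cutR_facts(8)[OF r(1)[of i], of "x $. x"] unfolding gm_def
   by (auto simp: not_le[symmetric])
  have m: "2*(r i)^2 <= (r i')^2" if "i < i'" for i i'
  proof -
   have "2*r i <= r i'" using power_increasing[of "Suc i" i' "2::real"] that by (simp add: r_def)
   then have "(2*r i)^2 <= (r i')^2" using r(1)[of i] by (intro power_mono) auto
   then have "4*(r i)^2 <= (r i')^2" by (simp add: pmd)
   then show ?thesis using zero_le_power2[of "r i"] by linarith
  qed
  consider "j < k" | "k < j" using \<open>j ~= k\<close> by linarith
  then show False using s[OF nj] s[OF that(1)] m[of j k] m[of k j] by cases auto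
 qed
 have EB2: "(LINT x|lborel. indicator (ball 0 (2*r j)) x*wt x) <= CE*(2*r j)^2" for j
 proof -
  have "2*r j > 1" using r(2)[of j] by simp
  then have "(2*r j)^(DIM('a) - 1) <= (2*r j)^2" using n3 by (intro power_increasing) auto
  then have "CE*(2*r j)^(DIM('a) - 1) <= CE*(2*r j)^2" using CE by simp
  then show ?thesis using EB[OF \<open>2 * r j > 1\<close>] by linarith
 qed
 have key: "(LINT x|lborel. indicator (ball 0 (r m)) x $* (wt x*g x)) <= 2304*CE/real N" if N: "N >= 1" for m N :: nat
 proof -
  define J where "J = {m..<m + N}"
  have J: "finite J" "card J = N" by (auto simp: J_def)
  define et where "et x = (1/real N)*(\<Sum>j\<in>J. cutR (r j) (x $. x))" for x :: 'a
  define gm' where "gm' x = (1/real N) $* (\<Sum>j\<in>J. gm j x)" for x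
  have Cet: "C1g et gm'" unfolding et_def[abs_def] gm'_def[abs_def] gm_def by (intro C1g_cmult C1g_sum C1g_cut_ball(1) r)
  have z: "cutR (r j) (x $. x) = 0" if "norm x >= 2*r (m + N)" "j : J" for j x
  proof -
   have "r j <= r (m + N)" using that(2) by (auto simp: r_def J_def intro!: power_increasing)
   then have "norm x >= 2*r j" using that by linarith
   then have "(norm x)^2 >= (2*r j)^2" using r(1)[of j] by (intro power_mono) auto
   then have "x $. x >= 4*(r j)^2" by (simp add: nrm2 pmd)
   then have "x $. x >= 2*(r j)^2" using zero_le_power2[of "r j"] by linarith
   then show ?thesis by (rule cutR_facts(5)[OF r(1)])
  qed
  have cs: "csupp et" unfolding csupp_def
  proof (intro exI[of _ "2*r (m + N)"] allI impI)
   fix x :: 'a assume "2*r (m + N) < norm x"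
   then have "(\<Sum>j\<in>J. cutR (r j) (x $. x)) = 0" using z[OF less_imp_le] by (intro sum.neutral) blast
   then show "et x = 0" by (simp add: et_def)
  qed
  note cac = caccioppoli[OF w Cet cs]
  have one: "et x = 1" if "x : ball 0 (r m)" for x
  proof -
   have "cutR (r j) (x $. x) = 1" if "j : J" for j
   proof (rule cutR_facts(4)[OF r(1)])
    have "r m <= r j" using that by (auto simp: r_def J_def intro!: power_increasing)
    then have "(norm x)^2 <= (r j)^2" using \<open>x : ball 0 (r m)\<close> by (intro power_mono) auto
    then show "x $. x <= (r j)^2" by (simp add: nrm2)
   qed
   then have "et x = (1/real N)*(\<Sum>j\<in>J. 1)" unfolding et_def by simp
   then show ?thesis using J N by simp
  qed
  have "(LINT x|lborel. indicator (ball 0 (r m)) x $* (wt x*g x)) <= (LINT x|lborel. wt x*((et x)^2*(gd 0 x $. gd 0 x)))"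
  proof (rule integral_mono[OF integral_bounded_open(3)[OF open_ball bounded_ball cg] cac(2)])
   fix x show "indicator (ball 0 (r m)) x $* (wt x*g x) <= wt x*((et x)^2*(gd 0 x $. gd 0 x))"
    using one[of x] wt_pos[of x] by (cases "x : ball 0 (r m)") (auto simp: g_def)
  qed
  also have "... <= 4*(LINT x|lborel. wt x*(gm' x $. gm' x))" by (rule cac(1))
  also have "(LINT x|lborel. wt x*(gm' x $. gm' x)) <= (LINT x|lborel. (1/real N)^2*(\<Sum>j\<in>J. (12/r j)^2*(indicator (ball 0 (2*r j)) x*wt x)))"
  proof (rule integral_mono[OF cac(3)])
   have "integrable lborel (%x. indicator (ball 0 (2*r j)) x*wt x)" for j
    using integral_bounded_open(3)[OF open_ball bounded_ball wt_cont] by simp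
   then show "integrable lborel (%x. (1/real N)^2*(\<Sum>j\<in>J. (12/r j)^2*(indicator (ball 0 (2*r j)) x*wt x)))"
    by (intro integrable_mult_right Bochner_Integration.integrable_sum)
   fix x :: 'a
   have gb: "gm j x $. gm j x <= (12/r j)^2*indicator (ball 0 (2*r j)) x" for j
   proof -
    have "norm (gm j x) <= 12/r j*indicator (ball 0 (2*r j)) x" unfolding gm_def by (rule C1g_cut_ball(3)[OF r(1)])
    then have "(norm (gm j x))^2 <= (12/r j*indicator (ball 0 (2*r j)) x)^2" by (intro power_mono) auto
    then show ?thesis by (cases "x : ball 0 (2*r j)") (simp_all add: nrm2)
   qed
   have "(\<Sum>j\<in>J. gm j x) $. (\<Sum>j\<in>J. gm j x) <= (\<Sum>j\<in>J. gm j x $. gm j x)"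
   proof (cases "\<exists>k\<in>J. gm k x ~= 0")
    case True
    then obtain k where k: "k : J" "gm k x ~= 0" by blast
    have "(\<Sum>j\<in>J. gm j x) = gm k x + (\<Sum>j\<in>J - {k}. gm j x)" using sum.remove[OF J(1) k(1)] .
    also have "(\<Sum>j\<in>J - {k}. gm j x) = 0" using disj[OF k(2)] by (intro sum.neutral) auto
    finally have "(\<Sum>j\<in>J. gm j x) $. (\<Sum>j\<in>J. gm j x) = gm k x $. gm k x" by simp
    also have "... <= (\<Sum>j\<in>J. gm j x $. gm j x)" using J(1) k(1) by (intro member_le_sum) auto
    finally show ?thesis .
   qed (simp add: sum_nonneg)
   also have "... <= (\<Sum>j\<in>J. (12/r j)^2*indicator (ball 0 (2*r j)) x)" by (intro sum_mono gb)
   finally have "(1/real N)^2*((\<Sum>j\<in>J. gm j x) $. (\<Sum>j\<in>J. gm j x)) <= (1/real N)^2*(\<Sum>j\<in>J. (12/r j)^2*indicator (ball 0 (2*r j)) x)"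
    by (intro mlm) auto
   then have "gm' x $. gm' x <= (1/real N)^2*(\<Sum>j\<in>J. (12/r j)^2*indicator (ball 0 (2*r j)) x)"
    by (simp add: gm'_def pow2)
   from mlm[OF this, of "wt x"] wt_pos[of x]
   show "wt x*(gm' x $. gm' x) <= (1/real N)^2*(\<Sum>j\<in>J. (12/r j)^2*(indicator (ball 0 (2*r j)) x*wt x))"
    by (simp add: sum_distrib_left mult_ac)
  qed
  also have "(LINT x|lborel. (1/real N)^2*(\<Sum>j\<in>J. (12/r j)^2*(indicator (ball 0 (2*r j)) x*wt x)))
    = (1/real N)^2*(\<Sum>j\<in>J. (12/r j)^2*(LINT x|lborel. indicator (ball 0 (2*r j)) x*wt x))"
  proof -
   have i: "integrable lborel (%x. (12/r j)^2*(indicator (ball 0 (2*r j)) x*wt x))" for j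
    using integral_bounded_open(3)[OF open_ball bounded_ball wt_cont] by simp
   show ?thesis using Bochner_Integration.integral_sum[of J lborel, OF i] by simp
  qed
  also have "... <= (1/real N)^2*(\<Sum>j\<in>J. 576*CE)"
  proof (intro mlm sum_mono)
   fix j
   have "(12/r j)^2*(LINT x|lborel. indicator (ball 0 (2*r j)) x*wt x) <= (12/r j)^2*(CE*(2*r j)^2)" by (intro mlm EB2) auto
   also have "... = 576*CE" using r(1)[of j] by (simp add: pow2)
   finally show "(12/r j)^2*(LINT x|lborel. indicator (ball 0 (2*r j)) x*wt x) <= 576*CE" .
  qed auto
  also have "... = 576*CE/real N" using J N by (simp add: pow2)
  finally show ?thesis by simp
 qed
 have gd0: "gd 0 x = 0" for x
 proof -
  obtain m where m: "norm x < r m" using real_arch_pow[of 2 "norm x"] unfolding r_def by auto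
  have "wt x*g x = 0"
  proof (rule zero_of_integral_le[OF cg])
   show "0 <= wt x*g x" for x using wt_pos[of x] by (simp add: g_def)
   show "x : ball 0 (r m)" using m by simp
   fix evq :: real assume e: "evq > 0"
   obtain N where N: "2304*CE/evq < real N" using reals_Archimedean2 by blast
   have "0 <= 2304*CE/evq" using e CE by simp
   then have "N >= 1" using N by (cases N) auto
   moreover from this have "2304*CE/real N <= evq" using N e by (simp add: field_simps)
   ultimately show "(LINT x|lborel. indicator (ball 0 (r m)) x $* (wt x*g x)) <= evq" using key[of N m] by linarith
  qed
  then show ?thesis using wt_pos[of x] by (simp add: g_def)
 qed
 have "Q x = 0" for x
 proof -
  have "(gd 0 has_derivative Hd 0 x) (at x)" by (rule C2gD(3)[OF w(1)])
  moreover have "(gd 0 has_derivative (%h. 0)) (at x)" proof -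
   have "gd 0 = (%x. 0)" using gd0 by auto
   then show ?thesis by simp
  qed
  ultimately have "Hd 0 x = (%h. 0)" by (rule has_derivative_unique)
  then have "Mo (gd 0) (Hd 0) x = 0" by (simp add: Mo_def gd0 tr_zero)
  then show "Q x = 0" using wd_facts(2)[of 0 x] gd0 sg_pos[of x] ze_pos[of x] by simp
 qed
 note Q0 = this
 have "be x = 0" for x
 proof -
  have "Q = (%x. 0)" using Q0 by (simp add: fun_eq_iff)
  then have "C2g Q (%x. 0) (%x h. 0)" using C2g_const[of 0] by simp
  from C2g_unique[OF C2g_Q this] have "Mo (%x. (-2) $* B x (Z x)) HQ x = 0" by (simp add: Mo_const)
  then show ?thesis using Mo_Q[of x] Q0[of x] by simp
 qed
 then have B0: "B x h = 0" for x h using norm_B[of x h] by simp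
 have "Z x = Z 0" for x
 proof -
  have "(Z has_derivative (%h. 0)) (at y)" for y using C2gD(3)[OF C2g_z, of y] B0 by (metis (no_types, lifting) ext)
  then show ?thesis by (intro has_derivative_zero_unique[of UNIV Z x 0]) auto
 qed
 note Zc = this
 show ?thesis
 proof (rule parallel_gradient_imp_one_dim)
  show "Z 0 ~= 0" using ze_pos[of 0] by (auto simp: ze_def)
  show "\<exists>k. U x = k $* Z 0" for x using U_eq[of x] Zc[of x] by metis
 qed
qed

end

section \<open>The limit sets\<close>

context ac
begin

lemma u_line_mono: "s <= s' ==> u (x + s $* e) <= u (x + s' $* e)"
 using u_line_strict_mono[of s s' x] by (cases "s = s'") auto

lemma z_le_iff: "z x <= z y \<longleftrightarrow> u x <= u y"
 unfolding u_eq_tanh[of x] u_eq_tanh[of y] tanh_real_le_iff by simp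

lemma z_ge: "tanh (sqrt 2*M) <= u y ==> M <= z y" and z_le: "u y <= tanh (sqrt 2*M) ==> z y <= M"
 unfolding u_eq_tanh[of y] tanh_real_le_iff by simp_all

text \<open>By dominated convergence the rescaled functions tend to \<open>sn\<close> in the mean on
  \<open>S\<close>. A point of \<open>T\<close> with \<open>|z| <= 1\<close> would, by
  \<open>clearing_out\<close> at radius about \<open>rh / eps j\<close>, contribute at least the
  fixed amount \<open>c\<close> after rescaling.\<close>

lemma clearing_eventually:
 assumes n4: "DIM('a) >= 4" and r: reaches and sn: "sn = 1 | sn = -1" and S: "open S" "bounded S"
  and eps: "!!j. eps j > 0" "eps \<longlonglongrightarrow> 0" and conv: "!!p. p : S ==> (%j. u ((1/eps j) $* p)) \<longlonglongrightarrow> sn"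
  and rh: "rh > 0" and T: "!!q. q : T ==> ball q (2*rh) \<subseteq> S"
 shows "\<forall>\<^sub>F j in sequentially. \<forall>q\<in>T. \<not> \<bar>z ((1/eps j) $* q)\<bar> <= 1"
proof -
 define f where "f j p = indicator S p*\<bar>sn - u ((1/eps j) $* p)\<bar>" for j p
 have uc: "continuous_on UNIV (%p. \<bar>sn - u (c $* p)\<bar>)" for c
  by (intro cnt cnt2[OF u_cont(1)[of UNIV]]) auto
 have fm: "f j : borel_measurable borel" for j unfolding f_def[abs_def]
  using S(1) by (intro borel_measurable_times borel_measurable_indicator borel_measurable_continuous_onI[OF uc]) auto
 have b2: "\<bar>sn - u x\<bar> <= 2" for x using u_bound[of x] sn by auto
 have "(%j. integral\<^sup>L lborel (f j)) \<longlonglongrightarrow> integral\<^sup>L lborel (%p::'a. 0::real)"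
 proof (rule integral_dominated_convergence[where s = f and f = "%p::'a. 0::real" and w = "%p. 2*indicator S p"])
  show "integrable lborel (%p. 2*indicator S p :: real)" using integral_bounded_open(3)[OF S, of "%_. 1"] by simp
  show "AE p in lborel. (%j. f j p) \<longlonglongrightarrow> 0"
  proof (rule AE_I2)
   fix p
   show "(%j. f j p) \<longlonglongrightarrow> 0"
   proof (cases "p : S")
    case True
    have "(%j. \<bar>sn - u ((1/eps j) $* p)\<bar>) \<longlonglongrightarrow> \<bar>sn - sn\<bar>" by (intro tendsto_intros conv[OF True])
    then show ?thesis using True by (simp add: f_def)
   qed (simp add: f_def)
  qed
  show "AE p in lborel. norm (f j p) <= 2*indicator S p" for j
   using b2 by (intro AE_I2) (auto simp: f_def indicator_def)
 qed (use fm in simp_all)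
 then have J0: "(%j. LINT p|lborel. f j p) \<longlonglongrightarrow> 0" by simp
 have cmv: "Cmv > 0" unfolding Cmv_def[OF n4] using nn4[OF n4] by simp
 define c where "c = mu2*unit_ball_vol (real DIM('a))*(rh/2)^DIM('a)/(304*Cmv)"
 have c: "c > 0" unfolding c_def using mu2_pos rh cmv by (intro divide_pos_pos mult_pos_pos) auto
 have "\<forall>\<^sub>F j in sequentially. (LINT p|lborel. f j p) < c" using order_tendstoD(2)[OF J0 c] .
 moreover have "\<forall>\<^sub>F j in sequentially. eps j < rh/4" using order_tendstoD(2)[OF eps(2), of "rh/4"] rh by simp
 ultimately show ?thesis
 proof eventually_elim
  case (elim j)
  define evq where "evq = eps j"
  have e: "evq > 0" "evq < rh/4" using eps(1) elim by (auto simp: evq_def)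
  show ?case
  proof (intro ballI notI)
   fix q assume q: "q : T" and zq: "\<bar>z ((1/eps j) $* q)\<bar> <= 1"
   define p where "p = (1/evq) $* q"
   have zp: "\<bar>z p\<bar> <= 1" using zq by (simp add: p_def evq_def)
   \<comment> \<open>The largest integer with \<open>N*evq <= rh\<close>, so that the ball of radius
     \<open>2*N\<close> rescales into \<open>ball q (2*rh)\<close>. From \<open>evq < rh/4\<close>
     follow \<open>N >= 2\<close> and \<open>N*evq >= rh/2\<close>.\<close>
   define N where "N = nat \<lfloor>rh/evq\<rfloor>"
   have re: "rh/evq >= 4" using e by (simp add: le_divide_eq)
   then have N: "real N <= rh/evq" "real N > rh/evq - 1" unfolding N_def by linarith+
   have N2: "N >= 2" using N re by linarith
   define X where "X = rh/evq"
   have "X/2 <= real N" using N re unfolding X_def[symmetric] by linarith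
   then have Nl: "real N >= (rh/2)*(1/evq)" by (simp add: X_def)
   define S' where "S' = (%x. evq $* x) -` S"
   have oS: "open S'" unfolding S'_def by (intro open_vimage S cnt)
   have bS: "bounded S'"
   proof -
    obtain R where "!!x. x : S ==> norm x <= R" using S(2) unfolding bounded_iff by blast
    then have "norm x <= R/evq" if "x : S'" for x using that e by (fastforce simp: S'_def le_divide_eq mult.commute)
    then show ?thesis unfolding bounded_iff by blast
   qed
   have uc1: "continuous_on UNIV (%x. \<bar>sn - u x\<bar>)" by (intro cnt u_cont)
   have sub: "ball p (2*real N) \<subseteq> S'"
   proof
    fix x assume "x : ball p (2*real N)"
    then have "norm (x - p) < 2*real N" by (simp add: dist_norm norm_minus_commute)
    then have "evq*norm (x - p) < evq*(2*real N)" using e by simp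
    also have "... <= 2*rh" using N(1) e by (simp add: le_divide_eq mult.commute)
    finally have "norm (evq $* (x - p)) < 2*rh" using e by simp
    then have "norm (q - evq $* x) < 2*rh" using e by (simp add: p_def scaleR_diff_right norm_minus_commute)
    then show "x : S'" using T[OF q] by (auto simp: S'_def dist_norm)
   qed
   have "(LINT x|lborel. f j x) = evq^DIM('a)*(LINT x|lborel. f j (0 + evq $* x))" by (rule lborel_integral_affine[OF fm e(1)])
   also have "(LINT x|lborel. f j (0 + evq $* x)) = (LINT x|lborel. indicator S' x $* \<bar>sn - u x\<bar>)"
    using e by (intro Bochner_Integration.integral_cong) (auto simp: f_def S'_def evq_def[symmetric] indicator_def)
   finally have sc: "(LINT x|lborel. indicator S' x $* \<bar>sn - u x\<bar>)*evq^DIM('a) < c" using elim by (simp add: mult.commute)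
   have H: "(LINT x|lborel. indicator (ball p (2*real N)) x $* \<bar>sn - u x\<bar>) <= (LINT x|lborel. indicator S' x $* \<bar>sn - u x\<bar>)"
    using sub by (intro integral_mono integral_bounded_open(3)[OF open_ball bounded_ball uc1] integral_bounded_open(3)[OF oS bS uc1]) (auto simp: indicator_def)
   have "0 <= evq^DIM('a)" using e by simp
   from le_less_trans[OF mrm[OF H this] sc]
   have "(LINT x|lborel. indicator (ball p (2*real N)) x*\<bar>sn - u x\<bar>)*evq^DIM('a) < c" by simp
   then have "304*Cmv*((LINT x|lborel. indicator (ball p (2*real N)) x*\<bar>sn - u x\<bar>)*evq^DIM('a)) < 304*Cmv * c" using cmv by simp
   moreover have "mu2*unit_ball_vol (real DIM('a))*real N^DIM('a)*evq^DIM('a) <= 304*Cmv*(LINT x|lborel. indicator (ball p (2*real N)) x*\<bar>sn - u x\<bar>)*evq^DIM('a)"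
    using e by (intro mrm clearing_out[OF n4 r sn zp N2]) auto
   moreover have "mu2*unit_ball_vol (real DIM('a))*(rh/2)^DIM('a) <= mu2*unit_ball_vol (real DIM('a))*(real N^DIM('a)*evq^DIM('a))"
   proof (intro mlm)
    have "rh/2 <= real N*evq" using Nl e by (simp add: divide_le_eq)
    then have "(rh/2)^DIM('a) <= (real N*evq)^DIM('a)" using rh by (intro power_mono) auto
    then show "(rh/2)^DIM('a) <= real N^DIM('a)*evq^DIM('a)" by (simp add: pmd)
   qed (use mu2_pos in auto)
   moreover have "304*Cmv * c = mu2*unit_ball_vol (real DIM('a))*(rh/2)^DIM('a)" using cmv by (simp add: c_def)
   ultimately show False by (simp add: mult_ac)
  qed
 qed
qed

end

theorem theorem1p2:
  fixes u :: "(real^'m) \<times> real \<Rightarrow> real"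
    and eps :: "nat \<Rightarrow> real"
    and d0 h0 d Kbar K :: real
  assumes C2u: "C2 u"
    and range_u: "\<forall>x. u x \<in> {-1..1}"
    and pde: "\<forall>x. laplacian u x = W' (u x)"
    and mono: "\<forall>x. partial u (0, 1) x > 0"
    and energy_bound: "\<exists>C>0. \<forall>R>1.
          integral (ball 0 R) (\<lambda>x. grad_sq u x / 2 + W (u x)) \<le> C * R ^ CARD('m)"
    and d0_pos: "d0 > 0" and h0_pos: "h0 > 0"
    and eps_pos: "\<forall>j. eps j > 0"
    and eps_lim: "eps \<longlonglongrightarrow> 0"
    and ae_conv: "\<exists>v. (\<forall>p. v p \<in> {-1, 1}) \<and>
          (AE p in lebesgue. p \<in> cyl d0 h0 \<longrightarrow> (\<lambda>j. u ((1 / eps j) *\<^sub>R p)) \<longlonglongrightarrow> v p)"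
    and d: "0 < d" "d \<le> d0"
    and K: "0 < K" "K \<le> h0" and Kbar: "0 < Kbar" "Kbar \<le> h0" and KK: "K < Kbar"
    and Lm_ne: "Lset u eps d0 h0 (-1) \<inter> cyl d Kbar \<noteq> {}"
    and Lp_ne: "Lset u eps d0 h0 1 \<inter> cyl d Kbar \<noteq> {}"
    and bdry: "(frontier (Lset u eps d0 h0 (-1)) \<union> frontier (Lset u eps d0 h0 1)) \<inter> cyl d Kbar
          \<subseteq> {x. \<bar>snd x\<bar> < K}"
  shows "(\<forall>x'. ((\<lambda>t. u (x', t)) \<longlongrightarrow> -1) at_bot \<and> ((\<lambda>t. u (x', t)) \<longlongrightarrow> 1) at_top)
    \<and> local_minimizer u
    \<and> (CARD('m) + 1 \<le> 8 \<longrightarrow> one_dim u)"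
proof -
 define e :: "(real^'m) \<times> real" where "e = (0, 1)"
 obtain U Hu where cu: "C2g u U Hu" using C2_imp_C2g[OF C2u] by blast
 have Ue: "U x $. e > 0" for x using mono[rule_format, of x] C2g_partial_eq(1)[OF cu, of e x] by (simp add: e_def)
 have smono: "u (x + s $* e) < u (x + s' $* e)" if "s < s'" for x s s'
  by (rule DERIV_pos_imp_increasing[OF that]) (use C1g_DERIV[OF C2gD(1)[OF cu], of x e] Ue in blast)
 \<comment> \<open>Strict monotonicity excludes the values 1 and -1, since moving on along the line
   would leave the range.\<close>
 have ub: "\<bar>u x\<bar> < 1" for x
 proof -
  have "u x < u (x + 1 $* e)" "u (x + (-1) $* e) < u x" using smono[of 0 1 x] smono[of "-1" 0 x] by auto
  moreover have "u (x + 1 $* e) <= 1" "-1 <= u (x + (-1) $* e)" using range_u by (auto simp only: atLeastAtMost_iff)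
  ultimately show ?thesis by linarith
 qed
 interpret ac u U Hu e
 proof
  show "tr (Hu x) = W' (u x)" for x using pde[rule_format, of x] C2g_laplacian[OF cu, of x] by simp
  show "norm e = 1" by (simp add: e_def norm_Pair)
 qed (use cu ub Ue in auto)
 have eps0: "!!j. eps j > 0" using eps_pos by blast
 have line: "x + s $* e = (fst x, snd x + s)" for x s by (simp add: e_def prod_eq_iff)
 have um: "u (y, t) <= u (y, t')" if "t <= t'" for y t t' using u_line_mono[OF that, of "(y, 0)"] by (simp add: line)
 have zm: "z (y, t) <= z (y, t')" if "t <= t'" for y t t' using um[OF that] by (simp add: z_le_iff)
 define L where "L s = Lset u eps d0 h0 s" for s
 \<comment> \<open>Upper slab for \<open>s = 1\<close>, lower one for \<open>s = -1\<close>.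
   Including the height \<open>K\<close> is allowed because the hypothesis places the boundaries
   strictly below it.\<close>
 define slab where "slab s = {p :: (real^'m) \<times> real. norm (fst p) < d & K <= s * snd p & s * snd p < Kbar}" for s
 define S where "S s = {p :: (real^'m) \<times> real. norm (fst p) < d & K < s * snd p & s * snd p < Kbar}" for s
 define k where "k = (K + Kbar)/2"
 have k: "K < k" "k < Kbar" "k > 0" using KK K by (auto simp: k_def)
 \<comment> \<open>A connected set that avoids the boundary of a limit set lies inside it or misses
   it. Almost everywhere convergence puts one point of the slab into a limit set, and monotonicity
   in the vertical direction decides which one it is.\<close>
 have slab_L: "slab s \<subseteq> L s" if s: "s = 1 | s = -1" for s
 proof -
  have sc: "slab s \<subseteq> cyl d Kbar" using s K by (auto simp: slab_def cyl_def)
  have c0: "cyl d Kbar \<subseteq> (cyl d0 h0 :: ((real^'m) \<times> real) set)" using d Kbar by (auto simp: cyl_def)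
  have "slab s = (%p. fst p) -` ball 0 d \<inter> ((%p. s * snd p) -` {K..<Kbar})" by (auto simp: slab_def)
  moreover have "linear (%p :: (real^'m) \<times> real. s * snd p)" by (rule linearI) (auto simp: alg)
  ultimately have "convex (slab s)"
   by (auto intro!: convex_Int convex_linear_vimage simp: linear_fst)
  then have con: "connected (slab s)" by (rule convex_connected)
  have nf: "slab s \<inter> frontier (L s') = {}" if "s' = 1 | s' = -1" for s'
  proof -
   have "K <= \<bar>snd p\<bar>" if "p : slab s" for p using that s by (auto simp: slab_def)
   then show ?thesis using bdry sc that unfolding L_def by fastforce
  qed
  have dich: "slab s \<subseteq> L s'" if "s' = 1 | s' = -1" "slab s \<inter> L s' ~= {}" for s'
   using connected_Int_frontier[OF con that(2)] nf[OF that(1)] by blast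
  obtain v where v: "!!p. v p : {-1, 1}" "AE p in lebesgue. p : cyl d0 h0 --> (%j. u ((1/eps j) $* p)) \<longlonglongrightarrow> v p" using ae_conv by blast
  obtain N where N: "N : null_sets lebesgue" "{p. \<not> (p : cyl d0 h0 --> (%j. u ((1/eps j) $* p)) \<longlonglongrightarrow> v p)} \<subseteq> N"
   using v(2) unfolding eventually_ae_filter by auto
  have "open (S s)" unfolding S_def by (intro open_Collect_conj open_Collect_less cnt)
  moreover have "(0, s*k) : S s" using s k d by (auto simp: S_def)
  ultimately have "\<not> negligible (S s)" using open_not_negligible by blast
  then have "\<not> S s \<subseteq> N" using N(1) negligible_subset negligible_iff_null_sets by blast
  then obtain p where p: "p : S s" "p ~: N" by blast
  have ps: "p : slab s" using p(1) by (auto simp: S_def slab_def)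
  then have pc: "p : cyl d0 h0" using sc c0 by blast
  then have "(%j. u ((1/eps j) $* p)) \<longlonglongrightarrow> v p" using N(2) p(2) by blast
  then have "p : L (v p)" using pc by (simp add: L_def Lset_def)
  then have "slab s \<inter> L (v p) ~= {}" using ps by blast
  moreover have "v p = 1 | v p = -1" using v(1)[of p] by auto
  ultimately have "slab s \<subseteq> L (v p)" using dich by blast
  moreover have "v p = s | v p = - s" using v(1)[of p] s by auto
  ultimately have "slab s \<subseteq> L s | slab s \<subseteq> L (- s)" by metis
  moreover have False if neg: "slab s \<subseteq> L (- s)"
  proof -
   obtain q where q: "q : L s" "q : cyl d Kbar" using Lm_ne Lp_ne s unfolding L_def by blast
   \<comment> \<open>A point with limit \<open>s\<close> is moved vertically into the slab;
     monotonicity forbids the limit \<open>- s\<close> there.\<close>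
   define q' where "q' = (fst q, s*max K (s * snd q))"
   have ss: "s * s = 1" using s by auto
   have "q' : slab s" using q(2) KK s ss unfolding slab_def cyl_def q'_def by (auto simp: mult.assoc[symmetric])
   then have "(%j. u ((1/eps j) $* q')) \<longlonglongrightarrow> - s" using neg by (auto simp: L_def Lset_def)
   then have l1: "(%j. s*u ((1/eps j) $* q')) \<longlonglongrightarrow> s*(- s)" by (intro tendsto_intros)
   have "(%j. u ((1/eps j) $* q)) \<longlonglongrightarrow> s" using q(1) by (auto simp: L_def Lset_def)
   then have l2: "(%j. s*u ((1/eps j) $* q)) \<longlonglongrightarrow> s * s" by (intro tendsto_intros)
   have "s*u ((1/eps j) $* q) <= s*u ((1/eps j) $* q')" for j
   proof -
    have e1: "1/eps j >= 0" using eps0[of j] by simp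
    from s show ?thesis
    proof
     assume "s = 1"
     then show ?thesis using um[OF mlm[OF _ e1], of "snd q" "snd q'" "(1/eps j) $* fst q"] by (cases q) (simp add: q'_def)
    next
     assume "s = -1"
     then show ?thesis using um[OF mlm[OF _ e1], of "snd q'" "snd q" "(1/eps j) $* fst q"] by (cases q) (simp add: q'_def)
    qed
   qed
   then have "s * s <= s*(- s)" using LIMSEQ_le[OF l2 l1] by blast
   then show False using ss by simp
  qed
  ultimately show ?thesis by blast
 qed
 have conv: "(%j. u ((1/eps j) $* p)) \<longlonglongrightarrow> s" if "s = 1 | s = -1" "p : slab s" for s p
  using slab_L[OF that(1)] that(2) by (auto simp: L_def Lset_def)
 have pk: "(0, s*k) : slab s" if "s = 1 | s = -1" for s using that k d by (auto simp: slab_def)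
 have ev: "\<forall>\<^sub>F j in sequentially. s*z (0, s*(k/eps j)) >= M" if s: "s = 1 | s = -1" for s M
 proof -
  have "(%j. s*u ((1/eps j) $* (0, s*k))) \<longlonglongrightarrow> s * s" by (intro tendsto_intros conv[OF s pk[OF s]])
  then have "(%j. s*u (0, s*(k/eps j))) \<longlonglongrightarrow> 1" using s by (auto simp: mult_ac)
  then have "\<forall>\<^sub>F j in sequentially. s*u (0, s*(k/eps j)) > tanh (sqrt 2*M)" by (rule order_tendstoD) (rule tanh_real_lt_1)
  then show ?thesis
  proof eventually_elim
   case (elim j)
   from s show ?case
   proof
    assume "s = 1" then show ?thesis using elim z_ge[of M "(0, s*(k/eps j))"] by simp
   next
    assume "s = -1" then show ?thesis using elim z_le[of "(0, s*(k/eps j))" "- M"] by (simp add: tanh_minus)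
   qed
  qed
 qed
 \<comment> \<open>On the axis \<open>z\<close> is large at the heights \<open>k/eps j\<close> and
   monotone in between. Any other vertical line differs from the axis by at most
   \<open>norm y\<close>, since \<open>z\<close> is 1-Lipschitz.\<close>
 have far: "\<exists>T. \<forall>t\<ge>T. s*z (y, s*t) >= M" if s: "s = 1 | s = -1" for s M y
 proof -
  obtain j where j: "s*z (0, s*(k/eps j)) >= M + norm y" using eventually_happens'[OF trivial_limit_sequentially ev[OF s, of "M + norm y"]] by blast
  have "s*z (y, s*t) >= M" if t: "t >= k/eps j" for t
  proof -
   have "s*z (0, s*(k/eps j)) <= s*z (0, s*t)" using s zm[of "k/eps j" t 0] zm[of "- t" "- (k/eps j)" 0] t by auto
   moreover have "\<bar>z (y, s*t) - z (0, s*t)\<bar> <= norm y" using z_lipschitz[of "(y, s*t)" "(0, s*t)"] by (simp add: norm_Pair)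
   ultimately show ?thesis using j s by (auto simp: abs_le_iff)
  qed
  then show ?thesis by blast
 qed
 have ut: "(%t. u (y, t)) = (%t. tanh (sqrt 2*z (y, t)))" for y by (rule ext) (rule u_eq_tanh)
 have lim1: "((%t. u (y, t)) \<longlongrightarrow> 1) at_top" for y
 proof -
  have "filterlim (%t. z (y, t)) at_top at_top" unfolding filterlim_at_top eventually_at_top_linorder using far[of 1 _ y] by simp
  then have "filterlim (%t. sqrt 2*z (y, t)) at_top at_top" by (intro filterlim_tendsto_pos_mult_at_top[OF tendsto_const]) auto
  from filterlim_compose[OF tanh_real_at_top this] show ?thesis unfolding ut .
 qed
 have lim2: "((%t. u (y, t)) \<longlongrightarrow> -1) at_bot" for y
 proof -
  have "\<exists>N. \<forall>t\<le>N. z (y, t) <= M" for M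
  proof -
   obtain T where T: "!!t. t >= T ==> - z (y, - t) >= - M" using far[of "-1" "- M" y] by auto
   have "z (y, t) <= M" if "t <= - T" for t using T[of "- t"] that by simp
   then show ?thesis by blast
  qed
  then have "filterlim (%t. z (y, t)) at_bot at_bot" unfolding filterlim_at_bot eventually_at_bot_linorder by blast
  then have "filterlim (%t. sqrt 2*z (y, t)) at_bot at_bot" by (intro filterlim_tendsto_pos_mult_at_bot[OF tendsto_const]) auto
  from filterlim_compose[OF tanh_real_at_bot this] show ?thesis unfolding ut .
 qed
 have rc: reaches unfolding reaches_def
 proof (intro allI impI)
  fix x :: "(real^'m) \<times> real" and c :: real assume c: "\<bar>c\<bar> < 1"
  have c1: "c < 1" "-1 < c" using c by auto
  obtain T1 where T1: "!!t. t >= T1 ==> u (fst x, t) > c"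
   using order_tendstoD(1)[OF lim1[of "fst x"] c1(1)] unfolding eventually_at_top_linorder by auto
  obtain T0 where T0: "!!t. t <= T0 ==> u (fst x, t) < c"
   using order_tendstoD(2)[OF lim2[of "fst x"] c1(2)] unfolding eventually_at_bot_linorder by auto
  define a where "a = min T0 T1"
  have "\<exists>t\<ge>a. t <= T1 & u (fst x, t) = c"
  proof (rule IVT')
   show "u (fst x, a) <= c" "c <= u (fst x, T1)" "a <= T1" using T0[of a] T1[of T1] by (auto simp: a_def)
   show "continuous_on {a..T1} (%t. u (fst x, t))" by (intro cnt2[OF u_cont(1)[of UNIV]] cnt) auto
  qed
  then obtain t where "u (fst x, t) = c" by blast
  then have "u (x + (t - snd x) $* e) = c" by (simp add: line)
  then show "\<exists>s. u (x + s $* e) = c" by blast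
 qed
 have dim: "DIM((real^'m) \<times> real) = CARD('m) + 1" by simp
 have "\<exists>CE>0. \<forall>R>1. (LINT x|lborel. indicator (ball 0 R) x*wt x) <= CE*R^(DIM((real^'m) \<times> real) - 1)"
 proof -
  obtain C where C: "C > 0" "!!R. R > 1 ==> integral (ball 0 R) (%x. grad_sq u x/2 + W (u x)) <= C*R^CARD('m)" using energy_bound by blast
  have "(LINT x|lborel. indicator (ball 0 R) x*wt x) <= C*R^CARD('m)" if "R > 1" for R
  proof -
   have "integral (ball 0 R) (%x. grad_sq u x/2 + W (u x)) = integral (ball 0 R) en" unfolding en_def[abs_def] C1g_grad_sq[OF C2gD(1)[OF cu]] ..
   also have "... = (LINT x|lborel. indicator (ball 0 R) x $* en x)" by (rule integral_bounded_open(2)[OF open_ball bounded_ball en_cont])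
   finally have "(LINT x|lborel. indicator (ball 0 R) x $* en x) <= C*R^CARD('m)" using C(2)[OF that] by simp
   moreover have "(LINT x|lborel. indicator (ball 0 R) x $* wt x) <= (LINT x|lborel. indicator (ball 0 R) x $* en x)"
   proof (intro integral_mono integral_bounded_open(3)[OF open_ball bounded_ball] wt_cont en_cont)
    fix x
    have "wt x*1 <= wt x*(2 - Q x)" using wt_pos[of x] Q_le[of x] by (intro mlm) auto
    then show "indicator (ball 0 R) x $* wt x <= indicator (ball 0 R) x $* en x" by (simp add: energy_density indicator_def)
   qed
   ultimately show ?thesis by simp
  qed
  then show ?thesis using C(1) by auto
 qed
 then obtain CE where CE: "CE > 0" and EB: "!!R. R > 1 ==> (LINT x|lborel. indicator (ball 0 R) x*wt x) <= CE*R^(DIM((real^'m) \<times> real) - 1)" by blast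
 have one: "one_dim u"
 proof (cases "DIM((real^'m) \<times> real) <= 3")
  case True
  then show ?thesis by (rule low_dimension_one_dim[OF _ CE EB])
 next
  case False
  then have n4: "DIM((real^'m) \<times> real) >= 4" by simp
  have EB': "mB (%_. 1) 0 R <= CE*R^(DIM((real^'m) \<times> real) - 1)" if "R > 1" for R using EB[OF that] by (simp add: mB_def[OF n4])
  define a where "a = d/2"
  \<comment> \<open>Small enough that balls of radius \<open>2*rh\<close> around the disc
    \<open>T s\<close>, which has radius \<open>a = d/2\<close> and lies in the middle of the slab,
    stay in the open slab \<open>S s\<close>.\<close>
  define rh where "rh = min (d/8) ((Kbar - K)/8)"
  have "rh <= d/8" "rh <= (Kbar - K)/8" unfolding rh_def by (rule min.cobounded1, rule min.cobounded2)
  moreover have "rh > 0" using d KK by (simp add: rh_def)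
  ultimately have rh: "rh > 0" "2*rh <= d/4" "2*rh <= (Kbar - K)/4" by auto
  define T where "T s = {q :: (real^'m) \<times> real. norm (fst q) <= a & snd q = s*k}" for s
  \<comment> \<open>Clearing-out excludes \<open>|z| <= 1\<close> on the rescaled disc. At its
    centre \<open>s*z >= 1\<close>, so by the intermediate value theorem along rays the phase is the
    same on the whole disc.\<close>
  have side: "\<forall>\<^sub>F j in sequentially. \<forall>y. norm y <= a/eps j --> s*z (y, s*(k/eps j)) >= 1" if s: "s = 1 | s = -1" for s
  proof -
   have oS: "open (S s)" unfolding S_def by (intro open_Collect_conj open_Collect_less cnt)
   have bS: "bounded (S s)"
   proof -
    have "norm p <= d + Kbar" if "p : S s" for p
    proof -
     have "\<bar>snd p\<bar> <= Kbar" using that s K by (auto simp: S_def)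
     then show ?thesis using norm_Pair_le[of "fst p" "snd p"] that by (auto simp: S_def)
    qed
    then show ?thesis unfolding bounded_iff by blast
   qed
   have Tb: "ball q (2*rh) \<subseteq> S s" if q: "q : T s" for q
   proof
    fix p assume "p : ball q (2*rh)"
    then have n: "norm (p - q) < 2*rh" by (simp add: dist_norm norm_minus_commute)
    have pq: "(fst p - fst q, snd p - snd q) = p - q" by (simp add: prod_eq_iff)
    have f1: "norm (fst p - fst q) <= norm (p - q)" using norm_fst_le[of "fst p - fst q" "snd p - snd q"] by (simp add: pq)
    have f2: "\<bar>snd p - snd q\<bar> <= norm (p - q)" using norm_snd_le[of "snd p - snd q" "fst p - fst q"] by (simp add: pq)
    have "norm (fst p) <= norm (fst q) + norm (fst p - fst q)" using norm_triangle_ineq[of "fst q" "fst p - fst q"] by simp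
    then have nd: "norm (fst p) < d" using f1 n q rh d by (simp add: T_def a_def)
    have "\<bar>s * snd p - k\<bar> <= norm (p - q)" using f2 q s by (auto simp: T_def)
    then have "s * snd p - k < 2*rh" "k - s * snd p < 2*rh" using n by linarith+
    moreover have "k = (K + Kbar)/2" by (simp add: k_def)
    ultimately have "K < s * snd p" "s * snd p < Kbar" using rh KK by argo+
    with nd show "p : S s" by (simp add: S_def)
   qed
   have "\<forall>\<^sub>F j in sequentially. \<forall>q\<in>T s. \<not> \<bar>z ((1/eps j) $* q)\<bar> <= 1"
    by (rule clearing_eventually[OF n4 rc s oS bS eps0 eps_lim conv[OF s] rh(1) Tb]) (auto simp: S_def slab_def)
   with ev[OF s, of 1] show ?thesis
   proof eventually_elim
    case (elim j)
    show ?case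
    proof (intro allI impI, rule ccontr)
     fix y :: "real^'m" assume y: "norm y <= a/eps j" and neg: "\<not> s*z (y, s*(k/eps j)) >= 1"
     define g where "g t = s*z (t $* y, s*(k/eps j))" for t
     have "\<exists>t\<ge>0. t <= 1 & g t = 1"
     proof (rule IVT2')
      show "g 1 <= 1" "1 <= g 0" using neg elim(1) by (auto simp: g_def)
      show "continuous_on {0..1} g" unfolding g_def by (intro cnt cnt2[OF z_cont[of UNIV]]) auto
     qed simp
     then obtain t where t: "0 <= t" "t <= 1" "g t = 1" by blast
     define q where "q = (eps j $* (t $* y), s*k)"
     have "t*norm y <= a/eps j" using t y mult_left_le_one_le[of "norm y" t] by simp
     then have "eps j*(t*norm y) <= a" using eps0[of j] by (simp add: le_divide_eq mult.commute)
     then have "q : T s" using eps0[of j] t(1) by (simp add: T_def q_def abs_mult mult.assoc)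
     moreover have "(1/eps j) $* q = (t $* y, s*(k/eps j))" using eps0[of j] by (simp add: q_def)
     ultimately have "\<not> \<bar>z (t $* y, s*(k/eps j))\<bar> <= 1" using elim(2) by metis
     moreover have "\<bar>z (t $* y, s*(k/eps j))\<bar> = 1" using t(3) s by (auto simp: g_def)
     ultimately show False by simp
    qed
   qed
  qed
  \<comment> \<open>The confinement radii are \<open>1 / eps j\<close>. Monotonicity along
    \<open>e\<close> carries the phases from the two discs to everything above and below
    them.\<close>
  have cf: "\<exists>R\<ge>M. conf a k R" for M
  proof -
   have "\<forall>\<^sub>F j in sequentially. eps j < 1/(\<bar>M\<bar> + 1)" using order_tendstoD(2)[OF eps_lim, of "1/(\<bar>M\<bar> + 1)"] by simp
   then obtain j where j: "eps j < 1/(\<bar>M\<bar> + 1)" "!!y. norm y <= a/eps j ==> 1*z (y, 1*(k/eps j)) >= 1" "!!y. norm y <= a/eps j ==> (-1)*z (y, (-1)*(k/eps j)) >= 1"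
    using eventually_happens'[OF trivial_limit_sequentially eventually_conj[OF _ eventually_conj[OF side[of 1] side[of "-1"]]]] by blast
   have "\<bar>M\<bar> + 1 < 1/eps j" using j(1) eps0[of j] by (simp add: field_simps)
   moreover have "conf a k (1/eps j)" unfolding conf_def
   proof (intro allI impI conjI)
    fix x :: "(real^'m) \<times> real" assume x: "norm (pr x) <= a*(1/eps j)"
    have xe: "x $. e = snd x" by (simp add: e_def inner_prod_def)
    have "pr x = (fst x, 0)" by (simp add: pr_def xe) (simp add: e_def prod_eq_iff)
    then have nx: "norm (fst x) <= a/eps j" using x by (simp add: norm_Pair)
    show "z x <= -1" if "x $. e <= - k*(1/eps j)" using j(3)[OF nx] zm[of "snd x" "- (k/eps j)" "fst x"] that by (simp add: xe)
    show "1 <= z x" if "k*(1/eps j) <= x $. e" using j(2)[OF nx] zm[of "k/eps j" "snd x" "fst x"] that by (simp add: xe)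
   qed
   ultimately show ?thesis by (intro exI[of _ "1/eps j"]) auto
  qed
  have a: "a > 0" using d by (simp add: a_def)
  obtain c0 where c0: "c0 > 0" "!!x. ze x >= c0" using slope_lower_bound[OF n4 a k(3) CE EB' cf] by blast
  show ?thesis by (rule flat_imp_one_dim[OF c0 interface_flat[OF c0 n4 CE EB']])
 qed
 show ?thesis using lim1 lim2 reaches_imp_local_minimizer[OF rc] one by blast
qed

end
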